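(* Let $n\ge2$, let $z_0\in\mathbb{R}^n$, and let $f:\mathbb{R}^n\setminus\{z_0\}\to\mathbb{R}^n$ be an isometry of $(\mathbb{R}^n\setminus\{z_0\},\lambda_{\mathbb{R}^n\setminus\{z_0\}})$ onto $(D',\lambda_{D'})$, where $D'=f(\mathbb{R}^n\setminus\{z_0\})$ is a domain; i.e. $\lambda_{D'}(f(x),f(y))=\lambda_{\mathbb{R}^n\setminus\{z_0\}}(x,y)$ for all distinct $x,y\in\mathbb{R}^n\setminus\{z_0\}$, $f$ being injective. Then $f$ is (the restriction of) a Möbius transformation of $\overline{\mathbb{R}^n}$.
   Context: $\overline{\mathbb{R}^n}=\mathbb{R}^n\cup\{\infty\}$; boundaries of domains are taken in $\overline{\mathbb{R}^n}$ (so $\partial(\mathbb{R}^n\setminus\{z_0\})=\{z_0,\infty\}$). For a family $\Gamma$ of curves, $M(\Gamma)$ denotes its conformal modulus, $M(\Gamma)=\inf_\rho\int_{\mathbb{R}^n}\rho^n\,dm_n$, where the infimum is over all nonnegative Borel functions $\rho$ with $\int_\gamma\rho\,ds\ge1$ for every locally rectifiable $\gamma\in\Gamma$. For sets $E,F,D$, $\Delta(E,F;D)$ is the family of all curves joining $E$ to $F$ in $D$. For a domain $D\subset\mathbb{R}^n$ and distinct $x,y\in D$, $$\lambda_D(x,y)=\inf_{C_x,C_y}M(\Delta(C_x,C_y;D)),$$ where the infimum is over all pairs of curves $C_x,C_y$ in $D$ such that $C_z$ (for $z=x,y$) joins $z$ to the boundary of $D$; that is, $C_z=\gamma_z([0,1))\subset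 D$ with $\gamma_z$ continuous, $\gamma_z(0)=z$ and $\gamma_z(t)\to\partial D$ as $t\to1$. Equivalently, being an isometry means being an isometry for the metrics $\lambda^{1/(1-n)}$ (set equal to $0$ on the diagonal). Möbius transformations are finite compositions of reflections in spheres and hyperplanes of $\overline{\mathbb{R}^n}$ (orientation-reversing maps are included). *)

theory Defs
  imports "HOL-Analysis.Analysis"
begin

section \<open>The extended space and Moebius transformations\<close>

text \<open>The extended space \<open>\<real>\<^sup>n \<union> {\<infinity>}\<close> is modelled on the type \<open>(real^'n) option\<close>, with \<open>None\<close> as the
  point at infinity.\<close>

abbreviation extended_space :: "(real^'n) option topology" where
  "extended_space \<equiv> Alexandroff_compactification euclidean"

definition extended_boundary :: "(real^'n) set \<Rightarrow> (real^'n) option set" where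
  "extended_boundary D = extended_space frontier_of (Some ` D)"

definition sphere_reflection :: "real^'n \<Rightarrow> real \<Rightarrow> (real^'n) option \<Rightarrow> (real^'n) option" where
  "sphere_reflection a r p =
    (case p of
       None \<Rightarrow> Some a
     | Some x \<Rightarrow> if x = a then None else Some (a + (r / norm (x - a))\<^sup>2 *\<^sub>R (x - a)))"

text \<open>Reflection in the hyperplane \<open>{x. v \<bullet> x = t}\<close>.\<close>

definition hyperplane_reflection :: "real^'n \<Rightarrow> real \<Rightarrow> (real^'n) option \<Rightarrow> (real^'n) option" where
  "hyperplane_reflection v t p =
    (case p of
       None \<Rightarrow> None
     | Some x \<Rightarrow> Some (x - (2 * (v \<bullet> x - t) / (v \<bullet> v)) *\<^sub>R v))"

inductive moebius :: "((real^'n) option \<Rightarrow> (real^'n) option) \<Rightarrow> bool" where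
  moebius_id: "moebius id"
| moebius_sphere: "r > 0 \<Longrightarrow> moebius m \<Longrightarrow> moebius (sphere_reflection a r \<circ> m)"
| moebius_hyperplane: "v \<noteq> 0 \<Longrightarrow> moebius m \<Longrightarrow> moebius (hyperplane_reflection v t \<circ> m)"

section \<open>The conformal modulus\<close>

text \<open>The length of the restriction of \<open>\<gamma>\<close> to \<open>[a, b]\<close>.\<close>

definition curve_length :: "(real \<Rightarrow> real^'n) \<Rightarrow> real \<Rightarrow> real \<Rightarrow> ennreal" where
  "curve_length \<gamma> a b =
    (SUP ts \<in> {ts. sorted ts \<and> set ts \<subseteq> {a..b}}.
       \<Sum>i<length ts - 1. ennreal (dist (\<gamma> (ts ! i)) (\<gamma> (ts ! Suc i))))"

text \<open>All curves below are closed curves, parametrized on the compact interval \<open>[0, 1]\<close>; for these,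
  locally rectifiable means rectifiable.\<close>

definition rectifiable_curve :: "(real \<Rightarrow> real^'n) \<Rightarrow> bool" where
  "rectifiable_curve \<gamma> \<longleftrightarrow> curve_length \<gamma> 0 1 < \<infinity>"

text \<open>The choice of the parameter \<open>t\<close> is immaterial: \<open>\<gamma>\<close> is constant between any two parameters
  with the same value of the length function.\<close>

definition arc_length_param :: "(real \<Rightarrow> real^'n) \<Rightarrow> real \<Rightarrow> real^'n" where
  "arc_length_param \<gamma> s = \<gamma> (SOME t. t \<in> {0..1} \<and> curve_length \<gamma> 0 t = ennreal s)"

definition curve_integral :: "(real \<Rightarrow> real^'n) \<Rightarrow> (real^'n \<Rightarrow> ennreal) \<Rightarrow> ennreal" where
  "curve_integral \<gamma> \<rho> =
    (\<integral>\<^sup>+ s \<in> {0..enn2real (curve_length \<gamma> 0 1)}. \<rho> (arc_length_param \<gamma> s) \<partial>lborel)"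

definition admissible :: "(real \<Rightarrow> real^'n) set \<Rightarrow> (real^'n \<Rightarrow> ennreal) set" where
  "admissible \<Gamma> =
    {\<rho> \<in> borel_measurable borel. \<forall>\<gamma>\<in>\<Gamma>. rectifiable_curve \<gamma> \<longrightarrow> 1 \<le> curve_integral \<gamma> \<rho>}"

definition modulus :: "(real \<Rightarrow> real^'n) set \<Rightarrow> ennreal" where
  "modulus \<Gamma> = (INF \<rho> \<in> admissible \<Gamma>. \<integral>\<^sup>+ x. \<rho> x ^ CARD('n) \<partial>lborel)"

definition joining_curves ::
  "(real^'n) set \<Rightarrow> (real^'n) set \<Rightarrow> (real^'n) set \<Rightarrow> (real \<Rightarrow> real^'n) set" where
  "joining_curves E F D =
    {\<gamma>. path \<gamma> \<and>
        (pathstart \<gamma> \<in> E \<and> pathfinish \<gamma> \<in> F \<or> pathstart \<gamma> \<in> F \<and> pathfinish \<gamma> \<in> E) \<and>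
        (\<forall>t\<in>{0<..<1}. \<gamma> t \<in> D)}"

section \<open>The modulus metric\<close>

text \<open>\<open>\<gamma>(t) \<rightarrow> \<partial>D\<close> means that \<open>\<gamma>(t)\<close> eventually lies in every neighbourhood of the boundary set, taken
  in the extended space; it need not converge to a single point.\<close>

definition boundary_curves :: "(real^'n) set \<Rightarrow> real^'n \<Rightarrow> (real^'n) set set" where
  "boundary_curves D z =
    {\<gamma> ` {0..<1} | \<gamma>.
        continuous_on {0..<1} \<gamma> \<and> \<gamma> ` {0..<1} \<subseteq> D \<and> \<gamma> 0 = z \<and>
        (\<forall>U. openin extended_space U \<and> extended_boundary D \<subseteq> U \<longrightarrow>
             (\<forall>\<^sub>F t in at_left (1::real). Some (\<gamma> t) \<in> U))}"

definition lambda_metric :: "(real^'n) set \<Rightarrow> real^'n \<Rightarrow> real^'n \<Rightarrow> ennreal" where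
  "lambda_metric D x y =
    (INF (Cx, Cy) \<in> boundary_curves D x \<times> boundary_curves D y. modulus (joining_curves Cx Cy D))"

end

theory Submission
  imports Defs
begin

text \<open>
  Three properties of the modulus metric \<open>\<lambda>\<close> suffice: \<open>\<lambda>\<close> is invariant under similarities; on
  \<open>X = \<real>\<^sup>n - {0}\<close> it is bounded where \<open>dist x y \<ge> \<eta> * norm x\<close>; and it blows up at the diagonal,
  because the curves joining two continua cross every small ring around a common limit
  point with a modulus bounded below.

  Continuity of the isometry \<open>f\<close> follows from the blow-up. As \<open>\<lambda>\<close> tends to \<open>0\<close> along pairs that
  approach different boundary points, \<open>f\<close> has a limit at each of the two ends of \<open>X\<close>, and the
  Jordan-Brouwer theorem makes the image a punctured space, so that \<open>f\<close> may be taken to be a self-map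
  of \<open>X\<close>.

  The superlevel sets of \<open>\<lambda>\<close> form neighbourhood systems of the diagonal that are invariant under the
  similarities fixing \<open>0\<close> and under \<open>f\<close>. A measure that gives all neighbourhoods of the same level
  the same finite mass is unique up to a factor, so \<open>f\<close> preserves \<open>norm x powr (- n) dx\<close>, and
  it respects averages over the neighbourhoods. Hence \<open>ln (norm (f x))\<close> has a mean value property,
  and a Liouville argument shows that \<open>norm (f x)\<close> depends on \<open>norm x\<close> only; comparing the measures of
  spherical rings, it is a multiple of \<open>norm x\<close> or of \<open>1 / norm x\<close>. On each sphere neither \<open>f\<close> nor its
  inverse increases angles, so \<open>f\<close> is orthogonal there, and a comparison of nearby radii shows that
  all spheres share the same orthogonal map.
\<close>

section \<open>Rectifiable curves\<close>

text \<open>No formula for the metric on punctured space is at hand, and not even its continuity is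
  established. The argument therefore uses only which pairs have large values; an invariant measure
  and averages over superlevel sets replace derivatives, and no regularity theory of conformal maps
  enters. The delicate analytic point is the lower bound of the modulus in one ring. Averaging line
  integrals over cones with apex \<open>a\<close> in the full space just fails: the Jacobian
  \<open>1 / t ^ n\<close> is too singular at the apex against an n-th power integral. Inside a
  hyperplane the Jacobian is \<open>1 / t ^ (n - 1)\<close> and the average converges. By Fubini
  there is a level at which all coordinate slices carry little energy, which is why cubes and the
  sup norm replace balls; two points of that level are joined through a common random point of a
  cube. An explicit upper bound away from the diagonal is proved only on punctured space, while the
  blow-up holds in every domain. This asymmetry makes the continuity of the inverse of the isometry
  precede that of the isometry itself.\<close>

fun polygon_length :: "(real \<Rightarrow> 'a::metric_space) \<Rightarrow> real list \<Rightarrow> real" where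
  "polygon_length \<gamma> (x # y # r) = dist (\<gamma> x) (\<gamma> y) + polygon_length \<gamma> (y # r)"
| "polygon_length \<gamma> _ = 0"

lemma polygon_length_nonneg: "0 \<le> polygon_length \<gamma> ts"
  by (induction \<gamma> ts rule: polygon_length.induct) auto

text \<open>Passing from the indexed \<open>ennreal\<close> sum to a real-valued recursion makes the
  triangle inequality and concatenation plain list inductions; \<open>ennreal\<close> enters only at
  the supremum.\<close>

lemma sum_dist_eq_polygon_length:
  "(\<Sum>i<length ts - 1. ennreal (dist (\<gamma> (ts ! i)) (\<gamma> (ts ! Suc i)))) = ennreal (polygon_length \<gamma> ts)"
proof (induction \<gamma> ts rule: polygon_length.induct)
  case (1 \<gamma> x y r)
  then show ?case
    by (simp add: sum.lessThan_Suc_shift ennreal_plus polygon_length_nonneg del: sum.lessThan_Suc)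
qed auto

lemma curve_length_eq_SUP_polygon_length:
  "curve_length \<gamma> a b = (SUP ts \<in> {ts. sorted ts \<and> set ts \<subseteq> {a..b}}. ennreal (polygon_length \<gamma> ts))"
  unfolding curve_length_def sum_dist_eq_polygon_length ..

lemma polygon_length_le_curve_length:
  "sorted ts \<Longrightarrow> set ts \<subseteq> {a..b} \<Longrightarrow> ennreal (polygon_length \<gamma> ts) \<le> curve_length \<gamma> a b"
  unfolding curve_length_eq_SUP_polygon_length by (rule SUP_upper) auto

lemma dist_le_curve_length:
  assumes "a \<le> b" shows "ennreal (dist (\<gamma> a) (\<gamma> b)) \<le> curve_length \<gamma> a b"
  using polygon_length_le_curve_length[of "[a,b]" a b \<gamma>] assms by simp

lemma polygon_length_append_ge:
  "polygon_length \<gamma> xs + polygon_length \<gamma> ys \<le> polygon_length \<gamma> (xs @ ys)"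
proof (induction \<gamma> xs rule: polygon_length.induct)
  case ("2_2" \<gamma> v)
  show ?case by (cases ys) auto
qed auto

lemma polygon_length_append_snoc:
  "polygon_length \<gamma> (xs @ b # ys) = polygon_length \<gamma> (xs @ [b]) + polygon_length \<gamma> (b # ys)"
proof (induction xs)
  case Nil
  then show ?case by simp
next
  case (Cons a xs)
  show ?case
  proof (cases xs)
    case Nil
    then show ?thesis by simp
  next
    case (Cons c cs)
    with Cons.IH show ?thesis by simp
  qed
qed

text \<open>Triangle inequality at the new vertex. It lets every polygon be refined to pass through
  a prescribed division point, as \<open>curve_length_add\<close> needs.\<close>

lemma polygon_length_insert_ge: "polygon_length \<gamma> (xs @ ys) \<le> polygon_length \<gamma> (xs @ b # ys)"
proof (induction xs)
  case Nil
  show ?case by (cases ys) auto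
next
  case (Cons a xs)
  show ?case
  proof (cases xs)
    case Nil
    then show ?thesis
      by (cases ys) (auto intro: order_trans[OF dist_triangle])
  next
    case (Cons c cs)
    with Cons.IH show ?thesis by simp
  qed
qed

lemma polygon_length_map: "polygon_length \<gamma> (map h ts) = polygon_length (\<gamma> \<circ> h) ts"
  by (induction "\<gamma> \<circ> h" ts rule: polygon_length.induct) auto

lemma polygon_length_cong:
  "(\<And>t. t \<in> set ts \<Longrightarrow> \<gamma> t = \<gamma>' t) \<Longrightarrow> polygon_length \<gamma> ts = polygon_length \<gamma>' ts"
  by (induction \<gamma> ts rule: polygon_length.induct) auto

lemma curve_length_cong:
  assumes "\<And>t. t \<in> {a..b} \<Longrightarrow> \<gamma> t = \<gamma>' t" shows "curve_length \<gamma> a b = curve_length \<gamma>' a b"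
  unfolding curve_length_eq_SUP_polygon_length
proof (rule SUP_cong[OF refl])
  fix ts assume ts: "ts \<in> {ts. sorted ts \<and> set ts \<subseteq> {a..b}}"
  have "polygon_length \<gamma> ts = polygon_length \<gamma>' ts"
    by (rule polygon_length_cong) (use ts assms in auto)
  then show "ennreal (polygon_length \<gamma> ts) = ennreal (polygon_length \<gamma>' ts)" by simp
qed

lemma curve_length_mono:
  assumes "a' \<le> a" "b \<le> b'" shows "curve_length \<gamma> a b \<le> curve_length \<gamma> a' b'"
  unfolding curve_length_eq_SUP_polygon_length
  by (rule SUP_subset_mono) (use assms in auto)

text \<open>For \<open>\<le>\<close> the division point \<open>b\<close> is inserted into an
  arbitrary partition, where its entries begin to exceed \<open>b\<close>; for \<open>\<ge>\<close>
  partitions of the two halves are concatenated, which can only add the length of a connecting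
  segment.\<close>

lemma curve_length_add:
  assumes "a \<le> b" "b \<le> c"
  shows "curve_length \<gamma> a c = curve_length \<gamma> a b + curve_length \<gamma> b c"
proof (rule antisym)
  show "curve_length \<gamma> a c \<le> curve_length \<gamma> a b + curve_length \<gamma> b c"
    unfolding curve_length_eq_SUP_polygon_length[of \<gamma> a c]
  proof (rule SUP_least)
    fix ts assume ts: "ts \<in> {ts. sorted ts \<and> set ts \<subseteq> {a..c}}"
    define xs where "xs = takeWhile (\<lambda>t. t \<le> b) ts"
    define ys where "ys = dropWhile (\<lambda>t. t \<le> b) ts"
    have eq: "ts = xs @ ys" by (simp add: xs_def ys_def)
    have sxs: "sorted (xs @ [b])" "set (xs @ [b]) \<subseteq> {a..b}"
    proof -
      have "x \<le> b" if "x \<in> set xs" for x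
        using that set_takeWhileD unfolding xs_def by fastforce
      moreover have "sorted xs" "set xs \<subseteq> {a..c}" using ts unfolding eq by (auto simp: sorted_append)
      ultimately show "sorted (xs @ [b])" "set (xs @ [b]) \<subseteq> {a..b}"
        using assms by (auto simp: sorted_append)
    qed
    have ysb: "y > b" if "y \<in> set ys" for y
    proof -
      have ne: "ys \<noteq> []" using that by auto
      have "hd ys > b" using hd_dropWhile[of "\<lambda>t. t \<le> b" ts] ne by (simp add: ys_def)
      moreover have "sorted ys" using ts unfolding eq by (auto simp: sorted_append)
      then have "hd ys \<le> y" using that ne by (cases ys) auto
      ultimately show ?thesis by simp
    qed
    have sys: "sorted (b # ys)" "set (b # ys) \<subseteq> {b..c}"
      using ts assms ysb unfolding eq by (auto simp: sorted_append less_imp_le)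
    have "polygon_length \<gamma> ts \<le> polygon_length \<gamma> (xs @ [b]) + polygon_length \<gamma> (b # ys)"
      using polygon_length_insert_ge[of \<gamma> xs ys b] polygon_length_append_snoc[of \<gamma> xs b ys] eq by simp
    then have "ennreal (polygon_length \<gamma> ts) \<le>
      ennreal (polygon_length \<gamma> (xs @ [b])) + ennreal (polygon_length \<gamma> (b # ys))"
      by (metis ennreal_leI ennreal_plus polygon_length_nonneg)
    also have "\<dots> \<le> curve_length \<gamma> a b + curve_length \<gamma> b c"
      by (intro add_mono polygon_length_le_curve_length sxs sys)
    finally show "ennreal (polygon_length \<gamma> ts) \<le> curve_length \<gamma> a b + curve_length \<gamma> b c" .
  qed
next
  have nen: "{ts. sorted ts \<and> set ts \<subseteq> {x..y::real}} \<noteq> {}" for x y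
    by (auto intro!: exI[of _ "[]"])
  have *: "ennreal (polygon_length \<gamma> xs) + ennreal (polygon_length \<gamma> ys) \<le> curve_length \<gamma> a c"
    if "sorted xs" "set xs \<subseteq> {a..b}" "sorted ys" "set ys \<subseteq> {b..c}" for xs ys
  proof -
    have "sorted (xs @ ys)" "set (xs @ ys) \<subseteq> {a..c}"
      using that assms by (fastforce simp: sorted_append)+
    then have "ennreal (polygon_length \<gamma> (xs @ ys)) \<le> curve_length \<gamma> a c"
      by (rule polygon_length_le_curve_length)
    moreover have "ennreal (polygon_length \<gamma> xs) + ennreal (polygon_length \<gamma> ys) \<le> ennreal (polygon_length \<gamma> (xs @ ys))"
      using polygon_length_append_ge[of \<gamma> xs ys]
      by (metis ennreal_leI ennreal_plus polygon_length_nonneg)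
    ultimately show ?thesis by (rule order_trans[rotated])
  qed
  show "curve_length \<gamma> a b + curve_length \<gamma> b c \<le> curve_length \<gamma> a c"
    unfolding curve_length_eq_SUP_polygon_length[of \<gamma> a b] curve_length_eq_SUP_polygon_length[of \<gamma> b c]
    apply (subst ennreal_SUP_add_left[symmetric, OF nen])
    apply (rule SUP_least)
    apply (subst ennreal_SUP_add_right[OF nen])
    apply (rule SUP_least)
    using * by auto
qed

lemma curve_length_self [simp]: "curve_length \<gamma> a a = 0"
proof -
  have "polygon_length \<gamma> ts = 0" if "set ts \<subseteq> {a}" for ts
    using that by (induction \<gamma> ts rule: polygon_length.induct) auto
  then show ?thesis
    unfolding curve_length_eq_SUP_polygon_length by (auto intro!: antisym SUP_least)
qed

lemma sorted_map_mono:
  "sorted ts \<Longrightarrow> (\<And>x y. x \<le> y \<Longrightarrow> h x \<le> h y) \<Longrightarrow> sorted (map h ts)"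
  by (induction ts) auto

text \<open>Partitions are written relative to \<open>[0, 1]\<close>, so that one list
  \<open>ts\<close> serves all intervals \<open>[a, b]\<close> at once and its polygon length
  becomes a continuous function of the end points.\<close>

lemma polygon_length_affine_in_interval:
  assumes "a \<le> b" "sorted ts" "set ts \<subseteq> {0..1}"
  shows "ennreal (polygon_length \<gamma> (map (\<lambda>q. a + q * (b - a)) ts)) \<le> curve_length \<gamma> a b"
proof (rule polygon_length_le_curve_length)
  show "sorted (map (\<lambda>q. a + q * (b - a)) ts)"
    using assms by (intro sorted_map_mono) (auto intro!: mult_right_mono)
  have "a + q * (b - a) \<le> b" if "q \<le> 1" for q :: real
    using mult_right_mono[OF that, of "b - a"] assms(1) by simp
  then show "set (map (\<lambda>q. a + q * (b - a)) ts) \<subseteq> {a..b}"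
    using assms by (fastforce intro!: mult_nonneg_nonneg)
qed

lemma curve_length_gtE:
  assumes "a \<le> b" "c < curve_length \<gamma> a b"
  obtains ts where "sorted ts" "set ts \<subseteq> {0..1}"
    "c < ennreal (polygon_length \<gamma> (map (\<lambda>q. a + q * (b - a)) ts))"
proof -
  obtain us where us: "sorted us" "set us \<subseteq> {a..b}" "c < ennreal (polygon_length \<gamma> us)"
    using assms(2) unfolding curve_length_eq_SUP_polygon_length less_SUP_iff by auto
  show thesis
  proof (cases "a = b")
    case True
    then show thesis using assms by simp
  next
    case False
    then have ab: "a < b" using assms by simp
    define ts where "ts = map (\<lambda>t. (t - a) / (b - a)) us"
    have "map (\<lambda>q. a + q * (b - a)) ts = us"
      using ab by (simp add: ts_def map_idI)
    moreover have "sorted ts"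
      unfolding ts_def using us(1) ab by (intro sorted_map_mono) (auto intro!: divide_right_mono)
    moreover have "set ts \<subseteq> {0..1}" using us(2) ab by (auto simp: ts_def)
    ultimately show thesis using that us by metis
  qed
qed


lemma curve_length_affine:
  assumes "m > 0"
  shows "curve_length (\<lambda>t. \<gamma> (m * t + c)) a b = curve_length \<gamma> (m * a + c) (m * b + c)"
proof -
  have img: "map (\<lambda>t. m * t + c) ` {ts. sorted ts \<and> set ts \<subseteq> {a..b}} =
    {ts. sorted ts \<and> set ts \<subseteq> {m * a + c..m * b + c}}" (is "?f ` ?A = ?B")
  proof (intro equalityI subsetI)
    fix us assume "us \<in> ?f ` ?A"
    then obtain ts where ts: "us = ?f ts" "sorted ts" "set ts \<subseteq> {a..b}" by auto
    have "sorted us" unfolding ts(1) using assms ts(2) by (intro sorted_map_mono) auto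
    then show "us \<in> ?B" using ts assms by auto
  next
    fix us assume us: "us \<in> ?B"
    define ts where "ts = map (\<lambda>t. (t - c) / m) us"
    have "?f ts = us" using assms by (simp add: ts_def map_idI)
    moreover have "sorted ts"
      unfolding ts_def using us assms by (intro sorted_map_mono) (auto intro!: divide_right_mono)
    moreover have "set ts \<subseteq> {a..b}" using us assms by (auto simp: ts_def field_simps)
    ultimately show "us \<in> ?f ` ?A" by (metis (mono_tags, lifting) image_eqI mem_Collect_eq)
  qed
  show ?thesis
    unfolding curve_length_eq_SUP_polygon_length img[symmetric] image_image polygon_length_map o_def ..
qed

lemma continuous_on_polygon_length_affine:
  assumes \<gamma>: "continuous_on {0..1} \<gamma>" and "set ts \<subseteq> {0..1}"
  shows "continuous_on ({0..1} \<times> {0..1})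
    (\<lambda>p. polygon_length \<gamma> (map (\<lambda>q. fst p + q * (snd p - fst p)) ts))"
proof -
  have in01: "a + q * (b - a) \<in> {0..1}" if "a \<in> {0..1}" "b \<in> {0..1}" "q \<in> {0..1}" for a b q :: real
  proof -
    have "a + q * (b - a) = (1 - q) * a + q * b" by (simp add: algebra_simps)
    moreover have "(1 - q) * a \<le> (1 - q) * 1" "q * b \<le> q * 1"
      using that by (intro mult_left_mono; simp)+
    ultimately show ?thesis using that by auto
  qed
  have c: "continuous_on ({0..1} \<times> {0..1}) (\<lambda>p. \<gamma> (fst p + q * (snd p - fst p)))" if "q \<in> {0..1}" for q
    by (rule continuous_on_compose2[OF \<gamma>]) (use in01 that in \<open>auto intro!: continuous_intros\<close>)
  show ?thesis
    using assms(2) by (induction ts rule: induct_list012) (auto intro!: continuous_intros c)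
qed

text \<open>A length is a supremum of polygon lengths, each continuous in the two end points by the
  relative parametrization, and suprema of continuous functions are lower semicontinuous.\<close>

lemma curve_length_lsc:
  assumes "path \<gamma>" "a \<in> {0..1}" "b \<in> {0..1}" "a \<le> b" "c < curve_length \<gamma> a b"
  shows "\<exists>\<delta>>0. \<forall>a'\<in>{0..1}. \<forall>b'\<in>{0..1}. a' \<le> b' \<and> dist a' a < \<delta> \<and> dist b' b < \<delta> \<longrightarrow> c < curve_length \<gamma> a' b'"
proof -
  obtain ts where ts: "sorted ts" "set ts \<subseteq> {0..1}"
    "c < ennreal (polygon_length \<gamma> (map (\<lambda>q. a + q * (b - a)) ts))"
    using curve_length_gtE assms by metis
  define P where "P p = polygon_length \<gamma> (map (\<lambda>q. fst p + q * (snd p - fst p)) ts)" for p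
  have "continuous_on ({0..1} \<times> {0..1}) P"
    unfolding P_def using assms(1) ts(2) by (intro continuous_on_polygon_length_affine) (auto simp: path_def)
  moreover have "c \<noteq> top" using ts(3) by auto
  then obtain r where r: "c = ennreal r" "0 \<le> r" by (cases c) auto
  have "r < P (a,b)" using ts(3) r by (simp add: P_def ennreal_less_iff)
  ultimately obtain \<delta> where \<delta>: "\<delta> > 0"
    "\<And>p. p \<in> {0..1} \<times> {0..1} \<Longrightarrow> dist p (a,b) < \<delta> \<Longrightarrow> dist (P p) (P (a,b)) < P (a,b) - r"
    using assms(2,3) unfolding continuous_on_iff by (metis SigmaI diff_gt_0_iff_gt)
  show ?thesis
  proof (intro exI[of _ "\<delta>/2"] conjI ballI impI)
    fix a' b' :: real assume *: "a' \<in> {0..1}" "b' \<in> {0..1}" "a' \<le> b' \<and> dist a' a < \<delta>/2 \<and> dist b' b < \<delta>/2"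
    have "dist (a',b') (a,b) \<le> dist a' a + dist b' b"
      unfolding dist_prod_def by (simp add: sqrt_sum_squares_le_sum)
    then have "dist (P (a',b')) (P (a,b)) < P (a,b) - r" using * \<delta>(2)[of "(a',b')"] by auto
    then have "r < P (a',b')" by (auto simp: dist_real_def)
    then have "c < ennreal (P (a',b'))" using r by (simp add: ennreal_less_iff)
    also have "\<dots> \<le> curve_length \<gamma> a' b'"
      unfolding P_def fst_conv snd_conv using * ts by (intro polygon_length_affine_in_interval) auto
    finally show "c < curve_length \<gamma> a' b'" .
  qed (use \<delta> in auto)
qed

lemma curve_length_finite:
  assumes "rectifiable_curve \<gamma>" "0 \<le> a" "b \<le> 1" shows "curve_length \<gamma> a b < top"
  using curve_length_mono[OF assms(2,3), of \<gamma>] assms(1)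
  unfolding rectifiable_curve_def by (simp add: le_less_trans)

section \<open>Arc length as a parameter\<close>

definition length_upto :: "(real \<Rightarrow> real^'n) \<Rightarrow> real \<Rightarrow> real" where
  "length_upto \<gamma> t = enn2real (curve_length \<gamma> 0 t)"

lemma ennreal_length_upto:
  assumes "rectifiable_curve \<gamma>" "t \<in> {0..1}"
  shows "ennreal (length_upto \<gamma> t) = curve_length \<gamma> 0 t"
  unfolding length_upto_def using curve_length_finite[OF assms(1), of 0 t] assms(2) by simp

lemma length_upto_0 [simp]: "length_upto \<gamma> 0 = 0"
  by (simp add: length_upto_def)

lemma length_upto_nonneg: "0 \<le> length_upto \<gamma> t"
  by (simp add: length_upto_def)

lemma length_upto_diff:
  assumes "rectifiable_curve \<gamma>" "0 \<le> s" "s \<le> t" "t \<le> 1"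
  shows "ennreal (length_upto \<gamma> t - length_upto \<gamma> s) = curve_length \<gamma> s t" "length_upto \<gamma> s \<le> length_upto \<gamma> t"
proof -
  obtain u where u: "curve_length \<gamma> s t = ennreal u" "0 \<le> u"
    using curve_length_finite[OF assms(1), of s t] assms by (cases "curve_length \<gamma> s t") auto
  have "ennreal (length_upto \<gamma> t) = ennreal (length_upto \<gamma> s + u)"
    using ennreal_length_upto[OF assms(1)] curve_length_add[of 0 s t \<gamma>] assms u
    by (simp add: ennreal_plus length_upto_nonneg)
  then have "length_upto \<gamma> t = length_upto \<gamma> s + u"
    using u length_upto_nonneg[of \<gamma>] by (subst (asm) ennreal_inj) auto
  then show "ennreal (length_upto \<gamma> t - length_upto \<gamma> s) = curve_length \<gamma> s t" "length_upto \<gamma> s \<le> length_upto \<gamma> t"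
    using u by auto
qed

lemma length_upto_dist:
  assumes "rectifiable_curve \<gamma>" "0 \<le> s" "s \<le> t" "t \<le> 1"
  shows "dist (\<gamma> s) (\<gamma> t) \<le> length_upto \<gamma> t - length_upto \<gamma> s"
  using dist_le_curve_length[OF assms(3), of \<gamma>] length_upto_diff[OF assms]
  by (metis diff_ge_0_iff_ge ennreal_le_iff)

lemma curve_length_gt_real:
  assumes "rectifiable_curve \<gamma>" "path \<gamma>" "0 \<le> a" "a \<le> b" "b \<le> 1" "\<epsilon> > 0"
  shows "\<exists>\<delta>>0. \<forall>a'\<in>{0..1}. \<forall>b'\<in>{0..1}. a' \<le> b' \<and> dist a' a < \<delta> \<and> dist b' b < \<delta> \<longrightarrow>
    length_upto \<gamma> b - length_upto \<gamma> a - \<epsilon> < length_upto \<gamma> b' - length_upto \<gamma> a'"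
proof (cases "length_upto \<gamma> b - length_upto \<gamma> a - \<epsilon> < 0")
  case True
  then show ?thesis
    using length_upto_diff(2)[OF assms(1)]
    by (intro exI[of _ 1]) (auto, smt (verit) atLeastAtMost_iff)
next
  case False
  define c where "c = length_upto \<gamma> b - length_upto \<gamma> a - \<epsilon>"
  have "ennreal c < curve_length \<gamma> a b"
    using False assms by (subst length_upto_diff(1)[symmetric]) (auto simp: c_def intro!: ennreal_lessI)
  from curve_length_lsc[OF assms(2) _ _ assms(4) this]
  obtain \<delta> where \<delta>: "\<delta> > 0" "\<And>a' b'. a'\<in>{0..1} \<Longrightarrow> b' \<in> {0..1} \<Longrightarrow> a' \<le> b' \<Longrightarrow> dist a' a < \<delta> \<Longrightarrow> dist b' b < \<delta> \<Longrightarrow>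
    ennreal c < curve_length \<gamma> a' b'"
    using assms by auto
  have "c < length_upto \<gamma> b' - length_upto \<gamma> a'"
    if "a'\<in>{0..1}" "b' \<in> {0..1}" "a' \<le> b'" "dist a' a < \<delta>" "dist b' b < \<delta>" for a' b'
    using \<delta>(2)[OF that] that length_upto_diff[OF assms(1), of a' b'] False
    by (metis atLeastAtMost_iff c_def ennreal_less_iff linorder_not_less)
  then show ?thesis using \<delta>(1) unfolding c_def by blast
qed

text \<open>Lower semicontinuity alone gives both bounds: applied to \<open>[0, t]\<close> it keeps
  the length up to a nearby parameter from dropping, applied to \<open>[t, 1]\<close> it keeps the
  remaining length from dropping, and the two add up to the constant total.\<close>

lemma continuous_on_length_upto:
  assumes "rectifiable_curve \<gamma>" "path \<gamma>"
  shows "continuous_on {0..1} (length_upto \<gamma>)"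
  unfolding continuous_on_iff
proof (intro ballI allI impI)
  fix t e :: real assume t: "t \<in> {0..1}" and e: "0 < e"
  obtain \<delta>1 where d1: "\<delta>1 > 0" "\<And>a' b'. a'\<in>{0..1} \<Longrightarrow> b' \<in> {0..1} \<Longrightarrow> a' \<le> b' \<Longrightarrow> dist a' 0 < \<delta>1 \<Longrightarrow> dist b' t < \<delta>1 \<Longrightarrow>
      length_upto \<gamma> t - length_upto \<gamma> 0 - e < length_upto \<gamma> b' - length_upto \<gamma> a'"
    using curve_length_gt_real[OF assms, of 0 t e] t e by auto
  obtain \<delta>2 where d2: "\<delta>2 > 0" "\<And>a' b'. a'\<in>{0..1} \<Longrightarrow> b' \<in> {0..1} \<Longrightarrow> a' \<le> b' \<Longrightarrow> dist a' t < \<delta>2 \<Longrightarrow> dist b' 1 < \<delta>2 \<Longrightarrow>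
      length_upto \<gamma> 1 - length_upto \<gamma> t - e < length_upto \<gamma> b' - length_upto \<gamma> a'"
    using curve_length_gt_real[OF assms, of t 1 e] t e by auto
  have "dist (length_upto \<gamma> t') (length_upto \<gamma> t) < e" if "t' \<in> {0..1}" "dist t' t < min \<delta>1 \<delta>2" for t'
    using d1(2)[of 0 t'] d2(2)[of t' 1] that d1(1) d2(1) by (auto simp: dist_real_def)
  then show "\<exists>d>0. \<forall>x'\<in>{0..1}. dist x' t < d \<longrightarrow> dist (length_upto \<gamma> x') (length_upto \<gamma> t) < e"
    using d1(1) d2(1) by (intro exI[of _ "min \<delta>1 \<delta>2"]) auto
qed

lemma arc_length_param_eq:
  assumes "rectifiable_curve \<gamma>" "t \<in> {0..1}" "length_upto \<gamma> t = s"
  shows "arc_length_param \<gamma> s = \<gamma> t"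
proof -
  define P where "P = (\<lambda>t. t \<in> {0..1} \<and> curve_length \<gamma> 0 t = ennreal s)"
  define u where "u = (SOME t. P t)"
  have "P t" unfolding P_def using assms ennreal_length_upto by metis
  then have u: "P u" unfolding u_def by (rule someI)
  then have "length_upto \<gamma> u = s" unfolding P_def
    using ennreal_length_upto[OF assms(1), of u] assms(3)
    by (metis ennreal_inj length_upto_nonneg)
  moreover have "u \<in> {0..1}" using u by (simp add: P_def)
  ultimately have "dist (\<gamma> u) (\<gamma> t) \<le> 0"
    using length_upto_dist[OF assms(1), of u t] length_upto_dist[OF assms(1), of t u] assms(2,3)
    by (metis atLeastAtMost_iff diff_self dist_commute nle_le)
  then have "\<gamma> u = \<gamma> t" by simp
  then show ?thesis by (simp add: arc_length_param_def u_def P_def)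
qed

lemma length_upto_surj:
  assumes "rectifiable_curve \<gamma>" "path \<gamma>" "s \<in> {0..length_upto \<gamma> 1}"
  obtains t where "t \<in> {0..1}" "length_upto \<gamma> t = s"
  using IVT'[of "length_upto \<gamma>" 0 s 1] continuous_on_length_upto[OF assms(1,2)] assms(3) by auto

lemma arc_length_param_lipschitz:
  assumes "rectifiable_curve \<gamma>" "path \<gamma>" "s \<in> {0..length_upto \<gamma> 1}" "s' \<in> {0..length_upto \<gamma> 1}"
  shows "dist (arc_length_param \<gamma> s) (arc_length_param \<gamma> s') \<le> \<bar>s - s'\<bar>"
proof -
  obtain t where t: "t \<in> {0..1}" "length_upto \<gamma> t = s" using length_upto_surj assms by metis
  obtain t' where t': "t' \<in> {0..1}" "length_upto \<gamma> t' = s'" using length_upto_surj assms by metis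
  have "arc_length_param \<gamma> s = \<gamma> t" "arc_length_param \<gamma> s' = \<gamma> t'"
    using t t' by (auto intro!: arc_length_param_eq[OF assms(1)])
  then show ?thesis
    using length_upto_dist[OF assms(1), of t t'] length_upto_dist[OF assms(1), of t' t] t t'
    by (cases "t \<le> t'") (auto simp: dist_commute)
qed

lemma arc_length_param_endpoints:
  assumes "rectifiable_curve \<gamma>"
  shows "arc_length_param \<gamma> 0 = \<gamma> 0" "arc_length_param \<gamma> (length_upto \<gamma> 1) = \<gamma> 1"
  by (rule arc_length_param_eq[OF assms]; simp)+

lemma continuous_on_arc_length_param:
  assumes "rectifiable_curve \<gamma>" "path \<gamma>"
  shows "continuous_on {0..length_upto \<gamma> 1} (arc_length_param \<gamma>)"
  unfolding continuous_on_iff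
  using arc_length_param_lipschitz[OF assms] by (metis dist_real_def le_less_trans)

lemma curve_integral_eq:
  "curve_integral \<gamma> \<rho> = (\<integral>\<^sup>+ s \<in> {0..length_upto \<gamma> 1}. \<rho> (arc_length_param \<gamma> s) \<partial>lborel)"
  by (simp add: curve_integral_def length_upto_def)

lemma measurable_arc_length_param_indicator:
  fixes \<rho> :: "real^'n \<Rightarrow> ennreal"
  assumes "rectifiable_curve \<gamma>" "path \<gamma>" "\<rho> \<in> borel_measurable borel"
  shows "(\<lambda>s. \<rho> (arc_length_param \<gamma> s) * indicator {0..length_upto \<gamma> 1} s) \<in> borel_measurable borel"
proof -
  define L where "L = length_upto \<gamma> 1"
  \<comment> \<open>Clamping \<open>s\<close> to \<open>[0, L]\<close> extends the parametrization
    continuously to the whole line, which yields measurability.\<close>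
  define g where "g s = arc_length_param \<gamma> (min L (max 0 s))" for s
  have L: "0 \<le> L" by (simp add: L_def length_upto_nonneg)
  have "continuous_on UNIV g" unfolding g_def
    by (rule continuous_on_compose2[OF continuous_on_arc_length_param[OF assms(1,2)]])
      (use L in \<open>auto simp: L_def[symmetric] intro!: continuous_intros\<close>)
  then have [measurable]: "g \<in> borel_measurable borel" by (rule borel_measurable_continuous_onI)
  note assms(3)[measurable]
  have "(\<lambda>s. \<rho> (g s) * indicator {0..L} s) \<in> borel_measurable borel" by measurable
  moreover have "(\<lambda>s. \<rho> (g s) * indicator {0..L} s) =
    (\<lambda>s. \<rho> (arc_length_param \<gamma> s) * indicator {0..length_upto \<gamma> 1} s)"
    by (auto simp: fun_eq_iff g_def L_def indicator_def min_def max_def)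
  ultimately show ?thesis by simp
qed

text \<open>\<open>q\<close> is the first time at which the level \<open>\<beta>\<close> is reached,
  \<open>p\<close> the last time before \<open>q\<close> at level at most \<open>\<alpha>\<close>.
  In between the values stay strictly between the levels, and the Lipschitz bound makes this time
  interval long enough.\<close>

lemma lipschitz_crossing_interval:
  fixes u :: "real \<Rightarrow> real"
  assumes "0 \<le> L" and lip: "\<And>s s'. s \<in> {0..L} \<Longrightarrow> s' \<in> {0..L} \<Longrightarrow> \<bar>u s - u s'\<bar> \<le> \<bar>s - s'\<bar>"
    and "u 0 \<le> \<alpha>" "\<beta> \<le> u L" "\<alpha> < \<beta>"
  obtains p q where "{p<..<q} \<subseteq> {0..L}" "\<beta> - \<alpha> \<le> q - p" "\<And>s. s \<in> {p<..<q} \<Longrightarrow> u s \<in> {\<alpha><..<\<beta>}"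
proof -
  have cont: "continuous_on {0..L} u"
    unfolding continuous_on_iff using lip by (metis dist_real_def le_less_trans)
  define Q where "Q = {0..L} \<inter> u -` {\<beta>..}"
  have Q: "closed Q" unfolding Q_def by (intro continuous_closed_preimage cont) auto
  have "L \<in> Q" using assms by (auto simp: Q_def)
  then have ne: "Q \<noteq> {}" and bb: "bdd_below Q" by (auto simp: Q_def bdd_below_def)
  define q where "q = Inf Q"
  have q: "q \<in> Q" unfolding q_def by (rule closed_contains_Inf[OF ne bb Q])
  define P where "P = {0..q} \<inter> u -` {..\<alpha>}"
  have P: "closed P" unfolding P_def
    by (intro continuous_closed_preimage continuous_on_subset[OF cont]) (use q Q_def in auto)
  have "0 \<in> P" using assms q by (auto simp: P_def Q_def)
  then have neP: "P \<noteq> {}" and bbP: "bdd_above P" by (auto simp: P_def bdd_above_def)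
  define p where "p = Sup P"
  have p: "p \<in> P" unfolding p_def by (rule closed_contains_Sup[OF neP bbP P])
  show thesis
  proof
    show "{p<..<q} \<subseteq> {0..L}" using p q by (auto simp: P_def Q_def)
    have "\<bar>u q - u p\<bar> \<le> \<bar>q - p\<bar>" using p q by (intro lip) (auto simp: P_def Q_def)
    then show "\<beta> - \<alpha> \<le> q - p" using p q by (auto simp: P_def Q_def)
    fix s assume s: "s \<in> {p<..<q}"
    have "s \<notin> Q" using cInf_lower[OF _ bb, of s] s by (auto simp: q_def)
    moreover have "s \<notin> P" using cSup_upper[OF _ bbP, of s] s by (auto simp: p_def)
    ultimately show "u s \<in> {\<alpha><..<\<beta>}" using s p q by (auto simp: P_def Q_def)
  qed
qed

text \<open>The basis of the upper bounds for the modulus: a density equal to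
  \<open>1 / (\<beta> - \<alpha>)\<close> on the shell between two levels of a Lipschitz function
  has integral at least \<open>1\<close> along every curve that crosses the shell, in either
  direction.\<close>

lemma curve_crossing:
  fixes v :: "real^'n \<Rightarrow> real"
  assumes "rectifiable_curve \<gamma>" "path \<gamma>" and lip: "\<And>x y. \<bar>v x - v y\<bar> \<le> dist x y" and "\<alpha> < \<beta>"
    and ends: "v (\<gamma> 0) \<le> \<alpha> \<and> \<beta> \<le> v (\<gamma> 1) \<or> v (\<gamma> 1) \<le> \<alpha> \<and> \<beta> \<le> v (\<gamma> 0)"
  obtains p q where "{p<..<q} \<subseteq> {0..length_upto \<gamma> 1}" "\<beta> - \<alpha> \<le> q - p"
    "\<And>s. s \<in> {p<..<q} \<Longrightarrow> v (arc_length_param \<gamma> s) \<in> {\<alpha><..<\<beta>}"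
proof -
  have lip': "\<bar>v (arc_length_param \<gamma> s) - v (arc_length_param \<gamma> s')\<bar> \<le> \<bar>s - s'\<bar>"
    if "s \<in> {0..length_upto \<gamma> 1}" "s' \<in> {0..length_upto \<gamma> 1}" for s s'
    using lip arc_length_param_lipschitz[OF assms(1,2) that] order_trans by blast
  from ends show thesis
  proof
    assume "v (\<gamma> 0) \<le> \<alpha> \<and> \<beta> \<le> v (\<gamma> 1)"
    then show thesis
      using lipschitz_crossing_interval[OF length_upto_nonneg lip' _ _ \<open>\<alpha> < \<beta>\<close>]
        arc_length_param_endpoints[OF assms(1)] that by metis
  next
    assume *: "v (\<gamma> 1) \<le> \<alpha> \<and> \<beta> \<le> v (\<gamma> 0)"
    have lip'': "\<bar>- v (arc_length_param \<gamma> s) - - v (arc_length_param \<gamma> s')\<bar> \<le> \<bar>s - s'\<bar>"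
      if "s \<in> {0..length_upto \<gamma> 1}" "s' \<in> {0..length_upto \<gamma> 1}" for s s'
      using lip'[OF that] by linarith
    obtain p q where "{p<..<q} \<subseteq> {0..length_upto \<gamma> 1}" "- \<alpha> - - \<beta> \<le> q - p"
      "\<And>s. s \<in> {p<..<q} \<Longrightarrow> - v (arc_length_param \<gamma> s) \<in> {- \<beta><..< - \<alpha>}"
      by (rule lipschitz_crossing_interval[OF length_upto_nonneg lip'', where \<alpha>="- \<beta>" and \<beta>="- \<alpha>"])
        (use * \<open>\<alpha> < \<beta>\<close> arc_length_param_endpoints[OF assms(1)] in auto)
    then show thesis using that[of p q] by force
  qed
qed

section \<open>Segments and concatenated curves\<close>

lemma curve_length_linepath:
  assumes "s \<le> t" shows "curve_length (linepath a b) s t = ennreal ((t - s) * dist a b)"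
proof (rule antisym)
  have d: "dist (linepath a b x) (linepath a b y) = (y - x) * dist a b" if "x \<le> y" for x y
  proof -
    have "linepath a b y - linepath a b x = (y - x) *\<^sub>R (b - a)" by (simp add: linepath_def algebra_simps)
    then show ?thesis using that by (metis abs_of_nonneg diff_ge_0_iff_ge dist_commute dist_norm norm_scaleR)
  qed
  have pl: "polygon_length (linepath a b) (x # ts) = (last (x # ts) - x) * dist a b" if "sorted (x # ts)" for x ts
    using that by (induction ts arbitrary: x) (auto simp: d algebra_simps)
  show "curve_length (linepath a b) s t \<le> ennreal ((t - s) * dist a b)"
    unfolding curve_length_eq_SUP_polygon_length
  proof (rule SUP_least)
    fix ts assume ts: "ts \<in> {ts. sorted ts \<and> set ts \<subseteq> {s..t}}"
    show "ennreal (polygon_length (linepath a b) ts) \<le> ennreal ((t - s) * dist a b)"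
    proof (cases ts)
      case (Cons x xs)
      have "last ts \<le> t" "s \<le> x" using ts Cons last_in_set[of ts] by auto
      then show ?thesis using pl[of x xs] Cons ts by (auto intro!: ennreal_leI mult_right_mono)
    qed simp
  qed
  show "ennreal ((t - s) * dist a b) \<le> curve_length (linepath a b) s t"
    using dist_le_curve_length[OF assms, of "linepath a b"] d[OF assms] by simp
qed

lemma rectifiable_linepath: "rectifiable_curve (linepath a b)"
  unfolding rectifiable_curve_def by (simp add: curve_length_linepath)

lemma length_upto_linepath: "0 \<le> t \<Longrightarrow> length_upto (linepath a b) t = t * dist a b"
  unfolding length_upto_def by (simp add: curve_length_linepath)

lemma curve_integral_linepath:
  assumes [measurable]: "\<rho> \<in> borel_measurable borel"
  shows "curve_integral (linepath a b) \<rho> = ennreal (dist a b) * (\<integral>\<^sup>+t\<in>{0..1}. \<rho> (linepath a b t) \<partial>lborel)"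
proof (cases "a = b")
  case True
  then have "curve_integral (linepath a b) \<rho> =
      (\<integral>\<^sup>+s. \<rho> (arc_length_param (linepath a b) s) * indicator {0::real} s \<partial>lborel)"
    by (simp add: curve_integral_eq length_upto_linepath)
  also have "\<dots> = 0" by (subst nn_integral_indicator_singleton) auto
  finally show ?thesis using True by simp
next
  case False
  then have d: "dist a b > 0" by simp
  have "(\<lambda>t. linepath a b t) \<in> borel_measurable borel"
    by (intro borel_measurable_continuous_onI) (auto simp: linepath_def intro!: continuous_intros)
  note [measurable] = this
  have eq: "\<rho> (arc_length_param (linepath a b) s) * indicator {0..dist a b} s =
    \<rho> (linepath a b (s / dist a b)) * indicator {0..dist a b} s" for s
    using arc_length_param_eq[OF rectifiable_linepath, of "s / dist a b" a b s] d
    by (auto simp: indicator_def length_upto_linepath)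
  have "curve_integral (linepath a b) \<rho> =
    (\<integral>\<^sup>+s. \<rho> (linepath a b (s / dist a b)) * indicator {0..dist a b} s \<partial>lborel)"
    by (simp add: curve_integral_eq length_upto_linepath eq)
  also have "\<dots> = ennreal \<bar>dist a b\<bar> * (\<integral>\<^sup>+t. \<rho> (linepath a b ((0 + dist a b * t) / dist a b)) * indicator {0..dist a b} (0 + dist a b * t) \<partial>lborel)"
    by (rule nn_integral_real_affine) (use d in auto)
  also have "\<dots> = ennreal (dist a b) * (\<integral>\<^sup>+t\<in>{0..1}. \<rho> (linepath a b t) \<partial>lborel)"
    using d by (auto simp: indicator_def zero_le_mult_iff intro!: arg_cong2[where f="(*)"] nn_integral_cong)
  finally show ?thesis .
qed

lemma curve_length_joinpaths:
  assumes "pathfinish g1 = pathstart g2"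
  shows "t \<in> {0..1} \<Longrightarrow> curve_length (g1 +++ g2) 0 (t / 2) = curve_length g1 0 t"
    and "t \<in> {0..1} \<Longrightarrow> curve_length (g1 +++ g2) (1/2) ((t + 1) / 2) = curve_length g2 0 t"
proof -
  assume t: "t \<in> {0..1}"
  have "curve_length (g1 +++ g2) 0 (t / 2) = curve_length (\<lambda>t. g1 (2 * t + 0)) 0 (t/2)"
    by (rule curve_length_cong) (use t in \<open>auto simp: joinpaths_def\<close>)
  then show "curve_length (g1 +++ g2) 0 (t / 2) = curve_length g1 0 t"
    using curve_length_affine[of 2 g1 0 0 "t/2"] by simp
  have "curve_length (g1 +++ g2) (1/2) ((t + 1) / 2) = curve_length (\<lambda>t. g2 (2 * t + -1)) (1/2) ((t + 1)/2)"
    by (rule curve_length_cong) (use t assms in \<open>auto simp: joinpaths_def pathstart_def pathfinish_def field_simps\<close>)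
  then show "curve_length (g1 +++ g2) (1/2) ((t + 1) / 2) = curve_length g2 0 t"
    using curve_length_affine[of 2 g2 "-1" "1/2" "(t+1)/2"] by (simp add: add_divide_distrib)
qed

lemma rectifiable_joinpaths:
  assumes "pathfinish g1 = pathstart g2" "rectifiable_curve g1" "rectifiable_curve g2"
  shows "rectifiable_curve (g1 +++ g2)"
  using curve_length_add[of 0 "1/2" 1 "g1 +++ g2"] curve_length_joinpaths[OF assms(1), of 1] assms(2,3)
  unfolding rectifiable_curve_def by simp

lemma length_upto_joinpaths:
  assumes "pathfinish g1 = pathstart g2" "rectifiable_curve g1" "rectifiable_curve g2" "t \<in> {0..1}"
  shows "length_upto (g1 +++ g2) (t / 2) = length_upto g1 t"
    and "length_upto (g1 +++ g2) ((t + 1) / 2) = length_upto g1 1 + length_upto g2 t"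
proof -
  show "length_upto (g1 +++ g2) (t / 2) = length_upto g1 t"
    using curve_length_joinpaths(1)[OF assms(1,4)] by (simp add: length_upto_def)
  have "ennreal (length_upto (g1 +++ g2) ((t + 1) / 2)) = ennreal (length_upto g1 1 + length_upto g2 t)"
    using curve_length_add[of 0 "1/2" "(t+1)/2" "g1 +++ g2"] curve_length_joinpaths[OF assms(1), of 1] assms(4)
      curve_length_joinpaths(2)[OF assms(1,4)]
    by (simp add: ennreal_length_upto assms rectifiable_joinpaths length_upto_nonneg ennreal_plus)
  then show "length_upto (g1 +++ g2) ((t + 1) / 2) = length_upto g1 1 + length_upto g2 t"
    using length_upto_nonneg[of g1 1] length_upto_nonneg[of g2 t] by (subst (asm) ennreal_inj) (auto simp: length_upto_nonneg)
qed

text \<open>The arc length \<open>L1\<close> of the joining point belongs to both pieces and is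
  counted twice by the sum of the integrands, hence an inequality. It serves to bound the integral
  over a concrete polygon from above.\<close>

lemma curve_integral_joinpaths:
  assumes j: "pathfinish g1 = pathstart g2" and r: "rectifiable_curve g1" "rectifiable_curve g2"
    and p: "path g1" "path g2" and [measurable]: "\<rho> \<in> borel_measurable borel"
  shows "curve_integral (g1 +++ g2) \<rho> \<le> curve_integral g1 \<rho> + curve_integral g2 \<rho>"
proof -
  define L1 L2 where "L1 = length_upto g1 1" and "L2 = length_upto g2 1"
  have L: "L1 \<ge> 0" "L2 \<ge> 0" "length_upto (g1 +++ g2) 1 = L1 + L2"
    using length_upto_joinpaths(2)[OF j r, of 1] by (auto simp: L1_def L2_def length_upto_nonneg)
  note rj = rectifiable_joinpaths[OF j r]
  have e1: "arc_length_param (g1 +++ g2) s = arc_length_param g1 s" if "s \<in> {0..L1}" for s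
  proof -
    obtain t where t: "t \<in> {0..1}" "length_upto g1 t = s"
      using length_upto_surj[OF r(1) p(1)] \<open>s \<in> {0..L1}\<close> unfolding L1_def by metis
    have "arc_length_param (g1 +++ g2) s = (g1 +++ g2) (t/2)"
      by (rule arc_length_param_eq[OF rj]) (use t length_upto_joinpaths(1)[OF j r t(1)] in auto)
    also have "\<dots> = g1 t" using t by (simp add: joinpaths_def)
    also have "\<dots> = arc_length_param g1 s" using arc_length_param_eq[OF r(1) t] by simp
    finally show ?thesis .
  qed
  have e2: "arc_length_param (g1 +++ g2) (L1 + s) = arc_length_param g2 s" if "s \<in> {0..L2}" for s
  proof -
    obtain t where t: "t \<in> {0..1}" "length_upto g2 t = s"
      using length_upto_surj[OF r(2) p(2)] \<open>s \<in> {0..L2}\<close> unfolding L2_def by metis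
    have "arc_length_param (g1 +++ g2) (L1 + s) = (g1 +++ g2) ((t+1)/2)"
      by (rule arc_length_param_eq[OF rj]) (use t length_upto_joinpaths(2)[OF j r t(1)] L1_def in auto)
    also have "\<dots> = g2 t" using t j by (auto simp: joinpaths_def pathstart_def pathfinish_def field_simps)
    also have "\<dots> = arc_length_param g2 s" using arc_length_param_eq[OF r(2) t] by simp
    finally show ?thesis .
  qed
  define F1 F2 where "F1 s = \<rho> (arc_length_param g1 s) * indicator {0..L1} s"
    and "F2 s = \<rho> (arc_length_param g2 s) * indicator {0..L2} s" for s
  have [measurable]: "F1 \<in> borel_measurable borel" "F2 \<in> borel_measurable borel"
    unfolding F1_def F2_def L1_def L2_def
    by (rule measurable_arc_length_param_indicator[OF r(1) p(1)] measurable_arc_length_param_indicator[OF r(2) p(2)]; simp)+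
  have "curve_integral (g1 +++ g2) \<rho> \<le> (\<integral>\<^sup>+s. F1 s + F2 (s - L1) \<partial>lborel)"
    unfolding curve_integral_eq L(3)
  proof (rule nn_integral_mono)
    fix s
    show "\<rho> (arc_length_param (g1 +++ g2) s) * indicator {0..L1 + L2} s \<le> F1 s + F2 (s - L1)"
      using e1[of s] e2[of "s - L1"] by (auto simp: F1_def F2_def indicator_def)
  qed
  also have "\<dots> = (\<integral>\<^sup>+s. F1 s \<partial>lborel) + (\<integral>\<^sup>+s. F2 (s - L1) \<partial>lborel)"
    by (rule nn_integral_add) auto
  also have "(\<integral>\<^sup>+s. F2 (s - L1) \<partial>lborel) = (\<integral>\<^sup>+s. F2 s \<partial>lborel)"
    using nn_integral_real_affine[of "\<lambda>s. F2 (s - L1)" 1 L1] by simp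
  finally show ?thesis
    unfolding curve_integral_eq F1_def F2_def L1_def L2_def .
qed

section \<open>Uniformly distributed measures\<close>

text \<open>Two measures that give all the sets \<open>E k x\<close> the same mass, where these sets shrink to
  \<open>x\<close>, agree on open sets: integrate the indicator of \<open>(x, y) \<in> E k\<close> over \<open>U \<times> U\<close> in both orders,
  and let \<open>k\<close> tend to infinity.\<close>

lemma uniformly_distributed_open_le:
  fixes \<mu> \<nu> :: "'a::euclidean_space measure" and E :: "nat \<Rightarrow> ('a \<times> 'a) set"
  assumes sets: "sets \<mu> = sets borel" "sets \<nu> = sets borel"
    and fin: "sigma_finite_measure \<mu>" "sigma_finite_measure \<nu>"
    and E: "\<And>k. open (E k)" "\<And>k x y. (x, y) \<in> E k \<Longrightarrow> (y, x) \<in> E k"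
    and m: "\<And>k. 0 < m k" "\<And>k. m k < \<infinity>"
    and \<mu>: "\<And>k x. x \<in> X \<Longrightarrow> emeasure \<mu> (E k `` {x}) = m k"
    and \<nu>: "\<And>k x. x \<in> X \<Longrightarrow> emeasure \<nu> (E k `` {x}) = m k"
    and shrink: "\<And>x V. x \<in> X \<Longrightarrow> open V \<Longrightarrow> x \<in> V \<Longrightarrow> \<forall>\<^sub>F k in sequentially. E k `` {x} \<subseteq> V"
    and U: "open U" "U \<subseteq> X"
  shows "emeasure \<nu> U \<le> emeasure \<mu> U"
proof -
  interpret \<mu>: sigma_finite_measure \<mu> by fact
  interpret \<nu>: sigma_finite_measure \<nu> by fact
  interpret P: pair_sigma_finite \<nu> \<mu> ..
  have sp: "space \<mu> = UNIV" "space \<nu> = UNIV" using sets_eq_imp_space_eq[OF sets(1)] sets_eq_imp_space_eq[OF sets(2)] by simp_all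
  define f where "f k y x = (indicator (E k) (y, x) * indicator U y * indicator U x :: ennreal)" for k y x
  have Es: "E k \<in> sets (\<nu> \<Otimes>\<^sub>M \<mu>)" for k
  proof -
    have "sets (\<nu> \<Otimes>\<^sub>M \<mu>) = sets (borel :: ('a \<times> 'a) measure)"
      using sets_pair_measure_cong[OF sets(2,1)] unfolding borel_prod .
    then show ?thesis using E(1) by auto
  qed
  have Us: "U \<in> sets \<mu>" "U \<in> sets \<nu>" using U sets by auto
  note [measurable] = Es Us
  have fm: "case_prod (f k) \<in> borel_measurable (\<nu> \<Otimes>\<^sub>M \<mu>)" for k
    unfolding f_def by measurable
  have [measurable]: "(\<lambda>y. \<integral>\<^sup>+x. f k y x \<partial>\<mu>) \<in> borel_measurable \<nu>" for k
    using \<mu>.borel_measurable_nn_integral[OF fm] by simp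
  define g where "g k y = (\<integral>\<^sup>+x. f k y x \<partial>\<mu>) / m k" for k y
  have open_sl: "open (E k `` {x})" for k x
  proof -
    have "E k `` {x} = (\<lambda>y. (x,y)) -` E k" by auto
    then show ?thesis using open_vimage[OF E(1), of "\<lambda>y. (x,y)"] by (simp add: continuous_on_Pair)
  qed
  \<comment> \<open>Once the slice at \<open>y\<close> lies in \<open>U\<close>, its whole mass
    \<open>m k\<close> is counted and \<open>g k y = 1\<close>. How large \<open>k\<close> has to be
    depends on \<open>y\<close>, so the limit is taken with Fatou's lemma.\<close>
  have lim: "indicator U y \<le> liminf (\<lambda>k. g k y)" for y
  proof (cases "y \<in> U")
    case True
    have "\<forall>\<^sub>F k in sequentially. 1 \<le> g k y"
      using shrink[of y U]
    proof (rule eventually_mono)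
      fix k assume sub: "E k `` {y} \<subseteq> U"
      have "f k y x = indicator (E k `` {y}) x" for x
        using sub True by (auto simp: f_def indicator_def)
      then have "(\<integral>\<^sup>+x. f k y x \<partial>\<mu>) = emeasure \<mu> (E k `` {y})"
        using open_sl sets by (simp add: nn_integral_indicator)
      then show "1 \<le> g k y" using \<mu>[of y k] True U m[of k]
        by (auto simp: g_def ennreal_divide_self)
    qed (use U True in auto)
    then have "1 \<le> liminf (\<lambda>k. g k y)" by (rule Liminf_bounded)
    then show ?thesis using True by simp
  qed auto
  have bound: "(\<integral>\<^sup>+y. g k y \<partial>\<nu>) \<le> emeasure \<mu> U" for k
  proof -
    have "(\<integral>\<^sup>+y. g k y \<partial>\<nu>) = (\<integral>\<^sup>+y. (\<integral>\<^sup>+x. f k y x \<partial>\<mu>) \<partial>\<nu>) / m k"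
      unfolding g_def by (intro nn_integral_divide) auto
    also have "(\<integral>\<^sup>+y. (\<integral>\<^sup>+x. f k y x \<partial>\<mu>) \<partial>\<nu>) = (\<integral>\<^sup>+x. (\<integral>\<^sup>+y. f k y x \<partial>\<nu>) \<partial>\<mu>)"
      by (rule P.Fubini'[OF fm, symmetric])
    also have "\<dots> \<le> (\<integral>\<^sup>+x. m k * indicator U x \<partial>\<mu>)"
    proof (rule nn_integral_mono)
      fix x
      show "(\<integral>\<^sup>+y. f k y x \<partial>\<nu>) \<le> m k * indicator U x"
      proof (cases "x \<in> U")
        case True
        have "(\<integral>\<^sup>+y. f k y x \<partial>\<nu>) \<le> (\<integral>\<^sup>+y. indicator (E k `` {x}) y \<partial>\<nu>)"
          using E(2) by (intro nn_integral_mono) (auto simp: f_def indicator_def)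
        also have "\<dots> = m k" using \<nu>[of x k] True U open_sl sets by (simp add: nn_integral_indicator subset_eq)
        finally show ?thesis using True by simp
      qed (simp add: f_def)
    qed
    also have "\<dots> = m k * emeasure \<mu> U" by (simp add: nn_integral_cmult)
    finally have "(\<integral>\<^sup>+y. g k y \<partial>\<nu>) \<le> (m k * emeasure \<mu> U) / m k"
      by (simp add: divide_right_mono_ennreal)
    also have "\<dots> = emeasure \<mu> U"
      using m[of k] ennreal_mult_divide_eq[of "m k" "emeasure \<mu> U"] by (simp add: mult.commute[of "m k"])
    finally show ?thesis .
  qed
  have "emeasure \<nu> U = (\<integral>\<^sup>+y. indicator U y \<partial>\<nu>)" by (simp add: nn_integral_indicator)
  also have "\<dots> \<le> (\<integral>\<^sup>+y. liminf (\<lambda>k. g k y) \<partial>\<nu>)" by (intro nn_integral_mono lim)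
  also have "\<dots> \<le> liminf (\<lambda>k. \<integral>\<^sup>+y. g k y \<partial>\<nu>)"
    by (rule nn_integral_liminf) (simp add: g_def)
  also have "\<dots> \<le> limsup (\<lambda>k. \<integral>\<^sup>+y. g k y \<partial>\<nu>)" by (rule Liminf_le_Limsup) simp
  also have "\<dots> \<le> emeasure \<mu> U" by (rule Limsup_bounded) (simp add: bound)
  finally show ?thesis .
qed

text \<open>With the pairs at distance less than \<open>1 / Suc k\<close> as uniformly distributed
  sets, the comparison applies in both directions. The scaling law of Lebesgue measure under
  similarities is derived from this, without determinants.\<close>

lemma measure_eq_lborel_if_balls:
  fixes \<nu> :: "'a::euclidean_space measure"
  assumes sets: "sets \<nu> = sets borel" and balls: "\<And>x r. 0 < r \<Longrightarrow> emeasure \<nu> (ball x r) = emeasure lborel (ball x r)"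
  shows "\<nu> = lborel"
proof -
  define E where "E k = {p :: 'a \<times> 'a. dist (fst p) (snd p) < 1 / Suc k}" for k
  define m where "m k = emeasure lborel (ball (0::'a) (1 / Suc k))" for k
  have sl: "E k `` {x} = ball x (1 / Suc k)" for k x by (auto simp: E_def)
  have opE: "open (E k)" for k
    unfolding E_def by (intro open_Collect_less continuous_intros)
  have sym: "(y, x) \<in> E k" if "(x, y) \<in> E k" for k x y
    using that by (simp add: E_def dist_commute)
  have m: "0 < m k" "m k < \<infinity>" for k
    by (simp_all add: m_def emeasure_ball)
  have \<mu>: "emeasure lborel (E k `` {x}) = m k" for k x
    by (simp add: sl m_def emeasure_ball)
  have \<nu>: "emeasure \<nu> (E k `` {x}) = m k" for k x
    by (simp add: sl m_def balls) (simp add: emeasure_ball)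
  have shrink: "\<forall>\<^sub>F k in sequentially. E k `` {x} \<subseteq> V" if V: "open V" "x \<in> V" for x V
  proof -
    obtain e where e: "e > 0" "ball x e \<subseteq> V" using V open_contains_ball by blast
    obtain N where N: "1 / real (Suc N) < e" using e(1) reals_Archimedean by (auto simp: inverse_eq_divide)
    show ?thesis
      using eventually_ge_at_top[of N]
    proof eventually_elim
      case (elim k)
      have "1 / real (Suc k) \<le> 1 / real (Suc N)" using elim by (simp add: frac_le)
      then have "ball x (1 / Suc k) \<subseteq> ball x e" using N by (intro subset_ball) simp
      then show ?case unfolding sl using e(2) by blast
    qed
  qed
  have sf: "sigma_finite_measure \<nu>"
  proof (rule sigma_finite_measure.intro, intro exI conjI ballI)
    show "countable (range (\<lambda>n. ball (0::'a) (Suc n)))" by simp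
    show "range (\<lambda>n. ball (0::'a) (real (Suc n))) \<subseteq> sets \<nu>" by (simp add: sets image_subset_iff)
    have "x \<in> (\<Union>n. ball (0::'a) (real (Suc n)))" for x
    proof -
      obtain n where "norm x < real n" using reals_Archimedean2 by blast
      then have "x \<in> ball 0 (real (Suc n))" by simp
      then show ?thesis by blast
    qed
    then show "\<Union> (range (\<lambda>n. ball (0::'a) (real (Suc n)))) = space \<nu>"
      using sets_eq_imp_space_eq[OF sets] by auto
    fix A assume "A \<in> range (\<lambda>n. ball (0::'a) (real (Suc n)))"
    then obtain n where "A = ball 0 (real (Suc n))" by blast
    then have "emeasure \<nu> A = emeasure lborel (ball (0::'a) (real (Suc n)))" by (simp add: balls)
    then show "emeasure \<nu> A \<noteq> \<infinity>"
      using emeasure_lborel_ball_finite[of "0::'a" "real (Suc n)"] by simp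
  qed
  have eq: "emeasure lborel U = emeasure \<nu> U" if "open U" for U
  proof (rule antisym)
    show "emeasure \<nu> U \<le> emeasure lborel U"
      by (rule uniformly_distributed_open_le[where X=UNIV and m=m and E=E,
            OF sets_lborel sets lborel.sigma_finite_measure_axioms sf opE _ m \<mu> \<nu>])
        (use sym shrink that in blast)+
    show "emeasure lborel U \<le> emeasure \<nu> U"
      by (rule uniformly_distributed_open_le[where X=UNIV and m=m and E=E,
            OF sets sets_lborel sf lborel.sigma_finite_measure_axioms opE _ m \<nu> \<mu>])
        (use sym shrink that in blast)+
  qed
  have "lborel = \<nu>"
  proof (rule measure_eqI_generator_eq[where E="{S::'a set. open S}" and \<Omega>=UNIV and A="\<lambda>n. ball 0 (real n)"])
    show "Int_stable {S::'a set. open S}" by (auto simp: Int_stable_def)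
    show "sets lborel = sigma_sets UNIV {S::'a set. open S}" by (simp add: borel_def)
    then show "sets \<nu> = sigma_sets UNIV {S::'a set. open S}" using sets by simp
    have "x \<in> (\<Union>n. ball (0::'a) (real n))" for x
      using reals_Archimedean2[of "norm x"] by auto
    then show "(\<Union>n. ball (0::'a) (real n)) = UNIV" by auto
    show "emeasure lborel (ball (0::'a) (real i)) \<noteq> \<infinity>" for i
      using emeasure_lborel_ball_finite[of "0::'a" "real i"] by simp
  qed (use eq in auto)
  then show ?thesis by simp
qed

section \<open>Similarities\<close>

text \<open>Purely metric, so that one notion covers translations, scalings, orthogonal maps and, on
  a product space, the exchange of two coordinates. Surjectivity makes the inverse a similarity
  again.\<close>

definition similarity :: "real \<Rightarrow> ('a::euclidean_space \<Rightarrow> 'a) \<Rightarrow> bool" where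
  "similarity c \<phi> \<longleftrightarrow> 0 < c \<and> surj \<phi> \<and> (\<forall>x y. dist (\<phi> x) (\<phi> y) = c * dist x y)"

lemma similarity_bij: "similarity c \<phi> \<Longrightarrow> bij \<phi>"
  unfolding similarity_def bij_def inj_def by (metis dist_eq_0_iff less_irrefl mult_eq_0_iff)

lemma similarity_inv:
  assumes "similarity c \<phi>" shows "similarity (1 / c) (inv \<phi>)"
proof -
  have b: "bij \<phi>" using similarity_bij assms by blast
  have "dist (inv \<phi> x) (inv \<phi> y) = (1 / c) * dist x y" for x y
    using assms b unfolding similarity_def
    by (metis bij_inv_eq_iff less_irrefl nonzero_mult_div_cancel_left times_divide_eq_left mult_1)
  then show ?thesis using assms b unfolding similarity_def by (simp add: bij_imp_bij_inv bij_is_surj)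
qed

lemma similarity_continuous_on:
  assumes "similarity c \<phi>" shows "continuous_on A \<phi>"
proof -
  have "0 < c" "\<And>x y. dist (\<phi> x) (\<phi> y) = c * dist x y" using assms by (auto simp: similarity_def)
  then show ?thesis
    unfolding continuous_on_iff by (metis mult.commute pos_less_divide_eq divide_pos_pos)
qed

lemma similarity_measurable: "similarity c \<phi> \<Longrightarrow> \<phi> \<in> borel_measurable borel"
  using similarity_continuous_on borel_measurable_continuous_onI by blast

text \<open>Preimages of balls are balls with the radius divided by \<open>c\<close>; hence the
  image of Lebesgue measure, multiplied by \<open>c ^ DIM('a)\<close>, gives every ball its Lebesgue
  measure.\<close>

lemma nn_integral_similarity:
  fixes \<phi> :: "'a::euclidean_space \<Rightarrow> 'a"
  assumes s: "similarity c \<phi>" and [measurable]: "g \<in> borel_measurable borel"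
  shows "(\<integral>\<^sup>+x. g x \<partial>lborel) = ennreal (c ^ DIM('a)) * (\<integral>\<^sup>+x. g (\<phi> x) \<partial>lborel)"
proof -
  note [measurable] = similarity_measurable[OF s]
  have c: "c > 0" using s by (simp add: similarity_def)
  have b: "bij \<phi>" using similarity_bij s by blast
  have "scale_measure (ennreal (c ^ DIM('a))) (distr lborel borel \<phi>) = lborel"
  proof (rule measure_eq_lborel_if_balls)
    fix x :: 'a and r :: real assume r: "0 < r"
    have "dist x (\<phi> z) = c * dist (inv \<phi> x) z" for z
      using s b unfolding similarity_def by (metis bij_inv_eq_iff)
    then have "\<phi> -` ball x r \<inter> space lborel = ball (inv \<phi> x) (r / c)"
      using c by (auto simp: field_simps)
    then have "emeasure (scale_measure (ennreal (c ^ DIM('a))) (distr lborel borel \<phi>)) (ball x r)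
      = ennreal (c ^ DIM('a)) * emeasure lborel (ball (inv \<phi> x) (r / c))"
      by (simp add: emeasure_distr)
    also have "\<dots> = emeasure lborel (ball x r)"
      using r c by (simp add: emeasure_ball ennreal_mult[symmetric] power_divide)
    finally show "emeasure (scale_measure (ennreal (c ^ DIM('a))) (distr lborel borel \<phi>)) (ball x r) = emeasure lborel (ball x r)" .
  qed simp
  then have "(\<integral>\<^sup>+x. g x \<partial>lborel) = (\<integral>\<^sup>+x. g x \<partial>scale_measure (ennreal (c ^ DIM('a))) (distr lborel borel \<phi>))"
    by simp
  also have "\<dots> = ennreal (c ^ DIM('a)) * (\<integral>\<^sup>+x. g x \<partial>distr lborel borel \<phi>)"
    by (rule nn_integral_scale_measure) simp
  also have "(\<integral>\<^sup>+x. g x \<partial>distr lborel borel \<phi>) = (\<integral>\<^sup>+x. g (\<phi> x) \<partial>lborel)"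
    by (rule nn_integral_distr) auto
  finally show ?thesis .
qed

lemma curve_length_similarity:
  fixes \<phi> :: "real^'n \<Rightarrow> real^'n"
  assumes "similarity c \<phi>"
  shows "curve_length (\<phi> \<circ> \<gamma>) a b = ennreal c * curve_length \<gamma> a b"
proof -
  have c: "0 < c" "\<And>x y. dist (\<phi> x) (\<phi> y) = c * dist x y" using assms by (auto simp: similarity_def)
  have "polygon_length (\<phi> \<circ> \<gamma>) ts = c * polygon_length \<gamma> ts" for ts
    by (induction ts rule: induct_list012) (auto simp: c algebra_simps)
  then have "ennreal (polygon_length (\<phi> \<circ> \<gamma>) ts) = ennreal c * ennreal (polygon_length \<gamma> ts)" for ts
    using c by (simp add: ennreal_mult polygon_length_nonneg)
  then show ?thesis
    unfolding curve_length_eq_SUP_polygon_length by (simp add: SUP_mult_left_ennreal)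
qed

lemma curve_integral_similarity:
  fixes \<phi> :: "real^'n \<Rightarrow> real^'n" and \<rho> :: "real^'n \<Rightarrow> ennreal"
  assumes s: "similarity c \<phi>" and r: "rectifiable_curve \<gamma>" and p: "path \<gamma>" and m: "\<rho> \<in> borel_measurable borel"
  shows "curve_integral (\<phi> \<circ> \<gamma>) \<rho> = ennreal c * curve_integral \<gamma> (\<rho> \<circ> \<phi>)"
proof -
  have c: "0 < c" using s by (auto simp: similarity_def)
  have L: "length_upto (\<phi> \<circ> \<gamma>) t = c * length_upto \<gamma> t" for t
    using c by (simp add: length_upto_def curve_length_similarity[OF s] enn2real_mult)
  have r': "rectifiable_curve (\<phi> \<circ> \<gamma>)"
    using r unfolding rectifiable_curve_def by (simp add: curve_length_similarity[OF s] ennreal_mult_less_top)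
  have p': "path (\<phi> \<circ> \<gamma>)"
    unfolding path_def by (rule continuous_on_compose) (use p similarity_continuous_on[OF s] in \<open>auto simp: path_def\<close>)
  have a: "arc_length_param (\<phi> \<circ> \<gamma>) (c * u) = \<phi> (arc_length_param \<gamma> u)" if u: "u \<in> {0..length_upto \<gamma> 1}" for u
  proof -
    obtain t where t: "t \<in> {0..1}" "length_upto \<gamma> t = u" using length_upto_surj[OF r p u] by metis
    have "arc_length_param (\<phi> \<circ> \<gamma>) (c * u) = (\<phi> \<circ> \<gamma>) t"
      by (rule arc_length_param_eq[OF r' t(1)]) (simp add: L t)
    then show ?thesis using arc_length_param_eq[OF r t] by simp
  qed
  have "curve_integral (\<phi> \<circ> \<gamma>) \<rho> = (\<integral>\<^sup>+u. \<rho> (arc_length_param (\<phi> \<circ> \<gamma>) u) * indicator {0..length_upto (\<phi> \<circ> \<gamma>) 1} u \<partial>lborel)"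
    by (simp add: curve_integral_eq)
  also have "\<dots> = ennreal \<bar>c\<bar> * (\<integral>\<^sup>+u. \<rho> (arc_length_param (\<phi> \<circ> \<gamma>) (0 + c * u)) * indicator {0..length_upto (\<phi> \<circ> \<gamma>) 1} (0 + c * u) \<partial>lborel)"
    by (rule nn_integral_real_affine[OF measurable_arc_length_param_indicator[OF r' p' m]]) (use c in auto)
  also have "(\<integral>\<^sup>+u. \<rho> (arc_length_param (\<phi> \<circ> \<gamma>) (0 + c * u)) * indicator {0..length_upto (\<phi> \<circ> \<gamma>) 1} (0 + c * u) \<partial>lborel)
    = (\<integral>\<^sup>+u. (\<rho> \<circ> \<phi>) (arc_length_param \<gamma> u) * indicator {0..length_upto \<gamma> 1} u \<partial>lborel)"
    using c a by (intro nn_integral_cong) (auto simp: indicator_def L zero_le_mult_iff)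
  finally show ?thesis by (simp only: curve_integral_eq[of \<gamma>] abs_of_pos[OF c])
qed

section \<open>Boundary curves\<close>

text \<open>For open \<open>D\<close>, tending to the boundary in the extended space means leaving every compact
  subset of \<open>D\<close>.\<close>

lemma boundary_curves_open:
  fixes D :: "(real^'n) set"
  assumes "open D"
  shows "boundary_curves D z = {\<gamma> ` {0..<1} | \<gamma>. continuous_on {0..<1} \<gamma> \<and> \<gamma> ` {0..<1} \<subseteq> D \<and> \<gamma> 0 = z \<and>
     (\<forall>K. compact K \<and> K \<subseteq> D \<longrightarrow> (\<forall>\<^sub>F t in at_left (1::real). \<gamma> t \<notin> K))}"
proof -
  have opD: "openin extended_space (Some ` D)" using assms by simp
  have bd: "extended_boundary D = extended_space closure_of (Some ` D) - Some ` D"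
    unfolding extended_boundary_def frontier_of_def using opD by (simp add: interior_of_openin)
  have "(\<forall>U. openin extended_space U \<and> extended_boundary D \<subseteq> U \<longrightarrow> (\<forall>\<^sub>F t in at_left (1::real). Some (\<gamma> t) \<in> U)) \<longleftrightarrow>
    (\<forall>K. compact K \<and> K \<subseteq> D \<longrightarrow> (\<forall>\<^sub>F t in at_left (1::real). \<gamma> t \<notin> K))" (is "?L \<longleftrightarrow> ?R")
    if \<gamma>: "\<gamma> ` {0..<1} \<subseteq> D" for \<gamma> :: "real \<Rightarrow> real^'n"
  proof
    assume L: ?L
    show ?R
    proof (intro allI impI)
      fix K assume K: "compact K \<and> K \<subseteq> D"
      define U where "U = insert None (Some ` (UNIV - K))"
      have "openin extended_space U"
        unfolding openin_Alexandroff_compactification U_def using K by (auto simp: compact_imp_closed)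
      moreover have "extended_boundary D \<subseteq> U"
      proof
        fix p assume "p \<in> extended_boundary D"
        then have "p \<notin> Some ` K" using K unfolding bd by blast
        then show "p \<in> U" by (cases p) (auto simp: U_def)
      qed
      ultimately have "\<forall>\<^sub>F t in at_left (1::real). Some (\<gamma> t) \<in> U" using L by blast
      then show "\<forall>\<^sub>F t in at_left (1::real). \<gamma> t \<notin> K"
        by eventually_elim (auto simp: U_def)
    qed
  next
    assume R: ?R
    show ?L
    proof (intro allI impI)
      fix U assume U: "openin extended_space U \<and> extended_boundary D \<subseteq> U"
      \<comment> \<open>The part of the closure of \<open>D\<close> outside \<open>U\<close> is
        closed and misses the boundary, so it lies in \<open>D\<close>; as it does not contain
        infinity, it is a compact subset of \<open>D\<close>.\<close>
      define S where "S = extended_space closure_of (Some ` D) - U"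
      have S: "closedin extended_space S" unfolding S_def using U by (intro closedin_diff) auto
      have SD: "S \<subseteq> Some ` D" using U unfolding S_def bd by blast
      have "None \<notin> S" using SD by auto
      then obtain K where K: "compact K" "S = Some ` K"
        using S unfolding closedin_Alexandroff_compactification by auto
      then have "K \<subseteq> D" using SD by auto
      then have "\<forall>\<^sub>F t in at_left (1::real). \<gamma> t \<notin> K" using R K by blast
      moreover have "\<forall>\<^sub>F t in at_left (1::real). t \<in> {0<..<1}" by (rule eventually_at_leftI[of 0]) auto
      ultimately show "\<forall>\<^sub>F t in at_left (1::real). Some (\<gamma> t) \<in> U"
      proof eventually_elim
        case (elim t)
        have "Some (\<gamma> t) \<in> extended_space closure_of (Some ` D)"
          using closure_of_subset[OF openin_subset[OF opD]] elim \<gamma> by force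
        moreover have "Some (\<gamma> t) \<notin> S" using elim K by auto
        ultimately show ?case by (simp add: S_def)
      qed
    qed
  qed
  then show ?thesis unfolding boundary_curves_def
    by (intro Collect_cong ex_cong1 conj_cong refl)
qed

lemma boundary_curvesI:
  assumes "open D" "continuous_on {0..<1} \<gamma>" "\<gamma> ` {0..<1} \<subseteq> D" "\<gamma> 0 = z"
    "\<And>K. compact K \<Longrightarrow> K \<subseteq> D \<Longrightarrow> \<forall>\<^sub>F t in at_left (1::real). \<gamma> t \<notin> K"
  shows "\<gamma> ` {0..<1} \<in> boundary_curves D z"
  unfolding boundary_curves_open[OF assms(1)] using assms by blast

lemma boundary_curvesE:
  assumes "open D" "C \<in> boundary_curves D z"
  obtains \<gamma> where "C = \<gamma> ` {0..<1}" "continuous_on {0..<1} \<gamma>" "\<gamma> ` {0..<1} \<subseteq> D" "\<gamma> 0 = z"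
    "\<And>K. compact K \<Longrightarrow> K \<subseteq> D \<Longrightarrow> \<forall>\<^sub>F t in at_left (1::real). \<gamma> t \<notin> K"
  using assms(2) unfolding boundary_curves_open[OF assms(1)] by blast

lemma boundary_curve_props:
  assumes "open D" "C \<in> boundary_curves D z"
  shows "connected C" "z \<in> C" "C \<subseteq> D" "\<And>K. compact K \<Longrightarrow> K \<subseteq> D \<Longrightarrow> \<exists>w\<in>C. w \<notin> K"
proof -
  obtain \<gamma> where \<gamma>: "C = \<gamma> ` {0..<1}" "continuous_on {0..<1} \<gamma>" "\<gamma> ` {0..<1} \<subseteq> D" "\<gamma> 0 = z"
    "\<And>K. compact K \<Longrightarrow> K \<subseteq> D \<Longrightarrow> \<forall>\<^sub>F t in at_left (1::real). \<gamma> t \<notin> K"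
    using boundary_curvesE[OF assms] by metis
  show "connected C" unfolding \<gamma>(1) using \<gamma>(2) by (intro connected_continuous_image) auto
  show "z \<in> C" using \<gamma> by force
  show "C \<subseteq> D" using \<gamma> by auto
  fix K assume "compact K" "K \<subseteq> D"
  then have "\<forall>\<^sub>F t in at_left (1::real). \<gamma> t \<notin> K" by (rule \<gamma>(5))
  moreover have "\<forall>\<^sub>F t in at_left (1::real). t \<in> {0<..<1}" by (rule eventually_at_leftI[of 0]) auto
  ultimately have "\<forall>\<^sub>F t in at_left (1::real). \<gamma> t \<notin> K \<and> t \<in> {0<..<1}" by eventually_elim auto
  then obtain t where "\<gamma> t \<notin> K" "t \<in> {0<..<1}"
    using eventually_happens[of _ "at_left (1::real)"] by (auto simp: trivial_limit_at_left_real)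
  then show "\<exists>w\<in>C. w \<notin> K" unfolding \<gamma>(1) by auto
qed

text \<open>The path is stopped at the first time \<open>\<tau>\<close> outside \<open>D\<close> and
  rescaled to \<open>[0, 1)\<close>; being continuous at \<open>\<tau>\<close>, it finally avoids
  each compact subset of \<open>D\<close>.\<close>

lemma boundary_curve_exit:
  fixes \<alpha> :: "real \<Rightarrow> real^'n"
  assumes D: "open D" "\<alpha> 0 \<in> D" and c: "continuous_on {0..1} \<alpha>" and "\<alpha> 1 \<notin> D"
  shows "\<exists>C\<in>boundary_curves D (\<alpha> 0). C \<subseteq> \<alpha> ` {0..1}"
proof -
  define Q where "Q = {0..1} \<inter> \<alpha> -` (- D)"
  have Q: "closed Q" unfolding Q_def by (intro continuous_closed_preimage c) (use D in auto)
  have "1 \<in> Q" using assms by (auto simp: Q_def)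
  then have ne: "Q \<noteq> {}" by auto
  have bb: "bdd_below Q" unfolding bdd_below_def Q_def by auto
  define \<tau> where "\<tau> = Inf Q"
  have \<tau>: "\<tau> \<in> Q" unfolding \<tau>_def by (rule closed_contains_Inf[OF ne bb Q])
  have "\<tau> \<noteq> 0" using \<tau> D by (auto simp: Q_def)
  then have \<tau>0: "0 < \<tau>" "\<tau> \<le> 1" using \<tau> by (auto simp: Q_def)
  have inD: "\<alpha> t \<in> D" if "0 \<le> t" "t < \<tau>" for t
  proof (rule ccontr)
    assume "\<alpha> t \<notin> D"
    then have "t \<in> Q" using that \<tau>0 by (auto simp: Q_def)
    then show False using cInf_lower[OF _ bb, of t] that by (simp add: \<tau>_def)
  qed
  have in1: "\<tau> * t \<in> {0..1}" if "t \<in> {0..1}" for t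
    using that \<tau>0 by (auto intro: mult_le_one)
  define \<gamma> where "\<gamma> t = \<alpha> (\<tau> * t)" for t
  have cg: "continuous_on {0..1} \<gamma>" unfolding \<gamma>_def
    by (rule continuous_on_compose2[OF c]) (use in1 in \<open>auto intro!: continuous_intros\<close>)
  have "\<gamma> ` {0..<1} \<in> boundary_curves D (\<alpha> 0)"
  proof (rule boundary_curvesI[OF D(1)])
    show "continuous_on {0..<1} \<gamma>" by (rule continuous_on_subset[OF cg]) auto
    show "\<gamma> ` {0..<1} \<subseteq> D" using \<tau>0 by (auto simp: \<gamma>_def intro!: inD)
    show "\<gamma> 0 = \<alpha> 0" by (simp add: \<gamma>_def)
    fix K assume K: "compact K" "K \<subseteq> D"
    have "\<gamma> 1 \<notin> K" using \<tau> K by (auto simp: \<gamma>_def Q_def)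
    moreover have "(\<gamma> \<longlongrightarrow> \<gamma> 1) (at_left 1)"
    proof -
      have "(\<gamma> \<longlongrightarrow> \<gamma> 1) (at 1 within {0..1})" using cg by (simp add: continuous_on_def)
      then show ?thesis by (simp add: at_within_Icc_at_left)
    qed
    moreover have "open (- K)" using K by (simp add: compact_imp_closed open_Compl)
    ultimately have "\<forall>\<^sub>F t in at_left 1. \<gamma> t \<in> - K" by (metis ComplI topological_tendstoD)
    then show "\<forall>\<^sub>F t in at_left 1. \<gamma> t \<notin> K" by simp
  qed
  moreover have "\<gamma> ` {0..<1} \<subseteq> \<alpha> ` {0..1}" using in1 by (auto simp: \<gamma>_def)
  ultimately show ?thesis by blast
qed

lemma boundary_curve_towards:
  fixes u e :: "real^'n"
  assumes "open D" "u \<in> D" "e \<notin> D"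
  shows "\<exists>C\<in>boundary_curves D u. C \<subseteq> closed_segment u e"
proof -
  have "\<exists>C\<in>boundary_curves D (linepath u e 0). C \<subseteq> linepath u e ` {0..1}"
    using path_linepath[of u e] assms unfolding path_def
    by (intro boundary_curve_exit) (auto simp: linepath_0' linepath_1')
  then show ?thesis by (simp only: linepath_0' linepath_image_01)
qed

text \<open>If the ray stays in \<open>D\<close>, it runs to infinity, which is then a boundary
  point; otherwise it is stopped at its first exit. This covers image domains whose shape is still
  unknown.\<close>

lemma boundary_curve_outward:
  fixes u :: "real^'n"
  assumes D: "open D" "u \<in> D" and u: "u \<noteq> 0"
  shows "\<exists>C\<in>boundary_curves D u. C \<subseteq> (\<lambda>s. s *\<^sub>R u) ` {1..}"
proof (cases "\<forall>s\<ge>1. s *\<^sub>R u \<in> D")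
  case True
  define \<gamma> where "\<gamma> t = (1 / (1 - t)) *\<^sub>R u" for t :: real
  have "\<gamma> ` {0..<1} \<in> boundary_curves D u"
  proof (rule boundary_curvesI[OF D(1)])
    show "continuous_on {0..<1} \<gamma>" unfolding \<gamma>_def by (intro continuous_intros) auto
    show "\<gamma> ` {0..<1} \<subseteq> D" using True by (auto simp: \<gamma>_def)
    show "\<gamma> 0 = u" by (simp add: \<gamma>_def)
    fix K :: "(real^'n) set" assume "compact K"
    then obtain B where B: "\<And>x. x \<in> K \<Longrightarrow> norm x \<le> B" using compact_imp_bounded bounded_iff by metis
    define b where "b = max (1 - norm u / (\<bar>B\<bar> + 1)) 0"
    have "b < 1" using u by (simp add: b_def)
    then have "\<forall>\<^sub>F t in at_left (1::real). t \<in> {b<..<1}" by (rule eventually_at_leftI[rotated]) auto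
    then show "\<forall>\<^sub>F t in at_left 1. \<gamma> t \<notin> K"
    proof eventually_elim
      case (elim t)
      then have t: "0 < 1 - t" "1 - t < norm u / (\<bar>B\<bar> + 1)" by (auto simp: b_def)
      then have "\<bar>B\<bar> + 1 < norm u / (1 - t)" by (simp add: field_simps)
      also have "\<dots> = norm (\<gamma> t)" using t by (simp add: \<gamma>_def)
      finally show ?case using B by fastforce
    qed
  qed
  moreover have "\<gamma> ` {0..<1} \<subseteq> (\<lambda>s. s *\<^sub>R u) ` {1..}" by (auto simp: \<gamma>_def)
  ultimately show ?thesis by blast
next
  case False
  then obtain s where s: "s \<ge> 1" "s *\<^sub>R u \<notin> D" by blast
  have "\<exists>C\<in>boundary_curves D u. C \<subseteq> closed_segment u (s *\<^sub>R u)"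
    by (rule boundary_curve_towards) (use D s in auto)
  moreover have "closed_segment u (s *\<^sub>R u) \<subseteq> (\<lambda>s. s *\<^sub>R u) ` {1..}"
  proof
    fix x assume "x \<in> closed_segment u (s *\<^sub>R u)"
    then obtain t where "x = (1 - t) *\<^sub>R u + t *\<^sub>R s *\<^sub>R u" "0 \<le> t" by (auto simp: in_segment)
    then have "x = (1 + t * (s - 1)) *\<^sub>R u" "1 + t * (s - 1) \<ge> 1"
      using s mult_nonneg_nonneg[of t "s - 1"] by (auto simp: algebra_simps)
    then show "x \<in> (\<lambda>s. s *\<^sub>R u) ` {1..}" by blast
  qed
  ultimately show ?thesis by blast
qed

section \<open>Invariance of the modulus metric\<close>

lemma joining_curves_commute: "joining_curves E F D = joining_curves F E D"
  unfolding joining_curves_def by auto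

lemma lambda_metric_le:
  assumes "Cx \<in> boundary_curves D x" "Cy \<in> boundary_curves D y"
  shows "lambda_metric D x y \<le> modulus (joining_curves Cx Cy D)"
  unfolding lambda_metric_def by (rule INF_lower2[of "(Cx, Cy)"]) (use assms in auto)

lemma lambda_metric_commute: "lambda_metric D x y = lambda_metric D y x"
proof -
  have "lambda_metric D x y \<le> lambda_metric D y x" for x y
    unfolding lambda_metric_def[of D y x]
  proof (rule INF_greatest, clarify)
    fix Cy Cx assume "Cy \<in> boundary_curves D y" "Cx \<in> boundary_curves D x"
    then show "lambda_metric D x y \<le> modulus (joining_curves Cy Cx D)"
      using lambda_metric_le joining_curves_commute by metis
  qed
  then show ?thesis by (simp add: antisym)
qed

lemma modulus_le:
  fixes \<rho> :: "real^'n \<Rightarrow> ennreal"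
  assumes "\<rho> \<in> borel_measurable borel" "\<And>\<gamma>. \<gamma> \<in> \<Gamma> \<Longrightarrow> rectifiable_curve \<gamma> \<Longrightarrow> 1 \<le> curve_integral \<gamma> \<rho>"
  shows "modulus \<Gamma> \<le> (\<integral>\<^sup>+x. \<rho> x ^ CARD('n) \<partial>lborel)"
  unfolding modulus_def by (rule INF_lower) (use assms in \<open>auto simp: admissible_def\<close>)

text \<open>A density is composed with the inverse map and divided by \<open>c\<close>. Lengths grow
  by \<open>c\<close> and volumes by \<open>c ^ n\<close>, so the curve integrals and the integral
  of the n-th power both stay the same.\<close>

lemma modulus_similarity_le:
  fixes \<phi> :: "real^'n \<Rightarrow> real^'n"
  assumes s: "similarity c \<phi>"
  shows "modulus (joining_curves (\<phi> ` E) (\<phi> ` F) (\<phi> ` D)) \<le> modulus (joining_curves E F D)"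
  unfolding modulus_def[of "joining_curves E F D"]
proof (rule INF_greatest)
  fix \<rho> :: "real^'n \<Rightarrow> ennreal" assume "\<rho> \<in> admissible (joining_curves E F D)"
  then have [measurable]: "\<rho> \<in> borel_measurable borel"
    and ad: "\<And>\<gamma>. \<gamma> \<in> joining_curves E F D \<Longrightarrow> rectifiable_curve \<gamma> \<Longrightarrow> 1 \<le> curve_integral \<gamma> \<rho>"
    by (auto simp: admissible_def)
  have c: "c > 0" using s by (simp add: similarity_def)
  note b = similarity_bij[OF s]
  note s' = similarity_inv[OF s]
  note [measurable] = similarity_measurable[OF s]  similarity_measurable[OF s']
  define \<rho>' where "\<rho>' x = ennreal (1 / c) * \<rho> (inv \<phi> x)" for x
  have [measurable]: "\<rho>' \<in> borel_measurable borel" unfolding \<rho>'_def by measurable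
  have "modulus (joining_curves (\<phi> ` E) (\<phi> ` F) (\<phi> ` D)) \<le> (\<integral>\<^sup>+x. \<rho>' x ^ CARD('n) \<partial>lborel)"
  proof (rule modulus_le)
    fix \<gamma>' assume \<gamma>': "\<gamma>' \<in> joining_curves (\<phi> ` E) (\<phi> ` F) (\<phi> ` D)" "rectifiable_curve \<gamma>'"
    define \<gamma> where "\<gamma> = inv \<phi> \<circ> \<gamma>'"
    have p: "path \<gamma>" unfolding path_def \<gamma>_def
      by (rule continuous_on_compose) (use \<gamma>' similarity_continuous_on[OF s'] in \<open>auto simp: path_def joining_curves_def\<close>)
    have i: "inv \<phi> z \<in> A \<longleftrightarrow> z \<in> \<phi> ` A" for z and A :: "(real^'n) set"
    proof
      assume "inv \<phi> z \<in> A"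
      then have "\<phi> (inv \<phi> z) \<in> \<phi> ` A" by (rule imageI)
      then show "z \<in> \<phi> ` A" using b by (simp add: bij_is_surj surj_f_inv_f)
    next
      assume "z \<in> \<phi> ` A"
      then show "inv \<phi> z \<in> A" using b by (auto simp: bij_is_inj)
    qed
    have "\<gamma> \<in> joining_curves E F D"
      using \<gamma>' p by (auto simp: joining_curves_def \<gamma>_def pathstart_def pathfinish_def i)
    moreover have r: "rectifiable_curve \<gamma>" unfolding \<gamma>_def
      using \<gamma>'(2) by (simp add: rectifiable_curve_def curve_length_similarity[OF s'] ennreal_mult_less_top)
    ultimately have one: "1 \<le> curve_integral \<gamma> \<rho>" using ad by blast
    have "\<gamma>' = \<phi> \<circ> \<gamma>" using b by (auto simp: \<gamma>_def bij_is_surj surj_f_inv_f)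
    then have "curve_integral \<gamma>' \<rho>' = ennreal c * curve_integral \<gamma> (\<rho>' \<circ> \<phi>)"
      using curve_integral_similarity[OF s r p, of \<rho>'] by simp
    also have "\<rho>' \<circ> \<phi> = (\<lambda>x. ennreal (1 / c) * \<rho> x)" using b by (auto simp: \<rho>'_def bij_is_inj)
    also have "curve_integral \<gamma> (\<lambda>x. ennreal (1 / c) * \<rho> x) = ennreal (1 / c) * curve_integral \<gamma> \<rho>"
      unfolding curve_integral_eq mult.assoc
      by (rule nn_integral_cmult) (simp add: measurable_arc_length_param_indicator[OF r p])
    also have "ennreal c * (ennreal (1 / c) * curve_integral \<gamma> \<rho>) = curve_integral \<gamma> \<rho>"
      using c by (simp add: mult.assoc[symmetric] ennreal_mult[symmetric])
    finally show "1 \<le> curve_integral \<gamma>' \<rho>'" using one by simp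
  qed simp
  also have "(\<integral>\<^sup>+x. \<rho>' x ^ CARD('n) \<partial>lborel) = ennreal (c ^ CARD('n)) * (\<integral>\<^sup>+x. \<rho>' (\<phi> x) ^ CARD('n) \<partial>lborel)"
    using nn_integral_similarity[OF s, of "\<lambda>x. \<rho>' x ^ CARD('n)"] by simp
  also have "(\<integral>\<^sup>+x. \<rho>' (\<phi> x) ^ CARD('n) \<partial>lborel) = (\<integral>\<^sup>+x. ennreal ((1 / c) ^ CARD('n)) * \<rho> x ^ CARD('n) \<partial>lborel)"
    using b c by (simp add: \<rho>'_def bij_is_inj power_mult_distrib ennreal_power)
  also have "\<dots> = ennreal ((1 / c) ^ CARD('n)) * (\<integral>\<^sup>+x. \<rho> x ^ CARD('n) \<partial>lborel)"
    by (rule nn_integral_cmult) simp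
  also have "ennreal (c ^ CARD('n)) * (ennreal ((1 / c) ^ CARD('n)) * (\<integral>\<^sup>+x. \<rho> x ^ CARD('n) \<partial>lborel)) = (\<integral>\<^sup>+x. \<rho> x ^ CARD('n) \<partial>lborel)"
    using c by (simp add: mult.assoc[symmetric] ennreal_mult[symmetric] power_mult_distrib[symmetric])
  finally show "modulus (joining_curves (\<phi> ` E) (\<phi> ` F) (\<phi> ` D)) \<le> (\<integral>\<^sup>+x. \<rho> x ^ CARD('n) \<partial>lborel)" .
qed

lemma similarity_open_image:
  assumes "similarity c \<phi>" "open D" shows "open (\<phi> ` D)"
proof -
  have "\<phi> ` D = inv \<phi> -` D" using similarity_bij[OF assms(1)] by (metis bij_vimage_eq_inv_image bij_imp_bij_inv inv_inv_eq)
  then show ?thesis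
    using open_vimage[OF assms(2)] similarity_continuous_on[OF similarity_inv[OF assms(1)]] by metis
qed

lemma boundary_curves_similarity:
  fixes \<phi> :: "real^'n \<Rightarrow> real^'n"
  assumes s: "similarity c \<phi>" and D: "open D" and C: "C \<in> boundary_curves D z"
  shows "\<phi> ` C \<in> boundary_curves (\<phi> ` D) (\<phi> z)"
proof -
  obtain \<gamma> where \<gamma>: "C = \<gamma> ` {0..<1}" "continuous_on {0..<1} \<gamma>" "\<gamma> ` {0..<1} \<subseteq> D" "\<gamma> 0 = z"
    "\<And>K. compact K \<Longrightarrow> K \<subseteq> D \<Longrightarrow> \<forall>\<^sub>F t in at_left (1::real). \<gamma> t \<notin> K"
    using boundary_curvesE[OF D C] by metis
  note b = similarity_bij[OF s]
  have "(\<phi> \<circ> \<gamma>) ` {0..<1} \<in> boundary_curves (\<phi> ` D) (\<phi> z)"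
  proof (rule boundary_curvesI[OF similarity_open_image[OF s D]])
    show "continuous_on {0..<1} (\<phi> \<circ> \<gamma>)"
      by (intro continuous_on_compose \<gamma> similarity_continuous_on[OF s])
    fix K assume K: "compact K" "K \<subseteq> \<phi> ` D"
    have "compact (inv \<phi> ` K)"
      by (intro compact_continuous_image K similarity_continuous_on[OF similarity_inv[OF s]])
    moreover have "inv \<phi> ` K \<subseteq> D" using K b by (auto simp: bij_is_inj)
    ultimately have "\<forall>\<^sub>F t in at_left (1::real). \<gamma> t \<notin> inv \<phi> ` K" by (rule \<gamma>(5))
    then show "\<forall>\<^sub>F t in at_left (1::real). (\<phi> \<circ> \<gamma>) t \<notin> K"
      by eventually_elim (metis b bij_is_inj comp_apply image_eqI inv_f_f)
  qed (use \<gamma> in auto)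
  then show ?thesis by (simp add: \<gamma>(1) image_comp)
qed

lemma lambda_metric_similarity:
  fixes \<phi> :: "real^'n \<Rightarrow> real^'n"
  assumes s: "similarity c \<phi>" and D: "open D"
  shows "lambda_metric (\<phi> ` D) (\<phi> x) (\<phi> y) = lambda_metric D x y"
proof -
  have le: "lambda_metric (\<phi> ` D) (\<phi> x) (\<phi> y) \<le> lambda_metric D x y"
    if s: "similarity c \<phi>" and D: "open D" for c and \<phi> :: "real^'n \<Rightarrow> real^'n" and D x y
    unfolding lambda_metric_def[of D]
  proof (rule INF_greatest, clarify)
    fix Cx Cy assume "Cx \<in> boundary_curves D x" "Cy \<in> boundary_curves D y"
    then have "lambda_metric (\<phi> ` D) (\<phi> x) (\<phi> y) \<le> modulus (joining_curves (\<phi> ` Cx) (\<phi> ` Cy) (\<phi> ` D))"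
      using lambda_metric_le boundary_curves_similarity[OF s D] by metis
    also have "\<dots> \<le> modulus (joining_curves Cx Cy D)" by (rule modulus_similarity_le[OF s])
    finally show "lambda_metric (\<phi> ` D) (\<phi> x) (\<phi> y) \<le> modulus (joining_curves Cx Cy D)" .
  qed
  have "inv \<phi> ` \<phi> ` D = D" "inv \<phi> (\<phi> x) = x" "inv \<phi> (\<phi> y) = y"
    using similarity_bij[OF s] by (auto simp: bij_is_inj image_comp)
  then show ?thesis
    using le[OF s D, of x y] le[OF similarity_inv[OF s] similarity_open_image[OF s D], of "\<phi> x" "\<phi> y"]
    by (simp add: antisym)
qed

section \<open>Upper bounds for the modulus\<close>

text \<open>Every joining curve crosses the \<open>\<delta>\<close>-neighbourhood of
  \<open>E\<close>, so the density \<open>1 / \<delta>\<close> on a ball containing that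
  neighbourhood is admissible. The set \<open>F\<close> may be unbounded.\<close>

lemma modulus_separated:
  fixes E F :: "(real^'n) set"
  assumes \<delta>: "0 < \<delta>" and E: "E \<subseteq> cball z r" "E \<noteq> {}" and sep: "\<And>x y. x \<in> E \<Longrightarrow> y \<in> F \<Longrightarrow> \<delta> \<le> dist x y"
  shows "modulus (joining_curves E F D) \<le> ennreal ((1 / \<delta>) ^ CARD('n)) * emeasure lborel (cball z (r + \<delta>))"
proof -
  define \<rho> where "\<rho> x = ennreal (1 / \<delta>) * indicator (cball z (r + \<delta>)) x" for x :: "real^'n"
  have [measurable]: "\<rho> \<in> borel_measurable borel"
    unfolding \<rho>_def by (intro borel_measurable_times_ennreal borel_measurable_const borel_measurable_indicator) simp
  have "modulus (joining_curves E F D) \<le> (\<integral>\<^sup>+x. \<rho> x ^ CARD('n) \<partial>lborel)"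
  proof (rule modulus_le)
    fix \<gamma> assume \<gamma>: "\<gamma> \<in> joining_curves E F D" and r: "rectifiable_curve \<gamma>"
    have p: "path \<gamma>" using \<gamma> by (simp add: joining_curves_def)
    have F0: "\<delta> \<le> infdist y E" if "y \<in> F" for y
      using sep[OF _ that] E(2) by (auto simp: infdist_notempty dist_commute intro!: cINF_greatest)
    have ends: "infdist (\<gamma> 0) E \<le> 0 \<and> \<delta> \<le> infdist (\<gamma> 1) E \<or> infdist (\<gamma> 1) E \<le> 0 \<and> \<delta> \<le> infdist (\<gamma> 0) E"
      using \<gamma> F0 by (auto simp: joining_curves_def pathstart_def pathfinish_def)
    obtain a b where ab: "{a<..<b} \<subseteq> {0..length_upto \<gamma> 1}" "\<delta> - 0 \<le> b - a"
      "\<And>s. s \<in> {a<..<b} \<Longrightarrow> infdist (arc_length_param \<gamma> s) E \<in> {0<..<\<delta>}"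
      by (rule curve_crossing[where v="\<lambda>x. infdist x E", OF r p infdist_triangle_abs \<delta> ends]) blast
    have in_ball: "arc_length_param \<gamma> s \<in> cball z (r + \<delta>)" if s: "s \<in> {a<..<b}" for s
    proof -
      have "infdist (arc_length_param \<gamma> s) E < \<delta>" using ab(3)[OF s] by simp
      then obtain x where x: "x \<in> E" "dist (arc_length_param \<gamma> s) x < \<delta>"
        using E(2) by (metis infdist_attains_inf infdist_notempty cINF_less_iff bdd_below.I2 zero_le_dist)
      have "dist z x \<le> r" using E x by auto
      then show ?thesis using x dist_triangle[of z "arc_length_param \<gamma> s" x] by (simp add: dist_commute)
    qed
    have "1 = ennreal (1 / \<delta>) * ennreal \<delta>" using \<delta> by (simp add: ennreal_mult[symmetric])
    also have "\<dots> \<le> ennreal (1 / \<delta>) * emeasure lborel {a<..<b}"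
      using ab(2) \<delta> by (intro mult_left_mono) (auto intro: ennreal_leI)
    also have "\<dots> = (\<integral>\<^sup>+s. ennreal (1 / \<delta>) * indicator {a<..<b} s \<partial>lborel)"
      by (simp add: nn_integral_cmult)
    also have "\<dots> \<le> curve_integral \<gamma> \<rho>" unfolding curve_integral_eq
    proof (rule nn_integral_mono)
      fix s
      show "ennreal (1 / \<delta>) * indicator {a<..<b} s \<le> \<rho> (arc_length_param \<gamma> s) * indicator {0..length_upto \<gamma> 1} s"
        using ab(1) in_ball[of s] by (cases "s \<in> {a<..<b}") (auto simp: \<rho>_def)
    qed
    finally show "1 \<le> curve_integral \<gamma> \<rho>" .
  qed simp
  also have "(\<integral>\<^sup>+x. \<rho> x ^ CARD('n) \<partial>lborel) =
      (\<integral>\<^sup>+x. ennreal ((1 / \<delta>) ^ CARD('n)) * indicator (cball z (r + \<delta>)) x \<partial>lborel)"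
    using \<delta> by (intro nn_integral_cong) (auto simp: \<rho>_def indicator_def ennreal_power)
  also have "\<dots> = ennreal ((1 / \<delta>) ^ CARD('n)) * emeasure lborel (cball z (r + \<delta>))"
    by (subst nn_integral_cmult) (auto intro!: borel_measurable_indicator)
  finally show ?thesis .
qed

lemma sum_disjoint_indicator_power:
  fixes c :: "'i \<Rightarrow> ennreal"
  assumes "finite J" "\<And>i j x. i \<in> J \<Longrightarrow> j \<in> J \<Longrightarrow> x \<in> R i \<Longrightarrow> x \<in> R j \<Longrightarrow> i = j" "n > 0"
  shows "(\<Sum>j\<in>J. c j * indicator (R j) x) ^ n = (\<Sum>j\<in>J. c j ^ n * indicator (R j) x)"
proof (cases "\<exists>i\<in>J. x \<in> R i")
  case True
  then obtain i where i: "i \<in> J" "x \<in> R i" by blast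
  have "(\<Sum>j\<in>J. d j * indicator (R j) x) = d i" for d :: "'i \<Rightarrow> ennreal"
  proof -
    have "(\<Sum>j\<in>J. d j * indicator (R j) x) = (\<Sum>j\<in>J. if j = i then d j else 0)"
      using i assms(2) by (intro sum.cong) (auto simp: indicator_def)
    then show ?thesis using i assms(1) by simp
  qed
  then show ?thesis by simp
next
  case False
  then show ?thesis using assms(3) by (simp add: indicator_def)
qed

text \<open>Each of \<open>N\<close> dyadic rings around \<open>e\<close> carries a constant density
  that gives its crossings integral at least \<open>1 / N\<close>. One ring then costs a constant
  times \<open>1 / N ^ n\<close> and all of them \<open>N\<close> times as much, which tends to
  \<open>0\<close> for \<open>n \<ge> 2\<close> as the number of rings grows.\<close>

lemma modulus_ring:
  fixes E F :: "(real^'n) set"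
  assumes N: "0 < N" and a: "0 < a" and E: "\<And>x. x \<in> E \<Longrightarrow> dist x e \<le> a"
    and F: "\<And>y. y \<in> F \<Longrightarrow> 2 ^ N * a \<le> dist y e"
  shows "modulus (joining_curves E F D) \<le>
    ennreal (unit_ball_vol (real CARD('n)) * 2 ^ CARD('n) * real N * (1 / real N) ^ CARD('n))"
proof -
  define R where "R j = {x :: real^'n. 2 ^ j * a \<le> dist x e \<and> dist x e < 2 ^ Suc j * a}" for j :: nat
  define c where "c j = 1 / (real N * (2 ^ j * a))" for j
  define \<rho> where "\<rho> x = (\<Sum>j<N. ennreal (c j) * indicator (R j) x)" for x
  have c0: "c j > 0" for j using N a by (simp add: c_def)
  have [measurable]: "R j \<in> sets borel" for j
  proof -
    have "R j = ball e (2 ^ Suc j * a) - ball e (2 ^ j * a)" by (auto simp: R_def dist_commute)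
    then show ?thesis by simp
  qed
  have [measurable]: "\<rho> \<in> borel_measurable borel" unfolding \<rho>_def by measurable
  have disj: "i = j" if "x \<in> R i" "x \<in> R j" for i j x
  proof -
    have False if "i < j" "x \<in> R i" "x \<in> R j" for i j
    proof -
      have "(2::real) ^ Suc i * a \<le> 2 ^ j * a" using that a by (intro mult_right_mono power_increasing) auto
      then show False using that by (auto simp: R_def)
    qed
    then show ?thesis using that by (metis nat_neq_iff)
  qed
  have "modulus (joining_curves E F D) \<le> (\<integral>\<^sup>+x. \<rho> x ^ CARD('n) \<partial>lborel)"
  proof (rule modulus_le)
    fix \<gamma> assume \<gamma>: "\<gamma> \<in> joining_curves E F D" and r: "rectifiable_curve \<gamma>"
    have p: "path \<gamma>" using \<gamma> by (simp add: joining_curves_def)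
    have "\<exists>p q. {p<..<q} \<subseteq> {0..length_upto \<gamma> 1} \<and> 2 ^ j * a \<le> q - p \<and>
        (\<forall>s\<in>{p<..<q}. arc_length_param \<gamma> s \<in> R j)" if j: "j < N" for j
    proof -
      have le: "a \<le> 2 ^ j * a" "2 ^ Suc j * a \<le> 2 ^ N * a"
        using a j by (auto intro!: mult_right_mono power_increasing simp del: power_Suc)
      have ends: "dist (\<gamma> 0) e \<le> 2 ^ j * a \<and> 2 ^ Suc j * a \<le> dist (\<gamma> 1) e \<or>
          dist (\<gamma> 1) e \<le> 2 ^ j * a \<and> 2 ^ Suc j * a \<le> dist (\<gamma> 0) e"
        using \<gamma> le E F by (force simp: joining_curves_def pathstart_def pathfinish_def simp del: power_Suc intro: order_trans)
      have lip: "\<bar>dist x e - dist y e\<bar> \<le> dist x y" for x y :: "real^'n"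
        using dist_triangle[of x e y] dist_triangle[of y e x] by (simp add: dist_commute)
      have lt: "2 ^ j * a < 2 ^ Suc j * a" using a by simp
      obtain p q where "{p<..<q} \<subseteq> {0..length_upto \<gamma> 1}" "2 ^ Suc j * a - 2 ^ j * a \<le> q - p"
        "\<And>s. s \<in> {p<..<q} \<Longrightarrow> dist (arc_length_param \<gamma> s) e \<in> {2 ^ j * a<..<2 ^ Suc j * a}"
        by (rule curve_crossing[where v="\<lambda>x. dist x e", OF r p lip lt ends]) blast
      note pq = this
      have "arc_length_param \<gamma> s \<in> R j" if "s \<in> {p<..<q}" for s
        using pq(3)[OF that] by (simp add: R_def)
      moreover have "2 ^ j * a \<le> q - p" using pq(2) by (simp add: mult.commute)
      ultimately show ?thesis using pq(1) by blast
    qed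
    then obtain P Q where PQ: "\<And>j. j < N \<Longrightarrow> {P j<..<Q j} \<subseteq> {0..length_upto \<gamma> 1}"
      "\<And>j. j < N \<Longrightarrow> 2 ^ j * a \<le> Q j - P j"
      "\<And>j s. j < N \<Longrightarrow> s \<in> {P j<..<Q j} \<Longrightarrow> arc_length_param \<gamma> s \<in> R j"
      by metis
    have "1 = ennreal (\<Sum>j<N. 1 / real N)" using N by simp
    also have "\<dots> = (\<Sum>j<N. ennreal (1 / real N))" by (rule sum_ennreal[symmetric]) simp
    also have "\<dots> \<le> (\<Sum>j<N. ennreal (c j) * emeasure lborel {P j<..<Q j})"
    proof (rule sum_mono)
      fix j assume j: "j \<in> {..<N}"
      have pos: "0 < 2 ^ j * a" using a by simp
      have "1 / real N = c j * (2 ^ j * a)" using a by (simp add: c_def)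
      also have "\<dots> \<le> c j * (Q j - P j)" using PQ(2)[of j] j c0[of j] by (intro mult_left_mono) auto
      finally have "ennreal (1 / real N) \<le> ennreal (c j * (Q j - P j))" by (rule ennreal_leI)
      also have "\<dots> = ennreal (c j) * emeasure lborel {P j<..<Q j}"
        using PQ(2)[of j] j pos c0[of j] by (subst ennreal_mult) auto
      finally show "ennreal (1 / real N) \<le> ennreal (c j) * emeasure lborel {P j<..<Q j}" .
    qed
    also have "\<dots> = (\<integral>\<^sup>+s. (\<Sum>j<N. ennreal (c j) * indicator {P j<..<Q j} s) \<partial>lborel)"
      by (subst nn_integral_sum) (auto simp: nn_integral_cmult)
    also have "\<dots> \<le> curve_integral \<gamma> \<rho>" unfolding curve_integral_eq
    proof (rule nn_integral_mono)
      fix s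
      show "(\<Sum>j<N. ennreal (c j) * indicator {P j<..<Q j} s) \<le> \<rho> (arc_length_param \<gamma> s) * indicator {0..length_upto \<gamma> 1} s"
      proof (cases "s \<in> {0..length_upto \<gamma> 1}")
        case True
        have "ennreal (c j) * indicator {P j<..<Q j} s \<le> ennreal (c j) * indicator (R j) (arc_length_param \<gamma> s)" if "j < N" for j
          using PQ(3)[OF that, of s] by (auto simp: indicator_def)
        then have "(\<Sum>j<N. ennreal (c j) * indicator {P j<..<Q j} s) \<le> \<rho> (arc_length_param \<gamma> s)"
          unfolding \<rho>_def by (intro sum_mono) (simp del: indicator_simps)
        then show ?thesis using True by simp
      next
        case False
        then have "s \<notin> {P j<..<Q j}" if "j < N" for j using PQ(1)[OF that] by blast
        then have "(\<Sum>j<N. ennreal (c j) * indicator {P j<..<Q j} s) = 0" by (intro sum.neutral) (auto simp: indicator_def)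
        then show ?thesis by simp
      qed
    qed
    finally show "1 \<le> curve_integral \<gamma> \<rho>" .
  qed simp
  also have "(\<integral>\<^sup>+x. \<rho> x ^ CARD('n) \<partial>lborel) = (\<integral>\<^sup>+x. (\<Sum>j<N. ennreal (c j) ^ CARD('n) * indicator (R j) x) \<partial>lborel)"
    unfolding \<rho>_def by (subst sum_disjoint_indicator_power) (auto dest: disj)
  also have "\<dots> = (\<Sum>j<N. ennreal (c j) ^ CARD('n) * emeasure lborel (R j))"
    by (subst nn_integral_sum) (auto simp: nn_integral_cmult)
  also have "\<dots> \<le> (\<Sum>j<N. ennreal (unit_ball_vol (real CARD('n)) * 2 ^ CARD('n) * (1 / real N) ^ CARD('n)))"
  proof (rule sum_mono)
    fix j
    have pos: "0 < 2 ^ Suc j * a" using a by simp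
    have "ennreal (c j) ^ CARD('n) * emeasure lborel (R j) \<le> ennreal (c j ^ CARD('n)) * emeasure lborel (ball e (2 ^ Suc j * a))"
      using c0[of j] by (intro mult_mono emeasure_mono) (auto simp: ennreal_power R_def dist_commute)
    also have "\<dots> = ennreal (c j ^ CARD('n) * (unit_ball_vol (real CARD('n)) * (2 ^ Suc j * a) ^ CARD('n)))"
      using pos c0[of j] by (subst emeasure_ball) (auto simp: ennreal_mult[symmetric])
    also have "c j ^ CARD('n) * (unit_ball_vol (real CARD('n)) * (2 ^ Suc j * a) ^ CARD('n)) =
        unit_ball_vol (real CARD('n)) * (c j * (2 ^ Suc j * a)) ^ CARD('n)"
      by (simp only: power_mult_distrib mult_ac)
    also have "c j * (2 ^ Suc j * a) = 2 * (1 / real N)" using a N by (simp add: c_def)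
    finally show "ennreal (c j) ^ CARD('n) * emeasure lborel (R j) \<le>
        ennreal (unit_ball_vol (real CARD('n)) * 2 ^ CARD('n) * (1 / real N) ^ CARD('n))"
      by (simp only: power_mult_distrib mult_ac)
  qed
  also have "\<dots> = ennreal (unit_ball_vol (real CARD('n)) * 2 ^ CARD('n) * real N * (1 / real N) ^ CARD('n))"
    by (simp add: ennreal_of_nat_eq_real_of_nat ennreal_mult[symmetric] mult_ac)
  finally show ?thesis .
qed

text \<open>Joining \<open>x\<close> radially to \<open>0\<close> and \<open>y\<close> radially to infinity.\<close>

lemma lambda_metric_punctured_le:
  fixes x y :: "real^'n"
  assumes x: "x \<noteq> 0" "norm x \<le> norm y" and \<eta>: "0 < \<eta>" "\<eta> * norm x \<le> dist x y"
  shows "lambda_metric (UNIV - {0}) x y \<le> ennreal (unit_ball_vol (real CARD('n)) * ((2 + \<eta>) / \<eta>) ^ CARD('n))"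
proof -
  have y: "y \<noteq> 0" using x by auto
  have D: "open (UNIV - {0} :: (real^'n) set)" by auto
  have "\<exists>C\<in>boundary_curves (UNIV - {0}) x. C \<subseteq> closed_segment x 0"
    by (rule boundary_curve_towards[OF D]) (simp_all add: x(1))
  then obtain Cx where Cx: "Cx \<in> boundary_curves (UNIV - {0}) x" "Cx \<subseteq> closed_segment x 0" ..
  have "\<exists>C\<in>boundary_curves (UNIV - {0}) y. C \<subseteq> (\<lambda>s. s *\<^sub>R y) ` {1..}"
    by (rule boundary_curve_outward[OF D]) (simp_all add: y)
  then obtain Cy where Cy: "Cy \<in> boundary_curves (UNIV - {0}) y" "Cy \<subseteq> (\<lambda>s. s *\<^sub>R y) ` {1..}" ..
  define \<delta> where "\<delta> = \<eta> * norm x / 2"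
  have \<delta>: "\<delta> > 0" using x \<eta> by (simp add: \<delta>_def)
  have sep: "\<delta> \<le> dist p q" if "p \<in> Cx" "q \<in> Cy" for p q
  proof -
    have "p \<in> closed_segment x 0" using \<open>p \<in> Cx\<close> Cx(2) by blast
    then obtain t where t: "p = (1 - t) *\<^sub>R x" "0 \<le> t" "t \<le> 1" unfolding in_segment by auto
    obtain s where s: "q = s *\<^sub>R y" "1 \<le> s" using \<open>q \<in> Cy\<close> Cy(2) by auto
    have "norm q - norm p \<le> dist p q" by (metis dist_commute dist_norm norm_triangle_ineq2)
    moreover have "norm p = (1 - t) * norm x" "norm q = s * norm y" using t s by auto
    moreover have "dist x y \<le> t * norm x + dist p q + (s - 1) * norm y"
    proof -
      have "x - p = t *\<^sub>R x" using t by (simp add: algebra_simps)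
      then have "dist x p = t * norm x" using t by (simp add: dist_norm)
      moreover have "dist q y = (s - 1) * norm y"
      proof -
        have "q - y = (s - 1) *\<^sub>R y" using s by (simp add: algebra_simps)
        then show ?thesis using s by (simp add: dist_norm)
      qed
      ultimately show ?thesis using dist_triangle[of x y p] dist_triangle[of p y q] by linarith
    qed
    \<comment> \<open>The radial displacements add up to
      \<open>t * norm x + (s - 1) * norm y\<close>, which is at most \<open>norm q - norm p\<close>
      because \<open>norm x \<le> norm y\<close>, and so at most \<open>dist p q\<close> once more;
      whence the factor \<open>2\<close> in \<open>\<delta>\<close>.\<close>
    ultimately have "dist x y \<le> 2 * dist p q" using x(2) by (simp add: algebra_simps)
    then show ?thesis using \<eta> by (simp add: \<delta>_def)
  qed
  have Cx2: "Cx \<subseteq> cball 0 (norm x)"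
    using Cx(2) by (force simp: in_segment mult_left_le_one_le)
  have "lambda_metric (UNIV - {0}) x y \<le> modulus (joining_curves Cx Cy (UNIV - {0}))"
    by (rule lambda_metric_le[OF Cx(1) Cy(1)])
  also have "\<dots> \<le> ennreal ((1 / \<delta>) ^ CARD('n)) * emeasure lborel (cball (0::real^'n) (norm x + \<delta>))"
    by (rule modulus_separated[OF \<delta> Cx2 _ sep]) (use boundary_curve_props(2)[OF D Cx(1)] in auto)
  also have "\<dots> = ennreal ((1 / \<delta>) ^ CARD('n) * (unit_ball_vol (real CARD('n)) * (norm x + \<delta>) ^ CARD('n)))"
    using \<delta> by (subst emeasure_cball) (auto simp: ennreal_mult[symmetric])
  also have "(1 / \<delta>) ^ CARD('n) * (unit_ball_vol (real CARD('n)) * (norm x + \<delta>) ^ CARD('n)) =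
     unit_ball_vol (real CARD('n)) * ((norm x + \<delta>) / \<delta>) ^ CARD('n)"
    by (simp add: power_divide)
  also have "(norm x + \<delta>) / \<delta> = (2 + \<eta>) / \<eta>"
    using x \<eta> by (simp add: \<delta>_def field_simps)
  finally show ?thesis .
qed

section \<open>Blow-up of the modulus metric at the diagonal\<close>

text \<open>Hyperplane slices stay in the type \<open>real^'n\<close>: the coordinate
  \<open>i\<close> is overwritten by the position of the slice, and its former value becomes a dummy
  variable. No type of dimension \<open>n - 1\<close> is introduced.\<close>

definition vupd :: "'n \<Rightarrow> real \<Rightarrow> real^'n \<Rightarrow> real^'n" where
  "vupd i s w = (\<chi> k. if k = i then s else w $ k)"

lemma vupd_nth [simp]: "vupd i s w $ k = (if k = i then s else w $ k)"
  by (simp add: vupd_def)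

lemma continuous_on_vupd:
  "continuous_on S f \<Longrightarrow> continuous_on S g \<Longrightarrow> continuous_on S (\<lambda>x. vupd i (f x) (g x))"
  unfolding vupd_def
proof (intro continuous_on_vec_lambda)
  fix k assume "continuous_on S f" "continuous_on S g"
  then show "continuous_on S (\<lambda>x. if k = i then f x else g x $ k)"
    by (cases "k = i") (auto intro: continuous_intros)
qed

lemma measurable_vupd [measurable]:
  "(\<lambda>p. vupd i (fst p) (snd p)) \<in> borel_measurable borel"
  by (intro borel_measurable_continuous_onI continuous_on_vupd continuous_intros)

lemma measurable_vupd' [measurable (raw)]:
  assumes [measurable]: "f \<in> borel_measurable M" "g \<in> borel_measurable M"
  shows "(\<lambda>x. vupd i (f x) (g x)) \<in> borel_measurable M"
proof -
  have "(\<lambda>x. (f x, g x)) \<in> measurable M (borel \<Otimes>\<^sub>M borel)" by measurable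
  then have "(\<lambda>x. (f x, g x)) \<in> borel_measurable M" by (simp add: borel_prod)
  from measurable_compose[OF this measurable_vupd[of i]] show ?thesis by simp
qed

lemma measurable_vec_nth_real [measurable]: "(\<lambda>w::real^'n. w $ k) \<in> borel_measurable borel"
  by (intro borel_measurable_continuous_onI continuous_intros)

lemma norm_vupd:
  fixes w :: "real^'n"
  shows "(norm (vupd i s w))\<^sup>2 = (norm w)\<^sup>2 - (w $ i)\<^sup>2 + s\<^sup>2"
proof -
  have "(norm w)\<^sup>2 = (w $ i)\<^sup>2 + (\<Sum>k\<in>UNIV - {i}. (w $ k)\<^sup>2)" for w :: "real^'n"
    unfolding power2_norm_eq_inner inner_vec_def by (simp add: power2_eq_square sum.remove[of UNIV i])
  from this[of w] this[of "vupd i s w"] show ?thesis by simp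
qed

text \<open>The map \<open>(s, w) \<mapsto> (w $ i, vupd i s w)\<close> exchanges two coordinates, so it is an isometry.\<close>

lemma nn_integral_coordinate_swap:
  fixes H :: "real \<times> (real^'n) \<Rightarrow> ennreal"
  assumes [measurable]: "H \<in> borel_measurable borel"
  shows "(\<integral>\<^sup>+s. \<integral>\<^sup>+w. H (w $ i, vupd i s w) \<partial>lborel \<partial>lborel) = (\<integral>\<^sup>+s. \<integral>\<^sup>+w. H (s, w) \<partial>lborel \<partial>lborel)"
proof -
  define T where "T p = (snd p $ i, vupd i (fst p) (snd p))" for p :: "real \<times> (real^'n)"
  have TT: "T (T p) = p" for p by (cases p) (auto simp: T_def vec_eq_iff)
  have "dist (T p) (T q) = dist p q" for p q
  proof -
    have "T p - T q = T (p - q)" by (auto simp: T_def vec_eq_iff)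
    moreover have "(norm (T p))\<^sup>2 = (norm p)\<^sup>2" for p
      by (cases p) (simp add: T_def norm_prod_def norm_vupd)
    then have "norm (T p) = norm p" for p by (simp add: power2_eq_iff_nonneg)
    ultimately show ?thesis by (simp add: dist_norm)
  qed
  then have sim: "similarity 1 T"
    unfolding similarity_def using TT by (metis mult_1 surjI zero_less_one)
  have mT: "T \<in> borel_measurable borel" by (rule similarity_measurable[OF sim])
  have mH: "(\<lambda>p. H (T p)) \<in> borel_measurable borel" using mT by measurable
  have "(\<integral>\<^sup>+s. \<integral>\<^sup>+w. H (w $ i, vupd i s w) \<partial>lborel \<partial>lborel) = (\<integral>\<^sup>+s. \<integral>\<^sup>+w. H (T (s, w)) \<partial>lborel \<partial>lborel)"
    by (simp add: T_def)
  also have "\<dots> = (\<integral>\<^sup>+p. H (T p) \<partial>(lborel \<Otimes>\<^sub>M lborel))"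
    by (rule lborel.nn_integral_fst) (use mH in \<open>simp add: lborel_prod\<close>)
  also have "\<dots> = (\<integral>\<^sup>+p. H p \<partial>(lborel \<Otimes>\<^sub>M lborel))"
    unfolding lborel_prod using nn_integral_similarity[OF sim, of H] by simp
  also have "\<dots> = (\<integral>\<^sup>+s. \<integral>\<^sup>+w. H (s, w) \<partial>lborel \<partial>lborel)"
    by (rule lborel.nn_integral_fst[symmetric]) (simp add: lborel_prod)
  finally show ?thesis .
qed

text \<open>Integrals over hyperplane slices, where the coordinate \<open>i\<close> is replaced by a dummy variable
  that ranges over \<open>[3, 4]\<close>.\<close>

definition slice_integral :: "'n \<Rightarrow> real \<Rightarrow> (real^'n \<Rightarrow> ennreal) \<Rightarrow> ennreal" where
  "slice_integral i s g = (\<integral>\<^sup>+w. indicator {3..4} (w $ i) * g (vupd i s w) \<partial>lborel)"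

lemma measurable_slice_integral [measurable]:
  assumes [measurable]: "g \<in> borel_measurable borel"
  shows "(\<lambda>s. slice_integral i s g) \<in> borel_measurable borel"
  unfolding slice_integral_def by measurable

text \<open>Fubini for slices: exchanging the position with the dummy coordinate turns the double
  integral into one over space, and the dummy contributes the length \<open>1\<close> of
  \<open>[3, 4]\<close>.\<close>

lemma nn_integral_slice_integral:
  fixes g :: "real^'n \<Rightarrow> ennreal"
  assumes [measurable]: "g \<in> borel_measurable borel" "\<phi> \<in> borel_measurable borel"
  shows "(\<integral>\<^sup>+s. \<phi> s * slice_integral i s g \<partial>lborel) = (\<integral>\<^sup>+z. \<phi> (z $ i) * g z \<partial>lborel)"
proof -
  define H where "H p = \<phi> (snd p $ i) * (indicator {3..4} (fst p) * g (snd p))" for p :: "real \<times> (real^'n)"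
  have [measurable]: "H \<in> borel_measurable borel" unfolding H_def borel_prod[symmetric] by measurable
  have "(\<integral>\<^sup>+s. \<phi> s * slice_integral i s g \<partial>lborel) = (\<integral>\<^sup>+s. \<integral>\<^sup>+w. H (w $ i, vupd i s w) \<partial>lborel \<partial>lborel)"
    unfolding slice_integral_def by (simp add: H_def nn_integral_cmult[symmetric])
  also have "\<dots> = (\<integral>\<^sup>+s. \<integral>\<^sup>+w. H (s, w) \<partial>lborel \<partial>lborel)"
    by (rule nn_integral_coordinate_swap) simp
  also have "\<dots> = (\<integral>\<^sup>+s. \<integral>\<^sup>+w. indicator {3..4::real} s * (\<phi> (w $ i) * g w) \<partial>lborel \<partial>lborel)"
    by (simp add: H_def mult_ac)
  also have "\<dots> = (\<integral>\<^sup>+s. indicator {3..4::real} s * (\<integral>\<^sup>+w. \<phi> (w $ i) * g w \<partial>lborel) \<partial>lborel)"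
    by (intro nn_integral_cong nn_integral_cmult) simp
  also have "\<dots> = (\<integral>\<^sup>+z. \<phi> (z $ i) * g z \<partial>lborel)"
    by (subst nn_integral_multc) auto
  finally show ?thesis .
qed

text \<open>Where \<open>\<rho> > \<tau>\<close> one has
  \<open>\<rho> \<le> \<rho> ^ n / \<tau> ^ (n - 1)\<close>. This weak form of Young's inequality
  takes the place of Hoelder's and leaves \<open>\<tau>\<close> free to vary along a
  segment.\<close>

lemma ennreal_young:
  fixes \<rho> :: ennreal
  assumes "\<tau> > 0" "n > 0"
  shows "\<rho> \<le> ennreal \<tau> + ennreal (1 / \<tau> ^ (n - 1)) * \<rho> ^ n"
proof (cases \<rho>)
  case (real r)
  have "r \<le> \<tau> + 1 / \<tau> ^ (n - 1) * r ^ n"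
  proof (cases "r \<le> \<tau>")
    case True
    then show ?thesis using assms real by (simp add: add_increasing2)
  next
    case False
    then have "1 \<le> (r / \<tau>) ^ (n - 1)" using assms by (intro one_le_power) simp
    then have "r * 1 \<le> r * (r / \<tau>) ^ (n - 1)" using real by (intro mult_left_mono) auto
    also have "\<dots> = 1 / \<tau> ^ (n - 1) * r ^ n" using assms(2) by (cases n) (auto simp: power_divide)
    finally show ?thesis using assms by simp
  qed
  then show ?thesis using real assms by (simp add: ennreal_power ennreal_mult[symmetric] ennreal_plus[symmetric] del: ennreal_plus)
next
  case top
  then have "ennreal (1 / \<tau> ^ (n - 1)) * \<rho> ^ n = top"
    using assms by (simp add: power_top_ennreal ennreal_mult_eq_top_iff)
  then show ?thesis by simp
qed

section \<open>Averages of line integrals over a unit cube\<close>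

lemma nn_integral_scale_other_coordinates:
  fixes g :: "real^'n \<Rightarrow> ennreal" and a :: "real^'n"
  assumes [measurable]: "g \<in> borel_measurable borel" and t: "t > 0"
  shows "(\<integral>\<^sup>+w. g (\<chi> k. if k = i then w $ k else a $ k + t * (w $ k - a $ k)) \<partial>lborel)
    = ennreal (1 / t ^ (CARD('n) - 1)) * (\<integral>\<^sup>+w. g w \<partial>lborel)"
proof -
  define c where "c j = (if j = axis i 1 then 1 else t)" for j :: "real^'n"
  define b where "b = (\<chi> k. if k = i then 0 else (1 - t) * a $ k)"
  define T where "T x = b + (\<Sum>j\<in>Basis. (c j * (x \<bullet> j)) *\<^sub>R j)" for x :: "real^'n"
  have T: "T w = (\<chi> k. if k = i then w $ k else a $ k + t * (w $ k - a $ k))" for w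
  proof (rule vec_eq_iff[THEN iffD2], rule allI)
    fix k
    have ax: "axis k (1::real) \<in> (Basis :: (real^'n) set)" by (simp add: axis_in_Basis_iff)
    have "T w $ k = T w \<bullet> axis k 1" by (simp add: inner_axis)
    also have "\<dots> = b \<bullet> axis k 1 + c (axis k 1) * (w \<bullet> axis k 1)"
      by (simp only: T_def inner_add_left inner_sum_left_Basis[OF ax])
    also have "\<dots> = b $ k + c (axis k 1) * w $ k" by (simp add: inner_axis)
    finally show "T w $ k = (\<chi> k. if k = i then w $ k else a $ k + t * (w $ k - a $ k)) $ k"
      by (simp add: b_def c_def axis_eq_axis algebra_simps)
  qed
  have P: "(\<Prod>j\<in>Basis. \<bar>c j\<bar>) = t ^ (CARD('n) - 1)"
  proof -
    have ax: "axis i (1::real) \<in> (Basis :: (real^'n) set)" by (simp add: axis_in_Basis_iff)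
    have "(\<Prod>j\<in>Basis. \<bar>c j\<bar>) = (\<Prod>j\<in>Basis - {axis i 1 :: real^'n}. t)"
    proof -
      have "(\<Prod>j\<in>Basis. \<bar>c j\<bar>) = \<bar>c (axis i 1)\<bar> * (\<Prod>j\<in>Basis - {axis i 1}. \<bar>c j\<bar>)"
        by (rule prod.remove[OF finite_Basis ax])
      also have "(\<Prod>j\<in>Basis - {axis i 1}. \<bar>c j\<bar>) = (\<Prod>j\<in>Basis - {axis i 1 :: real^'n}. t)"
        using t by (intro prod.cong) (auto simp: c_def)
      finally show ?thesis by (simp only: c_def if_True simp_thms abs_one mult_1)
    qed
    also have "\<dots> = t ^ card (Basis - {axis i 1} :: (real^'n) set)" by (rule prod_constant)
    also have "card (Basis - {axis i 1} :: (real^'n) set) = CARD('n) - 1"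
      using card_Diff_singleton[OF ax] by simp
    finally show ?thesis .
  qed
  have mT [measurable]: "T \<in> borel_measurable borel" unfolding T_def by measurable
  have "(\<integral>\<^sup>+w. g w \<partial>lborel) = (\<integral>\<^sup>+w. g w \<partial>density (distr lborel borel T) (\<lambda>_. ennreal (t ^ (CARD('n) - 1))))"
    using lborel_affine_euclidean[of c b] t unfolding T_def[abs_def] P[symmetric] by (simp add: c_def)
  also have "\<dots> = ennreal (t ^ (CARD('n) - 1)) * (\<integral>\<^sup>+w. g (T w) \<partial>lborel)"
    by (simp add: nn_integral_density nn_integral_distr nn_integral_cmult)
  finally have "ennreal (1 / t ^ (CARD('n) - 1)) * (\<integral>\<^sup>+w. g w \<partial>lborel) = (\<integral>\<^sup>+w. g (T w) \<partial>lborel)"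
    using t by (simp add: mult.assoc[symmetric] ennreal_mult[symmetric])
  then show ?thesis by (simp add: T)
qed

text \<open>A unit cube, so that integrals over it are averages. Its points are the meeting points
  of curves that start at sup norm at most \<open>2\<close>; its coordinates exceed
  \<open>2\<close>, and it stays within sup norm \<open>4\<close>.\<close>

definition target_box :: "(real^'n) set" where
  "target_box = {w. \<forall>k. w $ k \<in> {3..4}}"

lemma target_box_cbox: "target_box = cbox (\<chi> k. 3) (\<chi> k. 4)"
  by (auto simp: target_box_def mem_box_cart)

lemma target_box_sets [measurable]: "target_box \<in> sets borel"
  by (simp add: target_box_cbox)

lemma emeasure_target_box: "emeasure lborel (target_box :: (real^'n) set) = 1"
proof -
  have "emeasure lborel (cbox (\<chi> k. 3) (\<chi> k. 4) :: (real^'n) set) = (\<Prod>b\<in>Basis. ((\<chi> k. 4) - (\<chi> k. 3) :: real^'n) \<bullet> b)"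
    by (rule emeasure_lborel_cbox) (auto simp: Basis_vec_def inner_axis)
  also have "(\<Prod>b\<in>Basis. ((\<chi> k. 4) - (\<chi> k. 3) :: real^'n) \<bullet> b) = 1"
    by (intro prod.neutral) (auto simp: Basis_vec_def inner_axis)
  finally show ?thesis by (simp add: target_box_cbox)
qed

text \<open>The exponent is greater than \<open>-1\<close>, which makes the singularity at the apex
  of the cones below integrable.\<close>

lemma nn_integral_powr_unit:
  assumes "n > 0"
  shows "(\<integral>\<^sup>+t\<in>{0..1}. ennreal (t powr (- (real n - 1) / real n)) \<partial>lborel) = ennreal (real n)"
proof -
  have "((\<lambda>x. x powr (- (real n - 1) / real n)) has_integral (1 powr (- (real n - 1) / real n + 1) / (- (real n - 1) / real n + 1))) {0..1}"
    by (rule has_integral_powr_from_0) (use assms in \<open>auto simp: field_simps\<close>)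
  moreover have "- (real n - 1) / real n + 1 = 1 / real n" using assms by (simp add: field_simps)
  ultimately have "((\<lambda>x. x powr (- (real n - 1) / real n)) has_integral real n) {0..1}" by simp
  from nn_integral_has_integral_lebesgue'[OF _ this] show ?thesis by simp
qed

text \<open>The segments from \<open>a\<close> to the projections of the cube points fill a cone
  inside the slice through \<open>a\<close>. Contracting the slice by \<open>t\<close> costs the
  Jacobian \<open>1 / t ^ (n - 1)\<close>, one power less than in the full space, and this is what
  makes the singularity at the apex integrable.\<close>

lemma cone_average:
  fixes a :: "real^'n" and \<rho> :: "real^'n \<Rightarrow> ennreal"
  assumes [measurable]: "\<rho> \<in> borel_measurable borel" and a: "infnorm a \<le> 2" and \<delta>: "\<delta> > 0"
  shows "(\<integral>\<^sup>+w\<in>target_box. curve_integral (linepath a (vupd i (a $ i) w)) \<rho> \<partial>lborel) \<le>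
    ennreal (6 * (real CARD('n))\<^sup>2) * (ennreal \<delta> + ennreal (1 / \<delta> ^ (CARD('n) - 1)) *
      slice_integral i (a $ i) (\<lambda>z. \<rho> z ^ CARD('n) * indicator {z. infnorm z \<le> 4} z))"
proof -
  define n where "n = CARD('n)"
  have n: "n > 0" by (simp add: n_def)
  define G where "G z = \<rho> z ^ CARD('n) * indicator {z. infnorm z \<le> 4} z" for z
  define S where "S = slice_integral i (a $ i) G"
  have cl: "closed {z :: real^'n. infnorm z \<le> 4}"
    by (intro closed_Collect_le continuous_intros)
  have [measurable]: "{z :: real^'n. infnorm z \<le> 4} \<in> sets borel" using cl by simp
  have [measurable]: "G \<in> borel_measurable borel" unfolding G_def by measurable
  define L where "L t w = (\<chi> k. if k = i then w $ k else a $ k + t * (w $ k - a $ k))" for t :: real and w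
  have line: "linepath a (vupd i (a $ i) w) t = vupd i (a $ i) (L t w)" for t w
    by (simp add: vec_eq_iff linepath_def L_def algebra_simps)
  have mL: "(\<lambda>w. linepath a (vupd i (a $ i) w) t) \<in> borel_measurable borel" for t
    by (intro borel_measurable_continuous_onI) (auto simp: linepath_def intro!: continuous_intros continuous_on_vupd)
  have mL2: "(\<lambda>p. linepath a (vupd i (a $ i) (fst p)) (snd p)) \<in> borel_measurable borel"
    by (intro borel_measurable_continuous_onI) (auto simp: linepath_def intro!: continuous_intros continuous_on_vupd)
  have [measurable]: "(\<lambda>p. \<rho> (linepath a (vupd i (a $ i) (fst p)) (snd p))) \<in> borel_measurable (borel \<Otimes>\<^sub>M borel)"
    using measurable_compose[OF mL2 assms(1)] by (simp add: borel_prod)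
  have ak: "\<bar>a $ k\<bar> \<le> 2" for k using component_le_infnorm_cart[of a k] a by linarith
  have Linner: "(\<integral>\<^sup>+w\<in>target_box. \<rho> (linepath a (vupd i (a $ i) w) t) \<partial>lborel) \<le>
      ennreal (t powr (- (real n - 1) / real n)) * (ennreal \<delta> + ennreal (1 / \<delta> ^ (n - 1)) * S)"
    if t: "0 < t" "t \<le> 1" for t
  proof -
    \<comment> \<open>With this \<open>\<tau>\<close> both terms of \<open>ennreal_young\<close>
      carry the same power of \<open>t\<close>: together with the Jacobian,
      \<open>1 / \<tau> ^ (n - 1)\<close> has the exponent
      \<open>(n - 1) * (n - 1) / n - (n - 1)\<close>, which is \<open>- (n - 1) / n\<close>
      again.\<close>
    define \<tau> where "\<tau> = \<delta> * t powr (- (real n - 1) / real n)"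
    have \<tau>: "\<tau> > 0" using t \<delta> by (simp add: \<tau>_def)
    have in4: "infnorm (vupd i (a $ i) (L t w)) \<le> 4" if w: "w \<in> target_box" for w
    proof -
      have "\<bar>vupd i (a $ i) (L t w) $ k\<bar> \<le> 4" for k
      proof (cases "k = i")
        case True then show ?thesis using ak[of i] by simp
      next
        case False
        have "vupd i (a $ i) (L t w) $ k = (1 - t) * a $ k + t * w $ k" using False by (simp add: L_def algebra_simps)
        also have "\<bar>\<dots>\<bar> \<le> \<bar>(1 - t) * a $ k\<bar> + \<bar>t * w $ k\<bar>" by (rule abs_triangle_ineq)
        also have "\<dots> \<le> (1 - t) * 4 + t * 4"
        proof (rule add_mono)
          have "\<bar>a $ k\<bar> \<le> 4" "\<bar>w $ k\<bar> \<le> 4" using ak[of k] w[unfolded target_box_def, simplified, rule_format, of k] by auto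
          then show "\<bar>(1 - t) * a $ k\<bar> \<le> (1 - t) * 4" "\<bar>t * w $ k\<bar> \<le> t * 4"
            using t mult_left_mono[of "\<bar>a $ k\<bar>" 4 "1 - t"] mult_left_mono[of "\<bar>w $ k\<bar>" 4 t] by (auto simp: abs_mult)
        qed
        finally show ?thesis by simp
      qed
      then show ?thesis unfolding infnorm_cart by (intro cSup_least) auto
    qed
    have "(\<integral>\<^sup>+w\<in>target_box. \<rho> (linepath a (vupd i (a $ i) w) t) \<partial>lborel) \<le>
      (\<integral>\<^sup>+w. ennreal \<tau> * indicator target_box w + ennreal (1 / \<tau> ^ (n - 1)) * (indicator {3..4} (L t w $ i) * G (vupd i (a $ i) (L t w))) \<partial>lborel)"
    proof (rule nn_integral_mono)
      fix w :: "real^'n"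
      show "\<rho> (linepath a (vupd i (a $ i) w) t) * indicator target_box w \<le>
        ennreal \<tau> * indicator target_box w + ennreal (1 / \<tau> ^ (n - 1)) * (indicator {3..4} (L t w $ i) * G (vupd i (a $ i) (L t w)))"
      proof (cases "w \<in> target_box")
        case True
        have "L t w $ i \<in> {3..4}" using True by (simp add: L_def target_box_def)
        then show ?thesis
          using True in4[OF True] ennreal_young[OF \<tau> n, of "\<rho> (vupd i (a $ i) (L t w))"]
          by (simp add: line G_def n_def)
      qed simp
    qed
    also have "\<dots> = ennreal \<tau> * emeasure lborel (target_box :: (real^'n) set) +
        ennreal (1 / \<tau> ^ (n - 1)) * (\<integral>\<^sup>+w. indicator {3..4} (L t w $ i) * G (vupd i (a $ i) (L t w)) \<partial>lborel)"
    proof -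
      have [measurable]: "L t \<in> borel_measurable borel" unfolding L_def
      proof (intro borel_measurable_continuous_onI continuous_on_vec_lambda)
        fix k show "continuous_on UNIV (\<lambda>w. if k = i then w $ k else a $ k + t * (w $ k - a $ k))"
          by (cases "k = i") (auto intro!: continuous_intros)
      qed
      show ?thesis by (simp add: nn_integral_add nn_integral_cmult)
    qed
    also have "(\<integral>\<^sup>+w. indicator {3..4} (L t w $ i) * G (vupd i (a $ i) (L t w)) \<partial>lborel) = ennreal (1 / t ^ (n - 1)) * S"
      unfolding L_def S_def slice_integral_def n_def
      by (rule nn_integral_scale_other_coordinates[where g="\<lambda>w. indicator {3..4} (w $ i) * G (vupd i (a $ i) w)"]) (use t in auto)
    also have "ennreal (1 / \<tau> ^ (n - 1)) * (ennreal (1 / t ^ (n - 1)) * S) =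
        ennreal (t powr (- (real n - 1) / real n)) * (ennreal (1 / \<delta> ^ (n - 1)) * S)"
    proof -
      have "1 / \<tau> ^ (n - 1) * (1 / t ^ (n - 1)) = (1 / \<delta> ^ (n - 1)) * (1 / ((t powr (- (real n - 1) / real n)) ^ (n - 1) * t ^ (n - 1)))"
        by (simp add: \<tau>_def power_mult_distrib)
      also have "(t powr (- (real n - 1) / real n)) ^ (n - 1) * t ^ (n - 1) = t powr ((real n - 1) / real n)"
      proof -
        have "(t powr (- (real n - 1) / real n)) ^ (n - 1) * t ^ (n - 1) =
            t powr (- (real n - 1) / real n * real (n - 1)) * t powr real (n - 1)"
          using t by (simp add: powr_realpow[symmetric] powr_powr)
        also have "\<dots> = t powr (- (real n - 1) / real n * real (n - 1) + real (n - 1))" by (simp add: powr_add)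
        also have "- (real n - 1) / real n * real (n - 1) + real (n - 1) = (real n - 1) / real n"
        proof -
          have "real (n - 1) = real n - 1" using n by simp
          then show ?thesis using n by (simp add: field_simps)
        qed
        finally show ?thesis .
      qed
      also have "1 / t powr ((real n - 1) / real n) = t powr (- (real n - 1) / real n)"
        by (simp add: powr_minus_divide[symmetric] minus_divide_left)
      finally have e: "1 / \<tau> ^ (n - 1) * (1 / t ^ (n - 1)) = t powr (- (real n - 1) / real n) * (1 / \<delta> ^ (n - 1))"
        by (simp only: mult.commute)
      have "ennreal (1 / \<tau> ^ (n - 1)) * (ennreal (1 / t ^ (n - 1)) * S) = ennreal (1 / \<tau> ^ (n - 1) * (1 / t ^ (n - 1))) * S"
        using \<tau> t by (subst ennreal_mult) (auto simp: mult.assoc)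
      also have "\<dots> = ennreal (t powr (- (real n - 1) / real n)) * (ennreal (1 / \<delta> ^ (n - 1)) * S)"
        unfolding e using \<delta> by (subst ennreal_mult) (auto simp: mult.assoc)
      finally show ?thesis .
    qed
    also have "ennreal \<tau> * emeasure lborel (target_box :: (real^'n) set) = ennreal (t powr (- (real n - 1) / real n)) * ennreal \<delta>"
      using \<delta> by (simp add: emeasure_target_box \<tau>_def ennreal_mult[symmetric] mult.commute)
    finally show ?thesis by (simp add: distrib_left)
  qed
  \<comment> \<open>Coordinates of \<open>a\<close> are at most \<open>2\<close> and those of
    \<open>w\<close> at most \<open>4\<close> in absolute value; the bound \<open>6 * n\<close> and
    the value \<open>n\<close> of the power integral make up the constant
    \<open>6 * n\<^sup>2\<close>.\<close>
  have dist6: "dist a (vupd i (a $ i) w) \<le> 6 * real n" if w: "w \<in> target_box" for w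
  proof -
    have "dist a (vupd i (a $ i) w) \<le> (\<Sum>k\<in>UNIV. \<bar>(a - vupd i (a $ i) w) $ k\<bar>)"
      unfolding dist_norm by (rule norm_le_l1_cart)
    also have "\<dots> \<le> (\<Sum>k\<in>(UNIV::'n set). 6)"
    proof (rule sum_mono)
      fix k
      have "3 \<le> w $ k" "w $ k \<le> 4" using w by (auto simp: target_box_def)
      moreover have "- 2 \<le> a $ k" "a $ k \<le> 2" using ak[of k] by auto
      ultimately show "\<bar>(a - vupd i (a $ i) w) $ k\<bar> \<le> 6" by (auto simp: abs_le_iff)
    qed
    finally show ?thesis by (simp add: n_def mult.commute)
  qed
  have "(\<integral>\<^sup>+w\<in>target_box. curve_integral (linepath a (vupd i (a $ i) w)) \<rho> \<partial>lborel) \<le>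
     (\<integral>\<^sup>+w. ennreal (6 * real n) * (\<integral>\<^sup>+t. \<rho> (linepath a (vupd i (a $ i) w) t) * indicator target_box w * indicator {0..1} t \<partial>lborel) \<partial>lborel)"
  proof (rule nn_integral_mono)
    fix w :: "real^'n"
    show "curve_integral (linepath a (vupd i (a $ i) w)) \<rho> * indicator target_box w \<le>
      ennreal (6 * real n) * (\<integral>\<^sup>+t. \<rho> (linepath a (vupd i (a $ i) w) t) * indicator target_box w * indicator {0..1} t \<partial>lborel)"
      using dist6[of w] by (cases "w \<in> target_box") (auto simp: curve_integral_linepath intro!: mult_right_mono ennreal_leI)
  qed
  also have "\<dots> = ennreal (6 * real n) * (\<integral>\<^sup>+w. \<integral>\<^sup>+t. \<rho> (linepath a (vupd i (a $ i) w) t) * indicator target_box w * indicator {0..1} t \<partial>lborel \<partial>lborel)"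
    by (rule nn_integral_cmult) measurable
  also have "(\<integral>\<^sup>+w. \<integral>\<^sup>+t. \<rho> (linepath a (vupd i (a $ i) w) t) * indicator target_box w * indicator {0..1} t \<partial>lborel \<partial>lborel)
    = (\<integral>\<^sup>+t. \<integral>\<^sup>+w. \<rho> (linepath a (vupd i (a $ i) w) t) * indicator target_box w * indicator {0..1} t \<partial>lborel \<partial>lborel)"
    by (rule lborel_pair.Fubini'[symmetric]) measurable
  also have "\<dots> \<le> (\<integral>\<^sup>+t. (ennreal \<delta> + ennreal (1 / \<delta> ^ (n - 1)) * S) * (ennreal (t powr (- (real n - 1) / real n)) * indicator {0..1} t) \<partial>lborel)"
  proof (rule nn_integral_mono_AE)
    have "AE t in lborel. t \<noteq> (0::real)" by (rule AE_lborel_singleton)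
    then show "AE t in lborel. (\<integral>\<^sup>+w. \<rho> (linepath a (vupd i (a $ i) w) t) * indicator target_box w * indicator {0..1} t \<partial>lborel)
      \<le> (ennreal \<delta> + ennreal (1 / \<delta> ^ (n - 1)) * S) * (ennreal (t powr (- (real n - 1) / real n)) * indicator {0..1} t)"
    proof eventually_elim
      case (elim t)
      then show ?case using Linner[of t] by (cases "t \<in> {0..1}") (auto simp: mult.commute)
    qed
  qed
  also have "\<dots> = (ennreal \<delta> + ennreal (1 / \<delta> ^ (n - 1)) * S) * ennreal (real n)"
    by (subst nn_integral_cmult, measurable, simp only: nn_integral_powr_unit[OF n])
  finally have "(\<integral>\<^sup>+w\<in>target_box. curve_integral (linepath a (vupd i (a $ i) w)) \<rho> \<partial>lborel)
    \<le> ennreal (6 * real n) * ((ennreal \<delta> + ennreal (1 / \<delta> ^ (n - 1)) * S) * ennreal (real n))"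
    by (simp add: mult_left_mono)
  also have "\<dots> = ennreal (6 * (real n)\<^sup>2) * (ennreal \<delta> + ennreal (1 / \<delta> ^ (n - 1)) * S)"
  proof -
    have "ennreal (6 * (real n)\<^sup>2) = ennreal (6 * real n) * ennreal (real n)"
      by (simp add: ennreal_mult[symmetric] power2_eq_square mult_ac)
    then show ?thesis by (simp add: mult_ac)
  qed
  finally show ?thesis unfolding S_def G_def n_def .
qed


text \<open>Measured in the sup norm, so that every point of level \<open>s\<close> lies on one of
  the \<open>2 * n\<close> coordinate slices at position \<open>s\<close> or \<open>- s\<close>, as
  the cones require.\<close>

definition cubic_ring :: "(real^'n) set" where
  "cubic_ring = {z. 1 \<le> infnorm z \<and> infnorm z \<le> 4}"

lemma infnorm_le_iff: "infnorm (z::real^'n) \<le> r \<longleftrightarrow> (\<forall>k. \<bar>z $ k\<bar> \<le> r)"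
proof
  assume "infnorm z \<le> r" then show "\<forall>k. \<bar>z $ k\<bar> \<le> r" using component_le_infnorm_cart order_trans by blast
next
  assume "\<forall>k. \<bar>z $ k\<bar> \<le> r" then show "infnorm z \<le> r" unfolding infnorm_cart by (intro cSup_least) auto
qed

lemma infnorm_attained: "\<exists>i. infnorm (z::real^'n) = \<bar>z $ i\<bar>"
proof -
  have "infnorm z = Max (range (\<lambda>i. \<bar>z $ i\<bar>))"
    unfolding infnorm_cart by (subst cSup_eq_Max) (auto simp: full_SetCompr_eq)
  moreover have "Max (range (\<lambda>i. \<bar>z $ i\<bar>)) \<in> range (\<lambda>i. \<bar>z $ i\<bar>)" by (rule Max_in) auto
  then obtain i where "Max (range (\<lambda>i. \<bar>z $ i\<bar>)) = \<bar>z $ i\<bar>" by (rule rangeE)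
  ultimately show ?thesis by metis
qed

lemma cubic_ring_sets [measurable]: "(cubic_ring :: (real^'n) set) \<in> sets borel"
proof -
  have "closed (cubic_ring :: (real^'n) set)" unfolding cubic_ring_def
    by (intro closed_Collect_conj closed_Collect_le continuous_intros)
  then show ?thesis by simp
qed

lemma emeasure_cubic_ring_le: "emeasure lborel (cubic_ring :: (real^'n) set) \<le> ennreal (8 ^ CARD('n))"
proof -
  have "cubic_ring \<subseteq> cbox (\<chi> k. -4) (\<chi> k. 4 :: real^'n)"
    by (auto simp: cubic_ring_def infnorm_le_iff mem_box_cart abs_le_iff) (smt (verit))
  then have "emeasure lborel (cubic_ring :: (real^'n) set) \<le> emeasure lborel (cbox (\<chi> k. -4) (\<chi> k. 4) :: (real^'n) set)"
    by (intro emeasure_mono) auto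
  also have "\<dots> = (\<Prod>b\<in>Basis. ((\<chi> k. 4) - (\<chi> k. -4) :: real^'n) \<bullet> b)"
    by (rule emeasure_lborel_cbox) (auto simp: Basis_vec_def inner_axis)
  also have "(\<Prod>b\<in>Basis. ((\<chi> k. 4) - (\<chi> k. -4) :: real^'n) \<bullet> b) = (\<Prod>b\<in>(Basis :: (real^'n) set). 8)"
    by (intro prod.cong) (auto simp: Basis_vec_def inner_axis)
  finally show ?thesis by simp
qed

text \<open>The second leg runs from the projection of \<open>w\<close> to \<open>w\<close>,
  parallel to the axis \<open>i\<close>. As \<open>w\<close> varies these segments sweep out a box,
  so their average integral is bounded by a volume integral. Some coordinate other than
  \<open>i\<close> exists and is at least \<open>3\<close> there, which keeps the segments in
  \<open>cubic_ring\<close>; this is where \<open>n \<ge> 2\<close> enters.\<close>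

lemma axis_average:
  fixes \<rho> :: "real^'n \<Rightarrow> ennreal"
  assumes n: "CARD('n) \<ge> 2" and [measurable]: "\<rho> \<in> borel_measurable borel" and \<sigma>: "\<bar>\<sigma>\<bar> \<le> 2"
  shows "(\<integral>\<^sup>+w\<in>target_box. curve_integral (linepath (vupd i \<sigma> w) w) \<rho> \<partial>lborel) \<le> (\<integral>\<^sup>+z\<in>cubic_ring. \<rho> z \<partial>lborel)"
proof -
  \<comment> \<open>The \<open>3\<close> is just an admissible value for the coordinate
    \<open>i\<close>, so that only the other coordinates are tested.\<close>
  define B where "B z = (indicator target_box (vupd i 3 z) :: ennreal)" for z :: "real^'n"
  have [measurable]: "B \<in> borel_measurable borel" unfolding B_def by measurable
  have seg: "curve_integral (linepath (vupd i \<sigma> w) w) \<rho> \<le> (\<integral>\<^sup>+s. \<rho> (vupd i s w) * indicator {-4..4} s \<partial>lborel)"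
    if w: "w \<in> target_box" for w :: "real^'n"
  proof -
    have wi: "3 \<le> w $ i" "w $ i \<le> 4" using w by (auto simp: target_box_def)
    have pos: "w $ i - \<sigma> > 0" using wi \<sigma> by auto
    have "(dist (vupd i \<sigma> w) w)\<^sup>2 = (w $ i - \<sigma>)\<^sup>2"
    proof -
      have "w - vupd i \<sigma> w = vupd i (w $ i - \<sigma>) 0" by (simp add: vec_eq_iff)
      then show ?thesis by (simp add: dist_norm norm_minus_commute norm_vupd)
    qed
    then have d: "dist (vupd i \<sigma> w) w = w $ i - \<sigma>" using pos by (simp add: power2_eq_iff_nonneg)
    have l: "linepath (vupd i \<sigma> w) w t = vupd i (\<sigma> + (w $ i - \<sigma>) * t) w" for t
      by (simp add: vec_eq_iff linepath_def algebra_simps)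
    have "(\<integral>\<^sup>+s. \<rho> (vupd i s w) * indicator {\<sigma>..w $ i} s \<partial>lborel) =
      ennreal \<bar>w $ i - \<sigma>\<bar> * (\<integral>\<^sup>+t. \<rho> (vupd i (\<sigma> + (w $ i - \<sigma>) * t) w) * indicator {\<sigma>..w $ i} (\<sigma> + (w $ i - \<sigma>) * t) \<partial>lborel)"
      by (rule nn_integral_real_affine) (use pos in auto)
    also have "(\<integral>\<^sup>+t. \<rho> (vupd i (\<sigma> + (w $ i - \<sigma>) * t) w) * indicator {\<sigma>..w $ i} (\<sigma> + (w $ i - \<sigma>) * t) \<partial>lborel)
      = (\<integral>\<^sup>+t\<in>{0..1}. \<rho> (linepath (vupd i \<sigma> w) w t) \<partial>lborel)"
    proof (intro nn_integral_cong arg_cong2[where f="(*)"])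
      fix t :: real
      have "\<sigma> + (w $ i - \<sigma>) * t \<le> \<sigma> + (w $ i - \<sigma>) * 1 \<longleftrightarrow> t \<le> 1"
        by (simp only: add_le_cancel_left mult_le_cancel_left_pos[OF pos])
      moreover have "\<sigma> + (w $ i - \<sigma>) * 1 = w $ i" by simp
      ultimately have e1: "\<sigma> + (w $ i - \<sigma>) * t \<le> w $ i \<longleftrightarrow> t \<le> 1" by metis
      have e2: "\<sigma> \<le> \<sigma> + (w $ i - \<sigma>) * t \<longleftrightarrow> 0 \<le> t" using pos by (simp add: zero_le_mult_iff)
      show "indicator {\<sigma>..w $ i} (\<sigma> + (w $ i - \<sigma>) * t) = (indicator {0..1} t :: ennreal)"
        unfolding indicator_def atLeastAtMost_iff e1 e2 ..
    qed (simp add: l)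
    finally have "curve_integral (linepath (vupd i \<sigma> w) w) \<rho> = (\<integral>\<^sup>+s. \<rho> (vupd i s w) * indicator {\<sigma>..w $ i} s \<partial>lborel)"
      using pos by (simp add: curve_integral_linepath d)
    also have "\<dots> \<le> (\<integral>\<^sup>+s. \<rho> (vupd i s w) * indicator {-4..4} s \<partial>lborel)"
      using wi \<sigma> by (intro nn_integral_mono mult_left_mono) (auto simp: indicator_def)
    finally show ?thesis .
  qed
  have "(\<integral>\<^sup>+w\<in>target_box. curve_integral (linepath (vupd i \<sigma> w) w) \<rho> \<partial>lborel)
    \<le> (\<integral>\<^sup>+w. \<integral>\<^sup>+s. indicator target_box w * (\<rho> (vupd i s w) * indicator {-4..4} s) \<partial>lborel \<partial>lborel)"
  proof (rule nn_integral_mono)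
    fix w :: "real^'n"
    show "curve_integral (linepath (vupd i \<sigma> w) w) \<rho> * indicator target_box w
      \<le> (\<integral>\<^sup>+s. indicator target_box w * (\<rho> (vupd i s w) * indicator {-4..4} s) \<partial>lborel)"
      using seg[of w] by (cases "w \<in> target_box") auto
  qed
  also have "\<dots> = (\<integral>\<^sup>+s. \<integral>\<^sup>+w. indicator target_box w * (\<rho> (vupd i s w) * indicator {-4..4} s) \<partial>lborel \<partial>lborel)"
    by (rule lborel_pair.Fubini'[symmetric]) measurable
  also have "\<dots> = (\<integral>\<^sup>+s. indicator {-4..4} s * slice_integral i s (\<lambda>z. B z * \<rho> z) \<partial>lborel)"
  proof (rule nn_integral_cong)
    fix s :: real
    have "indicator target_box w = indicator {3..4} (w $ i) * B (vupd i s w)" for w :: "real^'n"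
      by (auto simp: B_def indicator_def target_box_def split: if_splits)
    then show "(\<integral>\<^sup>+w. indicator target_box w * (\<rho> (vupd i s w) * indicator {-4..4} s) \<partial>lborel)
      = indicator {-4..4} s * slice_integral i s (\<lambda>z. B z * \<rho> z)"
      unfolding slice_integral_def by (subst nn_integral_cmult[symmetric]) (auto simp: mult_ac)
  qed
  also have "\<dots> = (\<integral>\<^sup>+z. indicator {-4..4} (z $ i) * (B z * \<rho> z) \<partial>lborel)"
    by (rule nn_integral_slice_integral) auto
  also have "\<dots> \<le> (\<integral>\<^sup>+z\<in>cubic_ring. \<rho> z \<partial>lborel)"
  proof (rule nn_integral_mono)
    fix z :: "real^'n"
    have "z \<in> cubic_ring" if z: "z $ i \<in> {-4..4}" "vupd i 3 z \<in> target_box"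
    proof -
      have others: "3 \<le> z $ k \<and> z $ k \<le> 4" if "k \<noteq> i" for k
        using z(2) that unfolding target_box_def by (auto dest: spec[of _ k])
      have "\<exists>k. k \<noteq> i"
      proof (rule ccontr)
        assume "\<not> (\<exists>k. k \<noteq> i)"
        then have "(UNIV :: 'n set) = {i}" by auto
        then have "CARD('n) = card {i}" by simp
        then show False using n by simp
      qed
      then obtain k where k: "k \<noteq> i" by blast
      have "1 \<le> infnorm z" using component_le_infnorm_cart[of z k] others[OF k] by linarith
      moreover have "\<bar>z $ k\<bar> \<le> 4" for k using z(1) others[of k] by (cases "k = i") auto
      ultimately show ?thesis by (simp add: cubic_ring_def infnorm_le_iff)
    qed
    then show "indicator {-4..4} (z $ i) * (B z * \<rho> z) \<le> \<rho> z * indicator cubic_ring z"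
      by (auto simp: B_def indicator_def)
  qed
  finally show ?thesis .
qed

lemma nn_integral_cubic_ring_le:
  fixes \<rho> :: "real^'n \<Rightarrow> ennreal"
  assumes [measurable]: "\<rho> \<in> borel_measurable borel" and \<delta>: "\<delta> > 0"
  shows "(\<integral>\<^sup>+z\<in>cubic_ring. \<rho> z \<partial>lborel) \<le> ennreal (8 ^ CARD('n) * \<delta>) +
    ennreal (1 / \<delta> ^ (CARD('n) - 1)) * (\<integral>\<^sup>+z\<in>cubic_ring. \<rho> z ^ CARD('n) \<partial>lborel)"
proof -
  have "(\<integral>\<^sup>+z\<in>cubic_ring. \<rho> z \<partial>lborel) \<le>
    (\<integral>\<^sup>+z. ennreal \<delta> * indicator cubic_ring z + ennreal (1 / \<delta> ^ (CARD('n) - 1)) * (\<rho> z ^ CARD('n) * indicator cubic_ring z) \<partial>lborel)"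
  proof (rule nn_integral_mono)
    fix z :: "real^'n"
    show "\<rho> z * indicator cubic_ring z \<le> ennreal \<delta> * indicator cubic_ring z + ennreal (1 / \<delta> ^ (CARD('n) - 1)) * (\<rho> z ^ CARD('n) * indicator cubic_ring z)"
      using ennreal_young[OF \<delta>, of "CARD('n)" "\<rho> z"] by (auto simp: indicator_def)
  qed
  also have "\<dots> = ennreal \<delta> * emeasure lborel (cubic_ring :: (real^'n) set) + ennreal (1 / \<delta> ^ (CARD('n) - 1)) * (\<integral>\<^sup>+z\<in>cubic_ring. \<rho> z ^ CARD('n) \<partial>lborel)"
    by (simp add: nn_integral_add nn_integral_cmult)
  also have "\<dots> \<le> ennreal \<delta> * ennreal (8 ^ CARD('n)) + ennreal (1 / \<delta> ^ (CARD('n) - 1)) * (\<integral>\<^sup>+z\<in>cubic_ring. \<rho> z ^ CARD('n) \<partial>lborel)"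
    by (intro add_right_mono mult_left_mono emeasure_cubic_ring_le) auto
  also have "ennreal \<delta> * ennreal (8 ^ CARD('n)) = ennreal (8 ^ CARD('n) * \<delta>)"
    using \<delta> by (simp add: ennreal_mult[symmetric] mult.commute)
  finally show ?thesis .
qed

lemma measurable_curve_integral_linepath:
  fixes u v :: "real^'n \<Rightarrow> real^'n"
  assumes "continuous_on UNIV u" "continuous_on UNIV v" and [measurable]: "\<rho> \<in> borel_measurable borel"
  shows "(\<lambda>w. curve_integral (linepath (u w) (v w)) \<rho>) \<in> borel_measurable borel"
proof -
  have [measurable]: "u \<in> borel_measurable borel" "v \<in> borel_measurable borel"
    using assms(1,2) by (auto intro: borel_measurable_continuous_onI)
  have mL2: "(\<lambda>p. linepath (u (fst p)) (v (fst p)) (snd p)) \<in> borel_measurable borel"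
    unfolding linepath_def
    by (intro borel_measurable_continuous_onI continuous_intros
        continuous_on_compose2[OF assms(1)] continuous_on_compose2[OF assms(2)]) auto
  have [measurable]: "(\<lambda>p. \<rho> (linepath (u (fst p)) (v (fst p)) (snd p))) \<in> borel_measurable (borel \<Otimes>\<^sub>M borel)"
    using measurable_compose[OF mL2 assms(3)] by (simp add: borel_prod)
  show ?thesis unfolding curve_integral_linepath[OF assms(3)] by measurable
qed

lemma curve_integral_linepath_commute:
  assumes [measurable]: "\<rho> \<in> borel_measurable borel"
  shows "curve_integral (linepath a b) \<rho> = curve_integral (linepath b a) \<rho>"
proof -
  have [measurable]: "linepath b a \<in> borel_measurable borel"
    by (intro borel_measurable_continuous_onI) (auto simp: linepath_def intro!: continuous_intros)
  have "(\<integral>\<^sup>+t. \<rho> (linepath b a t) * indicator {0..1} t \<partial>lborel) =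
    ennreal \<bar>- 1\<bar> * (\<integral>\<^sup>+t. \<rho> (linepath b a (1 + - 1 * t)) * indicator {0..1} (1 + - 1 * t) \<partial>lborel)"
    by (rule nn_integral_real_affine) auto
  also have "\<dots> = (\<integral>\<^sup>+t. \<rho> (linepath a b t) * indicator {0..1} t \<partial>lborel)"
    by (auto simp: linepath_def indicator_def algebra_simps intro!: nn_integral_cong)
  finally show ?thesis by (simp add: curve_integral_linepath dist_commute)
qed

text \<open>The coordinate in which a point of level \<open>s\<close> attains its sup norm is
  unknown, so all \<open>2 * n\<close> slices must be small for the same \<open>s\<close>. Otherwise
  their sum is at least \<open>2 * n * \<epsilon>\<close> for every \<open>s\<close> in
  \<open>[1, 2]\<close>, while its integral over \<open>s\<close> is at most \<open>2 * n\<close>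
  times the integral over the ring.\<close>

lemma exists_small_slices:
  fixes \<rho> :: "real^'n \<Rightarrow> ennreal"
  assumes [measurable]: "\<rho> \<in> borel_measurable borel"
    and J: "(\<integral>\<^sup>+z\<in>cubic_ring. \<rho> z ^ CARD('n) \<partial>lborel) < ennreal \<epsilon>"
  shows "\<exists>s\<in>{1..2}. \<forall>i. \<forall>\<sigma>. \<bar>\<sigma>\<bar> = s \<longrightarrow>
    slice_integral i \<sigma> (\<lambda>z. \<rho> z ^ CARD('n) * indicator {z. infnorm z \<le> 4} z) \<le> ennreal (2 * real CARD('n) * \<epsilon>)"
proof (rule ccontr)
  assume contr: "\<not> ?thesis"
  define G where "G z = \<rho> z ^ CARD('n) * indicator {z. infnorm z \<le> 4} z" for z :: "real^'n"
  have cl: "closed {z :: real^'n. infnorm z \<le> 4}"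
    by (intro closed_Collect_le continuous_intros)
  have [measurable]: "{z :: real^'n. infnorm z \<le> 4} \<in> sets borel" using cl by simp
  have [measurable]: "G \<in> borel_measurable borel" unfolding G_def by measurable
  define J' where "J' = (\<integral>\<^sup>+z\<in>cubic_ring. \<rho> z ^ CARD('n) \<partial>lborel)"
  have \<epsilon>: "\<epsilon> > 0" using J by (metis ennreal_eq_0_iff linorder_not_le not_less_zero)
  have one: "(\<integral>\<^sup>+s. indicator {1..2} s * slice_integral i (\<alpha> * s) G \<partial>lborel) \<le> J'" if \<alpha>: "\<bar>\<alpha>\<bar> = 1" for i and \<alpha> :: real
  proof -
    have a2: "\<alpha> * (\<alpha> * s) = s" for s using \<alpha> by (cases "\<alpha> \<ge> 0") auto
    have "(\<integral>\<^sup>+s. indicator {1..2} (\<alpha> * s) * slice_integral i s G \<partial>lborel) =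
      ennreal \<bar>\<alpha>\<bar> * (\<integral>\<^sup>+s. indicator {1..2} (\<alpha> * (0 + \<alpha> * s)) * slice_integral i (0 + \<alpha> * s) G \<partial>lborel)"
      by (rule nn_integral_real_affine) (use \<alpha> in auto)
    then have "(\<integral>\<^sup>+s. indicator {1..2} s * slice_integral i (\<alpha> * s) G \<partial>lborel) =
      (\<integral>\<^sup>+s. indicator {1..2} (\<alpha> * s) * slice_integral i s G \<partial>lborel)"
      using \<alpha> by (simp add: a2)
    also have "\<dots> = (\<integral>\<^sup>+z. indicator {1..2} (\<alpha> * z $ i) * G z \<partial>lborel)"
      by (rule nn_integral_slice_integral[where \<phi>="\<lambda>s. indicator {1..2} (\<alpha> * s)"]) measurable
    also have "\<dots> \<le> J'" unfolding J'_def
    proof (rule nn_integral_mono)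
      fix z :: "real^'n"
      have "1 \<le> infnorm z" if "\<alpha> * z $ i \<in> {1..2}"
      proof -
        have "1 \<le> \<bar>\<alpha> * z $ i\<bar>" using that by auto
        also have "\<dots> = \<bar>z $ i\<bar>" using \<alpha> by (simp add: abs_mult)
        finally show ?thesis using component_le_infnorm_cart[of z i] by linarith
      qed
      then show "indicator {1..2} (\<alpha> * z $ i) * G z \<le> \<rho> z ^ CARD('n) * indicator cubic_ring z"
        by (auto simp: G_def indicator_def cubic_ring_def)
    qed
    finally show ?thesis .
  qed
  define T where "T s = (\<Sum>i\<in>(UNIV :: 'n set). slice_integral i (1 * s) G + slice_integral i (-1 * s) G)" for s
  have big: "ennreal (2 * real CARD('n) * \<epsilon>) \<le> T s" if s: "s \<in> {1..2}" for s
  proof -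
    have "\<exists>i \<sigma>. \<bar>\<sigma>\<bar> = s \<and> \<not> slice_integral i \<sigma> G \<le> ennreal (2 * real CARD('n) * \<epsilon>)"
      using contr s unfolding G_def by blast
    then obtain i \<sigma> where i: "\<bar>\<sigma>\<bar> = s" "ennreal (2 * real CARD('n) * \<epsilon>) < slice_integral i \<sigma> G"
      by (auto simp: not_le)
    have "slice_integral i \<sigma> G \<le> slice_integral i (1 * s) G + slice_integral i (-1 * s) G"
      using i(1) by (cases "\<sigma> \<ge> 0") auto
    also have "\<dots> \<le> T s" unfolding T_def by (rule member_le_sum) auto
    finally show ?thesis using i(2) by simp
  qed
  have "ennreal (2 * real CARD('n) * \<epsilon>) = (\<integral>\<^sup>+s. ennreal (2 * real CARD('n) * \<epsilon>) * indicator {1..2::real} s \<partial>lborel)"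
    by (subst nn_integral_cmult) auto
  also have "\<dots> \<le> (\<integral>\<^sup>+s. indicator {1..2} s * T s \<partial>lborel)"
    using big by (intro nn_integral_mono) (auto simp: indicator_def)
  also have "\<dots> = (\<integral>\<^sup>+s. (\<Sum>i\<in>(UNIV :: 'n set). indicator {1..2} s * slice_integral i (1 * s) G + indicator {1..2} s * slice_integral i (-1 * s) G) \<partial>lborel)"
    by (simp only: T_def sum_distrib_left distrib_left)
  also have "\<dots> = (\<Sum>i\<in>(UNIV :: 'n set). (\<integral>\<^sup>+s. indicator {1..2} s * slice_integral i (1 * s) G \<partial>lborel) + (\<integral>\<^sup>+s. indicator {1..2} s * slice_integral i (-1 * s) G \<partial>lborel))"
    by (subst nn_integral_sum, measurable, intro sum.cong refl nn_integral_add) measurable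
  also have "\<dots> \<le> (\<Sum>i\<in>(UNIV :: 'n set). J' + J')"
    by (intro sum_mono add_mono one) auto
  also have "\<dots> = ennreal (2 * real CARD('n)) * J'"
    by (simp add: mult_2[symmetric] ennreal_mult ennreal_of_nat_eq_real_of_nat mult.assoc mult.left_commute)
  also have "\<dots> < ennreal (2 * real CARD('n)) * ennreal \<epsilon>"
    using J by (intro ennreal_mult_strict_left_mono) (auto simp: J'_def)
  also have "\<dots> = ennreal (2 * real CARD('n) * \<epsilon>)" using \<epsilon> by (simp add: ennreal_mult)
  finally show False by simp
qed

section \<open>The modulus estimate at a single scale\<close>

lemma closed_segment_nth: "z \<in> closed_segment x y \<Longrightarrow> x $ k = c \<Longrightarrow> y $ k = c \<Longrightarrow> z $ k = (c :: real)"
proof -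
  assume z: "z \<in> closed_segment x y" and c: "x $ k = c" "y $ k = c"
  obtain u where "z = (1 - u) *\<^sub>R x + u *\<^sub>R y" using z unfolding in_segment by blast
  then have "z $ k = (1 - u) * c + u * c" using c by simp
  then show "z $ k = c" by (simp add: algebra_simps)
qed

lemma convex_infnorm_ball: "convex {z :: real^'n. infnorm z \<le> r}"
proof -
  have "{z :: real^'n. infnorm z \<le> r} = (\<Inter>k. {z. z $ k \<le> r} \<inter> {z. - z $ k \<le> r})"
    by (auto simp: infnorm_le_iff abs_le_iff)
  moreover have "convex {z :: real^'n. z $ k \<le> r}" "convex {z :: real^'n. - z $ k \<le> r}" for k
  proof -
    have "axis k 1 \<bullet> z = z $ k" for z :: "real^'n" by (simp add: cart_eq_inner_axis inner_commute)
    then show "convex {z :: real^'n. z $ k \<le> r}" "convex {z :: real^'n. - z $ k \<le> r}"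
      using convex_halfspace_le[of "axis k 1 :: real^'n" r] convex_halfspace_le[of "- axis k 1 :: real^'n" r] by simp_all
  qed
  ultimately show ?thesis by (simp add: convex_INT convex_Int)
qed

text \<open>Points \<open>a\<close> and \<open>b\<close> of one good level \<open>s\<close> are
  joined through a cube point \<open>w\<close> by two cone segments and two axis segments. If the
  integral over the ring is below \<open>\<epsilon>\<close>, the average over \<open>w\<close> of
  the four line integrals is at most \<open>1/2\<close>, so some \<open>w\<close> gives a curve with
  integral less than \<open>1\<close>, against admissibility.\<close>

lemma loewner_single_scale:
  assumes n: "CARD('n) \<ge> 2"
  shows "\<exists>\<epsilon>>0. \<forall>(\<rho> :: real^'n \<Rightarrow> ennreal) E F. \<rho> \<in> borel_measurable borel \<longrightarrow>
      (\<forall>s\<in>{1..2}. \<exists>a\<in>E. infnorm a = s) \<longrightarrow> (\<forall>s\<in>{1..2}. \<exists>b\<in>F. infnorm b = s) \<longrightarrow>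
      (\<forall>\<gamma>\<in>joining_curves E F cubic_ring. rectifiable_curve \<gamma> \<longrightarrow> 1 \<le> curve_integral \<gamma> \<rho>) \<longrightarrow>
      ennreal \<epsilon> \<le> (\<integral>\<^sup>+z\<in>cubic_ring. \<rho> z ^ CARD('n) \<partial>lborel)"
proof -
  define N where "N = real CARD('n)"
  \<comment> \<open>The averages will sum to \<open>2 * (R1 + R2)\<close> with
    \<open>R1 + R2 = M * \<delta> + K * (12 * N ^ 3 + 1) * \<epsilon>\<close>;
    \<open>\<delta>\<close> and \<open>\<epsilon>\<close> are chosen to make both terms
    \<open>1/8\<close>.\<close>
  define M where "M = 6 * N\<^sup>2 + 8 ^ CARD('n)"
  define \<delta> where "\<delta> = 1 / (8 * M)"
  define K where "K = 1 / \<delta> ^ (CARD('n) - 1)"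
  define \<epsilon> where "\<epsilon> = 1 / (8 * K * (12 * N ^ 3 + 1))"
  have N: "N > 0" by (simp add: N_def)
  have M: "M > 0" using N by (simp add: M_def add_nonneg_pos)
  have \<delta>: "\<delta> > 0" using M by (simp add: \<delta>_def)
  have K: "K > 0" using \<delta> by (simp add: K_def)
  have \<epsilon>: "\<epsilon> > 0" using K N by (simp add: \<epsilon>_def add_pos_pos)
  show ?thesis
  proof (rule exI[of _ \<epsilon>], intro conjI allI impI, rule \<epsilon>)
    fix \<rho> :: "real^'n \<Rightarrow> ennreal" and E F
    assume \<rho> [measurable]: "\<rho> \<in> borel_measurable borel"
      and E: "\<forall>s\<in>{1..2}. \<exists>a\<in>E. infnorm a = s" and F: "\<forall>s\<in>{1..2}. \<exists>b\<in>F. infnorm b = s"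
      and ad: "\<forall>\<gamma>\<in>joining_curves E F cubic_ring. rectifiable_curve \<gamma> \<longrightarrow> 1 \<le> curve_integral \<gamma> \<rho>"
    define J where "J = (\<integral>\<^sup>+z\<in>cubic_ring. \<rho> z ^ CARD('n) \<partial>lborel)"
    show "ennreal \<epsilon> \<le> (\<integral>\<^sup>+z\<in>cubic_ring. \<rho> z ^ CARD('n) \<partial>lborel)"
    proof (rule ccontr)
      assume "\<not> ?thesis"
      then have J: "J < ennreal \<epsilon>" by (simp add: J_def)
      define G where "G z = \<rho> z ^ CARD('n) * indicator {z. infnorm z \<le> 4} z" for z
      obtain s where s: "s \<in> {1..2}" and sl: "\<And>i \<sigma>. \<bar>\<sigma>\<bar> = s \<Longrightarrow> slice_integral i \<sigma> G \<le> ennreal (2 * N * \<epsilon>)"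
        using exists_small_slices[OF \<rho> J[unfolded J_def]] unfolding N_def G_def by blast
      obtain a where a: "a \<in> E" "infnorm a = s" using bspec[OF E s] by blast
      obtain b where b: "b \<in> F" "infnorm b = s" using bspec[OF F s] by blast
      obtain i where i: "\<bar>a $ i\<bar> = s" using infnorm_attained[of a] a by auto
      obtain j where j: "\<bar>b $ j\<bar> = s" using infnorm_attained[of b] b by auto
      define I1 where "I1 w = curve_integral (linepath a (vupd i (a $ i) w)) \<rho>" for w
      define I2 where "I2 w = curve_integral (linepath (vupd i (a $ i) w) w) \<rho>" for w
      define I3 where "I3 w = curve_integral (linepath (vupd j (b $ j) w) w) \<rho>" for w
      define I4 where "I4 w = curve_integral (linepath b (vupd j (b $ j) w)) \<rho>" for w
      have [measurable]: "I1 \<in> borel_measurable borel" "I2 \<in> borel_measurable borel"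
        "I3 \<in> borel_measurable borel" "I4 \<in> borel_measurable borel"
        unfolding I1_def[abs_def] I2_def[abs_def] I3_def[abs_def] I4_def[abs_def]
        by (intro measurable_curve_integral_linepath \<rho> continuous_on_vupd continuous_intros)+
      have cone: "(\<integral>\<^sup>+w\<in>target_box. curve_integral (linepath c (vupd k (c $ k) w)) \<rho> \<partial>lborel) \<le> ennreal (6 * N\<^sup>2 * (\<delta> + K * (2 * N * \<epsilon>)))"
        if c: "infnorm c = s" "\<bar>c $ k\<bar> = s" for c k
      proof -
        have "(\<integral>\<^sup>+w\<in>target_box. curve_integral (linepath c (vupd k (c $ k) w)) \<rho> \<partial>lborel) \<le>
          ennreal (6 * N\<^sup>2) * (ennreal \<delta> + ennreal K * slice_integral k (c $ k) G)"
          unfolding N_def K_def G_def by (rule cone_average) (use c s \<delta> in auto)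
        also have "\<dots> \<le> ennreal (6 * N\<^sup>2) * (ennreal \<delta> + ennreal K * ennreal (2 * N * \<epsilon>))"
          by (intro mult_left_mono add_left_mono sl c) auto
        also have "\<dots> = ennreal (6 * N\<^sup>2 * (\<delta> + K * (2 * N * \<epsilon>)))"
          using \<delta> K N \<epsilon> by (simp add: ennreal_mult[symmetric] ennreal_plus[symmetric] del: ennreal_plus)
        finally show ?thesis .
      qed
      have ax: "(\<integral>\<^sup>+w\<in>target_box. curve_integral (linepath (vupd k \<sigma> w) w) \<rho> \<partial>lborel) \<le> ennreal (8 ^ CARD('n) * \<delta> + K * \<epsilon>)"
        if "\<bar>\<sigma>\<bar> = s" for k \<sigma>
      proof -
        have "(\<integral>\<^sup>+w\<in>target_box. curve_integral (linepath (vupd k \<sigma> w) w) \<rho> \<partial>lborel) \<le> (\<integral>\<^sup>+z\<in>cubic_ring. \<rho> z \<partial>lborel)"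
          by (rule axis_average[OF n]) (use that s in auto)
        also have "\<dots> \<le> ennreal (8 ^ CARD('n) * \<delta>) + ennreal K * J"
          unfolding K_def J_def by (rule nn_integral_cubic_ring_le[OF \<rho> \<delta>])
        also have "\<dots> \<le> ennreal (8 ^ CARD('n) * \<delta>) + ennreal K * ennreal \<epsilon>"
          using J by (intro add_left_mono mult_left_mono) auto
        also have "\<dots> = ennreal (8 ^ CARD('n) * \<delta> + K * \<epsilon>)"
          using \<delta> K \<epsilon> by (simp add: ennreal_mult[symmetric] ennreal_plus[symmetric] del: ennreal_plus)
        finally show ?thesis .
      qed
      define R1 R2 where "R1 = 6 * N\<^sup>2 * (\<delta> + K * (2 * N * \<epsilon>))" and "R2 = 8 ^ CARD('n) * \<delta> + K * \<epsilon>"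
      have R: "R1 \<ge> 0" "R2 \<ge> 0" using \<delta> K N \<epsilon> by (auto simp: R1_def R2_def)
      have "R1 + R2 = M * \<delta> + K * (12 * N ^ 3 + 1) * \<epsilon>"
        by (simp add: R1_def R2_def M_def algebra_simps power2_eq_square power3_eq_cube)
      also have "M * \<delta> = 1/8" using M by (simp add: \<delta>_def)
      also have "K * (12 * N ^ 3 + 1) * \<epsilon> = 1/8"
      proof -
        have "K * (12 * N ^ 3 + 1) \<noteq> 0" using K N by (simp add: add_pos_pos less_imp_neq[symmetric])
        then show ?thesis by (simp add: \<epsilon>_def)
      qed
      finally have R12: "R1 + R2 = 1/4" by simp
      have "(\<integral>\<^sup>+w\<in>target_box. (I1 w + I2 w + (I3 w + I4 w)) \<partial>lborel) =
        ((\<integral>\<^sup>+w\<in>target_box. I1 w \<partial>lborel) + (\<integral>\<^sup>+w\<in>target_box. I2 w \<partial>lborel)) +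
        ((\<integral>\<^sup>+w\<in>target_box. I3 w \<partial>lborel) + (\<integral>\<^sup>+w\<in>target_box. I4 w \<partial>lborel))"
        by (simp add: distrib_right nn_integral_add)
      also have "\<dots> \<le> (ennreal R1 + ennreal R2) + (ennreal R2 + ennreal R1)"
        unfolding I1_def I2_def I3_def I4_def R1_def R2_def
        by (intro add_mono cone ax) (use a b i j in auto)
      also have "\<dots> = ennreal ((R1 + R2) + (R2 + R1))" using R by (simp only: ennreal_plus add_nonneg_nonneg)
      also have "(R1 + R2) + (R2 + R1) = 1/2" using R12 by simp
      finally have avg: "(\<integral>\<^sup>+w\<in>target_box. (I1 w + I2 w + (I3 w + I4 w)) \<partial>lborel) \<le> ennreal (1/2)" .
      have "\<exists>w\<in>target_box. I1 w + I2 w + (I3 w + I4 w) < 1"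
      proof (rule ccontr)
        assume "\<not> ?thesis"
        then have ge: "1 \<le> I1 w + I2 w + (I3 w + I4 w)" if "w \<in> target_box" for w using that by (auto simp: not_less)
        have "1 = (\<integral>\<^sup>+w. indicator (target_box :: (real^'n) set) w \<partial>lborel)" by (simp add: emeasure_target_box)
        also have "\<dots> \<le> (\<integral>\<^sup>+w\<in>target_box. (I1 w + I2 w + (I3 w + I4 w)) \<partial>lborel)"
          using ge by (intro nn_integral_mono) (auto simp: indicator_def)
        also note avg
        finally have "ennreal 1 \<le> ennreal (1/2)" by (simp only: ennreal_1)
        then show False by (subst (asm) ennreal_le_iff) auto
      qed
      then obtain w where w: "w \<in> target_box" and lt: "I1 w + I2 w + (I3 w + I4 w) < 1" by blast
      define z1 where "z1 = vupd i (a $ i) w"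
      define z2 where "z2 = vupd j (b $ j) w"
      define \<gamma> where "\<gamma> = (linepath a z1 +++ linepath z1 w) +++ (linepath w z2 +++ linepath z2 b)"
      have pth: "path (linepath a z1 +++ linepath z1 w)" "path (linepath w z2 +++ linepath z2 b)" "path \<gamma>"
        unfolding \<gamma>_def by auto
      have rec: "rectifiable_curve (linepath a z1 +++ linepath z1 w)" "rectifiable_curve (linepath w z2 +++ linepath z2 b)" "rectifiable_curve \<gamma>"
        unfolding \<gamma>_def by (intro rectifiable_joinpaths rectifiable_linepath; simp)+
      have "curve_integral \<gamma> \<rho> \<le> curve_integral (linepath a z1 +++ linepath z1 w) \<rho> + curve_integral (linepath w z2 +++ linepath z2 b) \<rho>"
        unfolding \<gamma>_def by (rule curve_integral_joinpaths) (use pth rec in auto)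
      also have "\<dots> \<le> (curve_integral (linepath a z1) \<rho> + curve_integral (linepath z1 w) \<rho>) + (curve_integral (linepath w z2) \<rho> + curve_integral (linepath z2 b) \<rho>)"
        by (intro add_mono curve_integral_joinpaths) (auto simp: rectifiable_linepath)
      also have "\<dots> = I1 w + I2 w + (I3 w + I4 w)"
        unfolding I1_def I2_def I3_def I4_def z1_def z2_def
        using curve_integral_linepath_commute[OF \<rho>] by simp
      finally have small: "curve_integral \<gamma> \<rho> < 1" using lt by (rule le_less_trans)
      have w4: "infnorm w \<le> 4" using w by (simp add: infnorm_le_iff target_box_def abs_le_iff) (smt (verit))
      have cone_in: "closed_segment c (vupd k (c $ k) w) \<subseteq> cubic_ring" if c: "infnorm c = s" "\<bar>c $ k\<bar> = s" for c k
      proof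
        fix z assume z: "z \<in> closed_segment c (vupd k (c $ k) w)"
        have "infnorm (vupd k (c $ k) w) \<le> 4" using w4 c s by (auto simp: infnorm_le_iff)
        then have "closed_segment c (vupd k (c $ k) w) \<subseteq> {z. infnorm z \<le> 4}"
          using c s by (intro closed_segment_subset convex_infnorm_ball) auto
        moreover have "z $ k = c $ k" by (rule closed_segment_nth[OF z]) auto
        then have "1 \<le> infnorm z" using component_le_infnorm_cart[of z k] c s by auto
        ultimately show "z \<in> cubic_ring" using z by (auto simp: cubic_ring_def)
      qed
      have ax_in: "closed_segment (vupd k \<sigma> w) w \<subseteq> cubic_ring" if \<sigma>: "\<bar>\<sigma>\<bar> = s" for k \<sigma>
      proof
        fix z assume z: "z \<in> closed_segment (vupd k \<sigma> w) w"
        have "infnorm (vupd k \<sigma> w) \<le> 4" using w4 \<sigma> s by (auto simp: infnorm_le_iff)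
        then have "closed_segment (vupd k \<sigma> w) w \<subseteq> {z. infnorm z \<le> 4}"
          using w4 by (intro closed_segment_subset convex_infnorm_ball) auto
        moreover have "\<exists>l. l \<noteq> k"
        proof (rule ccontr)
          assume "\<not> (\<exists>l. l \<noteq> k)"
          then have "(UNIV :: 'n set) = {k}" by auto
          then have "CARD('n) = card {k}" by simp
          then show False using n by simp
        qed
        then obtain l where l: "l \<noteq> k" by blast
        then have "z $ l = w $ l" by (intro closed_segment_nth[OF z]) auto
        moreover have "3 \<le> w $ l" using w by (auto simp: target_box_def)
        ultimately show "z \<in> cubic_ring" using component_le_infnorm_cart[of z l] z by (auto simp: cubic_ring_def)
      qed
      have "path_image \<gamma> \<subseteq> cubic_ring"
        unfolding \<gamma>_def using cone_in[OF a(2) i] cone_in[OF b(2) j] ax_in[OF i, of i] ax_in[OF j, of j]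
        by (simp add: path_image_join z1_def z2_def closed_segment_commute[of w] closed_segment_commute[of _ b])
      moreover have "pathstart \<gamma> = a" "pathfinish \<gamma> = b" by (simp_all add: \<gamma>_def)
      ultimately have "\<gamma> \<in> joining_curves E F cubic_ring"
        using pth(3) a b by (auto simp: joining_curves_def path_image_def)
      then show False using ad rec(3) small by (auto simp: not_less[symmetric])
    qed
  qed
qed

text \<open>Two connected sets that leave a neighbourhood of \<open>x\<close> are joined by many curves at every
  scale, and the rings of different scales are disjoint.\<close>

lemma modulus_ge_scales:
  fixes E F D :: "(real^'n) set"
  assumes \<epsilon>: "\<forall>(\<rho> :: real^'n \<Rightarrow> ennreal) E F. \<rho> \<in> borel_measurable borel \<longrightarrow>
      (\<forall>s\<in>{1..2}. \<exists>a\<in>E. infnorm a = s) \<longrightarrow> (\<forall>s\<in>{1..2}. \<exists>b\<in>F. infnorm b = s) \<longrightarrow>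
      (\<forall>\<gamma>\<in>joining_curves E F cubic_ring. rectifiable_curve \<gamma> \<longrightarrow> 1 \<le> curve_integral \<gamma> \<rho>) \<longrightarrow>
      ennreal \<epsilon> \<le> (\<integral>\<^sup>+z\<in>cubic_ring. \<rho> z ^ CARD('n) \<partial>lborel)"
    and R: "R > 0" and D: "\<And>z. infnorm (z - x) < R \<Longrightarrow> z \<in> D"
    and E: "\<And>s. R / 5 ^ N \<le> s \<Longrightarrow> s < R \<Longrightarrow> \<exists>a\<in>E. infnorm (a - x) = s"
    and F: "\<And>s. R / 5 ^ N \<le> s \<Longrightarrow> s < R \<Longrightarrow> \<exists>b\<in>F. infnorm (b - x) = s"
  shows "ennreal (real N * \<epsilon>) \<le> modulus (joining_curves E F D)"
  unfolding modulus_def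
proof (rule INF_greatest)
  fix \<rho> :: "real^'n \<Rightarrow> ennreal" assume "\<rho> \<in> admissible (joining_curves E F D)"
  then have \<rho> [measurable]: "\<rho> \<in> borel_measurable borel"
    and ad: "\<And>\<gamma>. \<gamma> \<in> joining_curves E F D \<Longrightarrow> rectifiable_curve \<gamma> \<Longrightarrow> 1 \<le> curve_integral \<gamma> \<rho>"
    by (auto simp: admissible_def)
  \<comment> \<open>The ring of index \<open>j\<close> reaches from \<open>r j\<close> to
    \<open>4 * r j\<close>, so the ratio \<open>5\<close> keeps the rings disjoint; the exponent
    \<open>Suc j\<close> puts even the outermost one inside the radius \<open>R\<close>.\<close>
  define r where "r j = R / 5 ^ Suc j" for j
  define A where "A j = {z :: real^'n. r j \<le> infnorm (z - x) \<and> infnorm (z - x) \<le> 4 * r j}" for j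
  have r0: "r j > 0" for j using R by (simp add: r_def)
  have [measurable]: "A j \<in> sets borel" for j
  proof -
    have "closed (A j)" unfolding A_def by (intro closed_Collect_conj closed_Collect_le continuous_intros)
    then show ?thesis by simp
  qed
  have rr: "5 * r k \<le> r j" if "j < k" for j k
  proof -
    have "(5::real) ^ Suc (Suc j) \<le> 5 ^ Suc k" using that by (intro power_increasing) auto
    then have "R / 5 ^ Suc k \<le> R / 5 ^ Suc (Suc j)" using R by (intro divide_left_mono) auto
    then show ?thesis by (simp add: r_def field_simps)
  qed
  have disj: "j = k" if "z \<in> A j" "z \<in> A k" for j k z
  proof -
    have False if "j < k" "z \<in> A j" "z \<in> A k" for j k
      using rr[OF that(1)] that(2,3) r0[of k] by (auto simp: A_def)
    then show ?thesis using that by (metis nat_neq_iff)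
  qed
  have scale: "ennreal \<epsilon> \<le> (\<integral>\<^sup>+z\<in>A j. \<rho> z ^ CARD('n) \<partial>lborel)" if j: "j < N" for j
  proof -
    define \<phi> where "\<phi> z = x + r j *\<^sub>R z" for z
    have sim: "similarity (r j) \<phi>"
    proof -
      have "\<phi> ((1 / r j) *\<^sub>R (z - x)) = z" for z using r0[of j] by (simp add: \<phi>_def)
      then have "surj \<phi>" by (rule surjI)
      then show ?thesis using r0[of j]
        by (auto simp: similarity_def \<phi>_def dist_norm scaleR_diff_right[symmetric])
    qed
    have m\<phi> [measurable]: "\<phi> \<in> borel_measurable borel" by (rule similarity_measurable[OF sim])
    have inf\<phi>: "infnorm (\<phi> z - x) = r j * infnorm z" for z using r0[of j] by (simp add: \<phi>_def infnorm_mul)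
    have A\<phi>: "\<phi> z \<in> A j \<longleftrightarrow> z \<in> cubic_ring" for z
      using r0[of j] by (simp add: A_def cubic_ring_def inf\<phi>)
    \<comment> \<open>The factor \<open>r j\<close> makes the curve integrals agree and is absorbed
      by the volume factor \<open>r j ^ n\<close>: the integral of the n-th power is the same on all
      scales.\<close>
    define \<rho>' where "\<rho>' z = ennreal (r j) * \<rho> (\<phi> z)" for z
    have m\<rho>' [measurable]: "\<rho>' \<in> borel_measurable borel" unfolding \<rho>'_def by measurable
    have lev: "R / 5 ^ N \<le> r j * s \<and> r j * s < R" if "s \<in> {1..4}" for s
    proof -
      have "(5::real) ^ Suc j \<le> 5 ^ N" using j by (intro power_increasing) auto
      then have "R / 5 ^ N \<le> r j * 1" unfolding r_def using R by (simp add: divide_left_mono del: power_Suc)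
      also have "\<dots> \<le> r j * s" using that r0[of j] by (intro mult_left_mono) auto
      finally have 1: "R / 5 ^ N \<le> r j * s" .
      have "r j * s \<le> r j * 4" using that r0[of j] by (intro mult_left_mono) auto
      also have "\<dots> < R"
      proof -
        have "(5::real) ^ 1 \<le> 5 ^ Suc j" by (intro power_increasing) auto
        then have "R / 5 ^ Suc j \<le> R / 5 ^ 1" using R by (intro divide_left_mono) auto
        then show ?thesis using R by (simp add: r_def)
      qed
      finally show ?thesis using 1 by simp
    qed
    have lift: "\<exists>a\<in>\<phi> -` S. infnorm a = s" if S: "\<And>s. R / 5 ^ N \<le> s \<Longrightarrow> s < R \<Longrightarrow> \<exists>a\<in>S. infnorm (a - x) = s" and s: "s \<in> {1..2}" for S s
    proof -
      obtain a where a: "a \<in> S" "infnorm (a - x) = r j * s" using S[of "r j * s"] lev[of s] s by auto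
      obtain a' where a': "a = \<phi> a'" using sim by (metis similarity_def surj_def)
      have "infnorm a' = s" using a(2) r0[of j] unfolding a' inf\<phi> by simp
      then show ?thesis using a a' by auto
    qed
    have "ennreal \<epsilon> \<le> (\<integral>\<^sup>+z\<in>cubic_ring. \<rho>' z ^ CARD('n) \<partial>lborel)"
    proof (rule \<epsilon>[rule_format, of \<rho>' "\<phi> -` E" "\<phi> -` F"])
      fix \<gamma> assume \<gamma>: "\<gamma> \<in> joining_curves (\<phi> -` E) (\<phi> -` F) cubic_ring" "rectifiable_curve \<gamma>"
      have p: "path \<gamma>" using \<gamma> by (simp add: joining_curves_def)
      have AD: "\<phi> z \<in> D" if "z \<in> cubic_ring" for z
        using that lev[of "infnorm z"] by (intro D) (auto simp: inf\<phi> cubic_ring_def)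
      have p': "path (\<phi> \<circ> \<gamma>)"
        unfolding path_def by (rule continuous_on_compose) (use p similarity_continuous_on[OF sim] in \<open>auto simp: path_def\<close>)
      have "\<phi> \<circ> \<gamma> \<in> joining_curves E F D"
        using \<gamma> p' AD by (auto simp: joining_curves_def pathstart_def pathfinish_def)
      moreover have "rectifiable_curve (\<phi> \<circ> \<gamma>)"
        using \<gamma>(2) by (simp add: rectifiable_curve_def curve_length_similarity[OF sim] ennreal_mult_less_top)
      ultimately have "1 \<le> curve_integral (\<phi> \<circ> \<gamma>) \<rho>" by (rule ad)
      also have "\<dots> = ennreal (r j) * curve_integral \<gamma> (\<rho> \<circ> \<phi>)"
        by (rule curve_integral_similarity[OF sim \<gamma>(2) p \<rho>])
      also have "\<dots> = curve_integral \<gamma> \<rho>'"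
      proof -
        have [measurable]: "\<rho> \<circ> \<phi> \<in> borel_measurable borel" by (rule measurable_comp[OF m\<phi> \<rho>])
        show ?thesis unfolding curve_integral_eq \<rho>'_def mult.assoc
          by (subst nn_integral_cmult[symmetric])
            (use measurable_arc_length_param_indicator[OF \<gamma>(2) p, of "\<rho> \<circ> \<phi>"] in auto)
      qed
      finally show "1 \<le> curve_integral \<gamma> \<rho>'" .
    qed (use lift[OF E] lift[OF F] m\<rho>' in blast)+
    also have "\<dots> = ennreal (r j ^ CARD('n)) * (\<integral>\<^sup>+z. \<rho> (\<phi> z) ^ CARD('n) * indicator (A j) (\<phi> z) \<partial>lborel)"
    proof -
      have "\<rho>' z ^ CARD('n) * indicator cubic_ring z = ennreal (r j ^ CARD('n)) * (\<rho> (\<phi> z) ^ CARD('n) * indicator (A j) (\<phi> z))" for z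
        using r0[of j] A\<phi>[of z] by (auto simp: \<rho>'_def power_mult_distrib ennreal_power indicator_def)
      then show ?thesis by (simp add: nn_integral_cmult)
    qed
    also have "\<dots> = (\<integral>\<^sup>+z\<in>A j. \<rho> z ^ CARD('n) \<partial>lborel)"
      using nn_integral_similarity[OF sim, of "\<lambda>z. \<rho> z ^ CARD('n) * indicator (A j) z"] by simp
    finally show ?thesis .
  qed
  have "ennreal (real N * \<epsilon>) \<le> (\<Sum>j<N. ennreal \<epsilon>)"
    by (cases "\<epsilon> \<ge> 0") (auto simp: ennreal_mult ennreal_of_nat_eq_real_of_nat ennreal_neg mult_nonneg_nonpos)
  also have "\<dots> \<le> (\<Sum>j<N. \<integral>\<^sup>+z\<in>A j. \<rho> z ^ CARD('n) \<partial>lborel)" by (intro sum_mono scale) auto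
  also have "\<dots> = (\<integral>\<^sup>+z. (\<Sum>j<N. \<rho> z ^ CARD('n) * indicator (A j) z) \<partial>lborel)"
    by (subst nn_integral_sum) auto
  also have "\<dots> \<le> (\<integral>\<^sup>+z. \<rho> z ^ CARD('n) \<partial>lborel)"
  proof (rule nn_integral_mono)
    fix z
    show "(\<Sum>j<N. \<rho> z ^ CARD('n) * indicator (A j) z) \<le> \<rho> z ^ CARD('n)"
    proof (cases "\<exists>k<N. z \<in> A k")
      case True
      then obtain k where k: "k < N" "z \<in> A k" by blast
      have "(\<Sum>j<N. \<rho> z ^ CARD('n) * indicator (A j) z) = (\<Sum>j<N. if j = k then \<rho> z ^ CARD('n) else 0)"
        using k disj by (intro sum.cong) (auto simp: indicator_def)
      then show ?thesis using k by simp
    next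
      case False
      then have "(\<Sum>j<N. \<rho> z ^ CARD('n) * indicator (A j) z) = 0" by (intro sum.neutral) auto
      then show ?thesis by (simp only: zero_le)
    qed
  qed
  finally show "ennreal (real N * \<epsilon>) \<le> (\<integral>\<^sup>+z. \<rho> z ^ CARD('n) \<partial>lborel)" .
qed

text \<open>A boundary curve that starts within \<open>e\<close> of \<open>x\<close> leaves the cube
  \<open>K\<close>, so by connectedness it meets all sup-norm levels between \<open>e\<close> and
  \<open>R\<close>. These levels contain \<open>N\<close> rings, each contributing at least
  \<open>\<epsilon>\<close> to the modulus. The radius \<open>e\<close> depends on \<open>x\<close>
  and \<open>D\<close>.\<close>

lemma lambda_metric_blow_up:
  fixes D :: "(real^'n) set"
  assumes n: "CARD('n) \<ge> 2" and D: "open D" "x \<in> D"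
  shows "\<exists>e>0. \<forall>y\<in>D. dist y x < e \<longrightarrow> ennreal M \<le> lambda_metric D x y"
proof -
  obtain \<epsilon> :: real where \<epsilon>: "\<epsilon> > 0"
    "\<forall>(\<rho> :: real^'n \<Rightarrow> ennreal) E F. \<rho> \<in> borel_measurable borel \<longrightarrow>
      (\<forall>s\<in>{1..2}. \<exists>a\<in>E. infnorm a = s) \<longrightarrow> (\<forall>s\<in>{1..2}. \<exists>b\<in>F. infnorm b = s) \<longrightarrow>
      (\<forall>\<gamma>\<in>joining_curves E F cubic_ring. rectifiable_curve \<gamma> \<longrightarrow> 1 \<le> curve_integral \<gamma> \<rho>) \<longrightarrow>
      ennreal \<epsilon> \<le> (\<integral>\<^sup>+z\<in>cubic_ring. \<rho> z ^ CARD('n) \<partial>lborel)"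
    using loewner_single_scale[OF n] by (elim exE conjE)
  obtain R0 where R0: "R0 > 0" "cball x R0 \<subseteq> D" using D open_contains_cball by blast
  \<comment> \<open>The sup-norm cube of half side \<open>R\<close> fits into the Euclidean ball of
    radius \<open>R0\<close>.\<close>
  define R where "R = R0 / sqrt (real CARD('n))"
  have R: "R > 0" using R0 by (simp add: R_def)
  have nle: "norm z \<le> sqrt (real CARD('n)) * infnorm z" for z :: "real^'n" using norm_le_infnorm[of z] by simp
  define K where "K = {z. infnorm (z - x) \<le> R}"
  have K: "K \<subseteq> cball x R0"
  proof
    fix z assume "z \<in> K"
    then have "norm (z - x) \<le> sqrt (real CARD('n)) * R"
      using nle[of "z - x"] by (auto simp: K_def intro: order_trans mult_left_mono)
    then show "z \<in> cball x R0" by (simp add: R_def dist_norm norm_minus_commute)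
  qed
  have "closed K" unfolding K_def by (intro closed_Collect_le continuous_intros)
  then have cK: "compact K" using K by (meson bounded_cball bounded_subset compact_eq_bounded_closed)
  obtain N where N: "M / \<epsilon> \<le> real N" using real_arch_simple by blast
  define e where "e = R / 5 ^ N"
  have "e > 0" using R by (simp add: e_def)
  moreover have "ennreal M \<le> lambda_metric D x y" if y: "y \<in> D" "dist y x < e" for y
    unfolding lambda_metric_def
  proof (rule INF_greatest, clarify)
    fix Cx Cy assume C: "Cx \<in> boundary_curves D x" "Cy \<in> boundary_curves D y"
    have level: "\<exists>a\<in>C. infnorm (a - x) = s"
      if C: "C \<in> boundary_curves D z" and z: "infnorm (z - x) < e" and s: "e \<le> s" "s < R" for C z s
    proof -
      note pr = boundary_curve_props[OF D(1) C]
      obtain w where w: "w \<in> C" "w \<notin> K" using pr(4)[OF cK] K R0 by blast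
      have "connected ((\<lambda>a. infnorm (a - x)) ` C)"
        by (intro connected_continuous_image pr continuous_intros)
      moreover have "infnorm (z - x) \<in> (\<lambda>a. infnorm (a - x)) ` C" "infnorm (w - x) \<in> (\<lambda>a. infnorm (a - x)) ` C"
        using pr(2) w by auto
      moreover have "infnorm (z - x) \<le> s" "s \<le> infnorm (w - x)" using z s w by (auto simp: K_def)
      ultimately have "s \<in> (\<lambda>a. infnorm (a - x)) ` C" by (rule connectedD_interval)
      then show ?thesis by auto
    qed
    have "infnorm (y - x) < e" using infnorm_le_norm[of "y - x"] y by (simp add: dist_norm)
    have "ennreal M \<le> ennreal (real N * \<epsilon>)" using N \<epsilon>(1) by (intro ennreal_leI) (simp add: field_simps)
    also have "\<dots> \<le> modulus (joining_curves Cx Cy D)"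
    proof (rule modulus_ge_scales[OF \<epsilon>(2) R])
      show "z \<in> D" if "infnorm (z - x) < R" for z 
      proof -
        have "z \<in> K" using that by (simp add: K_def)
        then show ?thesis using K R0(2) by blast
      qed
      show "\<exists>a\<in>Cx. infnorm (a - x) = s" if "R / 5 ^ N \<le> s" "s < R" for s
        by (rule level[OF C(1)]) (use that \<open>e > 0\<close> in \<open>auto simp: e_def infnorm_0\<close>)
      show "\<exists>a\<in>Cy. infnorm (a - x) = s" if "R / 5 ^ N \<le> s" "s < R" for s
        by (rule level[OF C(2)]) (use that \<open>infnorm (y - x) < e\<close> in \<open>auto simp: e_def\<close>)
    qed
    finally show "ennreal M \<le> modulus (joining_curves Cx Cy D)" .
  qed
  ultimately show ?thesis by blast
qed

section \<open>Reflections and the invariant measure of punctured space\<close>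

definition reflect :: "'a::euclidean_space \<Rightarrow> 'a \<Rightarrow> 'a" where
  "reflect v x = x - (2 * (v \<bullet> x) / (v \<bullet> v)) *\<^sub>R v"

lemma reflect_involution [simp]: "reflect v (reflect v x) = x"
  by (cases "v = 0") (auto simp: reflect_def inner_diff_right algebra_simps)

lemma orthogonal_reflect: "orthogonal_transformation (reflect v)"
proof -
  have "linear (reflect v)"
    by (rule linearI) (auto simp: reflect_def inner_add_right algebra_simps add_divide_distrib)
  moreover have "reflect v x \<bullet> reflect v y = x \<bullet> y" for x y
  proof (cases "v = 0")
    case False
    then show ?thesis
      by (simp add: reflect_def inner_diff_left inner_diff_right inner_commute field_simps)
  qed (simp add: reflect_def)
  ultimately show ?thesis by (simp add: orthogonal_transformation_def)
qed

text \<open>For \<open>a = b\<close> the reflection in the zero vector is the identity.\<close>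

lemma reflect_swap:
  assumes "norm a = norm b"
  shows "reflect (a - b) a = b" "reflect (a - b) b = a"
proof -
  have ab: "a \<bullet> a = b \<bullet> b" using assms by (simp add: dot_square_norm)
  show *: "reflect (a - b) a = b"
  proof (cases "a = b")
    case False
    have "(a - b) \<bullet> (a - b) = 2 * ((a - b) \<bullet> a)" using ab by (simp add: inner_diff_left inner_diff_right inner_commute)
    moreover have "(a - b) \<bullet> (a - b) \<noteq> 0" using False by simp
    ultimately show ?thesis by (simp add: reflect_def)
  qed (simp add: reflect_def)
  show "reflect (a - b) b = a" using reflect_involution[of "a - b" a] * by simp
qed

lemma reflect_orthogonal: "v \<bullet> x = 0 \<Longrightarrow> reflect v x = x"
  by (simp add: reflect_def)

lemma similarity_scaled_orthogonal:
  fixes A :: "'a::euclidean_space \<Rightarrow> 'a"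
  assumes "c > 0" "orthogonal_transformation A"
  shows "similarity c (\<lambda>x. c *\<^sub>R A x)"
proof -
  have "surj (\<lambda>x. c *\<^sub>R A x)"
  proof (rule surjI)
    fix y show "c *\<^sub>R A (inv A ((1 / c) *\<^sub>R y)) = y"
      using assms orthogonal_transformation_surj surj_f_inv_f by fastforce
  qed
  moreover have "dist (c *\<^sub>R A x) (c *\<^sub>R A y) = c * dist x y" for x y
  proof -
    have "c *\<^sub>R A x - c *\<^sub>R A y = c *\<^sub>R A (x - y)"
      by (simp add: linear_diff[OF orthogonal_transformation_linear[OF assms(2)]] scaleR_diff_right)
    then show ?thesis using assms by (simp add: dist_norm orthogonal_transformation_norm)
  qed
  ultimately show ?thesis using assms by (simp add: similarity_def)
qed

text \<open>Scalings and orthogonal maps act transitively on punctured space, a single reflection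
  providing the orthogonal part; quantities invariant under them are therefore constant.\<close>

lemma exists_scaled_orthogonal:
  fixes x y :: "'a::euclidean_space"
  assumes "x \<noteq> 0" "y \<noteq> 0"
  obtains c A where "c > 0" "orthogonal_transformation A" "c *\<^sub>R A x = y"
proof -
  define c where "c = norm y / norm x"
  have "norm x = norm ((1 / c) *\<^sub>R y)" using assms by (simp add: c_def)
  then have "reflect (x - (1 / c) *\<^sub>R y) x = (1 / c) *\<^sub>R y" by (rule reflect_swap)
  then have "c *\<^sub>R reflect (x - (1 / c) *\<^sub>R y) x = y" using assms by (simp add: c_def)
  moreover have "c > 0" using assms by (simp add: c_def)
  ultimately show thesis using that orthogonal_reflect by blast
qed

text \<open>In the coordinates \<open>ln (norm x)\<close> and \<open>x / norm x\<close> this is the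
  product of length and surface measure on a cylinder, whence its invariance under scalings and
  orthogonal maps. At \<open>0\<close> the quotient is \<open>0\<close> by convention.\<close>

definition cyl_measure :: "'a::euclidean_space measure" where
  "cyl_measure = density lborel (\<lambda>x. ennreal (1 / norm x ^ DIM('a)))"

lemma sets_cyl_measure [measurable_cong, simp]: "sets cyl_measure = sets borel"
  by (simp add: cyl_measure_def)

lemma space_cyl_measure [simp]: "space cyl_measure = UNIV"
  by (simp add: cyl_measure_def)

lemma distr_cyl_measure_similarity:
  fixes \<phi> :: "'a::euclidean_space \<Rightarrow> 'a"
  assumes s: "similarity c \<phi>" and 0: "\<phi> 0 = 0"
  shows "distr cyl_measure borel \<phi> = (cyl_measure :: 'a measure)"
proof (rule measure_eqI)
  note [measurable] = similarity_measurable[OF s]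
  have c: "c > 0" using s by (simp add: similarity_def)
  have nphi: "norm (\<phi> x) = c * norm x" for x
    using s 0 unfolding similarity_def by (metis dist_0_norm dist_commute)
  fix B assume "B \<in> sets (distr cyl_measure borel \<phi>)"
  then have B [measurable]: "B \<in> sets borel" by simp
  have pre: "\<phi> -` B \<in> sets borel" using measurable_sets[OF similarity_measurable[OF s] B] by simp
  have "emeasure cyl_measure B = (\<integral>\<^sup>+x. ennreal (1 / norm x ^ DIM('a)) * indicator B x \<partial>lborel)"
    unfolding cyl_measure_def by (subst emeasure_density) auto
  also have "\<dots> = ennreal (c ^ DIM('a)) * (\<integral>\<^sup>+x. ennreal (1 / norm (\<phi> x) ^ DIM('a)) * indicator B (\<phi> x) \<partial>lborel)"
    by (rule nn_integral_similarity[OF s]) measurable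
  also have "\<dots> = (\<integral>\<^sup>+x. ennreal (c ^ DIM('a)) * (ennreal (1 / norm (\<phi> x) ^ DIM('a)) * indicator B (\<phi> x)) \<partial>lborel)"
    by (rule nn_integral_cmult[symmetric]) measurable
  also have "\<dots> = (\<integral>\<^sup>+x. ennreal (1 / norm x ^ DIM('a)) * indicator (\<phi> -` B) x \<partial>lborel)"
  proof (rule nn_integral_cong)
    fix x
    have "ennreal (c ^ DIM('a)) * ennreal (1 / norm (\<phi> x) ^ DIM('a)) = ennreal (1 / norm x ^ DIM('a))"
      using c by (simp add: nphi ennreal_mult[symmetric] power_mult_distrib)
    then show "ennreal (c ^ DIM('a)) * (ennreal (1 / norm (\<phi> x) ^ DIM('a)) * indicator B (\<phi> x)) =
       ennreal (1 / norm x ^ DIM('a)) * indicator (\<phi> -` B) x"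
      by (simp add: mult.assoc[symmetric] indicator_def)
  qed
  also have "\<dots> = emeasure cyl_measure (\<phi> -` B)"
    unfolding cyl_measure_def using pre by (subst emeasure_density) auto
  finally show "emeasure (distr cyl_measure borel \<phi>) B = emeasure cyl_measure B"
    by (subst emeasure_distr) auto
qed simp

lemma emeasure_cyl_measure_zero: "emeasure cyl_measure {0} = 0"
  unfolding cyl_measure_def by (subst emeasure_density) (auto simp: nn_integral_0_iff_AE indicator_def intro!: AE_I2)

lemma emeasure_cyl_measure_finite:
  fixes B :: "'a::euclidean_space set"
  assumes "B \<in> sets borel" "0 < r" "B \<subseteq> cball 0 R - ball 0 r"
  shows "emeasure cyl_measure B < \<infinity>"
proof -
  have "emeasure cyl_measure B = (\<integral>\<^sup>+x. ennreal (1 / norm x ^ DIM('a)) * indicator B x \<partial>lborel)"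
    unfolding cyl_measure_def using assms(1) by (subst emeasure_density) auto
  also have "\<dots> \<le> (\<integral>\<^sup>+x. ennreal (1 / r ^ DIM('a)) * indicator (cball (0::'a) R) x \<partial>lborel)"
  proof (rule nn_integral_mono)
    fix x :: 'a
    have "1 / norm x ^ DIM('a) \<le> 1 / r ^ DIM('a)" if "x \<in> B"
    proof -
      have "r \<le> norm x" using that assms(3) by force
      moreover have "0 < norm x" using calculation assms(2) by linarith
      ultimately show ?thesis
        using assms(2) zero_less_power[OF \<open>0 < norm x\<close>, of "DIM('a)"] by (intro divide_left_mono power_mono mult_pos_pos) auto
    qed
    then show "ennreal (1 / norm x ^ DIM('a)) * indicator B x \<le> ennreal (1 / r ^ DIM('a)) * indicator (cball 0 R) x"
      using assms(3) by (cases "x \<in> B") (auto simp: indicator_def intro!: ennreal_leI)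
  qed
  also have "\<dots> = ennreal (1 / r ^ DIM('a)) * emeasure lborel (cball (0::'a) R)"
    by (subst nn_integral_cmult) (auto intro!: borel_measurable_indicator)
  also have "\<dots> < \<infinity>"
    using emeasure_lborel_cball_finite[of "0::'a" R] by (simp add: ennreal_mult_less_top)
  finally show ?thesis .
qed

lemma emeasure_cyl_measure_pos:
  fixes B :: "'a::euclidean_space set"
  assumes "open B" "x \<in> B" "x \<noteq> 0"
  shows "0 < emeasure cyl_measure B"
proof -
  have "emeasure cyl_measure B \<noteq> 0"
  proof
    assume "emeasure cyl_measure B = 0"
    then have "(\<integral>\<^sup>+x. ennreal (1 / norm x ^ DIM('a)) * indicator B x \<partial>lborel) = 0"
      unfolding cyl_measure_def using assms(1) by (subst (asm) emeasure_density) auto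
    then have "AE x in lborel. ennreal (1 / norm x ^ DIM('a)) * indicator B x = 0"
      using assms(1) by (subst (asm) nn_integral_0_iff_AE) auto
    then have "AE x in lborel. x \<notin> B - {0}"
    proof eventually_elim
      case (elim x)
      show ?case
      proof
        assume x: "x \<in> B - {0}"
        then have "0 < 1 / norm x ^ DIM('a)" by simp
        then show False using elim x by (simp add: ennreal_eq_0_iff)
      qed
    qed
    then have "emeasure lborel (B - {0}) = 0"
    proof -
      have "B \<inter> {x. x \<noteq> 0} = B - {0}" by auto
      then show ?thesis
        using \<open>AE x in lborel. x \<notin> B - {0}\<close> assms(1) by (subst (asm) AE_iff_measurable[OF _ refl]) (auto simp: Collect_conj_eq)
    qed
    moreover have "open (B - {0})" using assms by auto
    then obtain r where r: "r > 0" "ball x r \<subseteq> B - {0}" using assms by (meson DiffI open_contains_ball singletonD)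
    ultimately have "emeasure lborel (ball x r) = 0"
      using assms(1) emeasure_mono[OF r(2), of lborel] by simp
    moreover have "0 < unit_ball_vol (real DIM('a)) * r ^ DIM('a)" using r(1) by (intro mult_pos_pos) auto
    ultimately show False using r(1) by (simp add: emeasure_ball ennreal_eq_0_iff del: mult_pos_pos zero_less_mult_iff)
  qed
  then show ?thesis by (simp add: zero_less_iff_neq_zero)
qed

lemma sigma_finite_cyl_measure: "sigma_finite_measure (cyl_measure :: 'a::euclidean_space measure)"
  unfolding cyl_measure_def by (subst sigma_finite_measure.sigma_finite_iff_density_finite[OF lborel.sigma_finite_measure_axioms]) auto

section \<open>Chains\<close>

text \<open>Distances are taken relative to \<open>norm x\<close>, which makes the relation
  invariant under scalings and orthogonal maps; it is not symmetric.\<close>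

definition near :: "real \<Rightarrow> ('a::euclidean_space \<times> 'a) set" where
  "near \<zeta> = {(x, y). x \<noteq> 0 \<and> y \<noteq> 0 \<and> dist x y < \<zeta> * norm x}"

text \<open>The angle between \<open>u\<close> and \<open>v\<close> is at most a right one, so the
  chord stays at distance at least \<open>norm u / 2\<close> from \<open>0\<close>; its
  \<open>N\<close> equal pieces have length at most \<open>2 * norm u / N\<close>, less than
  \<open>\<zeta>\<close> times the norm of their starting points.\<close>

lemma near_chain_segment:
  fixes u v :: "'a::euclidean_space"
  assumes "\<zeta> > 0" "norm u = norm v" "u \<noteq> 0" "0 \<le> u \<bullet> v" "real N * \<zeta> > 4"
  shows "(u, v) \<in> near \<zeta> ^^ N"
proof -
  have N: "N > 0" using assms(5) by (cases N) auto
  define p where "p i = u + (real i / real N) *\<^sub>R (v - u)" for i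
  have big: "norm u \<le> 2 * norm (p i)" if "i \<le> N" for i
  proof -
    define t where "t = real i / real N"
    have t: "0 \<le> t" "t \<le> 1" using that N by (auto simp: t_def)
    have pe: "p i = (1 - t) *\<^sub>R u + t *\<^sub>R v" by (simp add: p_def t_def algebra_simps)
    have "(norm (p i))\<^sup>2 = ((1 - t)\<^sup>2 + t\<^sup>2) * (norm u)\<^sup>2 + 2 * t * (1 - t) * (u \<bullet> v)"
    proof -
      have "p i \<bullet> p i = (1 - t)\<^sup>2 * (u \<bullet> u) + t\<^sup>2 * (v \<bullet> v) + 2 * t * (1 - t) * (u \<bullet> v)"
        by (simp add: pe inner_add_left inner_add_right inner_commute power2_eq_square algebra_simps)
      then show ?thesis using assms(2) by (simp add: dot_square_norm algebra_simps)
    qed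
    also have "\<dots> \<ge> (1/4) * (norm u)\<^sup>2"
    proof -
      have "(1 - t)\<^sup>2 + t\<^sup>2 = 1/2 + 2 * (t - 1/2)\<^sup>2" by (simp add: power2_eq_square algebra_simps)
      then have "(1 - t)\<^sup>2 + t\<^sup>2 \<ge> 1/4" by simp
      then have "((1 - t)\<^sup>2 + t\<^sup>2) * (norm u)\<^sup>2 \<ge> (1/4) * (norm u)\<^sup>2" by (intro mult_right_mono) auto
      moreover have "2 * t * (1 - t) * (u \<bullet> v) \<ge> 0" using t assms(4) by (intro mult_nonneg_nonneg) auto
      ultimately show ?thesis by linarith
    qed
    finally have "(norm u)\<^sup>2 \<le> (2 * norm (p i))\<^sup>2" by (simp add: power_mult_distrib)
    then show ?thesis by (rule power2_le_imp_le) simp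
  qed
  have "(p i, p (Suc i)) \<in> near \<zeta>" if i: "Suc i \<le> N" for i
  proof -
    have "p (Suc i) - p i = (1 / real N) *\<^sub>R (v - u)"
      by (simp add: p_def scaleR_left_diff_distrib[symmetric] diff_divide_distrib[symmetric])
    moreover have "dist (p i) (p (Suc i)) = norm (p (Suc i) - p i)" by (simp add: dist_norm norm_minus_commute)
    ultimately have "dist (p i) (p (Suc i)) = norm (v - u) / real N" by simp
    also have "\<dots> \<le> 2 * norm u / real N"
      using norm_triangle_ineq4[of v u] assms(2) by (simp add: divide_right_mono)
    also have "\<dots> \<le> 4 * norm (p i) / real N" using big[of i] i by (simp add: divide_right_mono)
    also have "\<dots> < \<zeta> * norm (p i)"
    proof -
      have "norm (p i) > 0" using big[of i] i assms(3) by (metis Suc_leD mult_zero_right norm_le_zero_iff norm_eq_zero not_less zero_less_norm_iff)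
      then show ?thesis using assms(5) N by (simp add: field_simps)
    qed
    finally show ?thesis
      using big[of i] big[of "Suc i"] i assms(3) by (auto simp: near_def)
  qed
  then have "(p 0, p m) \<in> near \<zeta> ^^ m" if "m \<le> N" for m
    using that by (induction m) (auto intro: relcompI)
  moreover have "p 0 = u" "p N = v" using N by (auto simp: p_def)
  ultimately show ?thesis by (metis order_refl)
qed

lemma exists_orthogonal_unit:
  fixes u :: "'a::euclidean_space"
  assumes "2 \<le> DIM('a)"
  obtains e where "norm e = 1" "u \<bullet> e = 0"
proof -
  obtain w where w: "w \<noteq> 0" "orthogonal u w" using orthogonal_to_vector_exists[OF assms] by (metis orthogonal_commute)
  show thesis
    by (rule that[of "w /\<^sub>R norm w"]) (use w in \<open>auto simp: orthogonal_def\<close>)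
qed

text \<open>The chain passes through a vector at an angle of at most \<open>pi / 2\<close> to both
  \<open>u\<close> and \<open>v\<close>: the bisector or, for antipodal points, an orthogonal
  vector. What matters later is that the number of steps does not depend on the radius.\<close>

lemma near_chain_sphere:
  assumes d: "2 \<le> DIM('a::euclidean_space)" and \<zeta>: "\<zeta> > 0"
  shows "\<exists>N. \<forall>u v :: 'a. norm u = norm v \<longrightarrow> u \<noteq> 0 \<longrightarrow> (u, v) \<in> near \<zeta> ^^ N"
proof -
  obtain N where N: "real N * \<zeta> > 4" using ex_less_of_nat_mult[OF \<zeta>] by blast
  have "(u, v) \<in> near \<zeta> ^^ (N + N)" if uv: "norm u = norm v" "u \<noteq> 0" for u v :: 'a
  proof -
    have "\<exists>w. norm w = norm u \<and> 0 \<le> u \<bullet> w \<and> 0 \<le> w \<bullet> v"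
    proof (cases "u + v = 0")
      case True
      obtain e where e: "norm e = 1" "u \<bullet> e = 0" using exists_orthogonal_unit[OF d] by blast
      then show ?thesis using True
        by (intro exI[of _ "norm u *\<^sub>R e"]) (auto simp: eq_neg_iff_add_eq_0[symmetric] inner_commute)
    next
      case False
      have "0 \<le> u \<bullet> (u + v)"
      proof -
        have "\<bar>u \<bullet> v\<bar> \<le> norm u * norm v" by (rule Cauchy_Schwarz_ineq2)
        then show ?thesis using uv by (simp add: inner_add_right dot_square_norm power2_eq_square abs_le_iff)
      qed
      moreover have "0 \<le> (u + v) \<bullet> v"
      proof -
        have "\<bar>u \<bullet> v\<bar> \<le> norm u * norm v" by (rule Cauchy_Schwarz_ineq2)
        then show ?thesis using uv by (simp add: inner_add_left dot_square_norm power2_eq_square abs_le_iff)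
      qed
      ultimately show ?thesis using False
        by (intro exI[of _ "(norm u / norm (u + v)) *\<^sub>R (u + v)"]) (auto simp: divide_nonneg_pos)
    qed
    then obtain w where w: "norm w = norm u" "0 \<le> u \<bullet> w" "0 \<le> w \<bullet> v" by blast
    have "(u, w) \<in> near \<zeta> ^^ N" by (rule near_chain_segment) (use w uv \<zeta> N in auto)
    moreover have "(w, v) \<in> near \<zeta> ^^ N" by (rule near_chain_segment) (use w uv \<zeta> N in auto)
    ultimately show ?thesis unfolding relpow_add by (rule relcompI)
  qed
  then show ?thesis by blast
qed

section \<open>Rigidity of invariant neighbourhood systems on punctured space\<close>

text \<open>In the application \<open>E k\<close> is the interior of the set of pairs whose modulus metric exceeds a
  bound that tends to infinity with \<open>k\<close>.\<close>

locale invariant_gauge =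
  fixes E :: "nat \<Rightarrow> ('a::euclidean_space \<times> 'a) set"
  assumes dim: "2 \<le> DIM('a)"
    and open_E: "open (E k)"
    and E_nonzero: "(x, y) \<in> E k \<Longrightarrow> x \<noteq> 0"
    and E_sym: "(x, y) \<in> E k \<Longrightarrow> (y, x) \<in> E k"
    and E_similarity: "c > 0 \<Longrightarrow> orthogonal_transformation A \<Longrightarrow> (x, y) \<in> E k \<Longrightarrow> (c *\<^sub>R A x, c *\<^sub>R A y) \<in> E k"
    and E_near: "\<exists>\<zeta>>0. near \<zeta> \<subseteq> E k"
    and E_half: "(x, y) \<in> E k \<Longrightarrow> dist x y < norm x / 2"
    and E_shrink: "\<eta> > 0 \<Longrightarrow> \<forall>\<^sub>F k in sequentially. E k \<subseteq> near \<eta>"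
begin

lemma E_nonzero2: "(x, y) \<in> E k \<Longrightarrow> y \<noteq> 0"
  using E_sym E_nonzero by blast

lemma open_slice: "open (E k `` {x})"
proof -
  have "E k `` {x} = (\<lambda>y. (x,y)) -` E k" by auto
  then show ?thesis using open_vimage[OF open_E, of "\<lambda>y. (x,y)" k] by (simp add: continuous_on_Pair)
qed

lemma slice_sets [measurable]: "E k `` {x} \<in> sets borel"
  using open_slice by auto

lemma E_similarity_iff:
  assumes "c > 0" "orthogonal_transformation A"
  shows "(c *\<^sub>R A x, c *\<^sub>R A y) \<in> E k \<longleftrightarrow> (x, y) \<in> E k"
proof
  assume "(c *\<^sub>R A x, c *\<^sub>R A y) \<in> E k"
  then have "((1 / c) *\<^sub>R inv A (c *\<^sub>R A x), (1 / c) *\<^sub>R inv A (c *\<^sub>R A y)) \<in> E k"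
    using assms by (intro E_similarity[of "1 / c" "inv A"] orthogonal_transformation_inv) auto
  moreover have "inv A (c *\<^sub>R A z) = c *\<^sub>R z" for z
    using assms by (metis inv_f_f orthogonal_transformation_inj orthogonal_transformation_scaleR)
  ultimately show "(x, y) \<in> E k" using assms by simp
qed (rule E_similarity[OF assms])

lemma E_bounds:
  assumes "(x, y) \<in> E k"
  shows "norm x / 2 < norm y" "norm y < 3 / 2 * norm x"
proof -
  have "norm (y - x) < norm x / 2" using E_half[OF assms] by (simp add: dist_norm norm_minus_commute)
  moreover have "norm x - norm (y - x) \<le> norm y" using norm_triangle_ineq2[of x "x - y"] by (simp add: norm_minus_commute)
  moreover have "norm y \<le> norm x + norm (y - x)" using norm_triangle_ineq[of x "y - x"] by simp
  ultimately show "norm x / 2 < norm y" "norm y < 3 / 2 * norm x" by auto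
qed

lemma slice_finite: 
  assumes "x \<noteq> 0" shows "emeasure cyl_measure (E k `` {x}) < \<infinity>"
proof (rule emeasure_cyl_measure_finite[where r="norm x / 2" and R="3 / 2 * norm x"])
  show "E k `` {x} \<subseteq> cball 0 (3 / 2 * norm x) - ball 0 (norm x / 2)"
    using E_bounds by (fastforce simp: less_imp_le not_less)
qed (use assms in auto)

lemma E_diag: "x \<noteq> 0 \<Longrightarrow> (x, x) \<in> E k"
  using E_near[of k] by (auto simp: near_def)

lemma slice_pos: "x \<noteq> 0 \<Longrightarrow> 0 < emeasure cyl_measure (E k `` {x})"
  by (rule emeasure_cyl_measure_pos[OF open_slice, of x]) (auto simp: E_diag)

lemma similarity_measurable_scaled:
  fixes A :: "'a \<Rightarrow> 'a"
  shows "c > 0 \<Longrightarrow> orthogonal_transformation A \<Longrightarrow> (\<lambda>x::'a. c *\<^sub>R A x) \<in> borel_measurable borel"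
  by (rule similarity_measurable[OF similarity_scaled_orthogonal])

lemma distr_scaled:
  fixes A :: "'a \<Rightarrow> 'a"
  assumes "c > 0" "orthogonal_transformation A"
  shows "distr cyl_measure borel (\<lambda>x::'a. c *\<^sub>R A x) = cyl_measure"
  by (rule distr_cyl_measure_similarity[OF similarity_scaled_orthogonal[OF assms]])
    (simp add: linear_0[OF orthogonal_transformation_linear[OF assms(2)]])

lemma slice_measure_const:
  assumes "x \<noteq> 0" "y \<noteq> 0"
  shows "emeasure cyl_measure (E k `` {x}) = emeasure cyl_measure (E k `` {y})"
proof -
  obtain c and A :: "'a \<Rightarrow> 'a" where cA: "c > 0" "orthogonal_transformation A" "c *\<^sub>R A x = y"
    using exists_scaled_orthogonal[OF assms] by metis
  have "emeasure cyl_measure (E k `` {y}) = emeasure (distr cyl_measure borel (\<lambda>x::'a. c *\<^sub>R A x)) (E k `` {y})"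
    by (simp add: distr_scaled[OF cA(1,2)])
  also have "\<dots> = emeasure cyl_measure ((\<lambda>x. c *\<^sub>R A x) -` (E k `` {y}))"
    using similarity_measurable_scaled[OF cA(1,2)] by (subst emeasure_distr) auto
  also have "(\<lambda>x. c *\<^sub>R A x) -` (E k `` {y}) = E k `` {x}"
    using E_similarity_iff[OF cA(1,2), of x _ k] cA(3) by auto
  finally show ?thesis by simp
qed

end

text \<open>The origin is adjoined as a fixed point to make \<open>F\<close> and \<open>G\<close>
  total and mutually inverse. Continuity is required only away from it, since inversions are among
  the intended maps. The assumptions are symmetric, so everything proved for \<open>F\<close> holds
  for \<open>G\<close>.\<close>

locale gauge_isometry = invariant_gauge E for E :: "nat \<Rightarrow> ('a::euclidean_space \<times> 'a) set" +
  fixes F G :: "'a \<Rightarrow> 'a"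
  assumes F0: "F 0 = 0" and G0: "G 0 = 0" and GF: "G (F x) = x" and FG: "F (G x) = x"
    and contF: "continuous_on (- {0}) F" and contG: "continuous_on (- {0}) G"
    and preserves: "(F x, F y) \<in> E k \<longleftrightarrow> (x, y) \<in> E k"
begin

lemma inverse_isometry: "gauge_isometry E G F"
proof unfold_locales
  show "(G x, G y) \<in> E k \<longleftrightarrow> (x, y) \<in> E k" for x y k using preserves[of "G x" "G y" k] by (simp add: FG)
qed (simp_all add: F0 G0 GF FG contF contG)

lemma F_nonzero: "x \<noteq> 0 \<Longrightarrow> F x \<noteq> 0"
  using GF G0 by metis

lemma measurable_F [measurable]: "F \<in> borel_measurable borel"
proof -
  have "(\<lambda>x. indicator (- {0}) x *\<^sub>R F x) \<in> borel_measurable borel"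
    by (rule borel_measurable_continuous_on_indicator[OF _ contF]) auto
  moreover have "(\<lambda>x. indicator (- {0}) x *\<^sub>R F x) = F" using F0 by (auto simp: indicator_def)
  ultimately show ?thesis by simp
qed

lemma vimage_slice: "F -` (E k `` {y}) = E k `` {G y}"
  using preserves[of "G y" _ k] FG by auto

text \<open>The preimage under \<open>F\<close> of the slice at \<open>x\<close> is the slice at
  \<open>G x\<close>, so \<open>cyl_measure\<close> and its image both give all slices of one level
  the same mass, and the comparison of uniformly distributed measures applies in both
  directions.\<close>

lemma distr_F: "distr cyl_measure borel F = cyl_measure"
proof -
  define \<nu> where "\<nu> = distr (cyl_measure :: 'a measure) borel F"
  define e :: 'a where "e = (SOME b. b \<in> Basis)"
  have e: "e \<noteq> 0" using some_in_eq[of "Basis :: 'a set"] nonempty_Basis nonzero_Basis unfolding e_def by metis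
  define m where "m k = emeasure cyl_measure (E k `` {e})" for k
  have m: "0 < m k" "m k < \<infinity>" for k using slice_pos[OF e] slice_finite[OF e] by (auto simp: m_def)
  have \<mu>: "emeasure cyl_measure (E k `` {x}) = m k" if "x \<in> - {0}" for k x
    unfolding m_def using that e by (intro slice_measure_const) auto
  have G_nz: "G x \<noteq> 0" if "x \<noteq> 0" for x using that FG F0 by metis
  have \<nu>: "emeasure \<nu> (E k `` {x}) = m k" if "x \<in> - {0}" for k x
    unfolding \<nu>_def using that \<mu>[of "G x" k] G_nz by (subst emeasure_distr) (auto simp: vimage_slice)
  have sets\<nu>: "sets \<nu> = sets borel" by (simp add: \<nu>_def)
  have shrink: "\<forall>\<^sub>F k in sequentially. E k `` {x} \<subseteq> V" if V: "x \<in> - {0}" "open V" "x \<in> V" for x V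
  proof -
    obtain r where r: "r > 0" "ball x r \<subseteq> V" using openE[OF V(2,3)] by blast
    have "\<forall>\<^sub>F k in sequentially. E k \<subseteq> near (r / norm x)" by (rule E_shrink) (use r V in auto)
    then show ?thesis
    proof eventually_elim
      case (elim k)
      have "E k `` {x} \<subseteq> ball x r" using elim V(1) by (auto simp: near_def)
      then show ?case using r by blast
    qed
  qed
  \<comment> \<open>Rings of finite mass that exhaust punctured space. Neighbourhoods of
    \<open>0\<close> have infinite mass, so \<open>{0}\<close> is added as a separate set, both to
    the covers and to the generator of the Borel sets.\<close>
  define An where "An i = ball (0::'a) (real (Suc i)) - cball 0 (1 / real (Suc i))" for i :: nat
  have An_open: "open (An i :: 'a set)" for i unfolding An_def by auto
  have An_fin: "emeasure cyl_measure (An i :: 'a set) < \<infinity>" for i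
    by (rule emeasure_cyl_measure_finite[where r="1 / real (Suc i)" and R="real (Suc i)"])
      (auto simp: An_def)
  have An_cover: "\<exists>i. x \<in> An i" if "x \<noteq> 0" for x :: 'a
  proof -
    obtain i where i: "norm x + 1 / norm x < real i" using reals_Archimedean2 by blast
    have pos: "0 < norm x" "0 < 1 / norm x" using that by auto
    then have "norm x < real (Suc i)" "1 / norm x < real (Suc i)" unfolding of_nat_Suc using i by linarith+
    then have "x \<in> An i" using pos by (auto simp: An_def field_simps)
    then show ?thesis ..
  qed
  have sf\<nu>: "sigma_finite_measure \<nu>"
  proof (rule sigma_finite_measure.intro, intro exI conjI ballI)
    \<comment> \<open>For the image measure the preimages of the rings under \<open>G\<close> are
      used: pulled back by \<open>F\<close> they lie in the rings again.\<close>
    let ?A = "insert {0} (range (\<lambda>i. G -` An i - {0}))"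
    have Gm: "G \<in> borel_measurable borel"
      by (rule gauge_isometry.measurable_F[OF inverse_isometry])
    have GAn: "G -` An i \<in> sets borel" for i
      using measurable_sets[OF Gm, of "An i"] An_open by simp
    show "countable ?A" by simp
    show "?A \<subseteq> sets \<nu>" using GAn by (auto simp: sets\<nu>)
    show "\<Union> ?A = space \<nu>"
    proof -
      have "x \<in> \<Union> ?A" for x using An_cover[of "G x"] G_nz[of x] by (cases "x = 0") auto
      then show ?thesis by (auto simp: \<nu>_def)
    qed
    fix B assume "B \<in> ?A"
    then consider "B = {0}" | i where "B = G -` An i - {0}" by auto
    then show "emeasure \<nu> B \<noteq> \<infinity>"
    proof cases
      case 1
      have "F -` {0} = {0}" using F0 F_nonzero by auto
      then show ?thesis unfolding 1 \<nu>_def by (subst emeasure_distr) (auto simp: emeasure_cyl_measure_zero)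
    next
      case 2
      have "F -` B \<subseteq> An i" unfolding 2 using GF by auto
      then have "emeasure \<nu> B \<le> emeasure cyl_measure (An i :: 'a set)"
        unfolding \<nu>_def using GAn An_open by (subst emeasure_distr) (auto simp: 2 intro!: emeasure_mono)
      then show ?thesis using An_fin[of i] by (auto simp: top_unique)
    qed
  qed
  have opeq: "emeasure cyl_measure U = emeasure \<nu> U" if U: "open U" for U
  proof -
    have op: "open (U - {0})" "U - {0} \<subseteq> - {0}" using U by auto
    have "emeasure cyl_measure (U - {0}) = emeasure \<nu> (U - {0})"
    proof (rule antisym)
      show "emeasure \<nu> (U - {0}) \<le> emeasure cyl_measure (U - {0})"
        by (rule uniformly_distributed_open_le[where X="- {0}" and m=m and E=E,
            OF sets_cyl_measure sets\<nu> sigma_finite_cyl_measure sf\<nu> open_E E_sym m \<mu> \<nu> shrink op])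
      show "emeasure cyl_measure (U - {0}) \<le> emeasure \<nu> (U - {0})"
        by (rule uniformly_distributed_open_le[where X="- {0}" and m=m and E=E,
            OF sets\<nu> sets_cyl_measure sf\<nu> sigma_finite_cyl_measure open_E E_sym m \<nu> \<mu> shrink op])
    qed
    moreover have z: "emeasure \<nu> {0} = 0"
    proof -
      have "F -` {0} = {0}" using F0 F_nonzero by auto
      then show ?thesis unfolding \<nu>_def by (subst emeasure_distr) (auto simp: emeasure_cyl_measure_zero)
    qed
    moreover have "emeasure M (U - {0}) = emeasure M U" if "emeasure M {0} = 0" "sets M = sets borel" for M :: "'a measure"
      using that U emeasure_Diff_null_set[of "{0}" M U] by (auto simp: null_sets_def)
    ultimately show ?thesis using emeasure_cyl_measure_zero sets\<nu> by (metis sets_cyl_measure)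
  qed
  have "cyl_measure = \<nu>"
  proof (rule measure_eqI_generator_eq_countable[where E="{S::'a set. open S} \<union> {{0}}" and \<Omega>=UNIV and A="insert {0} (range An)"])
    show "Int_stable ({S::'a set. open S} \<union> {{0}})"
      by (auto simp: Int_stable_def Int_insert_left Int_insert_right split: if_splits)
    show "emeasure cyl_measure B = emeasure \<nu> B" if "B \<in> {S::'a set. open S} \<union> {{0}}" for B
    proof -
      have "F -` {0} = {0}" using F0 F_nonzero by auto
      then have "emeasure \<nu> {0} = 0" unfolding \<nu>_def by (subst emeasure_distr) (auto simp: emeasure_cyl_measure_zero)
      then show ?thesis using that opeq emeasure_cyl_measure_zero by auto
    qed
    have sig: "sigma_sets UNIV ({S::'a set. open S} \<union> {{0}}) = sets borel"
    proof
      show "sigma_sets UNIV ({S::'a set. open S} \<union> {{0}}) \<subseteq> sets borel"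
        by (rule sets.sigma_sets_subset'[of _ borel, simplified]) auto
      have "sets (borel :: 'a measure) = sigma_sets UNIV {S::'a set. open S}" by (simp add: borel_def)
      also have "\<dots> \<subseteq> sigma_sets UNIV ({S::'a set. open S} \<union> {{0}})" by (rule sigma_sets_mono') auto
      finally show "sets borel \<subseteq> sigma_sets UNIV ({S::'a set. open S} \<union> {{0}})" .
    qed
    then show "sets cyl_measure = sigma_sets UNIV ({S::'a set. open S} \<union> {{0}})" by simp
    show "sets \<nu> = sigma_sets UNIV ({S::'a set. open S} \<union> {{0}})" using sig sets\<nu> by simp
    have "x \<in> \<Union> (insert {0} (range An))" for x using An_cover[of x] by (cases "x = 0") auto
    then show "\<Union> (insert {0} (range An)) = (UNIV :: 'a set)" by blast
    show "emeasure cyl_measure B \<noteq> \<infinity>" if "B \<in> insert {0::'a} (range An)" for B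
      using that An_fin by (auto simp: less_top[symmetric] emeasure_cyl_measure_zero)
    show "insert {0::'a} (range An) \<subseteq> {S. open S} \<union> {{0}}" using An_open by auto
  qed auto
  then show ?thesis by (simp add: \<nu>_def)
qed

end

text \<open>The density on the ball is at least \<open>1 / (2 * norm y) ^ DIM('a)\<close>, and the
  powers of \<open>norm y\<close> cancel: the bound does not depend on the position of the
  ball.\<close>

lemma emeasure_cyl_measure_ball_ge:
  fixes y :: "'a::euclidean_space"
  assumes "0 < \<delta>" "\<delta> \<le> 1" "y \<noteq> 0"
  shows "ennreal (unit_ball_vol (real DIM('a)) * (\<delta> / 2) ^ DIM('a)) \<le> emeasure cyl_measure (ball y (\<delta> * norm y))"
proof -
  define r where "r = \<delta> * norm y"
  have r: "r > 0" using assms by (simp add: r_def)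
  have vol: "unit_ball_vol (real DIM('a)) * (\<delta> / 2) ^ DIM('a) = 1 / (2 * norm y) ^ DIM('a) * (unit_ball_vol (real DIM('a)) * r ^ DIM('a))"
    using assms by (simp add: r_def power_mult_distrib power_divide)
  have "ennreal (unit_ball_vol (real DIM('a)) * (\<delta> / 2) ^ DIM('a)) =
      ennreal (1 / (2 * norm y) ^ DIM('a)) * emeasure lborel (ball y r)"
  proof -
    have "emeasure lborel (ball y r) = ennreal (unit_ball_vol (real DIM('a)) * r ^ DIM('a))"
      using r by (subst emeasure_ball) auto
    moreover have "ennreal (1 / (2 * norm y) ^ DIM('a)) * ennreal (unit_ball_vol (real DIM('a)) * r ^ DIM('a)) =
      ennreal (1 / (2 * norm y) ^ DIM('a) * (unit_ball_vol (real DIM('a)) * r ^ DIM('a)))"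
      using r by (intro ennreal_mult[symmetric]) auto
    ultimately show ?thesis using vol by (simp only:)
  qed
  also have "\<dots> = (\<integral>\<^sup>+z. ennreal (1 / (2 * norm y) ^ DIM('a)) * indicator (ball y r) z \<partial>lborel)"
    by (subst nn_integral_cmult) (auto intro!: borel_measurable_indicator)
  also have "\<dots> \<le> (\<integral>\<^sup>+z. ennreal (1 / norm z ^ DIM('a)) * indicator (ball y r) z \<partial>lborel)"
  proof (rule nn_integral_mono)
    fix z :: 'a
    have "1 / (2 * norm y) ^ DIM('a) \<le> 1 / norm z ^ DIM('a)" if z: "z \<in> ball y r"
    proof -
      have "\<delta> * norm y \<le> 1 * norm y" using assms by (intro mult_right_mono) auto
      then have d: "dist y z < norm y" using z unfolding r_def mem_ball by linarith
      then have "z \<noteq> 0" by auto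
      have "norm z \<le> norm y + dist y z" using norm_triangle_ineq[of y "z - y"] by (simp add: dist_norm norm_minus_commute)
      then have "norm z \<le> 2 * norm y" using d by simp
      then show ?thesis using \<open>z \<noteq> 0\<close> assms(3) by (intro divide_left_mono power_mono mult_pos_pos) auto
    qed
    then show "ennreal (1 / (2 * norm y) ^ DIM('a)) * indicator (ball y r) z \<le> ennreal (1 / norm z ^ DIM('a)) * indicator (ball y r) z"
      by (cases "z \<in> ball y r") (auto simp del: mem_ball intro!: ennreal_leI)
  qed
  also have "\<dots> = emeasure cyl_measure (ball y r)"
    unfolding cyl_measure_def by (subst emeasure_density) auto
  finally show ?thesis by (simp add: r_def)
qed

lemma near_orthogonal: "orthogonal_transformation A \<Longrightarrow> (x, y) \<in> near \<delta> \<Longrightarrow> (A x, A y) \<in> near \<delta>"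
proof -
  assume A: "orthogonal_transformation A" and xy: "(x, y) \<in> near \<delta>"
  have n: "norm (A z) = norm z" for z using A by (rule orthogonal_transformation_norm)
  have "dist (A x) (A y) = dist x y"
    using n[of "x - y"] linear_diff[OF orthogonal_transformation_linear[OF A], of x y] by (simp add: dist_norm)
  moreover have "A z \<noteq> 0" if "z \<noteq> 0" for z using n[of z] that by auto
  ultimately show ?thesis using xy n by (auto simp: near_def)
qed

section \<open>Mean values of the logarithm of the norm\<close>

context gauge_isometry
begin

definition lognorm :: "'a \<Rightarrow> real" where
  "lognorm x = ln (norm (F x))"

lemma measurable_lognorm [measurable]: "lognorm \<in> borel_measurable borel"
  unfolding lognorm_def by measurable

lemma lognorm_step:
  assumes "(x, y) \<in> E k" shows "\<bar>lognorm y - lognorm x\<bar> \<le> ln 2"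
proof -
  have FE: "(F x, F y) \<in> E k" using assms preserves by simp
  note b = E_bounds[OF FE]
  have nz: "0 < norm (F x)" "0 < norm (F y)" using E_nonzero[OF FE] E_nonzero2[OF FE] by auto
  have le: "norm (F y) \<le> 2 * norm (F x)" "norm (F x) \<le> 2 * norm (F y)" using b nz by linarith+
  have "lognorm y \<le> ln (2 * norm (F x))" unfolding lognorm_def using nz le(1) by (intro ln_mono) auto
  moreover have "lognorm x \<le> ln (2 * norm (F y))" unfolding lognorm_def using nz le(2) by (intro ln_mono) auto
  ultimately show ?thesis using nz by (simp add: ln_mult lognorm_def)
qed

text \<open>The increments of \<open>ln (norm y)\<close> are integrated over the slice without
  dividing by its mass. By homogeneity the result does not depend on \<open>x\<close>
  (\<open>drift_const\<close>), so it cancels when \<open>lognorm\<close> is subtracted from its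
  composition with an orthogonal map.\<close>

definition drift :: "'a \<Rightarrow> real" where
  "drift x = (\<integral>y. indicator (E 0 `` {x}) y *\<^sub>R (ln (norm y) - ln (norm x)) \<partial>cyl_measure)"

lemma drift_const:
  assumes "x \<noteq> 0" "y \<noteq> 0" shows "drift x = drift y"
proof -
  obtain c and A :: "'a \<Rightarrow> 'a" where cA: "c > 0" "orthogonal_transformation A" "c *\<^sub>R A x = y"
    using exists_scaled_orthogonal[OF assms] by metis
  note [measurable] = similarity_measurable_scaled[OF cA(1,2)]
  have n: "norm (A z) = norm z" for z using cA(2) by (rule orthogonal_transformation_norm)
  have "drift y = (\<integral>z. indicator (E 0 `` {y}) z *\<^sub>R (ln (norm z) - ln (norm y)) \<partial>distr cyl_measure borel (\<lambda>x. c *\<^sub>R A x))"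
    by (simp add: drift_def distr_scaled[OF cA(1,2)])
  also have "\<dots> = (\<integral>z. indicator (E 0 `` {y}) (c *\<^sub>R A z) *\<^sub>R (ln (norm (c *\<^sub>R A z)) - ln (norm y)) \<partial>cyl_measure)"
    by (rule integral_distr) measurable
  also have "\<dots> = drift x" unfolding drift_def
  proof (rule Bochner_Integration.integral_cong[OF refl])
    fix z
    have "c *\<^sub>R A z \<in> E 0 `` {y} \<longleftrightarrow> z \<in> E 0 `` {x}"
      using E_similarity_iff[OF cA(1,2), of x z 0] cA(3) by simp
    moreover have "ln (norm (c *\<^sub>R A z)) - ln (norm y) = ln (norm z) - ln (norm x)" if "z \<noteq> 0"
      using that cA n[of z] n[of x] assms by (simp add: cA(3)[symmetric] ln_mult)
    moreover have "z \<noteq> 0" if "z \<in> E 0 `` {x}" using that E_nonzero2 by auto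
    ultimately show "indicator (E 0 `` {y}) (c *\<^sub>R A z) *\<^sub>R (ln (norm (c *\<^sub>R A z)) - ln (norm y)) =
      indicator (E 0 `` {x}) z *\<^sub>R (ln (norm z) - ln (norm x))"
      by (auto simp: indicator_def)
  qed
  finally show ?thesis by simp
qed

text \<open>Substitution of \<open>F\<close>, which preserves \<open>cyl_measure\<close> and maps
  slices onto slices.\<close>

lemma mean_lognorm:
  assumes "x \<noteq> 0"
  shows "(\<integral>y. indicator (E 0 `` {x}) y *\<^sub>R (lognorm y - lognorm x) \<partial>cyl_measure) = drift (F x)"
proof -
  have "drift (F x) = (\<integral>z. indicator (E 0 `` {F x}) z *\<^sub>R (ln (norm z) - ln (norm (F x))) \<partial>distr cyl_measure borel F)"
    by (simp add: drift_def distr_F)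
  also have "\<dots> = (\<integral>y. indicator (E 0 `` {F x}) (F y) *\<^sub>R (ln (norm (F y)) - ln (norm (F x))) \<partial>cyl_measure)"
    by (rule integral_distr) measurable
  also have "\<dots> = (\<integral>y. indicator (E 0 `` {x}) y *\<^sub>R (lognorm y - lognorm x) \<partial>cyl_measure)"
    using preserves[of x _ 0] by (auto simp: indicator_def lognorm_def intro!: Bochner_Integration.integral_cong)
  finally show ?thesis by simp
qed

lemma mean_lognorm_orthogonal:
  fixes A :: "'a \<Rightarrow> 'a"
  assumes "x \<noteq> 0" and A: "orthogonal_transformation A"
  shows "(\<integral>y. indicator (E 0 `` {x}) y *\<^sub>R (lognorm (A y) - lognorm (A x)) \<partial>cyl_measure) = drift (F (A x))"
proof -
  have 1: "(1::real) > 0" by simp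
  have A1: "(\<lambda>x. 1 *\<^sub>R A x) = A" by auto
  have [measurable]: "A \<in> borel_measurable borel" using similarity_measurable_scaled[OF 1 A] by simp
  have dA: "distr cyl_measure borel A = cyl_measure" using distr_scaled[OF 1 A] by simp
  have "A x \<noteq> 0" using assms by (metis norm_eq_zero orthogonal_transformation_norm)
  then have "drift (F (A x)) = (\<integral>y. indicator (E 0 `` {A x}) y *\<^sub>R (lognorm y - lognorm (A x)) \<partial>cyl_measure)"
    by (rule mean_lognorm[symmetric])
  also have "\<dots> = (\<integral>y. indicator (E 0 `` {A x}) y *\<^sub>R (lognorm y - lognorm (A x)) \<partial>distr cyl_measure borel A)"
    by (simp add: dA)
  also have "\<dots> = (\<integral>y. indicator (E 0 `` {A x}) (A y) *\<^sub>R (lognorm (A y) - lognorm (A x)) \<partial>cyl_measure)"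
    by (rule integral_distr) measurable
  also have "\<dots> = (\<integral>y. indicator (E 0 `` {x}) y *\<^sub>R (lognorm (A y) - lognorm (A x)) \<partial>cyl_measure)"
    using E_similarity_iff[OF 1 A, of x _ 0] by (auto simp: indicator_def intro!: Bochner_Integration.integral_cong)
  finally show ?thesis by simp
qed

text \<open>\<open>near \<eta>\<close> contains some \<open>E k\<close>, which contains some
  \<open>near \<zeta>\<close>. As \<open>F\<close> preserves \<open>E k\<close>, pairs in
  \<open>near \<zeta>\<close> go to pairs in \<open>near \<eta>\<close>, with one
  \<open>\<zeta>\<close> for the whole noncompact space.\<close>

lemma lognorm_uniformly_continuous:
  assumes "\<epsilon> > 0"
  shows "\<exists>\<zeta>>0. \<forall>x y. (x, y) \<in> near \<zeta> \<longrightarrow> \<bar>lognorm y - lognorm x\<bar> < \<epsilon>"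
proof -
  define \<eta> where "\<eta> = min (1/2) (\<epsilon> / 4)"
  have \<eta>: "0 < \<eta>" "\<eta> \<le> 1/2" "2 * \<eta> < \<epsilon>" using assms by (auto simp: \<eta>_def)
  obtain k where k: "E k \<subseteq> near \<eta>" using eventually_happens[OF E_shrink[OF \<eta>(1)]] by auto
  obtain \<zeta> where \<zeta>: "\<zeta> > 0" "near \<zeta> \<subseteq> E k" using E_near by blast
  have "\<bar>lognorm y - lognorm x\<bar> < \<epsilon>" if "(x, y) \<in> near \<zeta>" for x y
  proof -
    have "(F x, F y) \<in> near \<eta>" using that \<zeta> k preserves by blast
    then have nz: "0 < norm (F x)" "0 < norm (F y)" and d: "dist (F x) (F y) < \<eta> * norm (F x)" by (auto simp: near_def)
    define a b where "a = norm (F x)" and "b = norm (F y)"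
    have ab: "0 < a" "0 < b" "\<bar>b - a\<bar> < \<eta> * a"
      using nz d norm_triangle_ineq3[of "F y" "F x"] by (auto simp: a_def b_def dist_norm norm_minus_commute)
    have "\<eta> * a \<le> a / 2" using \<eta> ab mult_right_mono[of \<eta> "1/2" a] by simp
    then have ba: "a / 2 \<le> b" using ab by linarith
    have "ln (b / a) \<le> b / a - 1" by (rule ln_le_minus_one) (use ab in auto)
    also have "b / a - 1 = (b - a) / a" using ab by (simp add: field_simps)
    also have "\<dots> < \<eta>" using ab by (simp add: pos_divide_less_eq)
    finally have 1: "ln b - ln a < \<eta>" using ab by (simp add: ln_div)
    have "ln (a / b) \<le> a / b - 1" by (rule ln_le_minus_one) (use ab in auto)
    also have "a / b - 1 = (a - b) / b" using ab by (simp add: field_simps)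
    also have "\<dots> < 2 * \<eta>"
    proof -
      have "a - b < \<eta> * a" using ab by linarith
      also have "\<dots> \<le> \<eta> * (2 * b)" using ba \<eta> by (intro mult_left_mono) auto
      finally show ?thesis using ab by (simp add: pos_divide_less_eq mult_ac)
    qed
    finally have 2: "ln a - ln b < 2 * \<eta>" using ab by (simp add: ln_div)
    show ?thesis using 1 2 \<eta> unfolding lognorm_def a_def[symmetric] b_def[symmetric] by linarith
  qed
  then show ?thesis using \<zeta>(1) by blast
qed

lemma lognorm_chain:
  assumes "near \<zeta> \<subseteq> E 0" "(x, y) \<in> near \<zeta> ^^ N"
  shows "\<bar>lognorm y - lognorm x\<bar> \<le> real N * ln 2"
  using assms(2)
proof (induction N arbitrary: y)
  case (Suc N)
  then obtain z where z: "(x, z) \<in> near \<zeta> ^^ N" "(z, y) \<in> near \<zeta>" by auto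
  have "\<bar>lognorm y - lognorm z\<bar> \<le> ln 2" using z(2) assms(1) lognorm_step by blast
  then show ?case using Suc.IH[OF z(1)] by (simp add: algebra_simps)
qed simp

text \<open>\<open>k = lognorm \<circ> A - lognorm\<close> is bounded, has the mean value property, and is odd under the
  reflection \<open>A\<close>. Where \<open>k\<close> is almost maximal, it is almost maximal at all points of the sphere,
  in particular at the reflected point, where it is almost minimal.\<close>

lemma lognorm_reflect:
  fixes v :: 'a
  assumes x0: "x0 \<noteq> 0"
  shows "lognorm (reflect v x0) \<le> lognorm x0"
proof (rule ccontr)
  define A where "A = reflect v"
  define k where "k x = lognorm (A x) - lognorm x" for x
  assume "\<not> ?thesis"
  then have k0: "k x0 > 0" by (simp add: k_def A_def)
  have A: "orthogonal_transformation A" unfolding A_def by (rule orthogonal_reflect)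
  have nA: "norm (A z) = norm z" for z using A by (rule orthogonal_transformation_norm)
  have A_nz: "A z \<noteq> 0" if "z \<noteq> 0" for z using nA[of z] that by auto
  have AA: "A (A z) = z" for z by (simp add: A_def)
  have [measurable]: "A \<in> borel_measurable borel" using similarity_measurable_scaled[of 1 A] A by simp
  have [measurable]: "k \<in> borel_measurable borel" unfolding k_def by measurable
  obtain \<zeta>0 where \<zeta>0: "\<zeta>0 > 0" "near \<zeta>0 \<subseteq> E 0" using E_near by blast
  obtain N0 where N0: "\<And>u v :: 'a. norm u = norm v \<Longrightarrow> u \<noteq> 0 \<Longrightarrow> (u, v) \<in> near \<zeta>0 ^^ N0"
    using near_chain_sphere[OF dim \<zeta>0(1)] by blast
  \<comment> \<open>\<open>x\<close> and \<open>A x\<close> lie on one sphere, so a chain of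
    \<open>N0\<close> steps joins them, and each step changes \<open>lognorm\<close> by at most
    \<open>ln 2\<close>.\<close>
  have kb: "\<bar>k x\<bar> \<le> real N0 * ln 2" if "x \<noteq> 0" for x
    unfolding k_def using that nA[of x] by (intro lognorm_chain[OF \<zeta>0(2)] N0) auto
  define M where "M = Sup (k ` (- {0}))"
  have bdd: "bdd_above (k ` (- {0}))"
    by (rule bdd_aboveI[of _ "real N0 * ln 2"]) (use kb in \<open>auto simp: abs_le_iff\<close>)
  have kM: "k x \<le> M" if "x \<noteq> 0" for x unfolding M_def using that by (intro cSup_upper bdd) auto
  have M: "M > 0" using kM[OF x0] k0 by simp
  define m where "m = measure cyl_measure (E 0 `` {x0})"
  have S_fin: "emeasure cyl_measure (E 0 `` {x}) < \<infinity>" if "x \<noteq> 0" for x using slice_finite[OF that] .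
  have m: "measure cyl_measure (E 0 `` {x}) = m" if "x \<noteq> 0" for x
    unfolding m_def measure_def using slice_measure_const[OF that x0] by simp
  have m0: "m > 0" unfolding m_def measure_def using slice_pos[OF x0, of 0] S_fin[OF x0] by (simp add: enn2real_positive_iff)
  \<comment> \<open>Small enough that for \<open>(x, y)\<close> in \<open>near \<zeta>1\<close> a
    ball of relative radius at most \<open>\<zeta>0 / 4\<close> around \<open>y\<close> still lies
    in the slice of \<open>E 0\<close> at \<open>x\<close>.\<close>
  define \<zeta>1 where "\<zeta>1 = min (1/2) (\<zeta>0 / 4)"
  have \<zeta>1: "0 < \<zeta>1" "\<zeta>1 \<le> 1/2" "\<zeta>1 \<le> \<zeta>0 / 4" using \<zeta>0 by (auto simp: \<zeta>1_def)
  have mean: "(\<integral>y. indicator (E 0 `` {x}) y *\<^sub>R (M - k y) \<partial>cyl_measure) = (M - k x) * m"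
    and int: "integrable cyl_measure (\<lambda>y. indicator (E 0 `` {x}) y *\<^sub>R (M - k y))" if x: "x \<noteq> 0" for x
  proof -
    have i1: "integrable cyl_measure (\<lambda>y. indicator (E 0 `` {x}) y *\<^sub>R (lognorm y - lognorm x))"
      by (rule integrableI_bounded_set_indicator[where B="ln 2"])
        (use S_fin[OF x] lognorm_step in \<open>auto intro!: AE_I2\<close>)
    have i2: "integrable cyl_measure (\<lambda>y. indicator (E 0 `` {x}) y *\<^sub>R (lognorm (A y) - lognorm (A x)))"
    proof (rule integrableI_bounded_set_indicator[where B="ln 2"])
      show "AE y in cyl_measure. y \<in> E 0 `` {x} \<longrightarrow> norm (lognorm (A y) - lognorm (A x)) \<le> ln 2"
        using lognorm_step[of "A x" "A _" 0] E_similarity[of 1 A x _ 0] A by (auto intro!: AE_I2)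
    qed (use S_fin[OF x] in auto)
    have i3: "integrable cyl_measure (\<lambda>y. indicator (E 0 `` {x}) y *\<^sub>R (M - k x))"
      by (rule integrableI_bounded_set_indicator[where B="\<bar>M - k x\<bar>"]) (use S_fin[OF x] in auto)
    have eq: "(\<lambda>y. indicator (E 0 `` {x}) y *\<^sub>R (M - k y)) =
       (\<lambda>y. indicator (E 0 `` {x}) y *\<^sub>R (M - k x) - (indicator (E 0 `` {x}) y *\<^sub>R (lognorm (A y) - lognorm (A x))
          - indicator (E 0 `` {x}) y *\<^sub>R (lognorm y - lognorm x)))"
      by (auto simp: k_def algebra_simps fun_eq_iff indicator_def)
    show "integrable cyl_measure (\<lambda>y. indicator (E 0 `` {x}) y *\<^sub>R (M - k y))"
      unfolding eq by (intro Bochner_Integration.integrable_diff i1 i2 i3)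
    have "(\<integral>y. indicator (E 0 `` {x}) y *\<^sub>R (M - k y) \<partial>cyl_measure) =
      (\<integral>y. indicator (E 0 `` {x}) y *\<^sub>R (M - k x) \<partial>cyl_measure) - (drift (F (A x)) - drift (F x))"
      unfolding eq mean_lognorm[OF x, symmetric] mean_lognorm_orthogonal[OF x A, symmetric]
      by (subst Bochner_Integration.integral_diff[OF i3 Bochner_Integration.integrable_diff[OF i2 i1]],
          subst Bochner_Integration.integral_diff[OF i2 i1]) simp
    also have "drift (F (A x)) = drift (F x)" by (intro drift_const F_nonzero A_nz x)
    also have "(\<integral>y. indicator (E 0 `` {x}) y *\<^sub>R (M - k x) \<partial>cyl_measure) = (M - k x) * m"
      using m[OF x] S_fin[OF x] by simp
    finally show "(\<integral>y. indicator (E 0 `` {x}) y *\<^sub>R (M - k y) \<partial>cyl_measure) = (M - k x) * m" by simp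
  qed
  \<comment> \<open>A quantitative maximum principle, as the supremum \<open>M\<close> need not be
    attained. If \<open>M - k y\<close> were at least \<open>\<epsilon>'\<close>, then
    \<open>M - k\<close> would be at least \<open>\<epsilon>' / 2\<close> on a ball of mass at least
    \<open>b0\<close> in the slice at \<open>x\<close>, and the mean value property would push
    \<open>M - k x\<close> up to \<open>\<epsilon>' / 2 * b0 / m\<close>.\<close>
  have spread: "\<exists>\<epsilon>>0. \<forall>x y. (x, y) \<in> near \<zeta>1 \<longrightarrow> M - k x < \<epsilon> \<longrightarrow> M - k y < \<epsilon>'" if \<epsilon>': "\<epsilon>' > 0" for \<epsilon>'
  proof -
    obtain \<delta>0 where \<delta>0: "\<delta>0 > 0" "\<And>x y. (x, y) \<in> near \<delta>0 \<Longrightarrow> \<bar>lognorm y - lognorm x\<bar> < \<epsilon>' / 4"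
      using lognorm_uniformly_continuous[of "\<epsilon>' / 4"] \<epsilon>' by auto
    define \<delta> where "\<delta> = min (min \<delta>0 (1/2)) (\<zeta>0 / 4)"
    have \<delta>: "0 < \<delta>" "\<delta> \<le> \<delta>0" "\<delta> \<le> 1/2" "\<delta> \<le> \<zeta>0 / 4" using \<delta>0 \<zeta>0 by (auto simp: \<delta>_def)
    have uk: "\<bar>k y - k x\<bar> < \<epsilon>' / 2" if "(x, y) \<in> near \<delta>0" for x y
      using \<delta>0(2)[OF that] \<delta>0(2)[OF near_orthogonal[OF A that]] unfolding k_def by linarith
    define b0 where "b0 = unit_ball_vol (real DIM('a)) * (\<delta> / 2) ^ DIM('a)"
    have b0: "b0 > 0" using \<delta> by (simp add: b0_def)
    define \<epsilon> where "\<epsilon> = \<epsilon>' / 2 * b0 / m"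
    have "\<epsilon> > 0" using \<epsilon>' b0 m0 by (simp add: \<epsilon>_def)
    moreover have "M - k y < \<epsilon>'" if xy: "(x, y) \<in> near \<zeta>1" and kx: "M - k x < \<epsilon>" for x y
    proof (rule ccontr)
      assume "\<not> M - k y < \<epsilon>'"
      then have ky: "M - k y \<ge> \<epsilon>'" by simp
      have nz: "x \<noteq> 0" "y \<noteq> 0" and dxy: "dist x y < \<zeta>1 * norm x" using xy by (auto simp: near_def)
      have "norm y \<le> norm x + dist x y" using norm_triangle_ineq[of x "y - x"] by (simp add: dist_norm norm_minus_commute)
      moreover have "\<zeta>1 * norm x \<le> 1/2 * norm x" using \<zeta>1 by (intro mult_right_mono) auto
      ultimately have ny: "norm y \<le> 3/2 * norm x" using dxy by linarith
      define B where "B = ball y (\<delta> * norm y)"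
      have BS: "B \<subseteq> E 0 `` {x}" and Bk: "\<And>z. z \<in> B \<Longrightarrow> \<epsilon>' / 2 \<le> M - k z"
      proof -
        fix z assume z: "z \<in> B"
        then have dz: "dist y z < \<delta> * norm y" by (simp add: B_def)
        have "\<delta> * norm y \<le> norm y" using \<delta> by (simp add: mult_left_le_one_le)
        then have znz: "z \<noteq> 0" using dz by auto
        have "(y, z) \<in> near \<delta>0"
          using nz znz less_le_trans[OF dz mult_right_mono[OF \<delta>(2) norm_ge_zero[of y]]] by (auto simp: near_def)
        from uk[OF this] show "\<epsilon>' / 2 \<le> M - k z" using ky by linarith
      next
        show "B \<subseteq> E 0 `` {x}"
        proof
          fix z assume z: "z \<in> B"
          then have dz: "dist y z < \<delta> * norm y" by (simp add: B_def)
          have "\<delta> * norm y \<le> norm y" using \<delta> by (simp add: mult_left_le_one_le)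
          then have znz: "z \<noteq> 0" using dz by auto
          have "\<delta> * norm y \<le> \<zeta>0 / 4 * (3/2 * norm x)" using \<delta> ny \<zeta>0 by (intro mult_mono) auto
          moreover have "\<zeta>1 * norm x \<le> \<zeta>0 / 4 * norm x" using \<zeta>1 by (intro mult_right_mono) auto
          moreover have "0 < \<zeta>0 * norm x" using \<zeta>0 nz by simp
          ultimately have "dist x z < \<zeta>0 * norm x" using dist_triangle[of x z y] dxy dz by (simp add: field_simps)
          then have "(x, z) \<in> near \<zeta>0" using nz znz by (simp add: near_def)
          then show "z \<in> E 0 `` {x}" using \<zeta>0(2) by auto
        qed
      qed
      have Bm: "B \<in> sets borel" by (simp add: B_def)
      have Bfin: "emeasure cyl_measure B < \<infinity>"
        using emeasure_mono[OF BS, of cyl_measure] S_fin[OF nz(1)] by (simp add: le_less_trans)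
      have "b0 \<le> measure cyl_measure B"
      proof -
        have "ennreal b0 \<le> emeasure cyl_measure B"
          unfolding b0_def B_def by (rule emeasure_cyl_measure_ball_ge) (use \<delta> nz in auto)
        then have "enn2real (ennreal b0) \<le> enn2real (emeasure cyl_measure B)"
          using Bfin by (intro enn2real_mono) auto
        then show ?thesis using b0 by (simp add: measure_def)
      qed
      then have "\<epsilon>' / 2 * b0 \<le> \<epsilon>' / 2 * measure cyl_measure B" using \<epsilon>' by (intro mult_left_mono) auto
      also have "\<dots> = (\<integral>z. indicator B z *\<^sub>R (\<epsilon>' / 2) \<partial>cyl_measure)" using Bfin Bm by simp
      also have "\<dots> \<le> (\<integral>z. indicator (E 0 `` {x}) z *\<^sub>R (M - k z) \<partial>cyl_measure)"
      proof (rule integral_mono)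
        show "integrable cyl_measure (\<lambda>z. indicator B z *\<^sub>R (\<epsilon>' / 2))"
          by (rule integrableI_bounded_set_indicator[where B="\<epsilon>' / 2"]) (use Bfin Bm \<epsilon>' in auto)
        show "integrable cyl_measure (\<lambda>z. indicator (E 0 `` {x}) z *\<^sub>R (M - k z))" by (rule int[OF nz(1)])
        fix z
        show "indicator B z *\<^sub>R (\<epsilon>' / 2) \<le> indicator (E 0 `` {x}) z *\<^sub>R (M - k z)"
        proof (cases "z \<in> B")
          case True
          then show ?thesis using BS Bk[OF True] by (auto simp: indicator_def)
        next
          case False
          then show ?thesis using kM[of z] E_nonzero2 by (auto simp: indicator_def)
        qed
      qed
      also have "\<dots> = (M - k x) * m" by (rule mean[OF nz(1)])
      also have "\<dots> < \<epsilon> * m" using kx m0 by (rule mult_strict_right_mono)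
      finally show False using m0 by (simp add: \<epsilon>_def)
    qed
    ultimately show ?thesis by blast
  qed
  have iter: "\<exists>\<epsilon>>0. \<forall>x y. (x, y) \<in> near \<zeta>1 ^^ N \<longrightarrow> M - k x < \<epsilon> \<longrightarrow> M - k y < \<epsilon>'" if "\<epsilon>' > 0" for N \<epsilon>'
    using that
  proof (induction N arbitrary: \<epsilon>')
    case 0
    then show ?case by (intro exI[of _ \<epsilon>']) auto
  next
    case (Suc N)
    obtain \<epsilon>1 where e1: "\<epsilon>1 > 0" "\<forall>x y. (x, y) \<in> near \<zeta>1 \<longrightarrow> M - k x < \<epsilon>1 \<longrightarrow> M - k y < \<epsilon>'"
      using spread[OF Suc.prems] by blast
    obtain \<epsilon> where e: "\<epsilon> > 0" "\<forall>x y. (x, y) \<in> near \<zeta>1 ^^ N \<longrightarrow> M - k x < \<epsilon> \<longrightarrow> M - k y < \<epsilon>1"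
      using Suc.IH[OF e1(1)] by blast
    show ?case
    proof (intro exI[of _ \<epsilon>] conjI allI impI)
      fix x y assume "(x, y) \<in> near \<zeta>1 ^^ Suc N" "M - k x < \<epsilon>"
      then obtain z where "(x, z) \<in> near \<zeta>1 ^^ N" "(z, y) \<in> near \<zeta>1" by auto
      then show "M - k y < \<epsilon>'" using e e1 \<open>M - k x < \<epsilon>\<close> by blast
    qed (rule e(1))
  qed
  obtain N where N: "\<And>u v :: 'a. norm u = norm v \<Longrightarrow> u \<noteq> 0 \<Longrightarrow> (u, v) \<in> near \<zeta>1 ^^ N"
    using near_chain_sphere[OF dim \<zeta>1(1)] by blast
  obtain \<epsilon> where \<epsilon>: "\<epsilon> > 0" "\<forall>x y. (x, y) \<in> near \<zeta>1 ^^ N \<longrightarrow> M - k x < \<epsilon> \<longrightarrow> M - k y < M"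
    using iter[OF M] by blast
  \<comment> \<open>The minimum with \<open>M\<close> makes \<open>k x\<close> positive as well. At
    the reflected point \<open>k\<close> takes the value \<open>- k x\<close>, yet it has to be
    positive there.\<close>
  have "M - min \<epsilon> M < Sup (k ` (- {0}))" using \<epsilon>(1) M by (simp add: M_def[symmetric])
  then obtain x where x: "x \<noteq> 0" "M - min \<epsilon> M < k x"
    using less_cSup_iff[OF _ bdd] x0 by auto
  have "(x, A x) \<in> near \<zeta>1 ^^ N" using N[of x "A x"] x(1) nA by simp
  then have "M - k (A x) < M" using \<epsilon>(2) x(2) by auto
  moreover have "k (A x) = - k x" by (simp add: k_def AA)
  moreover have "k x > 0" using x(2) by auto
  ultimately show False by simp
qed

lemma norm_F_radial:
  assumes "norm x = norm y" shows "norm (F x) = norm (F y)"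
proof (cases "x = 0")
  case True
  then show ?thesis using assms by simp
next
  case False
  then have y: "y \<noteq> 0" using assms by auto
  have "lognorm y \<le> lognorm x" using lognorm_reflect[OF False, of "x - y"] reflect_swap(1)[OF assms] by simp
  moreover have "lognorm x \<le> lognorm y" using lognorm_reflect[OF y, of "x - y"] reflect_swap(2)[OF assms] by simp
  ultimately have "ln (norm (F x)) = ln (norm (F y))" by (simp add: lognorm_def)
  then show ?thesis using F_nonzero[OF False] F_nonzero[OF y] by simp
qed

end

subsection \<open>The radial part\<close>

definition annulus :: "real \<Rightarrow> real \<Rightarrow> 'a::euclidean_space set" where
  "annulus s t = {x. s < norm x \<and> norm x < t}"

lemma open_annulus: "open (annulus s t)"
  unfolding annulus_def by (intro open_Collect_conj open_Collect_less continuous_intros)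

lemma annulus_sets [measurable]: "(annulus s t :: 'a::euclidean_space set) \<in> sets borel"
  using open_annulus by (rule borel_open)

lemma annulus_measure_finite: "0 < s \<Longrightarrow> emeasure cyl_measure (annulus s t :: 'a::euclidean_space set) < \<infinity>"
  by (rule emeasure_cyl_measure_finite[of _ s t]) (auto simp: annulus_def)

lemma annulus_measure_strict:
  assumes "0 < s" "s < t" "t < t'"
  shows "emeasure cyl_measure (annulus s t :: 'a::euclidean_space set) < emeasure cyl_measure (annulus s t' :: 'a set)"
proof -
  obtain b :: 'a where b: "norm b = 1" using norm_Basis nonempty_Basis by blast
  have pos: "0 < emeasure cyl_measure (annulus t t' :: 'a set)"
  proof (rule emeasure_cyl_measure_pos[OF open_annulus])
    show "((t + t') / 2) *\<^sub>R b \<in> annulus t t'" using assms b by (simp add: annulus_def)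
    show "((t + t') / 2) *\<^sub>R b \<noteq> 0" using assms b by auto
  qed
  have "emeasure cyl_measure (annulus s t :: 'a set) < emeasure cyl_measure (annulus s t :: 'a set) + emeasure cyl_measure (annulus t t' :: 'a set)"
    using annulus_measure_finite[of s t, where 'a='a] assms pos
      ennreal_add_left_cancel_less[of "emeasure cyl_measure (annulus s t :: 'a set)" 0] by simp
  also have "\<dots> = emeasure cyl_measure (annulus s t \<union> annulus t t' :: 'a set)"
    by (rule plus_emeasure) (auto simp: annulus_def[of s t] annulus_def[of t t'] intro: annulus_sets[unfolded annulus_def])
  also have "\<dots> \<le> emeasure cyl_measure (annulus s t' :: 'a set)"
    using assms by (intro emeasure_mono) (auto simp: annulus_def[of s t'] intro!: annulus_sets[unfolded annulus_def], auto simp: annulus_def)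
  finally show ?thesis .
qed

lemma annulus_measure_scale:
  assumes "0 < c"
  shows "emeasure cyl_measure (annulus (c * s) (c * t) :: 'a::euclidean_space set) = emeasure cyl_measure (annulus s t :: 'a set)"
proof -
  have sim: "similarity c (\<lambda>x::'a. c *\<^sub>R x)"
    using similarity_scaled_orthogonal[OF assms orthogonal_transformation_id] by simp
  have "emeasure cyl_measure (annulus (c * s) (c * t) :: 'a set) = emeasure (distr cyl_measure borel (\<lambda>x::'a. c *\<^sub>R x)) (annulus (c * s) (c * t))"
    by (simp add: distr_cyl_measure_similarity[OF sim])
  also have "\<dots> = emeasure cyl_measure ((\<lambda>x::'a. c *\<^sub>R x) -` annulus (c * s) (c * t))"
    using similarity_measurable[OF sim] by (subst emeasure_distr) auto
  also have "(\<lambda>x::'a. c *\<^sub>R x) -` annulus (c * s) (c * t) = annulus s t"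
    using assms by (auto simp: annulus_def)
  finally show ?thesis .
qed

text \<open>Scale invariance normalizes the inner radius to \<open>1\<close>, and strict
  monotonicity in the outer radius then determines the quotient; this avoids polar
  coordinates.\<close>

lemma annulus_ratio:
  assumes "0 < a" "a < b" "0 < s" "s < t"
    and eq: "emeasure cyl_measure (annulus a b :: 'a::euclidean_space set) = emeasure cyl_measure (annulus s t :: 'a set)"
  shows "b / a = t / s"
proof -
  have "emeasure cyl_measure (annulus 1 (b / a) :: 'a set) = emeasure cyl_measure (annulus 1 (t / s) :: 'a set)"
    using annulus_measure_scale[of "1 / a" a b, where 'a='a] annulus_measure_scale[of "1 / s" s t, where 'a='a] eq assms by simp
  moreover have "1 < b / a" "1 < t / s" using assms by auto
  ultimately show ?thesis
    using annulus_measure_strict[of 1 "b / a" "t / s", where 'a='a] annulus_measure_strict[of 1 "t / s" "b / a", where 'a='a]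
    by (metis less_irrefl linorder_neqE_linordered_idom zero_less_one)
qed

context gauge_isometry
begin

text \<open>The radial profile \<open>r\<close> is continuous and, by radiality of \<open>G\<close>,
  injective, hence monotone. So preimages of rings under \<open>F\<close> are rings, and equal
  measures mean equal quotients of radii. Increasing profiles give multiples of
  \<open>norm x\<close>, decreasing ones multiples of its reciprocal.\<close>

lemma norm_F_cases:
  "\<exists>C>0. (\<forall>x. x \<noteq> 0 \<longrightarrow> norm (F x) = C * norm x) \<or> (\<forall>x. x \<noteq> 0 \<longrightarrow> norm (F x) = C / norm x)"
proof -
  obtain b :: 'a where b: "norm b = 1" using norm_Basis nonempty_Basis by blast
  define r where "r t = norm (F (t *\<^sub>R b))" for t
  have rn: "norm (F x) = r (norm x)" for x
    unfolding r_def by (rule norm_F_radial) (simp add: b)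
  have rpos: "r t > 0" if "t > 0" for t
  proof -
    have "b \<noteq> 0" using b by auto
    then show ?thesis unfolding r_def using F_nonzero[of "t *\<^sub>R b"] that by simp
  qed
  have inj: "inj_on r {0<..}"
  proof (rule inj_onI)
    fix s t assume st: "s \<in> {0<..}" "t \<in> {0<..}" "r s = r t"
    have "norm (G (F (s *\<^sub>R b))) = norm (G (F (t *\<^sub>R b)))"
      by (rule gauge_isometry.norm_F_radial[OF inverse_isometry]) (use st in \<open>simp add: r_def\<close>)
    then show "s = t" using st b by (simp add: GF)
  qed
  have "continuous_on {0<..} r" unfolding r_def
    by (intro continuous_on_norm continuous_on_compose2[OF contF] continuous_intros) (use b in auto)
  moreover have "is_interval {0::real<..}" by (auto simp: is_interval_1)
  ultimately have mono: "strict_mono_on {0<..} r \<or> strict_antimono_on {0<..} r"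
    using injective_eq_monotone_map inj by blast
  have pre: "emeasure cyl_measure (F -` S) = emeasure cyl_measure S" if "S \<in> sets borel" for S
  proof -
    have "emeasure cyl_measure S = emeasure (distr cyl_measure borel F) S" by (simp add: distr_F)
    also have "\<dots> = emeasure cyl_measure (F -` S)" using that by (subst emeasure_distr) auto
    finally show ?thesis by simp
  qed
  from mono show ?thesis
  proof
    assume m: "strict_mono_on {0<..} r"
    have lt: "r s < r t \<longleftrightarrow> s < t" if "0 < s" "0 < t" for s t
      using m that by (auto simp: strict_mono_on_less)
    have q: "r t / r s = t / s" if st: "0 < s" "s < t" for s t
    proof (rule annulus_ratio[where 'a='a])
      have "F -` annulus (r s) (r t) = annulus s t"
      proof (intro set_eqI)
        fix x show "x \<in> F -` annulus (r s) (r t) \<longleftrightarrow> x \<in> annulus s t"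
        proof (cases "x = 0")
          case True
          then show ?thesis using F0 st rpos[of s] by (auto simp: annulus_def)
        next
          case False
          then show ?thesis using lt[of s "norm x"] lt[of "norm x" t] st by (auto simp: annulus_def rn)
        qed
      qed
      then show "emeasure cyl_measure (annulus (r s) (r t) :: 'a set) = emeasure cyl_measure (annulus s t :: 'a set)"
        using pre[of "annulus (r s) (r t)"] by simp
    qed (use st rpos lt[of s t] in auto)
    have *: "r t = r 1 * t" if "t > 0" for t
      using q[of 1 t] q[of t 1] rpos[of 1] rpos[OF that] that
      by (cases t "1::real" rule: linorder_cases) (auto simp: field_simps)
    have "norm (F x) = r 1 * norm x" if "x \<noteq> 0" for x unfolding rn using that by (intro *) simp
    then have "\<forall>x. x \<noteq> 0 \<longrightarrow> norm (F x) = r 1 * norm x" by (intro allI impI)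
    then show ?thesis using rpos[OF zero_less_one] by (intro exI[of _ "r 1"] conjI disjI1)
  next
    assume m: "strict_antimono_on {0<..} r"
    have dec: "r t < r s" if "0 < s" "s < t" for s t
      using m that unfolding monotone_on_def by auto
    have lt: "r s < r t \<longleftrightarrow> t < s" if "0 < s" "0 < t" for s t
      using dec[of s t] dec[of t s] that by (cases s t rule: linorder_cases) auto
    have q: "r s / r t = t / s" if st: "0 < s" "s < t" for s t
    proof (rule annulus_ratio[where 'a='a])
      have "F -` annulus (r t) (r s) = annulus s t"
      proof (intro set_eqI)
        fix x show "x \<in> F -` annulus (r t) (r s) \<longleftrightarrow> x \<in> annulus s t"
        proof (cases "x = 0")
          case True
          then show ?thesis using F0 st rpos[of t] by (auto simp: annulus_def)
        next
          case False
          then show ?thesis using lt[of "norm x" s] lt[of t "norm x"] st by (auto simp: annulus_def rn)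
        qed
      qed
      then show "emeasure cyl_measure (annulus (r t) (r s) :: 'a set) = emeasure cyl_measure (annulus s t :: 'a set)"
        using pre[of "annulus (r t) (r s)"] by simp
    qed (use st rpos lt[of t s] in auto)
    have *: "r t = r 1 / t" if "t > 0" for t
      using q[of 1 t] q[of t 1] rpos[of 1] rpos[OF that] that
      by (cases t "1::real" rule: linorder_cases) (auto simp: field_simps)
    have "norm (F x) = r 1 / norm x" if "x \<noteq> 0" for x unfolding rn using that by (intro *) simp
    then have "\<forall>x. x \<noteq> 0 \<longrightarrow> norm (F x) = r 1 / norm x" by (intro allI impI)
    then show ?thesis using rpos[OF zero_less_one] by (intro exI[of _ "r 1"] conjI disjI2)
  qed
qed

end

subsection \<open>The spherical part\<close>

definition ang :: "'a::euclidean_space \<Rightarrow> 'a \<Rightarrow> real" where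
  "ang u v = arccos (u \<bullet> v)"

lemma unit_dot: "norm u = 1 \<Longrightarrow> norm v = 1 \<Longrightarrow> \<bar>u \<bullet> v\<bar> \<le> 1"
  using Cauchy_Schwarz_ineq2[of u v] by simp

lemma cos_ang: "norm u = 1 \<Longrightarrow> norm v = 1 \<Longrightarrow> cos (ang u v) = u \<bullet> v"
  unfolding ang_def by (rule cos_arccos_abs) (rule unit_dot)

lemma ang_bounds: "norm u = 1 \<Longrightarrow> norm v = 1 \<Longrightarrow> 0 \<le> ang u v" "norm u = 1 \<Longrightarrow> norm v = 1 \<Longrightarrow> ang u v \<le> pi"
  unfolding ang_def using unit_dot[of u v] by (auto intro!: arccos_lbound arccos_ubound)

text \<open>\<open>e\<close> is the normalized part of \<open>v\<close> orthogonal to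
  \<open>u\<close>; for \<open>v = u\<close> and \<open>v = - u\<close> that part vanishes and any
  orthogonal unit vector serves.\<close>

lemma exists_arc:
  fixes u v :: "'a::euclidean_space"
  assumes "2 \<le> DIM('a)" "norm u = 1" "norm v = 1"
  obtains e where "norm e = 1" "u \<bullet> e = 0" "v = cos (ang u v) *\<^sub>R u + sin (ang u v) *\<^sub>R e"
proof -
  define c s where "c = cos (ang u v)" and "s = sin (ang u v)"
  have c: "u \<bullet> v = c" using cos_ang[OF assms(2,3)] by (simp add: c_def)
  have cs: "c\<^sup>2 + s\<^sup>2 = 1" by (simp add: c_def s_def)
  have uu: "u \<bullet> u = 1" "v \<bullet> v = 1" using assms by (auto simp: dot_square_norm)
  have "(v - c *\<^sub>R u) \<bullet> (v - c *\<^sub>R u) = 1 - c\<^sup>2"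
    using uu c by (simp add: inner_diff_left inner_diff_right inner_commute power2_eq_square)
  then have d: "(norm (v - c *\<^sub>R u))\<^sup>2 = s\<^sup>2" using cs by (simp add: power2_norm_eq_inner)
  have s0: "s \<ge> 0" unfolding s_def using ang_bounds[OF assms(2,3)] by (intro sin_ge_zero)
  then have nd: "norm (v - c *\<^sub>R u) = s" using d by (simp add: power2_eq_iff_nonneg)
  show thesis
  proof (cases "s = 0")
    case True
    obtain e where "norm e = 1" "u \<bullet> e = 0" using exists_orthogonal_unit[OF assms(1)] by blast
    moreover have "v = c *\<^sub>R u + s *\<^sub>R e" using True nd by simp
    ultimately show thesis using that[of e] unfolding c_def s_def by blast
  next
    case False
    define e where "e = (1 / s) *\<^sub>R (v - c *\<^sub>R u)"
    have "norm e = 1" using nd False s0 by (simp add: e_def)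
    moreover have "u \<bullet> e = 0" using c uu by (simp add: e_def inner_diff_right)
    moreover have "v = c *\<^sub>R u + s *\<^sub>R e" using False by (simp add: e_def)
    ultimately show thesis using that[of e] by (simp add: c_def s_def)
  qed
qed

lemma arc_dot:
  fixes u e :: "'a::euclidean_space"
  assumes "norm u = 1" "norm e = 1" "u \<bullet> e = 0"
  shows "(cos s *\<^sub>R u + sin s *\<^sub>R e) \<bullet> (cos t *\<^sub>R u + sin t *\<^sub>R e) = cos (s - t)"
    and "norm (cos s *\<^sub>R u + sin s *\<^sub>R e) = 1"
proof -
  show *: "(cos s *\<^sub>R u + sin s *\<^sub>R e) \<bullet> (cos t *\<^sub>R u + sin t *\<^sub>R e) = cos (s - t)" for s t
    using assms by (simp add: inner_add_left inner_add_right inner_commute dot_square_norm cos_diff)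
  show "norm (cos s *\<^sub>R u + sin s *\<^sub>R e) = 1" using *[of s s] by (simp add: norm_eq_sqrt_inner)
qed

lemma ang_arc:
  fixes u e :: "'a::euclidean_space"
  assumes "norm u = 1" "norm e = 1" "u \<bullet> e = 0" "s \<le> t" "t - s \<le> pi"
  shows "ang (cos s *\<^sub>R u + sin s *\<^sub>R e) (cos t *\<^sub>R u + sin t *\<^sub>R e) = t - s"
proof -
  have "cos (s - t) = cos (t - s)" by (metis cos_minus minus_diff_eq)
  then show ?thesis unfolding ang_def using arc_dot(1)[OF assms(1-3), of s t] assms(4,5) by (simp add: arccos_cos)
qed

text \<open>For arcs that start at \<open>v\<close>, the spherical law of cosines writes
  \<open>u \<bullet> w\<close> as \<open>cos \<alpha> * cos \<beta> + sin \<alpha> * sin \<beta> *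
  (e \<bullet> e')\<close>, and \<open>e \<bullet> e' \<ge> -1\<close> bounds this below by
  \<open>cos (\<alpha> + \<beta>)\<close>.\<close>

lemma ang_triangle:
  fixes u v w :: "'a::euclidean_space"
  assumes "2 \<le> DIM('a)" "norm u = 1" "norm v = 1" "norm w = 1"
  shows "ang u w \<le> ang u v + ang v w"
proof (cases "ang u v + ang v w \<le> pi")
  case True
  define \<alpha> \<beta> where "\<alpha> = ang v u" and "\<beta> = ang v w"
  have \<alpha>: "ang u v = \<alpha>" by (simp add: \<alpha>_def ang_def inner_commute)
  obtain e where e: "norm e = 1" "v \<bullet> e = 0" "u = cos \<alpha> *\<^sub>R v + sin \<alpha> *\<^sub>R e"
    using exists_arc[OF assms(1,3,2)] unfolding \<alpha>_def by metis
  obtain e' where e': "norm e' = 1" "v \<bullet> e' = 0" "w = cos \<beta> *\<^sub>R v + sin \<beta> *\<^sub>R e'"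
    using exists_arc[OF assms(1,3,4)] unfolding \<beta>_def by metis
  have "u \<bullet> w = cos \<alpha> * cos \<beta> + sin \<alpha> * sin \<beta> * (e \<bullet> e')"
  proof -
    have z: "v \<bullet> v = 1" "e \<bullet> v = 0" using assms(3) e(2) by (auto simp: dot_square_norm inner_commute)
    show ?thesis unfolding e(3) e'(3) using z e'(2) by (simp add: inner_add_left inner_add_right)
  qed
  moreover have "0 \<le> sin \<alpha> * sin \<beta>"
    using ang_bounds[OF assms(3,2)] ang_bounds[OF assms(3,4)] by (auto simp: \<alpha>_def \<beta>_def intro!: mult_nonneg_nonneg sin_ge_zero)
  moreover have "-1 \<le> e \<bullet> e'" using unit_dot[OF e(1) e'(1)] by auto
  ultimately have "cos (\<alpha> + \<beta>) \<le> u \<bullet> w"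
    using mult_left_mono[of "-1" "e \<bullet> e'" "sin \<alpha> * sin \<beta>"] by (simp add: cos_add)
  then have "arccos (u \<bullet> w) \<le> arccos (cos (\<alpha> + \<beta>))"
    using unit_dot[OF assms(2,4)] by (intro arccos_le_arccos) auto
  also have "\<dots> = \<alpha> + \<beta>"
    using True ang_bounds[OF assms(3,2)] ang_bounds[OF assms(3,4)] \<alpha> by (intro arccos_cos) (auto simp: \<alpha>_def \<beta>_def)
  finally show ?thesis by (simp add: \<alpha> \<beta>_def ang_def[of u w])
next
  case False
  then show ?thesis using ang_bounds(2)[OF assms(2,4)] by linarith
qed

text \<open>A reflection takes \<open>u\<close> to \<open>u'\<close>. A second one corrects the
  image of \<open>v\<close>; its mirror contains \<open>u'\<close> because the inner products
  agree.\<close>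

lemma orthogonal_pair_transitive:
  fixes u v u' v' :: "'a::euclidean_space"
  assumes "norm u = norm u'" "norm v = norm v'" "u \<bullet> v = u' \<bullet> v'"
  obtains A where "orthogonal_transformation A" "A u = u'" "A v = v'"
proof -
  define B where "B = reflect (u - u')"
  define v1 where "v1 = B v"
  have oB: "orthogonal_transformation B" unfolding B_def by (rule orthogonal_reflect)
  have Bu: "B u = u'" unfolding B_def by (rule reflect_swap(1)[OF assms(1)])
  have "u' \<bullet> v1 = u' \<bullet> v'"
    using oB Bu assms(3) by (metis orthogonal_transformation_def v1_def)
  then have "(v1 - v') \<bullet> u' = 0" by (simp add: inner_diff_left inner_diff_right inner_commute)
  then have fixu: "reflect (v1 - v') u' = u'" by (rule reflect_orthogonal)
  have "norm v1 = norm v'" using orthogonal_transformation_norm[OF oB, of v] assms(2) by (simp add: v1_def)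
  then have "reflect (v1 - v') v1 = v'" by (rule reflect_swap(1))
  then have "(reflect (v1 - v') \<circ> B) v = v'" by (simp add: v1_def)
  moreover have "(reflect (v1 - v') \<circ> B) u = u'" using fixu Bu by simp
  moreover have "orthogonal_transformation (reflect (v1 - v') \<circ> B)"
    by (rule orthogonal_transformation_compose[OF orthogonal_reflect oB])
  ultimately show thesis using that by blast
qed

context invariant_gauge
begin

lemma E_dot:
  assumes "norm u = norm u'" "norm v = norm v'" "u \<bullet> v = u' \<bullet> v'"
  shows "(u, v) \<in> E k \<longleftrightarrow> (u', v') \<in> E k"
proof -
  obtain A where A: "orthogonal_transformation A" "A u = u'" "A v = v'"
    using orthogonal_pair_transitive[OF assms] by metis
  then show ?thesis using E_similarity_iff[of 1 A u v k] by simp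
qed

lemma E_scale: "c > 0 \<Longrightarrow> (c *\<^sub>R x, c *\<^sub>R y) \<in> E k \<longleftrightarrow> (x, y) \<in> E k"
  using E_similarity_iff[of c "\<lambda>x. x" x y k] orthogonal_transformation_id by simp

text \<open>By \<open>E_dot\<close> the membership of unit vectors depends on their angle only, and
  \<open>\<theta>\<close> is the smallest angle outside \<open>E k\<close>: it exists because
  \<open>E_half\<close> excludes antipodal points and is attained because \<open>E k\<close> is
  open. Larger angles might belong to \<open>E k\<close> again.\<close>

lemma angle_threshold:
  obtains \<theta> where "0 < \<theta>" "\<theta> \<le> pi"
    "\<And>u v. norm u = 1 \<Longrightarrow> norm v = 1 \<Longrightarrow> ang u v < \<theta> \<Longrightarrow> (u, v) \<in> E k"
    "\<And>u v. norm u = 1 \<Longrightarrow> norm v = 1 \<Longrightarrow> ang u v = \<theta> \<Longrightarrow> (u, v) \<notin> E k"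
proof -
  obtain b :: 'a where b: "norm b = 1" using norm_Basis nonempty_Basis by blast
  obtain e where e: "norm e = 1" "b \<bullet> e = 0" using exists_orthogonal_unit[OF dim] by metis
  define w where "w t = cos t *\<^sub>R b + sin t *\<^sub>R e" for t
  define T where "T = {0..pi} \<inter> (\<lambda>t. (b, w t)) -` (- E k)"
  have "closed T" unfolding T_def w_def
    by (intro continuous_closed_preimage continuous_intros) (use open_E in auto)
  moreover have piT: "pi \<in> T"
  proof -
    have "dist b (w pi) = 2"
    proof -
      have "b - w pi = 2 *\<^sub>R b" by (simp add: w_def scaleR_2)
      then show ?thesis using b by (simp add: dist_norm)
    qed
    then show ?thesis using E_half[of b "w pi" k] b by (auto simp: T_def)
  qed
  moreover have bb: "bdd_below T" unfolding T_def bdd_below_def by auto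
  ultimately have "Inf T \<in> T" by (intro closed_contains_Inf) auto
  define \<theta> where "\<theta> = Inf T"
  have \<theta>: "\<theta> \<in> T" using \<open>Inf T \<in> T\<close> by (simp add: \<theta>_def)
  have "w 0 = b" by (simp add: w_def)
  moreover have "(b, b) \<in> E k" using E_diag[of b k] b by force
  ultimately have "\<theta> \<noteq> 0" using \<theta> by (auto simp: T_def)
  then have \<theta>0: "0 < \<theta>" "\<theta> \<le> pi" using \<theta> by (auto simp: T_def)
  have tr: "(u, v) \<in> E k \<longleftrightarrow> (b, w (ang u v)) \<in> E k" if "norm u = 1" "norm v = 1" for u v
  proof (rule E_dot)
    show "norm v = norm (w (ang u v))" unfolding w_def using arc_dot(2)[OF b e] that by simp
    have "b \<bullet> w (ang u v) = cos (ang u v)" using b e by (simp add: w_def inner_add_right dot_square_norm)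
    then show "u \<bullet> v = b \<bullet> w (ang u v)" using cos_ang[OF that] by simp
  qed (use that b in simp)
  show thesis
  proof
    show "0 < \<theta>" "\<theta> \<le> pi" by (rule \<theta>0)+
    show "(u, v) \<in> E k" if "norm u = 1" "norm v = 1" "ang u v < \<theta>" for u v
    proof -
      have "ang u v \<notin> T" using cInf_lower[OF _ bb, of "ang u v"] that(3) by (auto simp: \<theta>_def)
      then show ?thesis using tr[OF that(1,2)] ang_bounds[OF that(1,2)] by (auto simp: T_def)
    qed
    show "(u, v) \<notin> E k" if "norm u = 1" "norm v = 1" "ang u v = \<theta>" for u v
      using tr[OF that(1,2)] \<theta> that(3) by (auto simp: T_def)
  qed
qed

text \<open>Nothing is known about angles beyond \<open>\<theta>\<close>, so continuity is used:
  along an arc shorter than \<open>\<theta>\<close> the image angle cannot pass the forbidden value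
  \<open>\<theta>\<close>. Cutting the arc from \<open>u\<close> to \<open>v\<close> into such
  pieces gives the bound up to an error \<open>\<theta>\<close>, which is arbitrarily small for
  large \<open>k\<close>.\<close>

lemma sphere_map_nonexpanding:
  assumes f1: "\<And>u. norm u = 1 \<Longrightarrow> norm (f u) = 1" and cf: "continuous_on (sphere 0 1) f"
    and pres: "\<And>k u v. norm u = 1 \<Longrightarrow> norm v = 1 \<Longrightarrow> (u, v) \<in> E k \<Longrightarrow> (f u, f v) \<in> E k"
    and uv: "norm u = 1" "norm v = 1"
  shows "ang (f u) (f v) \<le> ang u v"
proof (rule field_le_epsilon)
  fix \<epsilon> :: real assume \<epsilon>: "\<epsilon> > 0"
  define \<epsilon>1 where "\<epsilon>1 = min \<epsilon> (pi / 2)"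
  have \<epsilon>1: "0 < \<epsilon>1" "\<epsilon>1 \<le> \<epsilon>" "\<epsilon>1 < pi" using \<epsilon> pi_gt_zero by (auto simp: \<epsilon>1_def min_def)
  have c1: "cos \<epsilon>1 < 1" using cos_monotone_0_pi[of 0 \<epsilon>1] \<epsilon>1 by simp
  \<comment> \<open>The chord of an arc of angle \<open>\<epsilon>1\<close>: unit vectors at this
    angle are not in \<open>near \<eta>\<close>, which will force
    \<open>\<theta> \<le> \<epsilon>1\<close>.\<close>
  define \<eta> where "\<eta> = sqrt (2 - 2 * cos \<epsilon>1)"
  have \<eta>: "\<eta> > 0" using c1 by (simp add: \<eta>_def)
  obtain k where k: "E k \<subseteq> near \<eta>" using eventually_happens[OF E_shrink[OF \<eta>]] by auto
  obtain \<theta> where \<theta>: "0 < \<theta>" "\<theta> \<le> pi"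
    "\<And>u v. norm u = 1 \<Longrightarrow> norm v = 1 \<Longrightarrow> ang u v < \<theta> \<Longrightarrow> (u, v) \<in> E k"
    "\<And>u v. norm u = 1 \<Longrightarrow> norm v = 1 \<Longrightarrow> ang u v = \<theta> \<Longrightarrow> (u, v) \<notin> E k"
    using angle_threshold[of k] by blast
  have "\<theta> \<le> \<epsilon>1"
  proof (rule ccontr)
    assume "\<not> \<theta> \<le> \<epsilon>1"
    then have lt: "\<epsilon>1 < \<theta>" by simp
    obtain e where e: "norm e = 1" "u \<bullet> e = 0" using exists_orthogonal_unit[OF dim] by metis
    define w where "w = cos \<epsilon>1 *\<^sub>R u + sin \<epsilon>1 *\<^sub>R e"
    have w1: "norm w = 1" unfolding w_def by (rule arc_dot(2)[OF uv(1) e])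
    have uw: "u \<bullet> w = cos \<epsilon>1" using uv e by (simp add: w_def inner_add_right dot_square_norm)
    have "ang u w = \<epsilon>1" unfolding ang_def uw using \<epsilon>1 by (intro arccos_cos) auto
    then have "(u, w) \<in> near \<eta>" using \<theta>(3)[OF uv(1) w1] lt k by auto
    then have "norm (u - w) < \<eta>" using uv by (simp add: near_def dist_norm)
    then have "(norm (u - w))\<^sup>2 < \<eta>\<^sup>2" by (intro power_strict_mono) auto
    moreover have "(norm (u - w))\<^sup>2 = 2 - 2 * cos \<epsilon>1"
    proof -
      have "(u - w) \<bullet> (u - w) = u \<bullet> u - 2 * (u \<bullet> w) + w \<bullet> w" by (simp add: inner_diff_left inner_diff_right inner_commute)
      moreover have "u \<bullet> u = 1" "w \<bullet> w = 1" using uv w1 by (simp_all add: dot_square_norm)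
      ultimately show ?thesis using uw by (simp add: power2_norm_eq_inner)
    qed
    moreover have "\<eta>\<^sup>2 = 2 - 2 * cos \<epsilon>1" using c1 by (simp add: \<eta>_def)
    ultimately show False by simp
  qed
  have local_le: "ang (f p) (f q) < \<theta>" if pq: "norm p = 1" "norm q = 1" "ang p q < \<theta>" for p q
  proof (rule ccontr)
    assume "\<not> ang (f p) (f q) < \<theta>"
    then have big: "\<theta> \<le> ang (f p) (f q)" by simp
    define \<alpha> where "\<alpha> = ang p q"
    have \<alpha>: "0 \<le> \<alpha>" "\<alpha> < \<theta>" using ang_bounds[OF pq(1,2)] pq(3) by (auto simp: \<alpha>_def)
    obtain e where e: "norm e = 1" "p \<bullet> e = 0" "q = cos \<alpha> *\<^sub>R p + sin \<alpha> *\<^sub>R e"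
      using exists_arc[OF dim pq(1,2)] unfolding \<alpha>_def by metis
    define w where "w t = cos t *\<^sub>R p + sin t *\<^sub>R e" for t
    have w1: "norm (w t) = 1" for t unfolding w_def by (rule arc_dot(2)[OF pq(1) e(1,2)])
    have cw: "continuous_on {0..\<alpha>} (\<lambda>t. f (w t))"
      by (rule continuous_on_compose2[OF cf]) (use w1 in \<open>auto simp: w_def intro!: continuous_intros\<close>)
    have "continuous_on {0..\<alpha>} (\<lambda>t. ang (f p) (f (w t)))" unfolding ang_def
    proof (intro continuous_on_arccos continuous_on_inner continuous_on_const cw ballI)
      fix t show "- 1 \<le> f p \<bullet> f (w t) \<and> f p \<bullet> f (w t) \<le> 1"
        using unit_dot[OF f1[OF pq(1)] f1[OF w1[of t]]] by auto
    qed
    moreover have "ang (f p) (f (w 0)) \<le> \<theta>"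
    proof -
      have "f p \<bullet> f (w 0) = 1" using f1[OF pq(1)] by (simp add: w_def dot_square_norm)
      then show ?thesis using \<theta>(1) by (simp add: ang_def)
    qed
    moreover have "\<theta> \<le> ang (f p) (f (w \<alpha>))" using big e(3) by (simp add: w_def)
    ultimately obtain t where t: "t \<in> {0..\<alpha>}" "ang (f p) (f (w t)) = \<theta>"
      using IVT'[of "\<lambda>t. ang (f p) (f (w t))" 0 \<theta> \<alpha>] \<alpha> by auto
    have "ang p (w t) = t"
      using ang_arc[OF pq(1) e(1,2), of 0 t] t \<alpha> \<theta>(2) by (simp add: w_def)
    then have "(p, w t) \<in> E k" using \<theta>(3)[OF pq(1) w1[of t]] t \<alpha> by auto
    then have "(f p, f (w t)) \<in> E k" using pres pq(1) w1 by blast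
    then show False using \<theta>(4)[OF f1[OF pq(1)] f1[OF w1[of t]] t(2)] by simp
  qed
  define \<alpha> where "\<alpha> = ang u v"
  have \<alpha>: "0 \<le> \<alpha>" "\<alpha> \<le> pi" using ang_bounds[OF uv] by (auto simp: \<alpha>_def)
  obtain e where e: "norm e = 1" "u \<bullet> e = 0" "v = cos \<alpha> *\<^sub>R u + sin \<alpha> *\<^sub>R e"
    using exists_arc[OF dim uv] unfolding \<alpha>_def by metis
  \<comment> \<open>The least number of equal pieces with angle strictly below
    \<open>\<theta>\<close>, so that \<open>m * \<theta>\<close> exceeds \<open>\<alpha>\<close> by
    at most \<open>\<theta>\<close>.\<close>
  define m where "m = Suc (nat \<lfloor>\<alpha> / \<theta>\<rfloor>)"
  have m: "\<alpha> / real m < \<theta>" "real m * \<theta> \<le> \<alpha> + \<theta>"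
  proof -
    have fl: "real (nat \<lfloor>\<alpha> / \<theta>\<rfloor>) \<le> \<alpha> / \<theta>" "\<alpha> / \<theta> < real (nat \<lfloor>\<alpha> / \<theta>\<rfloor>) + 1"
      using \<alpha>(1) \<theta>(1) by (auto simp: of_nat_nat floor_correct)
    then show "\<alpha> / real m < \<theta>" "real m * \<theta> \<le> \<alpha> + \<theta>" using \<theta>(1) by (auto simp: m_def field_simps)
  qed
  define w where "w i = cos (real i * (\<alpha> / real m)) *\<^sub>R u + sin (real i * (\<alpha> / real m)) *\<^sub>R e" for i
  have w1: "norm (w i) = 1" for i unfolding w_def by (rule arc_dot(2)[OF uv(1) e(1,2)])
  have step: "ang (f (w i)) (f (w (Suc i))) < \<theta>" for i
  proof (rule local_le[OF w1 w1])
    have d: "real (Suc i) * (\<alpha> / real m) - real i * (\<alpha> / real m) = \<alpha> / real m"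
      by (simp only: of_nat_Suc distrib_right mult_1 add_diff_cancel_left' add_diff_cancel_right')
    have "0 \<le> \<alpha> / real m" using \<alpha> by simp
    then have "ang (w i) (w (Suc i)) = real (Suc i) * (\<alpha> / real m) - real i * (\<alpha> / real m)"
      unfolding w_def using d m(1) \<theta>(2) by (intro ang_arc[OF uv(1) e(1,2)]) linarith+
    also note d
    finally show "ang (w i) (w (Suc i)) < \<theta>" using m by simp
  qed
  have "ang (f (w 0)) (f (w i)) \<le> real i * \<theta>" for i
  proof (induction i)
    case 0
    then show ?case using f1[OF w1[of 0]] by (simp add: ang_def dot_square_norm)
  next
    case (Suc i)
    have "ang (f (w 0)) (f (w (Suc i))) \<le> ang (f (w 0)) (f (w i)) + ang (f (w i)) (f (w (Suc i)))"
      by (intro ang_triangle dim f1 w1)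
    then show ?case using Suc step[of i] by (simp add: algebra_simps)
  qed
  from this[of m] have "ang (f (w 0)) (f (w m)) \<le> real m * \<theta>" .
  moreover have "w 0 = u" by (simp add: w_def)
  moreover have "w m = v" using e(3) by (simp add: w_def m_def)
  ultimately show "ang (f u) (f v) \<le> ang u v + \<epsilon>"
    using m(2) \<open>\<theta> \<le> \<epsilon>1\<close> \<epsilon>1(2) by (simp add: \<alpha>_def)
qed

end

definition sphere_map :: "('a::euclidean_space \<Rightarrow> 'a) \<Rightarrow> real \<Rightarrow> 'a \<Rightarrow> 'a" where
  "sphere_map H r u = (1 / norm (H (r *\<^sub>R u))) *\<^sub>R H (r *\<^sub>R u)"

text \<open>If \<open>B\<close> to the power \<open>m\<close> moves every vector \<open>d\<close> by at most \<open>3/4 * norm d\<close>, then with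
  \<open>d = (B ^^ m) u - u\<close> the power \<open>2 * m\<close> moves \<open>u\<close> by at least \<open>5/4 * norm d\<close>.\<close>

lemma orthogonal_small_powers_id:
  fixes B :: "'a::euclidean_space \<Rightarrow> 'a"
  assumes B: "orthogonal_transformation B"
    and small: "\<And>m u. norm u = 1 \<Longrightarrow> norm ((B ^^ m) u - u) \<le> 3/4" and u: "norm u = 1"
  shows "B u = u"
proof -
  have lin: "linear (B ^^ m)" for m
    using B by (induction m) (auto simp: linear_compose orthogonal_transformation_linear linear_id[unfolded id_def] id_def)
  have small': "norm ((B ^^ m) d - d) \<le> 3/4 * norm d" for m d
  proof (cases "d = 0")
    case True
    then show ?thesis using linear_0[OF lin] by simp
  next
    case False
    have "(B ^^ m) d - d = norm d *\<^sub>R ((B ^^ m) ((1 / norm d) *\<^sub>R d) - (1 / norm d) *\<^sub>R d)"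
      using False by (simp add: linear_scale[OF lin] scaleR_diff_right)
    then have "norm ((B ^^ m) d - d) = norm d * norm ((B ^^ m) ((1 / norm d) *\<^sub>R d) - (1 / norm d) *\<^sub>R d)" by simp
    also have "\<dots> \<le> norm d * (3/4)" using False by (intro mult_left_mono small) auto
    finally show ?thesis by simp
  qed
  have grow: "(5/4) ^ j * norm (B u - u) \<le> norm ((B ^^ (2 ^ j)) u - u)" for j :: nat
  proof (induction j)
    case (Suc j)
    define m where "m = (2::nat) ^ j"
    define d where "d = (B ^^ m) u - u"
    have "(B ^^ (2 ^ Suc j)) u = (B ^^ m) ((B ^^ m) u)"
    proof -
      have "(2::nat) ^ Suc j = m + m" by (simp add: m_def)
      then show ?thesis by (simp add: funpow_add)
    qed
    then have "(B ^^ (2 ^ Suc j)) u - u = 2 *\<^sub>R d + ((B ^^ m) d - d)"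
      by (simp add: d_def linear_diff[OF lin] scaleR_2)
    then have "norm ((B ^^ (2 ^ Suc j)) u - u) \<ge> norm (2 *\<^sub>R d) - norm ((B ^^ m) d - d)"
      using norm_diff_ineq[of "2 *\<^sub>R d" "(B ^^ m) d - d"] by simp
    then have "norm ((B ^^ (2 ^ Suc j)) u - u) \<ge> 5/4 * norm d" using small'[of m d] by simp
    moreover have "(5/4) ^ j * norm (B u - u) \<le> norm d" using Suc by (simp add: d_def m_def)
    moreover have "(5/4) ^ Suc j * norm (B u - u) = 5/4 * ((5/4) ^ j * norm (B u - u))" by simp
    ultimately show ?case by linarith
  qed simp
  show ?thesis
  proof (rule ccontr)
    assume "B u \<noteq> u"
    then have pos: "norm (B u - u) > 0" by simp
    obtain j where "3/4 / norm (B u - u) < (5/4) ^ j" using real_arch_pow[of "5/4" "3/4 / norm (B u - u)"] by auto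
    then have "3/4 < (5/4) ^ j * norm (B u - u)" using pos by (simp add: pos_divide_less_eq)
    then show False using grow[of j] small[OF u, of "2 ^ j"] by linarith
  qed
qed

section \<open>Orthogonality on spheres and comparison of radii\<close>

context gauge_isometry
begin

lemma sphere_map_unit: "r > 0 \<Longrightarrow> norm u = 1 \<Longrightarrow> norm (sphere_map F r u) = 1"
  using F_nonzero[of "r *\<^sub>R u"] by (cases "u = 0") (auto simp: sphere_map_def)

lemma sphere_map_nonexpanding_F:
  assumes r: "r > 0" and uv: "norm u = 1" "norm v = 1"
  shows "ang (sphere_map F r u) (sphere_map F r v) \<le> ang u v"
proof (rule sphere_map_nonexpanding[OF _ _ _ uv])
  show "norm (sphere_map F r u) = 1" if "norm u = 1" for u by (rule sphere_map_unit[OF r that])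
  have nz: "r *\<^sub>R u \<noteq> 0" if "norm u = 1" for u :: 'a using r that by auto
  have c: "continuous_on (sphere 0 1) (\<lambda>u. F (r *\<^sub>R u))"
    by (rule continuous_on_compose2[OF contF]) (use nz in \<open>auto intro!: continuous_intros\<close>)
  show "continuous_on (sphere 0 1) (sphere_map F r)"
    unfolding sphere_map_def using nz F_nonzero by (intro continuous_intros c) auto
  show "(sphere_map F r u, sphere_map F r v) \<in> E k" if "norm u = 1" "norm v = 1" "(u, v) \<in> E k" for k u v
  proof -
    have "(r *\<^sub>R u, r *\<^sub>R v) \<in> E k" using that(3) E_scale[OF r] by simp
    then have "(F (r *\<^sub>R u), F (r *\<^sub>R v)) \<in> E k" using preserves by simp
    moreover have n: "norm (F (r *\<^sub>R u)) = norm (F (r *\<^sub>R v))" by (rule norm_F_radial) (use that in simp)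
    moreover have "0 < 1 / norm (F (r *\<^sub>R u))" using F_nonzero[OF nz[OF that(1)]] by simp
    ultimately show ?thesis unfolding sphere_map_def using E_scale by metis
  qed
qed

text \<open>\<open>G\<close> acts on the image sphere as the inverse map and is nonexpanding too, so
  inner products of unit vectors are preserved; an isometry of the unit sphere extends to an
  orthogonal map.\<close>

lemma sphere_map_orthogonal:
  assumes r: "r > 0"
  shows "\<exists>A. orthogonal_transformation A \<and> (\<forall>u. norm u = 1 \<longrightarrow> F (r *\<^sub>R u) = norm (F (r *\<^sub>R u)) *\<^sub>R A u)"
proof -
  obtain b :: 'a where b: "norm b = 1" using norm_Basis nonempty_Basis by blast
  define r' where "r' = norm (F (r *\<^sub>R b))"
  have nz: "r *\<^sub>R u \<noteq> 0" if "norm u = 1" for u :: 'a using r that by auto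
  have r': "norm (F (r *\<^sub>R u)) = r'" if "norm u = 1" for u
    unfolding r'_def by (rule norm_F_radial) (use that b in simp)
  have r'0: "r' > 0" using F_nonzero[OF nz[OF b]] by (simp add: r'_def)
  have inv: "sphere_map G r' (sphere_map F r u) = u" if "norm u = 1" for u
  proof -
    have "r' *\<^sub>R sphere_map F r u = F (r *\<^sub>R u)" using r'[OF that] r'0 by (simp add: sphere_map_def)
    then show ?thesis using that r by (simp add: sphere_map_def[of G] GF)
  qed
  have dot: "sphere_map F r u \<bullet> sphere_map F r v = u \<bullet> v" if uv: "norm u = 1" "norm v = 1" for u v
  proof -
    have "ang u v \<le> ang (sphere_map F r u) (sphere_map F r v)"
      using gauge_isometry.sphere_map_nonexpanding_F[OF inverse_isometry r'0
          sphere_map_unit[OF r uv(1)] sphere_map_unit[OF r uv(2)]] inv uv by simp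
    then have "ang (sphere_map F r u) (sphere_map F r v) = ang u v"
      using sphere_map_nonexpanding_F[OF r uv] by simp
    then show ?thesis using cos_ang[OF uv] cos_ang[OF sphere_map_unit[OF r uv(1)] sphere_map_unit[OF r uv(2)]] by simp
  qed
  have "\<exists>A. orthogonal_transformation A \<and> (\<forall>u. norm u = 1 \<longrightarrow> A u = sphere_map F r u)"
  proof (rule isometry_sphere_extend)
    show "norm (sphere_map F r x) = 1" if "norm x = 1" for x by (rule sphere_map_unit[OF r that])
    show "dist (sphere_map F r x) (sphere_map F r y) = dist x y" if xy: "norm x = 1" "norm y = 1" for x y
    proof -
      have sq: "(dist p q)\<^sup>2 = 2 - 2 * (p \<bullet> q)" if "norm p = 1" "norm q = 1" for p q :: 'a
      proof -
        have "(p - q) \<bullet> (p - q) = p \<bullet> p - 2 * (p \<bullet> q) + q \<bullet> q" by (simp add: inner_diff_left inner_diff_right inner_commute)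
        moreover have "p \<bullet> p = 1" "q \<bullet> q = 1" using that by (simp_all add: dot_square_norm)
        ultimately show ?thesis by (simp add: dist_norm power2_norm_eq_inner)
      qed
      have "(dist (sphere_map F r x) (sphere_map F r y))\<^sup>2 = (dist x y)\<^sup>2"
        using sq[OF xy] sq[OF sphere_map_unit[OF r xy(1)] sphere_map_unit[OF r xy(2)]] dot[OF xy] by simp
      then show ?thesis by (simp add: power2_eq_iff_nonneg)
    qed
  qed
  then obtain A where A: "orthogonal_transformation A" "\<forall>u. norm u = 1 \<longrightarrow> A u = sphere_map F r u" by blast
  have "F (r *\<^sub>R u) = norm (F (r *\<^sub>R u)) *\<^sub>R A u" if "norm u = 1" for u
    using A(2) that F_nonzero[OF nz[OF that]] by (simp add: sphere_map_def)
  then show ?thesis using A(1) by blast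
qed

text \<open>Membership depends on the norms and the inner product only. In the inverting case the
  radii \<open>r\<close> and \<open>s\<close> become proportional to \<open>s\<close> and
  \<open>r\<close>, and this symmetry restores the order.\<close>

lemma E_swap_radii:
  assumes "norm u = 1" "norm v = 1"
  shows "(r *\<^sub>R u, s *\<^sub>R v) \<in> E k \<longleftrightarrow> (s *\<^sub>R u, r *\<^sub>R v) \<in> E k"
proof -
  have "(r *\<^sub>R u, s *\<^sub>R v) \<in> E k \<longleftrightarrow> (r *\<^sub>R v, s *\<^sub>R u) \<in> E k"
    by (rule E_dot) (use assms in \<open>auto simp: inner_commute\<close>)
  then show ?thesis using E_sym by blast
qed

lemma rigidity:
  "\<exists>C A. C > 0 \<and> orthogonal_transformation A \<and>
    ((\<forall>x. x \<noteq> 0 \<longrightarrow> F x = C *\<^sub>R A x) \<or> (\<forall>x. x \<noteq> 0 \<longrightarrow> F x = (C / (norm x)\<^sup>2) *\<^sub>R A x))"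
proof -
  obtain C where C: "C > 0" "(\<forall>x. x \<noteq> 0 \<longrightarrow> norm (F x) = C * norm x) \<or> (\<forall>x. x \<noteq> 0 \<longrightarrow> norm (F x) = C / norm x)"
    using norm_F_cases by blast
  define R where "R = (\<lambda>r. if (\<forall>x. x \<noteq> 0 \<longrightarrow> norm (F x) = C * norm x) then C * r else C / r)"
  have nR: "norm (F x) = R (norm x)" if "x \<noteq> 0" for x using C(2) that by (auto simp: R_def)
  have R0: "R r > 0" if "r > 0" for r using C(1) that by (simp add: R_def)
  have "\<forall>r. \<exists>A. r > 0 \<longrightarrow> orthogonal_transformation A \<and> (\<forall>u. norm u = 1 \<longrightarrow> F (r *\<^sub>R u) = R r *\<^sub>R A u)"
  proof
    fix r :: real
    show "\<exists>A. r > 0 \<longrightarrow> orthogonal_transformation A \<and> (\<forall>u. norm u = 1 \<longrightarrow> F (r *\<^sub>R u) = R r *\<^sub>R A u)"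
    proof (cases "r > 0")
      case True
      obtain A where A: "orthogonal_transformation A" "\<forall>u. norm u = 1 \<longrightarrow> F (r *\<^sub>R u) = norm (F (r *\<^sub>R u)) *\<^sub>R A u"
        using sphere_map_orthogonal[OF True] by blast
      have "F (r *\<^sub>R u) = R r *\<^sub>R A u" if "norm u = 1" for u
      proof -
        have "u \<noteq> 0" using that by auto
        then have "norm (F (r *\<^sub>R u)) = R r" using nR[of "r *\<^sub>R u"] True that by simp
        then show ?thesis using A(2) that by metis
      qed
      then show ?thesis using A(1) by blast
    qed auto
  qed
  then obtain A where A: "\<And>r. r > 0 \<Longrightarrow> orthogonal_transformation (A r)"
      "\<And>r u. r > 0 \<Longrightarrow> norm u = 1 \<Longrightarrow> F (r *\<^sub>R u) = R r *\<^sub>R A r u"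
    by metis
  obtain \<zeta> where \<zeta>: "\<zeta> > 0" "near \<zeta> \<subseteq> E 0" using E_near by blast
  \<comment> \<open>\<open>B\<close> compares the orthogonal maps at the radii \<open>r\<close> and
    \<open>s\<close>. As \<open>F\<close> preserves \<open>E 0\<close>, replacing \<open>w\<close>
    by \<open>B w\<close> keeps \<open>(r *\<^sub>R u, s *\<^sub>R w)\<close> in \<open>E 0\<close>.
    Starting from \<open>w = u\<close>, all powers of \<open>B\<close> keep unit vectors close to
    themselves, which is possible only for the identity.\<close>
  have step: "A s u = A r u" if r: "r > 0" and s: "s > 0" "\<bar>s - r\<bar> < \<zeta> * r" and u: "norm u = 1" for r s u
  proof -
    define P where "P = inv (A r)"
    have oP: "orthogonal_transformation P" unfolding P_def by (rule orthogonal_transformation_inv[OF A(1)[OF r]])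
    have PA: "P (A r z) = z" for z unfolding P_def using orthogonal_transformation_inj[OF A(1)[OF r]] by simp
    define B where "B = P \<circ> A s"
    have oB: "orthogonal_transformation B" unfolding B_def
      by (rule orthogonal_transformation_compose[OF oP A(1)[OF s(1)]])
    have B1: "norm (B w) = norm w" for w using oB by (rule orthogonal_transformation_norm)
    have inv: "(r *\<^sub>R u, s *\<^sub>R B w) \<in> E 0" if uw: "norm u = 1" "norm w = 1" "(r *\<^sub>R u, s *\<^sub>R w) \<in> E 0" for u w
    proof -
      have "(F (r *\<^sub>R u), F (s *\<^sub>R w)) \<in> E 0" using uw(3) preserves by simp
      then have "(R r *\<^sub>R A r u, R s *\<^sub>R A s w) \<in> E 0" using A(2)[OF r uw(1)] A(2)[OF s(1) uw(2)] by simp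
      then have "(1 *\<^sub>R P (R r *\<^sub>R A r u), 1 *\<^sub>R P (R s *\<^sub>R A s w)) \<in> E 0" by (rule E_similarity[OF zero_less_one oP])
      then have *: "(R r *\<^sub>R u, R s *\<^sub>R B w) \<in> E 0"
        by (simp add: orthogonal_transformation_scaleR[OF oP] PA B_def)
      show ?thesis
      proof (cases "\<forall>x. x \<noteq> 0 \<longrightarrow> norm (F x) = C * norm x")
        case True
        then have "(C *\<^sub>R (r *\<^sub>R u), C *\<^sub>R (s *\<^sub>R B w)) \<in> E 0" using * by (simp add: R_def)
        then show ?thesis using E_scale[OF C(1)] by blast
      next
        case False
        then have Rr: "R r = C / r" "R s = C / s" unfolding R_def by auto
        have "(C / (r * s)) *\<^sub>R (s *\<^sub>R u) = R r *\<^sub>R u" "(C / (r * s)) *\<^sub>R (r *\<^sub>R B w) = R s *\<^sub>R B w"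
          using r s by (simp_all add: Rr)
        then have "((C / (r * s)) *\<^sub>R (s *\<^sub>R u), (C / (r * s)) *\<^sub>R (r *\<^sub>R B w)) \<in> E 0" using * by (simp only:)
        moreover have "C / (r * s) > 0" using C(1) r s by simp
        ultimately have "(s *\<^sub>R u, r *\<^sub>R B w) \<in> E 0" using E_scale by blast
        then show ?thesis using E_swap_radii[OF uw(1), of "B w"] B1[of w] uw(2) by simp
      qed
    qed
    have "norm ((B ^^ m) u - u) \<le> 3/4" if u: "norm u = 1" for m u
    proof -
      have Bm: "norm ((B ^^ m) u) = 1 \<and> (r *\<^sub>R u, s *\<^sub>R (B ^^ m) u) \<in> E 0" for m
      proof (induction m)
        case 0
        have "dist (r *\<^sub>R u) (s *\<^sub>R u) = \<bar>s - r\<bar>"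
          using u by (simp add: dist_norm scaleR_left_diff_distrib[symmetric] abs_minus_commute)
        then have "(r *\<^sub>R u, s *\<^sub>R u) \<in> near \<zeta>" using r s u by (auto simp: near_def)
        then show ?case using \<zeta>(2) u by auto
      next
        case (Suc m)
        then show ?case using inv[OF u] B1 by auto
      qed
      define w where "w = (B ^^ m) u"
      have w: "norm w = 1" "(r *\<^sub>R u, s *\<^sub>R w) \<in> E 0" using Bm[of m] by (auto simp: w_def)
      have "dist (r *\<^sub>R u) (s *\<^sub>R w) < r / 2" using E_half[OF w(2)] u r by simp
      then have "(norm (r *\<^sub>R u - s *\<^sub>R w))\<^sup>2 < (r / 2)\<^sup>2" unfolding dist_norm by (rule power_strict_mono) auto
      moreover have "(norm (r *\<^sub>R u - s *\<^sub>R w))\<^sup>2 = r\<^sup>2 + s\<^sup>2 - 2 * r * s * (u \<bullet> w)"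
      proof -
        have "(r *\<^sub>R u - s *\<^sub>R w) \<bullet> (r *\<^sub>R u - s *\<^sub>R w) = r\<^sup>2 * (u \<bullet> u) + s\<^sup>2 * (w \<bullet> w) - 2 * r * s * (u \<bullet> w)"
          by (simp add: inner_diff_left inner_diff_right inner_commute power2_eq_square)
        moreover have "u \<bullet> u = 1" "w \<bullet> w = 1" using u w(1) by (simp_all add: dot_square_norm)
        ultimately show ?thesis by (simp add: power2_norm_eq_inner)
      qed
      ultimately have "r\<^sup>2 * (3/4) + s\<^sup>2 < 2 * r * s * (u \<bullet> w)" by (simp add: power_divide)
      \<comment> \<open>Completing the square eliminates the radii and leaves
        \<open>u \<bullet> w > 3/4\<close>, so that the square of \<open>norm (w - u)\<close> is
        below \<open>1/2\<close>.\<close>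
      moreover have "3/2 * r * s \<le> r\<^sup>2 * (3/4) + s\<^sup>2"
      proof -
        have "0 \<le> (s - 3/4 * r)\<^sup>2 + 3/16 * r\<^sup>2" by simp
        then show ?thesis by (simp add: power2_eq_square algebra_simps)
      qed
      ultimately have "3/2 * (r * s) < 2 * (u \<bullet> w) * (r * s)" by (simp add: algebra_simps)
      then have uw: "3/4 < u \<bullet> w" using r s by (simp add: mult_less_cancel_right)
      have "(norm (w - u))\<^sup>2 = 2 - 2 * (u \<bullet> w)"
      proof -
        have "(w - u) \<bullet> (w - u) = u \<bullet> u - 2 * (u \<bullet> w) + w \<bullet> w" by (simp add: inner_diff_left inner_diff_right inner_commute)
        moreover have "u \<bullet> u = 1" "w \<bullet> w = 1" using u w(1) by (simp_all add: dot_square_norm)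
        ultimately show ?thesis by (simp add: power2_norm_eq_inner)
      qed
      then have "(norm (w - u))\<^sup>2 \<le> (3/4)\<^sup>2" using uw by (simp add: power2_eq_square)
      then show ?thesis unfolding w_def by (rule power2_le_imp_le) simp
    qed
    then have "B u = u" by (rule orthogonal_small_powers_id[OF oB _ u])
    then have "A r (P (A s u)) = A r u" by (simp add: B_def)
    moreover have "A r (P z) = z" for z unfolding P_def
      using orthogonal_transformation_surj[OF A(1)[OF r]] by (simp add: surj_f_inv_f)
    ultimately show ?thesis by simp
  qed
  have const: "A t u = A 1 u" if t: "t > 0" and u: "norm u = 1" for t u
  proof -
    \<comment> \<open>The radii \<open>1\<close> and \<open>t\<close> are joined by the powers of
      \<open>q = root n t\<close>, whose consecutive quotients are close to \<open>1\<close>, so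
      that \<open>step\<close> applies \<open>n\<close> times.\<close>
    have "(\<lambda>n. root n t) \<longlonglongrightarrow> 1" by (rule LIMSEQ_root_const[OF t])
    then have "\<forall>\<^sub>F n in sequentially. dist (root n t) 1 < \<zeta>" using \<zeta>(1) by (rule tendstoD)
    then have "\<forall>\<^sub>F n in sequentially. dist (root n t) 1 < \<zeta> \<and> n > 0"
      using eventually_gt_at_top[of 0] by eventually_elim auto
    then obtain n where n: "dist (root n t) 1 < \<zeta>" "n > 0" using eventually_happens by fastforce
    define q where "q = root n t"
    have q: "q > 0" "q ^ n = t" "\<bar>q - 1\<bar> < \<zeta>" using n t by (auto simp: q_def dist_real_def)
    have "A (q ^ i) u = A 1 u" for i
    proof (induction i)
      case (Suc i)
      have "\<bar>q ^ Suc i - q ^ i\<bar> = \<bar>q - 1\<bar> * q ^ i"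
      proof -
        have "q ^ Suc i - q ^ i = (q - 1) * q ^ i" by (simp add: algebra_simps)
        then show ?thesis using q(1) by (simp add: abs_mult)
      qed
      also have "\<dots> < \<zeta> * q ^ i" using q by (intro mult_strict_right_mono) auto
      finally have "A (q ^ Suc i) u = A (q ^ i) u" using q(1) u by (intro step) auto
      then show ?case using Suc by simp
    qed simp
    from this[of n] show ?thesis using q(2) by simp
  qed
  have form: "F x = R (norm x) *\<^sub>R (1 / norm x) *\<^sub>R A 1 x" if x: "x \<noteq> 0" for x
  proof -
    define u where "u = (1 / norm x) *\<^sub>R x"
    have u: "norm u = 1" "x = norm x *\<^sub>R u" using x by (auto simp: u_def)
    have "F x = R (norm x) *\<^sub>R A (norm x) u" using A(2)[of "norm x" u] x u by simp
    also have "A (norm x) u = A 1 u" by (rule const) (use x u in auto)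
    also have "A 1 u = (1 / norm x) *\<^sub>R A 1 x"
      unfolding u_def by (rule orthogonal_transformation_scaleR[OF A(1)]) simp
    finally show ?thesis .
  qed
  show ?thesis
  proof (intro exI[of _ C] exI[of _ "A 1"] conjI)
    show "C > 0" by fact
    show "orthogonal_transformation (A 1)" by (rule A(1)) simp
    show "(\<forall>x. x \<noteq> 0 \<longrightarrow> F x = C *\<^sub>R A 1 x) \<or> (\<forall>x. x \<noteq> 0 \<longrightarrow> F x = (C / (norm x)\<^sup>2) *\<^sub>R A 1 x)"
    proof (cases "\<forall>x. x \<noteq> 0 \<longrightarrow> norm (F x) = C * norm x")
      case True
      then have "F x = C *\<^sub>R A 1 x" if "x \<noteq> 0" for x using form[OF that] that by (simp add: R_def)
      then show ?thesis by blast
    next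
      case False
      then have "R = (\<lambda>r. C / r)" unfolding R_def by (subst if_not_P) auto
      then have "F x = (C / (norm x)\<^sup>2) *\<^sub>R A 1 x" if "x \<noteq> 0" for x
        using form[OF that] that by (simp add: power2_eq_square)
      then show ?thesis by blast
    qed
  qed
qed

end

section \<open>Images of punctured space under isometries\<close>

subsection \<open>Convergence in the extended space\<close>

text \<open>Neighbourhood bases of finite points and of infinity, chosen so that in dimension at
  least \<open>2\<close> the complements are connected, as the separation argument for spheres
  requires.\<close>

definition ext_nbhds :: "'a::euclidean_space option \<Rightarrow> 'a set set" where
  "ext_nbhds p = (case p of None \<Rightarrow> {- cball 0 R | R. True} | Some e \<Rightarrow> {ball e \<epsilon> | \<epsilon>. \<epsilon> > 0})"

definition ext_tendsto :: "(nat \<Rightarrow> 'a::euclidean_space) \<Rightarrow> 'a option \<Rightarrow> bool" where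
  "ext_tendsto x p \<longleftrightarrow> (\<forall>V\<in>ext_nbhds p. \<forall>\<^sub>F k in sequentially. x k \<in> V)"

lemma ext_nbhds_Some [simp]: "ext_nbhds (Some e) = {ball e \<epsilon> | \<epsilon>. \<epsilon> > 0}"
  and ext_nbhds_None [simp]: "ext_nbhds None = {- cball 0 R | R. True}"
  by (simp_all add: ext_nbhds_def)

lemma ext_tendsto_Some: "ext_tendsto x (Some e) \<longleftrightarrow> x \<longlonglongrightarrow> e"
proof
  assume "ext_tendsto x (Some e)"
  then have "\<forall>\<^sub>F k in sequentially. x k \<in> ball e \<epsilon>" if "\<epsilon> > 0" for \<epsilon> using that by (auto simp: ext_tendsto_def)
  then show "x \<longlonglongrightarrow> e" by (auto intro!: tendstoI simp: dist_commute)
next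
  assume "x \<longlonglongrightarrow> e"
  then show "ext_tendsto x (Some e)" by (auto simp: ext_tendsto_def dist_commute dest: tendstoD)
qed

lemma ext_tendsto_None: "ext_tendsto x None \<longleftrightarrow> (\<forall>R. \<forall>\<^sub>F k in sequentially. R < norm (x k))"
proof -
  have "ext_tendsto x None \<longleftrightarrow> (\<forall>R. \<forall>\<^sub>F k in sequentially. x k \<in> - cball 0 R)"
    unfolding ext_tendsto_def ext_nbhds_None by blast
  then show ?thesis by (simp add: not_le)
qed

lemma ext_tendsto_subseq:
  assumes "ext_tendsto x p" "strict_mono r" shows "ext_tendsto (x \<circ> r) p"
  unfolding ext_tendsto_def
proof
  fix V assume "V \<in> ext_nbhds p"
  then have "\<forall>\<^sub>F k in sequentially. x k \<in> V" using assms(1) by (simp add: ext_tendsto_def)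
  from eventually_subseq[OF assms(2) this] show "\<forall>\<^sub>F k in sequentially. (x \<circ> r) k \<in> V" by simp
qed

lemma ext_nbhds_disjoint:
  assumes "p \<noteq> q"
  obtains V W where "V \<in> ext_nbhds p" "W \<in> ext_nbhds q" "V \<inter> W = {}"
proof -
  have mixed: "ball e 1 \<inter> - cball 0 (norm e + 1) = {}" for e :: 'a
  proof -
    have False if "dist e z < 1" "norm e + 1 < norm z" for z
      using that norm_triangle_ineq[of e "z - e"] by (simp add: dist_norm norm_minus_commute)
    then show ?thesis by fastforce
  qed
  show thesis
  proof (cases p)
    case None
    then obtain e where "q = Some e" using assms by (cases q) auto
    then show thesis using None mixed[of e] by (intro that[of "- cball 0 (norm e + 1)" "ball e 1"]) auto
  next
    case (Some e)
    show thesis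
    proof (cases q)
      case None
      then show thesis using Some mixed[of e] by (intro that[of "ball e 1" "- cball 0 (norm e + 1)"]) auto
    next
      case (Some e')
      have d: "dist e e' > 0" using Some \<open>p = Some e\<close> assms by auto
      have "ball e (dist e e' / 2) \<inter> ball e' (dist e e' / 2) = {}" by (rule disjoint_ballI) simp
      then show thesis using Some \<open>p = Some e\<close> d by (intro that[of "ball e (dist e e' / 2)" "ball e' (dist e e' / 2)"]) auto
    qed
  qed
qed

lemma ext_tendsto_unique:
  assumes "ext_tendsto x p" "ext_tendsto x q" shows "p = q"
proof (rule ccontr)
  assume "p \<noteq> q"
  then obtain V W where VW: "V \<in> ext_nbhds p" "W \<in> ext_nbhds q" "V \<inter> W = {}" by (rule ext_nbhds_disjoint)
  have "\<forall>\<^sub>F k in sequentially. x k \<in> V" "\<forall>\<^sub>F k in sequentially. x k \<in> W" using assms VW by (auto simp: ext_tendsto_def)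
  then have "\<forall>\<^sub>F k in sequentially. x k \<in> V \<inter> W" by eventually_elim simp
  then show False using VW(3) by simp
qed

lemma frequently_subseq:
  assumes "\<exists>\<^sub>F k in sequentially. P k"
  shows "\<exists>r :: nat \<Rightarrow> nat. strict_mono r \<and> (\<forall>k. P (r k))"
proof -
  have inf: "infinite {k. P k}" using assms by (simp add: frequently_cofinite cofinite_eq_sequentially[symmetric])
  show ?thesis
    by (rule exI[of _ "enumerate {k. P k}"]) (use strict_mono_enumerate[OF inf] enumerate_in_set[OF inf] in auto)
qed

text \<open>Sequential compactness of the extended space: a sequence that does not tend to infinity
  has a bounded subsequence.\<close>

lemma ext_subseq:
  fixes x :: "nat \<Rightarrow> 'a::euclidean_space"
  obtains r p where "strict_mono (r :: nat \<Rightarrow> nat)" "ext_tendsto (x \<circ> r) p"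
proof (cases "ext_tendsto x None")
  case True
  then show thesis using that[of id None] by (simp add: strict_mono_id)
next
  case False
  then obtain R where "\<exists>\<^sub>F k in sequentially. \<not> R < norm (x k)"
    unfolding ext_tendsto_None by (auto simp: frequently_def)
  from frequently_subseq[OF this] obtain r :: "nat \<Rightarrow> nat" where r: "strict_mono r" "\<forall>k. \<not> R < norm (x (r k))" by blast
  have "\<forall>k. (x \<circ> r) k \<in> cball 0 R" using r(2) by (auto simp: not_less)
  then obtain l r' where "strict_mono r'" "((x \<circ> r) \<circ> r') \<longlonglongrightarrow> l"
    using compact_cball[of "0::'a" R] unfolding compact_def by blast
  then show thesis
    using that[of "r \<circ> r'" "Some l"] r(1) by (simp add: strict_mono_o ext_tendsto_Some comp_assoc)
qed

lemma not_ext_tendsto: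
  fixes x :: "nat \<Rightarrow> 'a::euclidean_space"
  assumes "\<not> ext_tendsto x q"
  obtains r q' where "strict_mono (r :: nat \<Rightarrow> nat)" "ext_tendsto (x \<circ> r) q'" "q' \<noteq> q"
proof -
  obtain V where V: "V \<in> ext_nbhds q" "\<exists>\<^sub>F k in sequentially. \<not> x k \<in> V"
    using assms unfolding ext_tendsto_def by (auto simp: frequently_def)
  obtain r :: "nat \<Rightarrow> nat" where r: "strict_mono r" "\<forall>k. \<not> x (r k) \<in> V" using frequently_subseq[OF V(2)] by blast
  obtain r' q' where r': "strict_mono r'" "ext_tendsto ((x \<circ> r) \<circ> r') q'" by (rule ext_subseq[of "x \<circ> r"])
  have "q' \<noteq> q"
  proof
    assume "q' = q"
    then have "\<forall>\<^sub>F k in sequentially. ((x \<circ> r) \<circ> r') k \<in> V" using r'(2) V(1) by (simp add: ext_tendsto_def)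
    then show False using r(2) by simp
  qed
  then show thesis using that[of "r \<circ> r'" q'] r r' by (simp add: strict_mono_o comp_assoc)
qed

lemma ext_nbhds_avoid:
  assumes "V \<in> ext_nbhds q" "Some w \<noteq> q"
  obtains V' where "V' \<in> ext_nbhds q" "V' \<subseteq> V" "w \<notin> V'"
proof (cases q)
  case None
  then obtain R where R: "V = - cball 0 R" using assms by auto
  show thesis by (rule that[of "- cball 0 (max R (norm w))"]) (auto simp: None R)
next
  case (Some e)
  then obtain \<epsilon> where \<epsilon>: "V = ball e \<epsilon>" "\<epsilon> > 0" using assms by auto
  have "dist e w > 0" using assms Some by auto
  then show thesis by (intro that[of "ball e (min \<epsilon> (dist e w))"]) (use \<epsilon> in \<open>auto simp: Some\<close>)
qed

lemma connected_Compl_ext_nbhd: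
  fixes V :: "'a::euclidean_space set"
  assumes "2 \<le> DIM('a)" "V \<in> ext_nbhds q"
  shows "connected (- V)"
proof (cases q)
  case None
  then show ?thesis using assms(2) by (auto intro!: convex_connected)
next
  case (Some e)
  then show ?thesis using assms by (auto intro!: connected_complement_bounded_convex)
qed

subsection \<open>Small values of the modulus metric near the boundary\<close>

text \<open>The bound of \<open>modulus_ring\<close> is at most \<open>K / N\<close> for
  \<open>n \<ge> 2\<close>, so one number of dyadic rings works for all domains and centres. The
  curve from \<open>u\<close> is the segment towards \<open>e\<close>, stopped at the
  boundary.\<close>

lemma lambda_metric_ring:
  fixes D :: "(real^'n) set"
  assumes n: "CARD('n) \<ge> 2"
  obtains N :: nat where "\<And>(D :: (real^'n) set) u v e C. open D \<Longrightarrow> u \<in> D \<Longrightarrow> e \<notin> D \<Longrightarrow> C \<in> boundary_curves D v \<Longrightarrow>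
    (\<And>z. z \<in> C \<Longrightarrow> 2 ^ N * dist u e \<le> dist z e) \<Longrightarrow> lambda_metric D u v < 1"
proof -
  define K where "K = unit_ball_vol (real CARD('n)) * 2 ^ CARD('n)"
  have K: "K > 0" by (simp add: K_def)
  obtain N where N: "K < real N" using reals_Archimedean2 by blast
  have N0: "N > 0" using N K by (cases N) auto
  have bound: "K * real N * (1 / real N) ^ CARD('n) < 1"
  proof -
    have "(1 / real N) ^ CARD('n) \<le> (1 / real N) ^ 2" using n N0 by (intro power_decreasing) auto
    then have "K * real N * (1 / real N) ^ CARD('n) \<le> K * real N * (1 / real N) ^ 2"
      using K by (intro mult_left_mono) auto
    also have "\<dots> = K / real N" using N0 by (simp add: power2_eq_square)
    also have "\<dots> < 1" using N N0 by simp
    finally show ?thesis .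
  qed
  show thesis
  proof (rule that[of N])
    fix D :: "(real^'n) set" and u v e C
    assume D: "open D" "u \<in> D" "e \<notin> D" and C: "C \<in> boundary_curves D v"
      and far: "\<And>z. z \<in> C \<Longrightarrow> 2 ^ N * dist u e \<le> dist z e"
    obtain Cu where Cu: "Cu \<in> boundary_curves D u" "Cu \<subseteq> closed_segment u e"
      using boundary_curve_towards[OF D] by blast
    have "lambda_metric D u v \<le> modulus (joining_curves Cu C D)" by (rule lambda_metric_le[OF Cu(1) C])
    also have "\<dots> \<le> ennreal (unit_ball_vol (real CARD('n)) * 2 ^ CARD('n) * real N * (1 / real N) ^ CARD('n))"
    proof (rule modulus_ring[OF N0 _ _ far])
      show "0 < dist u e" using D by auto
      show "dist x e \<le> dist u e" if "x \<in> Cu" for x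
        using Cu(2) that segment_bound(1)[of x e u] by (auto simp: dist_norm closed_segment_commute norm_minus_commute)
    qed
    also have "\<dots> < 1" using bound ennreal_lessI[of 1 "K * real N * (1 / real N) ^ CARD('n)"]
      unfolding K_def by (simp flip: ennreal_1)
    finally show "lambda_metric D u v < 1" .
  qed
qed

text \<open>Of two different limits at least one is a finite point \<open>e\<close>, and the metric
  is symmetric, so rings around \<open>e\<close> suffice: one curve runs straight towards
  \<open>e\<close>, the other towards its own finite limit or radially outward, which keeps it far
  from \<open>e\<close>.\<close>

lemma lambda_metric_boundary_small:
  fixes D :: "(real^'n) set"
  assumes n: "CARD('n) \<ge> 2" and D: "open D" and uv: "\<And>k. u k \<in> D" "\<And>k. v k \<in> D"
    and lim: "ext_tendsto u p" "ext_tendsto v q" "p \<noteq> q" "p \<notin> Some ` D" "q \<notin> Some ` D"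
  shows "\<forall>\<^sub>F k in sequentially. lambda_metric D (u k) (v k) < 1"
proof -
  obtain N :: nat where N: "\<And>(D :: (real^'n) set) u v e C. open D \<Longrightarrow> u \<in> D \<Longrightarrow> e \<notin> D \<Longrightarrow> C \<in> boundary_curves D v \<Longrightarrow>
    (\<And>z. z \<in> C \<Longrightarrow> 2 ^ N * dist u e \<le> dist z e) \<Longrightarrow> lambda_metric D u v < 1"
    using lambda_metric_ring[OF n] by metis
  have fin: "\<forall>\<^sub>F k in sequentially. lambda_metric D (u k) (v k) < 1"
    if uv: "\<And>k. u k \<in> D" "\<And>k. v k \<in> D" and u: "u \<longlonglongrightarrow> e" and v: "ext_tendsto v q"
      and eq: "q \<noteq> Some e" "e \<notin> D" "q \<notin> Some ` D" for u v :: "nat \<Rightarrow> real^'n" and e q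
  proof (cases q)
    case None
    have "(\<lambda>k. 2 ^ N * dist (u k) e) \<longlonglongrightarrow> 2 ^ N * 0"
      using u by (intro tendsto_mult tendsto_const) (simp add: tendsto_dist_iff[symmetric])
    from order_tendstoD(2)[OF this, of 1] have "\<forall>\<^sub>F k in sequentially. 2 ^ N * dist (u k) e < 1" by simp
    moreover have "\<forall>\<^sub>F k in sequentially. norm e + 1 < norm (v k)" using v None by (simp add: ext_tendsto_None)
    ultimately show ?thesis
    proof eventually_elim
      case (elim k)
      have "v k \<noteq> 0"
      proof
        assume "v k = 0"
        then show False using elim(2) norm_ge_zero[of e] by simp
      qed
      then obtain C where C: "C \<in> boundary_curves D (v k)" "C \<subseteq> (\<lambda>s. s *\<^sub>R v k) ` {1..}"
        using boundary_curve_outward[OF D uv(2)] by blast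
      show ?case
      proof (rule N[OF D uv(1) eq(2) C(1)])
        fix z assume "z \<in> C"
        then obtain s where s: "z = s *\<^sub>R v k" "1 \<le> s" using C(2) by auto
        have "norm (v k) \<le> norm z" using s mult_right_mono[of 1 s "norm (v k)"] by simp
        moreover have "norm z - norm e \<le> dist z e" unfolding dist_norm by (rule norm_triangle_ineq2)
        ultimately show "2 ^ N * dist (u k) e \<le> dist z e" using elim by linarith
      qed
    qed
  next
    case (Some e')
    define d where "d = dist e e'"
    have d: "d > 0" using eq(1) Some by (auto simp: d_def)
    have e': "e' \<notin> D" using eq(3) Some by auto
    have "(\<lambda>k. 2 ^ N * dist (u k) e) \<longlonglongrightarrow> 2 ^ N * 0"
      using u by (intro tendsto_mult tendsto_const) (simp add: tendsto_dist_iff[symmetric])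
    from order_tendstoD(2)[OF this, of "d / 2"] have "\<forall>\<^sub>F k in sequentially. 2 ^ N * dist (u k) e < d / 2" using d by simp
    moreover have "\<forall>\<^sub>F k in sequentially. dist (v k) e' < d / 2"
      using v Some d by (intro tendstoD) (auto simp: ext_tendsto_Some)
    ultimately show ?thesis
    proof eventually_elim
      case (elim k)
      obtain C where C: "C \<in> boundary_curves D (v k)" "C \<subseteq> closed_segment (v k) e'"
        using boundary_curve_towards[OF D uv(2) e'] by blast
      show ?case
      proof (rule N[OF D uv(1) eq(2) C(1)])
        fix z assume "z \<in> C"
        then have "dist z e' \<le> dist (v k) e'"
          using C(2) segment_bound(1)[of z e' "v k"] by (auto simp: dist_norm closed_segment_commute norm_minus_commute)
        moreover have "d \<le> dist z e + dist z e'" unfolding d_def by (metis dist_commute dist_triangle2 add.commute)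
        ultimately show "2 ^ N * dist (u k) e \<le> dist z e" using elim by linarith
      qed
    qed
  qed
  show ?thesis
  proof (cases p)
    case (Some e)
    then show ?thesis
      by (intro fin[of u v e q]) (use uv lim in \<open>auto simp: ext_tendsto_Some\<close>)
  next
    case None
    then obtain e where e: "q = Some e" using lim(3) by (cases q) auto
    have "\<forall>\<^sub>F k in sequentially. lambda_metric D (v k) (u k) < 1"
      by (intro fin[of v u e p]) (use uv lim e None in \<open>auto simp: ext_tendsto_Some\<close>)
    then show ?thesis by (simp add: lambda_metric_commute)
  qed
qed

subsection \<open>The modulus metric of punctured space\<close>

lemma lambda_metric_punctured_bound:
  fixes x y :: "real^'n"
  assumes "x \<noteq> 0" "y \<noteq> 0" "0 < \<eta>" "\<eta> * norm x \<le> dist x y"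
  shows "lambda_metric (UNIV - {0}) x y \<le> ennreal (unit_ball_vol (real CARD('n)) * ((2 + \<eta>) / \<eta>) ^ CARD('n))"
proof (cases "norm x \<le> norm y")
  case True
  then show ?thesis using lambda_metric_punctured_le assms by blast
next
  case False
  then have "\<eta> * norm y \<le> \<eta> * norm x" using assms(3) by (intro mult_left_mono) auto
  then have "\<eta> * norm y \<le> dist y x" using assms(4) by (simp add: dist_commute)
  then show ?thesis using lambda_metric_punctured_le[of y x \<eta>] assms False by (simp add: lambda_metric_commute)
qed

lemma lambda_metric_punctured_similarity:
  fixes A :: "real^'n \<Rightarrow> real^'n"
  assumes "c > 0" "orthogonal_transformation A"
  shows "lambda_metric (UNIV - {0}) (c *\<^sub>R A x) (c *\<^sub>R A y) = lambda_metric (UNIV - {0}) x y"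
proof -
  have s: "similarity c (\<lambda>x. c *\<^sub>R A x)" by (rule similarity_scaled_orthogonal[OF assms])
  have 0: "c *\<^sub>R A 0 = 0" using linear_0[OF orthogonal_transformation_linear[OF assms(2)]] by simp
  have "(\<lambda>x. c *\<^sub>R A x) ` (UNIV - {0}) = UNIV - {0}"
    using similarity_bij[OF s] 0 by (metis bij_def image_set_diff image_insert image_empty)
  moreover have "open (UNIV - {0} :: (real^'n) set)" by auto
  ultimately show ?thesis using lambda_metric_similarity[OF s, of "UNIV - {0}" x y] by simp
qed

text \<open>The radius in \<open>lambda_metric_blow_up\<close> depends on the point; homogeneity
  carries the one found at \<open>b\<close> to all points, as a relative radius.\<close>

lemma lambda_metric_punctured_near:
  assumes n: "CARD('n) \<ge> 2"
  shows "\<exists>\<zeta>>0. \<forall>(x :: real^'n) y. (x, y) \<in> near \<zeta> \<longrightarrow> ennreal M \<le> lambda_metric (UNIV - {0}) x y"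
proof -
  obtain b :: "real^'n" where b: "norm b = 1" using norm_Basis nonempty_Basis by blast
  then have b0: "b \<noteq> 0" by auto
  obtain e where e: "e > 0" "\<forall>y\<in>UNIV - {0}. dist y b < e \<longrightarrow> ennreal M \<le> lambda_metric (UNIV - {0}) b y"
    using lambda_metric_blow_up[OF n, of "UNIV - {0}" b M] b0 by auto
  have "ennreal M \<le> lambda_metric (UNIV - {0}) x y" if xy: "(x, y) \<in> near e" for x y :: "real^'n"
  proof -
    have nz: "x \<noteq> 0" "y \<noteq> 0" and d: "dist x y < e * norm x" using xy by (auto simp: near_def)
    obtain c and A :: "real^'n \<Rightarrow> real^'n" where cA: "c > 0" "orthogonal_transformation A" "c *\<^sub>R A b = x"
      using exists_scaled_orthogonal[OF b0 nz(1)] by metis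
    have s: "similarity c (\<lambda>x. c *\<^sub>R A x)" by (rule similarity_scaled_orthogonal[OF cA(1,2)])
    then obtain y' where y': "y = c *\<^sub>R A y'" unfolding similarity_def surj_def by blast
    have "norm x = c" using cA b orthogonal_transformation_norm[OF cA(2), of b] by auto
    moreover have "dist x y = c * dist b y'" using s cA(3) y' unfolding similarity_def by metis
    ultimately have "dist y' b < e" using d cA(1) by (simp add: dist_commute)
    moreover have "y' \<noteq> 0" using nz(2) y' linear_0[OF orthogonal_transformation_linear[OF cA(2)]] by auto
    ultimately have "ennreal M \<le> lambda_metric (UNIV - {0}) b y'" using e(2) by auto
    also have "\<dots> = lambda_metric (UNIV - {0}) x y"
      using lambda_metric_punctured_similarity[OF cA(1,2), of b y'] cA(3) y' by simp
    finally show ?thesis .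
  qed
  then show ?thesis using e(1) by blast
qed

subsection \<open>The image is a punctured space\<close>

locale punctured_isometry =
  fixes f :: "real^'n \<Rightarrow> real^'n" and D :: "(real^'n) set"
  assumes card: "CARD('n) \<ge> 2" and inj: "inj_on f (UNIV - {0})" and D: "D = f ` (UNIV - {0})"
    and open_D: "open D"
    and iso: "\<And>x y. x \<noteq> 0 \<Longrightarrow> y \<noteq> 0 \<Longrightarrow> x \<noteq> y \<Longrightarrow>
      lambda_metric D (f x) (f y) = lambda_metric (UNIV - {0}) x y"
begin

definition g :: "real^'n \<Rightarrow> real^'n" where
  "g = inv_into (UNIV - {0}) f"

lemma gf: "x \<noteq> 0 \<Longrightarrow> g (f x) = x"
  unfolding g_def using inj by (simp add: inv_into_f_f)

lemma fg: "w \<in> D \<Longrightarrow> f (g w) = w"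
  unfolding g_def D by (rule f_inv_into_f)

lemma g_nonzero: "w \<in> D \<Longrightarrow> g w \<noteq> 0"
  unfolding D using gf by auto

lemma f_in_D: "x \<noteq> 0 \<Longrightarrow> f x \<in> D"
  unfolding D by auto

text \<open>The blow-up in \<open>D\<close> makes the metric large near \<open>w\<close>, and the
  upper bound in punctured space makes it small away from the diagonal. No such upper bound is known
  in \<open>D\<close>, so it is the inverse whose continuity can be read off; invariance of domain
  then yields that of \<open>f\<close>.\<close>

lemma continuous_on_g: "continuous_on D g"
  unfolding continuous_on_iff
proof (intro ballI allI impI)
  fix w and e :: real assume w: "w \<in> D" and e: "0 < e"
  define x where "x = g w"
  have x: "x \<noteq> 0" "f x = w" using g_nonzero[OF w] fg[OF w] by (auto simp: x_def)
  define \<eta> where "\<eta> = e / norm x"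
  have \<eta>: "\<eta> > 0" using e x by (simp add: \<eta>_def)
  define K where "K = unit_ball_vol (real CARD('n)) * ((2 + \<eta>) / \<eta>) ^ CARD('n)"
  have K0: "K \<ge> 0" using \<eta> by (simp add: K_def)
  obtain d where d: "d > 0" "\<forall>w'\<in>D. dist w' w < d \<longrightarrow> ennreal (K + 1) \<le> lambda_metric D w w'"
    using lambda_metric_blow_up[OF card open_D w] by blast
  have "dist (g w') (g w) < e" if w': "w' \<in> D" "dist w' w < d" for w'
  proof (cases "w' = w")
    case False
    define y where "y = g w'"
    have y: "y \<noteq> 0" "f y = w'" using g_nonzero[OF w'(1)] fg[OF w'(1)] by (auto simp: y_def)
    have "x \<noteq> y" using x y False by auto
    then have "lambda_metric D w w' = lambda_metric (UNIV - {0}) x y" using iso[of x y] x y by simp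
    then have big: "ennreal (K + 1) \<le> lambda_metric (UNIV - {0}) x y" using d(2) w' by auto
    show ?thesis
    proof (rule ccontr)
      assume "\<not> ?thesis"
      then have "\<eta> * norm x \<le> dist x y" using x by (simp add: \<eta>_def x_def y_def dist_commute)
      then have "lambda_metric (UNIV - {0}) x y \<le> ennreal K"
        unfolding K_def by (intro lambda_metric_punctured_bound x y \<eta>)
      then have "ennreal (K + 1) \<le> ennreal K" using big by (rule order_trans[rotated])
      then show False using K0 by (simp add: ennreal_le_iff)
    qed
  qed (use e in simp)
  then show "\<exists>d>0. \<forall>w'\<in>D. dist w' w < d \<longrightarrow> dist (g w') (g w) < e" using d(1) by blast
qed

lemma homeomorphism_f: "homeomorphism (UNIV - {0}) D f g"
proof -
  have inj_g: "inj_on g D" using fg by (metis inj_on_inverseI)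
  have gD: "g ` D = UNIV - {0}"
  proof
    show "g ` D \<subseteq> UNIV - {0}" using g_nonzero by auto
    show "UNIV - {0} \<subseteq> g ` D" using gf f_in_D by (metis Diff_iff image_eqI singletonI subsetI)
  qed
  obtain h where h: "homeomorphism D (g ` D) g h"
    using invariance_of_domain_homeomorphism[OF open_D continuous_on_g _ inj_g] by auto
  have "h x = f x" if "x \<in> UNIV - {0}" for x
    using homeomorphism_apply1[OF h, of "f x"] f_in_D[of x] gf[of x] that by auto
  then have "continuous_on (UNIV - {0}) f"
    using homeomorphism_cont2[OF h] gD by (metis continuous_on_cong)
  then show ?thesis
    unfolding homeomorphism_def using continuous_on_g gf fg gD D by auto
qed

lemma continuous_on_f: "continuous_on (UNIV - {0}) f"
  using homeomorphism_f homeomorphism_cont1 by blast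

lemma lambda_near_ge:
  "\<exists>\<zeta>>0. \<zeta> \<le> 1/2 \<and> (\<forall>x y. (x, y) \<in> near \<zeta> \<longrightarrow> 1 \<le> lambda_metric D (f x) (f y))"
proof -
  obtain \<zeta> where \<zeta>: "\<zeta> > 0" "\<forall>(x :: real^'n) y. (x, y) \<in> near \<zeta> \<longrightarrow> ennreal 1 \<le> lambda_metric (UNIV - {0}) x y"
    using lambda_metric_punctured_near[OF card] by blast
  have "1 \<le> lambda_metric D (f x) (f y)" if xy: "(x, y) \<in> near (min \<zeta> (1/2))" for x y
  proof (cases "x = y")
    case True
    have "f x \<in> D" using xy f_in_D by (auto simp: near_def)
    \<comment> \<open>On the diagonal the isometry says nothing; the blow-up is applied to a point
      and itself.\<close>
    from lambda_metric_blow_up[OF card open_D this, of 1] show ?thesis using \<open>f x \<in> D\<close> True by auto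
  next
    case False
    have "dist x y < \<zeta> * norm x"
    proof -
      have "min \<zeta> (1/2) * norm x \<le> \<zeta> * norm x" by (intro mult_right_mono) auto
      moreover have "dist x y < min \<zeta> (1/2) * norm x" using xy unfolding near_def by blast
      ultimately show ?thesis by linarith
    qed
    then have "(x, y) \<in> near \<zeta>" using xy by (auto simp: near_def)
    then have "1 \<le> lambda_metric (UNIV - {0}) x y" using \<zeta>(2) unfolding ennreal_1 by blast
    then show ?thesis using iso[of x y] False xy by (auto simp: near_def)
  qed
  then show ?thesis using \<zeta>(1) by (intro exI[of _ "min \<zeta> (1/2)"]) auto
qed

text \<open>Otherwise continuity of \<open>g\<close> at the limit would make
  \<open>x k = g (f (x k))\<close> converge inside punctured space.\<close>

lemma limit_notin_D:
  assumes x: "\<And>k. x k \<noteq> 0" "ext_tendsto x p" "p \<in> {Some 0, None}" and q: "ext_tendsto (\<lambda>k. f (x k)) q"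
  shows "q \<notin> Some ` D"
proof
  assume "q \<in> Some ` D"
  then obtain w where w: "q = Some w" "w \<in> D" by auto
  have "(\<lambda>k. g (f (x k))) \<longlonglongrightarrow> g w"
    by (rule continuous_on_tendsto_compose[OF continuous_on_g]) (use q w f_in_D x(1) in \<open>auto simp: ext_tendsto_Some\<close>)
  then have "ext_tendsto x (Some (g w))" using gf x(1) by (simp add: ext_tendsto_Some)
  then have "p = Some (g w)" using x(2) ext_tendsto_unique by blast
  then show False using x(3) g_nonzero[OF w(2)] by auto
qed

lemma near_end:
  assumes near: "\<And>k. (x k, y k) \<in> near \<zeta>" "\<zeta> \<le> 1/2" and x: "ext_tendsto x p" "p \<in> {Some 0, None}"
  shows "ext_tendsto y p"
proof -
  have b: "norm (x k) / 2 \<le> norm (y k)" "norm (y k) \<le> 2 * norm (x k)" for k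
  proof -
    have "dist (x k) (y k) < \<zeta> * norm (x k)" using near(1)[of k] by (auto simp: near_def)
    also have "\<dots> \<le> 1/2 * norm (x k)" using near(2) by (intro mult_right_mono) auto
    finally have d: "norm (y k - x k) < norm (x k) / 2" by (simp add: dist_norm norm_minus_commute)
    have "norm (x k) - norm (y k - x k) \<le> norm (y k)" using norm_triangle_ineq2[of "x k" "x k - y k"] by (simp add: norm_minus_commute)
    moreover have "norm (y k) \<le> norm (x k) + norm (y k - x k)" using norm_triangle_ineq[of "x k" "y k - x k"] by simp
    ultimately show "norm (x k) / 2 \<le> norm (y k)" "norm (y k) \<le> 2 * norm (x k)" using d norm_ge_zero[of "x k"] by linarith+
  qed
  from x(2) consider "p = Some 0" | "p = None" by auto
  then show ?thesis
  proof cases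
    case 1
    then have "(\<lambda>k. norm (x k)) \<longlonglongrightarrow> 0" using x(1) by (simp add: ext_tendsto_Some tendsto_norm_zero_iff)
    then have "(\<lambda>k. 2 * norm (x k)) \<longlonglongrightarrow> 0" using tendsto_mult_right_zero by blast
    then have "y \<longlonglongrightarrow> 0" by (rule Lim_null_comparison[rotated]) (intro always_eventually allI b(2))
    then show ?thesis using 1 by (simp add: ext_tendsto_Some)
  next
    case 2
    have "\<forall>\<^sub>F k in sequentially. R < norm (y k)" for R
    proof -
      have "\<forall>\<^sub>F k in sequentially. 2 * R < norm (x k)" using x(1) 2 by (simp add: ext_tendsto_None)
      then show ?thesis
      proof eventually_elim
        case (elim k)
        then show ?case using b(1)[of k] by linarith
      qed
    qed
    then show ?thesis using 2 by (simp add: ext_tendsto_None)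
  qed
qed

text \<open>Two different limits would both lie outside \<open>D\<close>, and
  \<open>lambda_metric_boundary_small\<close> would push the metric below \<open>1\<close> along a
  subsequence, against the bound for near pairs.\<close>

lemma near_limit:
  assumes near: "\<And>k. (x k, y k) \<in> near \<zeta>" "\<zeta> \<le> 1/2"
    and \<zeta>: "\<And>x y. (x, y) \<in> near \<zeta> \<Longrightarrow> 1 \<le> lambda_metric D (f x) (f y)"
    and x: "ext_tendsto x p" "p \<in> {Some 0, None}" and q: "ext_tendsto (\<lambda>k. f (x k)) q"
  shows "ext_tendsto (\<lambda>k. f (y k)) q"
proof (rule ccontr)
  have nz: "x k \<noteq> 0" "y k \<noteq> 0" for k using near(1)[of k] by (auto simp: near_def)
  assume "\<not> ?thesis"
  then obtain r q' where r: "strict_mono (r :: nat \<Rightarrow> nat)" "ext_tendsto ((\<lambda>k. f (y k)) \<circ> r) q'" "q' \<noteq> q"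
    by (rule not_ext_tendsto)
  have y: "ext_tendsto y p" by (rule near_end[OF near x])
  have xr: "ext_tendsto ((\<lambda>k. f (x k)) \<circ> r) q" by (rule ext_tendsto_subseq[OF q r(1)])
  have q1: "q \<notin> Some ` D" by (rule limit_notin_D[OF nz(1) x q])
  have q2: "q' \<notin> Some ` D"
  proof (rule limit_notin_D[of "y \<circ> r" p])
    show "ext_tendsto (y \<circ> r) p" by (rule ext_tendsto_subseq[OF y r(1)])
    show "ext_tendsto (\<lambda>k. f ((y \<circ> r) k)) q'" using r(2) by (simp add: comp_def)
  qed (use nz x in auto)
  have "\<forall>\<^sub>F k in sequentially. lambda_metric D (f (x (r k))) (f (y (r k))) < 1"
    using lambda_metric_boundary_small[OF card open_D _ _ xr r(2) r(3)[symmetric] q1 q2] f_in_D nz by simp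
  then have "\<forall>\<^sub>F k in sequentially. False"
    by eventually_elim (use \<zeta> near(1) in \<open>auto simp: not_le[symmetric]\<close>)
  then show False by simp
qed

lemma chain_limit:
  assumes \<zeta>: "\<zeta> \<le> 1/2" "\<And>x y. (x, y) \<in> near \<zeta> \<Longrightarrow> 1 \<le> lambda_metric D (f x) (f y)"
    and x: "ext_tendsto x p" "p \<in> {Some 0, None}" "ext_tendsto (\<lambda>k. f (x k)) q"
  shows "(\<And>k. (x k, y k) \<in> near \<zeta> ^^ N) \<Longrightarrow> ext_tendsto y p \<and> ext_tendsto (\<lambda>k. f (y k)) q"
proof (induction N arbitrary: y)
  case 0
  then have "y = x" by auto
  then show ?case using x by simp
next
  case (Suc N)
  have "\<exists>z. (x k, z) \<in> near \<zeta> ^^ N \<and> (z, y k) \<in> near \<zeta>" for k using Suc.prems[of k] by auto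
  then obtain z where z: "\<And>k. (x k, z k) \<in> near \<zeta> ^^ N" "\<And>k. (z k, y k) \<in> near \<zeta>" by metis
  have zp: "ext_tendsto z p" "ext_tendsto (\<lambda>k. f (z k)) q" using Suc.IH[OF z(1)] by auto
  show ?case using near_end[OF z(2) \<zeta>(1) zp(1) x(2)] near_limit[OF z(2) \<zeta> zp(1) x(2) zp(2)] by simp
qed

text \<open>If a sphere has a point with image outside \<open>V\<close>, such a point is taken as
  \<open>y k\<close>. It is joined to \<open>x k\<close> by a chain whose length is independent of
  the radius, so \<open>chain_limit\<close> puts its image into \<open>V\<close> after all.\<close>

lemma sphere_images:
  assumes x: "\<And>k. x k \<noteq> 0" "ext_tendsto x p" "p \<in> {Some 0, None}" "ext_tendsto (\<lambda>k. f (x k)) q" and V: "V \<in> ext_nbhds q"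
  shows "\<forall>\<^sub>F k in sequentially. f ` sphere 0 (norm (x k)) \<subseteq> V"
proof -
  obtain \<zeta> where \<zeta>: "\<zeta> > 0" "\<zeta> \<le> 1/2" "\<And>x y. (x, y) \<in> near \<zeta> \<Longrightarrow> 1 \<le> lambda_metric D (f x) (f y)"
    using lambda_near_ge by blast
  have dim: "2 \<le> DIM(real^'n)" using card by simp
  obtain N where N: "\<forall>u v :: real^'n. norm u = norm v \<longrightarrow> u \<noteq> 0 \<longrightarrow> (u, v) \<in> near \<zeta> ^^ N"
    using near_chain_sphere[OF dim \<zeta>(1)] by blast
  define y where "y k = (if f ` sphere 0 (norm (x k)) \<subseteq> V then x k else (SOME z. z \<in> sphere 0 (norm (x k)) \<and> f z \<notin> V))" for k
  have y: "norm (y k) = norm (x k) \<and> (f (y k) \<in> V \<longrightarrow> f ` sphere 0 (norm (x k)) \<subseteq> V)" for k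
  proof (cases "f ` sphere 0 (norm (x k)) \<subseteq> V")
    case True
    then show ?thesis by (simp add: y_def)
  next
    case False
    then have "\<exists>z. z \<in> sphere 0 (norm (x k)) \<and> f z \<notin> V" by blast
    from someI_ex[OF this] have "y k \<in> sphere 0 (norm (x k)) \<and> f (y k) \<notin> V" using False by (simp add: y_def)
    then show ?thesis by simp
  qed
  have "(x k, y k) \<in> near \<zeta> ^^ N" for k using N[rule_format, of "x k" "y k"] y[of k] x(1)[of k] by simp
  then have "ext_tendsto (\<lambda>k. f (y k)) q" using chain_limit[OF \<zeta>(2,3) x(2,3,4)] by blast
  then have "\<forall>\<^sub>F k in sequentially. f (y k) \<in> V" using V by (simp add: ext_tendsto_def)
  then show ?thesis by eventually_elim (use y in auto)
qed

text \<open>By the Jordan-Brouwer theorem, one of the two sides of \<open>f ` sphere 0 r\<close> stays in \<open>V\<close>.\<close>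

lemma sphere_side:
  assumes r: "r > 0" and V: "f ` sphere 0 r \<subseteq> V" "connected (- V)"
  shows "f ` (ball 0 r - {0}) \<subseteq> V \<or> f ` (- cball 0 r) \<subseteq> V"
proof -
  define \<Sigma> where "\<Sigma> = f ` sphere 0 r"
  have dim: "2 \<le> DIM(real^'n)" using card by simp
  have sub: "sphere 0 r \<subseteq> UNIV - {0 :: real^'n}" using r by auto
  have "homeomorphism (sphere 0 r) \<Sigma> f g"
    unfolding \<Sigma>_def by (rule homeomorphism_of_subsets[OF homeomorphism_f sub]) (use D in auto)
  then have hom: "\<Sigma> homeomorphic sphere (0 :: real^'n) r" using homeomorphic_sym homeomorphic_def by blast
  have nc: "\<not> connected (- \<Sigma>)" by (rule Jordan_Brouwer_separation[OF hom r])
  have VS: "- V \<subseteq> - \<Sigma>" using V(1) by (auto simp: \<Sigma>_def)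
  \<comment> \<open>The complement of \<open>V\<close> is connected and misses the image sphere, so
    it lies in one component; as there are at least two, another component \<open>W\<close> lies
    entirely in \<open>V\<close>.\<close>
  obtain W where W: "W \<in> components (- \<Sigma>)" "W \<subseteq> V"
  proof (cases "- V = {}")
    case True
    have "- \<Sigma> \<noteq> {}" using nc by auto
    then obtain W where "W \<in> components (- \<Sigma>)" using components_eq_empty by blast
    then show thesis using that True by blast
  next
    case False
    then obtain z where z: "z \<notin> V" by auto
    define T where "T = connected_component_set (- \<Sigma>) z"
    have VT: "- V \<subseteq> T" unfolding T_def by (rule connected_component_maximal[OF _ V(2) VS]) (use z in simp)
    have "connected T" unfolding T_def by (rule connected_connected_component)
    then have "T \<noteq> - \<Sigma>" using nc by blast
    moreover have "T \<subseteq> - \<Sigma>" unfolding T_def by (rule connected_component_subset)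
    ultimately obtain y where y: "y \<in> - \<Sigma>" "y \<notin> T" by blast
    define W where "W = connected_component_set (- \<Sigma>) y"
    have "W \<inter> T = {}"
      using y(2) connected_component_disjoint[of "- \<Sigma>" y z] by (simp add: W_def T_def connected_component_sym_eq)
    then have "W \<subseteq> V" using VT by blast
    moreover have "W \<in> components (- \<Sigma>)" unfolding W_def components_def using y(1) by blast
    ultimately show thesis using that by blast
  qed
  \<comment> \<open>Since its frontier is the whole image sphere, \<open>W\<close> meets the open
    set \<open>D\<close> and thus contains some \<open>f y\<close>; the side of the sphere on which
    \<open>y\<close> lies is then mapped into \<open>W\<close>.\<close>
  have fr: "frontier W = \<Sigma>" by (rule Jordan_Brouwer_frontier[OF hom W(1) dim])
  obtain b :: "real^'n" where b: "norm b = 1" using norm_Basis nonempty_Basis by blast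
  have sg: "f (r *\<^sub>R b) \<in> \<Sigma>" using b r by (auto simp: \<Sigma>_def)
  have "r *\<^sub>R b \<noteq> 0" using b r by auto
  then have "f (r *\<^sub>R b) \<in> D" by (rule f_in_D)
  moreover have "f (r *\<^sub>R b) \<in> closure W" using fr sg by (auto simp: frontier_def)
  ultimately have "D \<inter> W \<noteq> {}" using open_D open_Int_closure_eq_empty[of D W] by blast
  then obtain y where y: "y \<noteq> 0" "f y \<in> W" unfolding D by auto
  have side: "f ` S \<subseteq> V" if S: "connected S" "S \<subseteq> UNIV - {0}" "y \<in> S" "S \<inter> sphere 0 r = {}" for S
  proof -
    have "f x \<notin> \<Sigma>" if x: "x \<in> S" for x
    proof
      assume "f x \<in> \<Sigma>"
      then obtain x' where x': "x' \<in> sphere 0 r" "f x = f x'" by (auto simp: \<Sigma>_def)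
      then have "x = x'" using inj x S(2) sub unfolding inj_on_def by blast
      then show False using S(4) x x' by blast
    qed
    then have "f ` S \<subseteq> - \<Sigma>" by auto
    moreover have "connected (f ` S)"
      by (intro connected_continuous_image continuous_on_subset[OF continuous_on_f] S)
    ultimately have "f ` S \<subseteq> W" using components_maximal[OF W(1), of "f ` S"] y(2) S(3) by blast
    then show ?thesis using W(2) by blast
  qed
  have "norm y \<noteq> r"
  proof
    assume "norm y = r"
    then have "f y \<in> \<Sigma>" by (auto simp: \<Sigma>_def)
    then show False using y(2) in_components_subset[OF W(1)] by blast
  qed
  then consider "norm y < r" | "norm y > r" by linarith
  then show ?thesis
  proof cases
    case 1
    have "connected (ball 0 r - {0 :: real^'n})" by (rule connected_open_delete) (use dim in auto)
    moreover have "ball 0 r - {0} \<subseteq> UNIV - {0 :: real^'n}" "y \<in> ball 0 r - {0}" "(ball 0 r - {0}) \<inter> sphere 0 r = {}" using 1 y(1) by auto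
    ultimately show ?thesis using side[of "ball 0 r - {0}"] by blast
  next
    case 2
    have "connected (- cball (0 :: real^'n) r)" by (rule connected_complement_bounded_convex) (use dim in auto)
    moreover have "- cball (0 :: real^'n) r \<subseteq> UNIV - {0}" using r by auto
    moreover have "y \<in> - cball 0 r" "- cball (0 :: real^'n) r \<inter> sphere 0 r = {}" using 2 by auto
    ultimately show ?thesis using side[of "- cball 0 r"] by blast
  qed
qed

text \<open>Along one sequence a limit \<open>q\<close> exists by compactness. Images of spheres
  near the end \<open>p\<close> lie in a neighbourhood of \<open>q\<close>, hence so does the image
  of one side. The image \<open>f b\<close> of a point on the far side is kept out of the
  neighbourhood, so it is the side at the end, and all sequences tending to \<open>p\<close> are
  caught.\<close>

lemma end_limit:
  assumes p: "p \<in> {Some 0, None}"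
  shows "\<exists>q. q \<notin> Some ` D \<and> (\<forall>y. (\<forall>k. y k \<noteq> 0) \<longrightarrow> ext_tendsto y p \<longrightarrow> ext_tendsto (\<lambda>k. f (y k)) q)"
proof -
  obtain b :: "real^'n" where b: "norm b = 1" using norm_Basis nonempty_Basis by blast
  then have b0: "b \<noteq> 0" by auto
  define x where "x k = (if p = None then real (Suc k) else 1 / real (Suc k)) *\<^sub>R b" for k
  have xnz: "x k \<noteq> 0" for k using b0 by (simp add: x_def)
  have xp: "ext_tendsto x p"
  proof (cases p)
    case None
    have "\<forall>\<^sub>F k in sequentially. R < norm (x k)" for R
    proof -
      obtain N where N: "R < real N" using reals_Archimedean2 by blast
      show ?thesis using eventually_ge_at_top[of N] by eventually_elim (use N b None in \<open>auto simp: x_def\<close>)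
    qed
    then show ?thesis using None by (simp add: ext_tendsto_None)
  next
    case (Some e)
    have "(\<lambda>k. (1 / real (Suc k)) *\<^sub>R b) \<longlonglongrightarrow> 0 *\<^sub>R b"
      by (intro tendsto_scaleR tendsto_const LIMSEQ_Suc[OF lim_1_over_n])
    moreover have "x = (\<lambda>k. (1 / real (Suc k)) *\<^sub>R b)" using Some by (simp add: x_def fun_eq_iff)
    ultimately show ?thesis using Some p by (simp add: ext_tendsto_Some)
  qed
  obtain r q where r: "strict_mono (r :: nat \<Rightarrow> nat)" "ext_tendsto ((\<lambda>k. f (x k)) \<circ> r) q" by (rule ext_subseq)
  define x' where "x' = x \<circ> r"
  have x': "\<And>k. x' k \<noteq> 0" "ext_tendsto x' p" "ext_tendsto (\<lambda>k. f (x' k)) q"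
    using xnz ext_tendsto_subseq[OF xp r(1)] r(2) by (auto simp: x'_def comp_def)
  have q: "q \<notin> Some ` D" by (rule limit_notin_D[OF x'(1,2) p x'(3)])
  have "ext_tendsto (\<lambda>k. f (y k)) q" if y: "\<forall>k. y k \<noteq> 0" "ext_tendsto y p" for y
    unfolding ext_tendsto_def
  proof
    fix V assume V: "V \<in> ext_nbhds q"
    have "Some (f b) \<noteq> q" using q f_in_D[OF b0] by auto
    then obtain V' where V': "V' \<in> ext_nbhds q" "V' \<subseteq> V" "f b \<notin> V'" using ext_nbhds_avoid[OF V] by blast
    have dim: "2 \<le> DIM(real^'n)" using card by simp
    have conn: "connected (- V')" by (rule connected_Compl_ext_nbhd[OF dim V'(1)])
    have ev: "\<forall>\<^sub>F k in sequentially. f ` sphere 0 (norm (x' k)) \<subseteq> V'" by (rule sphere_images[OF x'(1,2) p x'(3) V'(1)])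
    from p consider "p = Some 0" | "p = None" by auto
    then have "\<forall>\<^sub>F k in sequentially. f (y k) \<in> V'"
    proof cases
      case 1
      have "x' \<longlonglongrightarrow> 0" using x'(2) 1 by (simp add: ext_tendsto_Some)
      then have "\<forall>\<^sub>F k in sequentially. norm (x' k) < 1" using tendstoD[of x' 0 sequentially 1] by simp
      then have "\<forall>\<^sub>F k in sequentially. f ` sphere 0 (norm (x' k)) \<subseteq> V' \<and> norm (x' k) < 1" using ev by eventually_elim simp
      then obtain k where k: "f ` sphere 0 (norm (x' k)) \<subseteq> V'" "norm (x' k) < 1" using eventually_happens'[OF sequentially_bot] by blast
      have pos: "norm (x' k) > 0" using x'(1) by simp
      have "f b \<in> f ` (- cball 0 (norm (x' k)))" using b k(2) by auto
      then have sub: "f ` (ball 0 (norm (x' k)) - {0}) \<subseteq> V'" using sphere_side[OF pos k(1) conn] V'(3) by blast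
      have "y \<longlonglongrightarrow> 0" using y(2) 1 by (simp add: ext_tendsto_Some)
      then have "\<forall>\<^sub>F j in sequentially. norm (y j) < norm (x' k)" using tendstoD[of y 0 sequentially "norm (x' k)"] pos by simp
      then show ?thesis
      proof eventually_elim
        case (elim j)
        then have "y j \<in> ball 0 (norm (x' k)) - {0}" using y(1) by simp
        then show ?case using sub by blast
      qed
    next
      case 2
      have "\<forall>\<^sub>F k in sequentially. 1 < norm (x' k)" using x'(2) 2 by (simp add: ext_tendsto_None)
      then have "\<forall>\<^sub>F k in sequentially. f ` sphere 0 (norm (x' k)) \<subseteq> V' \<and> 1 < norm (x' k)" using ev by eventually_elim simp
      then obtain k where k: "f ` sphere 0 (norm (x' k)) \<subseteq> V'" "1 < norm (x' k)" using eventually_happens'[OF sequentially_bot] by blast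
      have pos: "norm (x' k) > 0" using x'(1) by simp
      have "f b \<in> f ` (ball 0 (norm (x' k)) - {0})" using b b0 k(2) by auto
      then have sub: "f ` (- cball 0 (norm (x' k))) \<subseteq> V'" using sphere_side[OF pos k(1) conn] V'(3) by blast
      have "\<forall>\<^sub>F j in sequentially. norm (x' k) < norm (y j)" using y(2) 2 by (simp add: ext_tendsto_None)
      then show ?thesis
      proof eventually_elim
        case (elim j)
        then have "y j \<in> - cball 0 (norm (x' k))" by simp
        then show ?case using sub by blast
      qed
    qed
    then show "\<forall>\<^sub>F k in sequentially. f (y k) \<in> V" by eventually_elim (use V'(2) in auto)
  qed
  then show ?thesis using q by blast
qed

text \<open>Sequences in \<open>D\<close> accumulate only in \<open>D\<close> or at the two end
  limits, so \<open>D\<close> is open and closed in the complement of the set \<open>T\<close> of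
  finite end limits, hence equal to it. \<open>D\<close> is unbounded, so one end tends to infinity;
  both cannot, and \<open>T\<close> is a single point.\<close>

theorem image_punctured: "\<exists>w. D = UNIV - {w}"
proof -
  have dim: "2 \<le> DIM(real^'n)" using card by simp
  obtain b :: "real^'n" where b: "norm b = 1" using norm_Basis nonempty_Basis by blast
  then have b0: "b \<noteq> 0" by auto
  obtain Q where Q: "\<And>p. p \<in> {Some 0, None} \<Longrightarrow> Q p \<notin> Some ` D"
    "\<And>p y. p \<in> {Some 0, None} \<Longrightarrow> (\<And>k. y k \<noteq> 0) \<Longrightarrow> ext_tendsto y p \<Longrightarrow> ext_tendsto (\<lambda>k. f (y k)) (Q p)"
  proof -
    have "\<forall>p\<in>{Some 0, None}. \<exists>q. q \<notin> Some ` D \<and> (\<forall>y. (\<forall>k. y k \<noteq> 0) \<longrightarrow> ext_tendsto y p \<longrightarrow> ext_tendsto (\<lambda>k. f (y k)) q)"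
      using end_limit by blast
    then obtain Q where "\<forall>p\<in>{Some 0, None}. Q p \<notin> Some ` D \<and> (\<forall>y. (\<forall>k. y k \<noteq> 0) \<longrightarrow> ext_tendsto y p \<longrightarrow> ext_tendsto (\<lambda>k. f (y k)) (Q p))"
      unfolding bchoice_iff by blast
    then show thesis using that[of Q] by blast
  qed
  have limits: "q \<in> Some ` D \<or> q = Q (Some 0) \<or> q = Q None"
    if d: "\<And>k. d k \<in> D" "ext_tendsto d q" for d q
  proof -
    define x where "x k = g (d k)" for k
    have xnz: "x k \<noteq> 0" for k using g_nonzero d(1) by (simp add: x_def)
    have fx: "(\<lambda>k. f (x k)) = d" using fg d(1) by (simp add: x_def)
    obtain r p where r: "strict_mono (r :: nat \<Rightarrow> nat)" "ext_tendsto (x \<circ> r) p" by (rule ext_subseq)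
    have dr: "ext_tendsto (\<lambda>k. f ((x \<circ> r) k)) q"
      using ext_tendsto_subseq[OF d(2) r(1)] fx by (simp add: comp_def fun_eq_iff)
    show ?thesis
    proof (cases "p \<in> {Some 0, None}")
      case True
      have "ext_tendsto (\<lambda>k. f ((x \<circ> r) k)) (Q p)" by (rule Q(2)[OF True _ r(2)]) (use xnz in simp)
      then have "q = Q p" using dr ext_tendsto_unique by blast
      then show ?thesis using True by auto
    next
      case False
      then obtain z where z: "p = Some z" "z \<noteq> 0" by (cases p) auto
      have "(\<lambda>k. f ((x \<circ> r) k)) \<longlonglongrightarrow> f z"
        by (rule continuous_on_tendsto_compose[OF continuous_on_f]) (use r(2) z xnz in \<open>auto simp: ext_tendsto_Some comp_def\<close>)
      then have "q = Some (f z)" by (intro ext_tendsto_unique[OF dr]) (simp add: ext_tendsto_Some)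
      then show ?thesis using f_in_D[OF z(2)] by auto
    qed
  qed
  define T where "T = {w. Some w = Q (Some 0) \<or> Some w = Q None}"
  have "T \<subseteq> the ` {Q (Some 0), Q None}"
  proof
    fix w assume "w \<in> T"
    then have "Some w \<in> {Q (Some 0), Q None}" by (auto simp: T_def)
    then have "the (Some w) \<in> the ` {Q (Some 0), Q None}" by (rule imageI)
    then show "w \<in> the ` {Q (Some 0), Q None}" by simp
  qed
  then have finT: "finite T" by (rule finite_subset) simp
  have "Some w \<noteq> Q p" if w: "w \<in> D" and p: "p \<in> {Some 0, None}" for w p using Q(1)[OF p] imageI[OF w, of Some] by metis
  then have DT: "D \<subseteq> - T" by (auto simp: T_def)
  have clD: "closure D \<subseteq> D \<union> T"
  proof
    fix z assume "z \<in> closure D"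
    then obtain d where "\<forall>k. d k \<in> D" "d \<longlonglongrightarrow> z" unfolding closure_sequential by blast
    then show "z \<in> D \<union> T" using limits[of d "Some z"] by (auto simp: ext_tendsto_Some T_def)
  qed
  have D_eq: "D = - T"
  proof -
    have conn: "connected (- T)"
      using connected_open_delete_finite[OF open_UNIV connected_UNIV dim finT] by (simp add: Compl_eq_Diff_UNIV)
    have "openin (top_of_set (- T)) D" using open_D DT by (simp add: openin_open_eq finT finite_imp_closed open_Compl)
    moreover have "closedin (top_of_set (- T)) D"
    proof -
      have "D = - T \<inter> closure D" using clD DT closure_subset[of D] by blast
      then show ?thesis by (metis closed_closure closedin_closed)
    qed
    ultimately have "D = {} \<or> D = - T" using conn connected_clopen by blast
    then show ?thesis using f_in_D[OF b0] by auto
  qed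
  have one_inf: "Q (Some 0) = None \<or> Q None = None"
  proof -
    have "\<not> bounded D"
    proof
      assume "bounded D"
      then have "bounded (D \<union> T)" using finT by (simp add: finite_imp_bounded)
      then have "bounded (UNIV :: (real^'n) set)" using D_eq by (simp add: Un_commute)
      then show False using not_bounded_UNIV by blast
    qed
    then have "\<forall>k :: nat. \<exists>w. w \<in> D \<and> real k < norm w" unfolding bounded_iff by (metis not_le)
    then obtain d where d: "\<And>k :: nat. d k \<in> D \<and> real k < norm (d k)" by metis
    have "ext_tendsto d None"
      unfolding ext_tendsto_None
    proof
      fix R
      obtain N where N: "R < real N" using reals_Archimedean2 by blast
      show "\<forall>\<^sub>F k in sequentially. R < norm (d k)" using eventually_ge_at_top[of N]
      proof eventually_elim
        case (elim k)
        then have "real N \<le> real k" by simp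
        then show ?case using d[of k] N by linarith
      qed
    qed
    then show ?thesis using limits[of d None] d by auto
  qed
  have one_fin: "T \<noteq> {}"
  proof
    assume T0: "T = {}"
    have QN: "Q p = None" if "p \<in> {Some 0, None}" for p using T0 that by (cases "Q p") (auto simp: T_def)
    \<comment> \<open>With both ends at infinity, the separation argument for
      \<open>V = ball 0 R\<close> bounds the image of one side of the unit sphere, although the end
      on that side tends to infinity.\<close>
    have "compact (f ` sphere 0 1)"
      by (intro compact_continuous_image continuous_on_subset[OF continuous_on_f]) auto
    then obtain R where R: "f ` sphere 0 1 \<subseteq> ball 0 R" using bounded_subset_ballD[OF compact_imp_bounded] by blast
    have "connected (- ball (0 :: real^'n) R)" by (rule connected_complement_bounded_convex) (use dim in auto)
    then have sides: "f ` (ball 0 1 - {0}) \<subseteq> ball 0 R \<or> f ` (- cball 0 1) \<subseteq> ball 0 R"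
      using sphere_side[OF zero_less_one R] by blast
    have far: "\<forall>\<^sub>F k in sequentially. R < norm (f (y k))" if "p \<in> {Some 0, None}" "\<And>k. y k \<noteq> 0" "ext_tendsto y p" for p y
      using Q(2)[OF that] QN[OF that(1)] by (simp add: ext_tendsto_None)
    from sides show False
    proof
      assume s: "f ` (ball 0 1 - {0}) \<subseteq> ball 0 R"
      define y where "y k = (1 / real (Suc (Suc k))) *\<^sub>R b" for k
      have "(\<lambda>k. (1 / real (Suc (Suc k))) *\<^sub>R b) \<longlonglongrightarrow> 0 *\<^sub>R b"
        by (intro tendsto_scaleR tendsto_const LIMSEQ_Suc[OF LIMSEQ_Suc[OF lim_1_over_n]])
      then have "ext_tendsto y (Some 0)" by (simp add: ext_tendsto_Some y_def[abs_def])
      moreover have "y k \<noteq> 0" for k by (simp add: y_def b0)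
      ultimately have "\<forall>\<^sub>F k in sequentially. R < norm (f (y k))" by (intro far[of "Some 0"]) auto
      then obtain k where k: "R < norm (f (y k))" using eventually_happens'[OF sequentially_bot] by blast
      have "y k \<in> ball 0 1 - {0}" using b b0 by (simp add: y_def)
      then show False using s k by force
    next
      assume s: "f ` (- cball 0 1) \<subseteq> ball 0 R"
      define y where "y k = real (Suc (Suc k)) *\<^sub>R b" for k
      have "\<forall>\<^sub>F k in sequentially. R < norm (y k)" for R
      proof -
        obtain N where N: "R < real N" using reals_Archimedean2 by blast
        show ?thesis using eventually_ge_at_top[of N] by eventually_elim (use N b in \<open>auto simp: y_def\<close>)
      qed
      then have "ext_tendsto y None" by (simp add: ext_tendsto_None)
      moreover have "y k \<noteq> 0" for k by (simp add: y_def b0)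
      ultimately have "\<forall>\<^sub>F k in sequentially. R < norm (f (y k))" by (intro far[of None]) auto
      then obtain k where k: "R < norm (f (y k))" using eventually_happens'[OF sequentially_bot] by blast
      have "y k \<in> - cball 0 1" using b by (simp add: y_def)
      then show False using s k by force
    qed
  qed
  then obtain w where w: "w \<in> T" by blast
  have "T = {w}" using one_inf w by (auto simp: T_def) (metis option.inject option.distinct(1))+
  then show ?thesis using D_eq by (auto simp: Compl_eq_Diff_UNIV)
qed

end

section \<open>Gauges of the modulus metric\<close>

text \<open>Tends to \<open>0\<close>; the shift by \<open>2\<close> keeps it at most
  \<open>1/2\<close>, as \<open>E_half\<close> demands.\<close>

definition gauge_radius :: "nat \<Rightarrow> real" where
  "gauge_radius k = 1 / (real k + 2)"

text \<open>The right-hand side of \<open>lambda_metric_punctured_bound\<close> for this radius: a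
  larger value of the metric forces the pair into \<open>near (gauge_radius k)\<close>.\<close>

definition gauge_bound :: "nat \<Rightarrow> nat \<Rightarrow> real" where
  "gauge_bound n k = unit_ball_vol (real n) * ((2 + gauge_radius k) / gauge_radius k) ^ n"

text \<open>The diagonal is put in by hand, because the isometry preserves the metric only for
  distinct points.\<close>

definition gauge_set :: "nat \<Rightarrow> ((real^'n) \<times> (real^'n)) set" where
  "gauge_set k = {(x, y). x \<noteq> 0 \<and> y \<noteq> 0 \<and>
     (x = y \<or> ennreal (gauge_bound CARD('n) k) < lambda_metric (UNIV - {0}) x y)}"

text \<open>Taking the interior yields open sets without any continuity of the metric, and
  homeomorphisms that preserve the superlevel sets preserve their interiors.\<close>

definition modulus_gauge :: "nat \<Rightarrow> ((real^'n) \<times> (real^'n)) set" where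
  "modulus_gauge k = interior (gauge_set k)"

lemma gauge_radius_bounds: "0 < gauge_radius k" "gauge_radius k \<le> 1 / 2"
  by (auto simp: gauge_radius_def field_simps)

lemma gauge_bound_nonneg: "0 \<le> gauge_bound n k"
  using gauge_radius_bounds(1)[of k] by (auto simp: gauge_bound_def intro!: mult_nonneg_nonneg zero_le_power)

lemma modulus_gauge_subset: "modulus_gauge k \<subseteq> gauge_set k"
  unfolding modulus_gauge_def by (rule interior_subset)

lemma interior_transfer:
  assumes "open U" "continuous_on U h" "q \<in> U" "h q \<in> interior S"
    and "\<And>q. q \<in> U \<Longrightarrow> h q \<in> S \<Longrightarrow> q \<in> S'"
  shows "q \<in> interior S'"
proof -
  have "open (U \<inter> h -` interior S)" by (rule continuous_open_preimage[OF assms(2,1) open_interior])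
  moreover have "U \<inter> h -` interior S \<subseteq> S'" using assms(5) interior_subset by blast
  ultimately have "U \<inter> h -` interior S \<subseteq> interior S'" by (rule interior_maximal[rotated])
  then show ?thesis using assms(3,4) by blast
qed

text \<open>Formulated for one map and one direction, so that it serves the similarities as well as
  the isometry and its inverse.\<close>

lemma modulus_gauge_pullback:
  fixes H :: "real^'n \<Rightarrow> real^'n"
  assumes H: "H 0 = 0" "inj H" "continuous_on (- {0}) H"
    "\<And>x y. x \<noteq> 0 \<Longrightarrow> y \<noteq> 0 \<Longrightarrow> x \<noteq> y \<Longrightarrow> lambda_metric (UNIV - {0}) (H x) (H y) = lambda_metric (UNIV - {0}) x y"
    and xy: "(H x, H y) \<in> modulus_gauge k"
  shows "(x, y) \<in> modulus_gauge k"
  unfolding modulus_gauge_def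
proof (rule interior_transfer[where U="(- {0}) \<times> (- {0})" and S="gauge_set k" and h="\<lambda>p. (H (fst p), H (snd p))"])
  show "open ((- {0 :: real^'n}) \<times> (- {0 :: real^'n}))" by (intro open_Times open_Compl closed_singleton)
  show "continuous_on ((- {0}) \<times> (- {0})) (\<lambda>p. (H (fst p), H (snd p)))"
    by (intro continuous_on_Pair continuous_on_compose2[OF H(3)] continuous_on_fst continuous_on_snd continuous_on_id) auto
  have "H x \<noteq> 0" "H y \<noteq> 0" using xy modulus_gauge_subset[of k] by (auto simp: gauge_set_def)
  then show "(x, y) \<in> (- {0}) \<times> (- {0})" using H(1) by auto
  show "(H (fst (x, y)), H (snd (x, y))) \<in> interior (gauge_set k)" using xy by (simp add: modulus_gauge_def)
  fix q assume q: "q \<in> (- {0}) \<times> (- {0 :: real^'n})" "(H (fst q), H (snd q)) \<in> gauge_set k"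
  obtain u v where uv: "q = (u, v)" "u \<noteq> 0" "v \<noteq> 0" using q(1) by auto
  show "q \<in> gauge_set k"
  proof (cases "u = v")
    case True
    then show ?thesis using uv by (simp add: gauge_set_def)
  next
    case False
    then have "H u \<noteq> H v" using H(2) by (auto dest: injD)
    then show ?thesis using uv q(2) H(4)[OF uv(2,3) False] by (simp add: gauge_set_def)
  qed
qed

lemma modulus_gauge_near: "modulus_gauge k \<subseteq> near (gauge_radius k)"
proof
  fix p :: "(real^'n) \<times> (real^'n)" assume "p \<in> modulus_gauge k"
  then have "p \<in> gauge_set k" using modulus_gauge_subset by blast
  then obtain x y where p: "p = (x, y)" "x \<noteq> 0" "y \<noteq> 0"
    "x = y \<or> ennreal (gauge_bound CARD('n) k) < lambda_metric (UNIV - {0}) x y"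
    by (auto simp: gauge_set_def)
  have "dist x y < gauge_radius k * norm x"
  proof (rule ccontr)
    assume "\<not> ?thesis"
    then have d: "gauge_radius k * norm x \<le> dist x y" by simp
    have "x \<noteq> y" using d p(2) gauge_radius_bounds(1)[of k] by (auto simp: mult_le_0_iff)
    moreover have "lambda_metric (UNIV - {0}) x y \<le> ennreal (gauge_bound CARD('n) k)"
      unfolding gauge_bound_def by (rule lambda_metric_punctured_bound[OF p(2,3) gauge_radius_bounds(1) d])
    ultimately show False using p(4) by simp
  qed
  then show "p \<in> near (gauge_radius k)" using p by (simp add: near_def)
qed

lemma open_near: "open (near \<zeta> :: ('a::euclidean_space \<times> 'a) set)"
proof -
  have "near \<zeta> = {p :: 'a \<times> 'a. fst p \<noteq> 0 \<and> snd p \<noteq> 0 \<and> dist (fst p) (snd p) < \<zeta> * norm (fst p)}"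
    by (auto simp: near_def)
  then show ?thesis by (simp only:) (intro open_Collect_conj open_Collect_neq open_Collect_less continuous_intros)
qed

lemma invariant_gauge_modulus:
  assumes n: "CARD('n) \<ge> 2"
  shows "invariant_gauge (modulus_gauge :: nat \<Rightarrow> ((real^'n) \<times> (real^'n)) set)"
proof
  show "2 \<le> DIM(real^'n)" using n by simp
  fix k
  show "open (modulus_gauge k :: ((real^'n) \<times> (real^'n)) set)" by (simp add: modulus_gauge_def)
  fix x y :: "real^'n"
  show "x \<noteq> 0" if "(x, y) \<in> modulus_gauge k" using that modulus_gauge_subset by (auto simp: gauge_set_def)
  show "(y, x) \<in> modulus_gauge k" if xy: "(x, y) \<in> modulus_gauge k"
    unfolding modulus_gauge_def
  proof (rule interior_transfer[where U=UNIV and S="gauge_set k" and h=prod.swap])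
    show "continuous_on UNIV (prod.swap :: (real^'n) \<times> (real^'n) \<Rightarrow> _)" by (rule continuous_on_swap)
    show "prod.swap (y, x) \<in> interior (gauge_set k)" using xy by (simp add: modulus_gauge_def)
    show "q \<in> gauge_set k" if "prod.swap q \<in> gauge_set k" for q :: "(real^'n) \<times> (real^'n)"
    proof -
      obtain u v where "q = (u, v)" by (cases q)
      then show ?thesis using that lambda_metric_commute[of "UNIV - {0}" u v] by (auto simp: gauge_set_def)
    qed
  qed auto
  show "(c *\<^sub>R A x, c *\<^sub>R A y) \<in> modulus_gauge k"
    if c: "c > 0" and A: "orthogonal_transformation A" and xy: "(x, y) \<in> modulus_gauge k"
    for c and A :: "real^'n \<Rightarrow> real^'n"
  proof -
    define H where "H z = (1 / c) *\<^sub>R inv A z" for z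
    have B: "orthogonal_transformation (inv A)" by (rule orthogonal_transformation_inv[OF A])
    have HA: "H (c *\<^sub>R A z) = z" for z
      using c by (simp add: H_def orthogonal_transformation_scaleR[OF B] inv_f_f[OF orthogonal_transformation_inj[OF A]])
    show ?thesis
    proof (rule modulus_gauge_pullback[of H])
      show "H 0 = 0" using linear_0[OF orthogonal_transformation_linear[OF B]] by (simp add: H_def)
      show "inj H" using orthogonal_transformation_inj[OF B] c by (auto simp: H_def inj_def)
      show "continuous_on (- {0}) H" unfolding H_def
        by (intro continuous_intros linear_continuous_on_compose[OF _ orthogonal_transformation_linear[OF B]])
      show "lambda_metric (UNIV - {0}) (H x) (H y) = lambda_metric (UNIV - {0}) x y" for x y
        unfolding H_def by (rule lambda_metric_punctured_similarity[OF _ B]) (use c in simp)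
      show "(H (c *\<^sub>R A x), H (c *\<^sub>R A y)) \<in> modulus_gauge k" using xy by (simp add: HA)
    qed
  qed
  show "\<exists>\<zeta>>0. near \<zeta> \<subseteq> (modulus_gauge k :: ((real^'n) \<times> (real^'n)) set)"
  proof -
    obtain \<zeta> where \<zeta>: "\<zeta> > 0" "\<forall>(x :: real^'n) y. (x, y) \<in> near \<zeta> \<longrightarrow>
        ennreal (gauge_bound CARD('n) k + 1) \<le> lambda_metric (UNIV - {0}) x y"
      using lambda_metric_punctured_near[OF n] by blast
    have lt: "ennreal (gauge_bound CARD('n) k) < ennreal (gauge_bound CARD('n) k + 1)"
      using gauge_bound_nonneg[of "CARD('n)" k] by (simp add: ennreal_less_iff)
    have "near \<zeta> \<subseteq> (gauge_set k :: ((real^'n) \<times> (real^'n)) set)"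
    proof
      fix p :: "(real^'n) \<times> (real^'n)" assume p: "p \<in> near \<zeta>"
      obtain x y where xy: "p = (x, y)" by (cases p)
      have "ennreal (gauge_bound CARD('n) k) < lambda_metric (UNIV - {0}) x y"
        using \<zeta>(2) p xy less_le_trans[OF lt] by blast
      then show "p \<in> gauge_set k" using p xy by (auto simp: near_def gauge_set_def)
    qed
    then have "near \<zeta> \<subseteq> (modulus_gauge k :: ((real^'n) \<times> (real^'n)) set)"
      unfolding modulus_gauge_def by (rule interior_maximal) (rule open_near)
    then show ?thesis using \<zeta>(1) by blast
  qed
  show "dist x y < norm x / 2" if "(x, y) \<in> modulus_gauge k"
  proof -
    have "dist x y < gauge_radius k * norm x" using that modulus_gauge_near by (fastforce simp: near_def)
    also have "\<dots> \<le> 1 / 2 * norm x" using gauge_radius_bounds(2) by (intro mult_right_mono) auto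
    finally show ?thesis by simp
  qed
  fix \<eta> :: real assume "\<eta> > 0"
  then obtain N where N: "inverse (real (Suc N)) < \<eta>" using reals_Archimedean by blast
  show "\<forall>\<^sub>F k in sequentially. modulus_gauge k \<subseteq> (near \<eta> :: ((real^'n) \<times> (real^'n)) set)"
    using eventually_ge_at_top[of N]
  proof eventually_elim
    case (elim k)
    have "gauge_radius k \<le> inverse (real (Suc N))" using elim by (simp add: gauge_radius_def field_simps)
    then have "gauge_radius k \<le> \<eta>" using N by simp
    then have "gauge_radius k * norm x \<le> \<eta> * norm x" for x :: "real^'n" by (intro mult_right_mono) auto
    then have "near (gauge_radius k) \<subseteq> (near \<eta> :: ((real^'n) \<times> (real^'n)) set)"
      unfolding near_def using less_le_trans by blast
    then show ?case using modulus_gauge_near by blast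
  qed
qed

lemma similarity_translation: "similarity 1 (\<lambda>x. x + a)"
  unfolding similarity_def surj_def by (auto intro: exI[of _ "_ - a"])

context punctured_isometry
begin

lemma isometry_form:
  "\<exists>w C A. C > 0 \<and> orthogonal_transformation A \<and>
     ((\<forall>x. x \<noteq> 0 \<longrightarrow> f x = w + C *\<^sub>R A x) \<or> (\<forall>x. x \<noteq> 0 \<longrightarrow> f x = w + (C / (norm x)\<^sup>2) *\<^sub>R A x))"
proof -
  obtain w where w: "D = UNIV - {w}" using image_punctured by blast
  define F where "F x = (if x = 0 then 0 else f x - w)" for x
  define G where "G x = (if x = 0 then 0 else g (x + w))" for x
  have fw: "f x \<noteq> w" if "x \<noteq> 0" for x using f_in_D[OF that] w by auto
  have inD: "x + w \<in> D" if "x \<noteq> 0" for x using that w by auto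
  have GF: "G (F x) = x" for x using fw gf by (simp add: F_def G_def)
  have FG: "F (G x) = x" for x using fg[OF inD] g_nonzero[OF inD] by (simp add: F_def G_def)
  have contF: "continuous_on (- {0}) F"
  proof (rule continuous_on_eq)
    show "continuous_on (- {0}) (\<lambda>x. f x - w)"
      using continuous_on_f by (intro continuous_intros) (simp add: Compl_eq_Diff_UNIV)
  qed (simp add: F_def)
  have contG: "continuous_on (- {0}) G"
  proof (rule continuous_on_eq)
    show "continuous_on (- {0}) (\<lambda>x. g (x + w))"
      by (intro continuous_on_compose2[OF continuous_on_g] continuous_intros) (use inD in auto)
  qed (simp add: G_def)
  have F0: "F 0 = 0" "G 0 = 0" by (simp_all add: F_def G_def)
  have Fnz: "F x \<noteq> 0" "G x \<noteq> 0" if "x \<noteq> 0" for x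
    using that GF[of x] FG[of x] F0 by auto
  have lamF: "lambda_metric (UNIV - {0}) (F x) (F y) = lambda_metric (UNIV - {0}) x y"
    if xy: "x \<noteq> 0" "y \<noteq> 0" "x \<noteq> y" for x y
  proof -
    have im: "(\<lambda>z. z + (- w)) ` D = UNIV - {0}"
    proof
      show "UNIV - {0} \<subseteq> (\<lambda>z. z + (- w)) ` D"
      proof
        fix u :: "real^'n" assume "u \<in> UNIV - {0}"
        then show "u \<in> (\<lambda>z. z + (- w)) ` D" using inD[of u] by (intro image_eqI[of _ _ "u + w"]) auto
      qed
    qed (use w in auto)
    show ?thesis using lambda_metric_similarity[OF similarity_translation[of "- w"] open_D, of "f x" "f y"] iso[OF xy] xy
      by (simp only: im F_def if_False) simp
  qed
  have injF: "inj F" "inj G" by (metis GF injI, metis FG injI)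
  have lamG: "lambda_metric (UNIV - {0}) (G x) (G y) = lambda_metric (UNIV - {0}) x y"
    if xy: "x \<noteq> 0" "y \<noteq> 0" "x \<noteq> y" for x y
    using lamF[OF Fnz(2)[OF xy(1)] Fnz(2)[OF xy(2)]] injF(2) xy(3) by (simp add: FG inj_eq)
  interpret invariant_gauge "modulus_gauge :: nat \<Rightarrow> ((real^'n) \<times> (real^'n)) set"
    by (rule invariant_gauge_modulus[OF card])
  interpret gauge_isometry "modulus_gauge :: nat \<Rightarrow> ((real^'n) \<times> (real^'n)) set" F G
  proof
    show "(F x, F y) \<in> modulus_gauge k \<longleftrightarrow> (x, y) \<in> modulus_gauge k" for x y k
    proof
      show "(x, y) \<in> modulus_gauge k" if "(F x, F y) \<in> modulus_gauge k"
        by (rule modulus_gauge_pullback[OF F0(1) injF(1) contF lamF that])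
      show "(F x, F y) \<in> modulus_gauge k" if "(x, y) \<in> modulus_gauge k"
        by (rule modulus_gauge_pullback[OF F0(2) injF(2) contG lamG]) (simp_all add: GF that)
    qed
  qed (simp_all add: F0 GF FG contF contG)
  obtain C A where CA: "C > 0" "orthogonal_transformation A"
    "(\<forall>x. x \<noteq> 0 \<longrightarrow> F x = C *\<^sub>R A x) \<or> (\<forall>x. x \<noteq> 0 \<longrightarrow> F x = (C / (norm x)\<^sup>2) *\<^sub>R A x)"
    using rigidity by blast
  have fF: "f x = w + F x" if "x \<noteq> 0" for x using that by (simp add: F_def)
  show ?thesis using CA fF by (intro exI[of _ w] exI[of _ C] exI[of _ A]) auto
qed

end

section \<open>Moebius transformations\<close>

lemma moebius_comp: "moebius p \<Longrightarrow> moebius q \<Longrightarrow> moebius (p \<circ> q)"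
proof (induction rule: moebius.induct)
  case (moebius_sphere r m a)
  then show ?case unfolding comp_assoc by (intro moebius.moebius_sphere)
next
  case (moebius_hyperplane v m t)
  then show ?case unfolding comp_assoc by (intro moebius.moebius_hyperplane)
qed simp

lemma moebius_reflections:
  "r > 0 \<Longrightarrow> moebius (sphere_reflection a r)" "v \<noteq> 0 \<Longrightarrow> moebius (hyperplane_reflection v t)"
  using moebius_sphere[OF _ moebius_id] moebius_hyperplane[OF _ moebius_id] by simp_all

text \<open>Two parallel mirrors at distance \<open>norm a / 2\<close> compose to the translation by
  \<open>a\<close>.\<close>

lemma moebius_translation: "\<exists>m. moebius m \<and> (\<forall>x. m (Some x) = Some (x + a))"
proof (cases "a = 0")
  case True
  then show ?thesis using moebius_id by (intro exI[of _ id]) simp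
next
  case False
  have "hyperplane_reflection a (a \<bullet> a / 2) (hyperplane_reflection a 0 (Some x)) = Some (x + a)" for x
    using False by (simp add: hyperplane_reflection_def inner_diff_right field_simps flip: scaleR_left.add scaleR_left.diff)
  then show ?thesis using False
    by (intro exI[of _ "hyperplane_reflection a (a \<bullet> a / 2) \<circ> hyperplane_reflection a 0"]) (simp add: moebius_comp moebius_reflections)
qed

text \<open>Inversions in the concentric spheres of radius \<open>1\<close> and
  \<open>sqrt C\<close> compose to the scaling; the origin passes through infinity and
  returns.\<close>

lemma moebius_scaling:
  assumes "C > 0" shows "\<exists>m. moebius m \<and> (\<forall>x :: real^'n. m (Some x) = Some (C *\<^sub>R x))"
proof -
  have "sphere_reflection 0 (sqrt C) (sphere_reflection 0 1 (Some x)) = Some (C *\<^sub>R x)" for x :: "real^'n"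
    using assms by (simp add: sphere_reflection_def power_divide power_mult_distrib field_simps power2_eq_square)
  then show ?thesis using assms
    by (intro exI[of _ "sphere_reflection 0 (sqrt C) \<circ> sphere_reflection 0 1"]) (simp add: moebius_comp moebius_reflections)
qed

text \<open>Cartan--Dieudonne: one reflection per basis vector corrects the image of that vector and leaves
  the images of the earlier ones alone.\<close>

lemma moebius_orthogonal:
  fixes A :: "real^'n \<Rightarrow> real^'n"
  assumes A: "orthogonal_transformation A"
  shows "\<exists>m. moebius m \<and> (\<forall>x. m (Some x) = Some (A x))"
proof -
  have "\<exists>m T. moebius m \<and> orthogonal_transformation T \<and> (\<forall>x. m (Some x) = Some (T x)) \<and> (\<forall>b\<in>S. T b = A b)"
    if "finite S" "S \<subseteq> Basis" for S
    using that
  proof (induction S)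
    case empty
    show ?case
      by (intro exI[of _ id] exI[of _ "\<lambda>x. x"] conjI moebius_id orthogonal_transformation_id) auto
  next
    case (insert b S)
    then obtain m T where mT: "moebius m" "orthogonal_transformation T" "\<forall>x. m (Some x) = Some (T x)" "\<forall>c\<in>S. T c = A c"
      by auto
    define v where "v = T b - A b"
    show ?case
    proof (cases "v = 0")
      case True
      then have "\<forall>c\<in>insert b S. T c = A c" using mT(4) by (simp add: v_def)
      then show ?thesis using mT(1-3) by blast
    next
      case False
      have "norm (T b) = norm (A b)" using mT(2) A by (simp add: orthogonal_transformation_norm)
      then have 1: "reflect v (T b) = A b" unfolding v_def by (rule reflect_swap)
      have 2: "reflect v (T c) = A c" if c: "c \<in> S" for c
      proof -
        have "T b \<bullet> T c = b \<bullet> c" "A b \<bullet> A c = b \<bullet> c"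
          using mT(2) A by (simp_all add: orthogonal_transformation_def)
        then have "v \<bullet> T c = 0" using mT(4) c by (simp add: v_def inner_diff_left)
        then show ?thesis using mT(4) c by (simp add: reflect_orthogonal)
      qed
      have "\<forall>c\<in>insert b S. (reflect v \<circ> T) c = A c" using 1 2 by simp
      moreover have "moebius (hyperplane_reflection v 0 \<circ> m)" by (rule moebius_hyperplane[OF False mT(1)])
      moreover have "\<forall>x. (hyperplane_reflection v 0 \<circ> m) (Some x) = Some ((reflect v \<circ> T) x)"
        using mT(3) by (simp add: hyperplane_reflection_def reflect_def)
      moreover have "orthogonal_transformation (reflect v \<circ> T)"
        by (rule orthogonal_transformation_compose[OF orthogonal_reflect mT(2)])
      ultimately show ?thesis by blast
    qed
  qed
  from this[OF finite_Basis order_refl] obtain m T where mT: "moebius m" "orthogonal_transformation T"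
    "\<forall>x. m (Some x) = Some (T x)" "\<forall>b\<in>Basis. T b = A b" by blast
  have "T = A"
    by (rule linear_eq_stdbasis) (use mT A in \<open>auto simp: orthogonal_transformation_linear\<close>)
  then show ?thesis using mT(1,3) by blast
qed

theorem theorem1p3:
  fixes f :: "real^'n \<Rightarrow> real^'n" and z0 :: "real^'n"
  assumes "CARD('n) \<ge> 2"
    and "inj_on f (UNIV - {z0})"
    and "open (f ` (UNIV - {z0}))"
    and "connected (f ` (UNIV - {z0}))"
    and "\<And>x y. x \<in> UNIV - {z0} \<Longrightarrow> y \<in> UNIV - {z0} \<Longrightarrow> x \<noteq> y \<Longrightarrow>
           lambda_metric (f ` (UNIV - {z0})) (f x) (f y) = lambda_metric (UNIV - {z0}) x y"
  shows "\<exists>m. moebius m \<and> (\<forall>x \<in> UNIV - {z0}. m (Some x) = Some (f x))"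
proof -
  define D where "D = f ` (UNIV - {z0})"
  have im: "(\<lambda>x. x + z0) ` (UNIV - {0}) = UNIV - {z0}"
  proof
    show "UNIV - {z0} \<subseteq> (\<lambda>x. x + z0) ` (UNIV - {0})"
    proof
      fix u assume "u \<in> UNIV - {z0}"
      then show "u \<in> (\<lambda>x. x + z0) ` (UNIV - {0})" by (intro image_eqI[of _ _ "u - z0"]) auto
    qed
  qed auto
  interpret punctured_isometry "\<lambda>x. f (x + z0)" D
  proof
    show "inj_on (\<lambda>x. f (x + z0)) (UNIV - {0})"
      by (rule inj_onI) (use inj_onD[OF assms(2)] in force)
    show "D = (\<lambda>x. f (x + z0)) ` (UNIV - {0})" unfolding D_def im[symmetric] by (simp add: image_image)
    fix x y :: "real^'n" assume xy: "x \<noteq> 0" "y \<noteq> 0" "x \<noteq> y"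
    have "lambda_metric D (f (x + z0)) (f (y + z0)) = lambda_metric (UNIV - {z0}) (x + z0) (y + z0)"
      unfolding D_def by (rule assms(5)) (use xy in auto)
    also have "\<dots> = lambda_metric (UNIV - {0}) x y"
      using lambda_metric_similarity[OF similarity_translation[of z0], of "UNIV - {0}" x y] by (simp add: im open_delete)
    finally show "lambda_metric D (f (x + z0)) (f (y + z0)) = lambda_metric (UNIV - {0}) x y" .
  qed (use assms(1,3) in \<open>auto simp: D_def\<close>)
  obtain w C A where CA: "C > 0" "orthogonal_transformation A"
    "(\<forall>x. x \<noteq> 0 \<longrightarrow> f (x + z0) = w + C *\<^sub>R A x) \<or> (\<forall>x. x \<noteq> 0 \<longrightarrow> f (x + z0) = w + (C / (norm x)\<^sup>2) *\<^sub>R A x)"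
    using isometry_form by blast
  obtain a where a: "moebius a" "\<And>x. a (Some x) = Some (x + (- z0))" using moebius_translation by blast
  obtain b where b: "moebius b" "\<And>x. b (Some x) = Some (A x)" using moebius_orthogonal[OF CA(2)] by blast
  obtain c where c: "moebius c" "\<And>x :: real^'n. c (Some x) = Some (C *\<^sub>R x)" using moebius_scaling[OF CA(1)] by blast
  obtain d where d: "moebius d" "\<And>x. d (Some x) = Some (x + w)" using moebius_translation by blast
  from CA(3) show ?thesis
  proof
    assume f: "\<forall>x. x \<noteq> 0 \<longrightarrow> f (x + z0) = w + C *\<^sub>R A x"
    have "f x = C *\<^sub>R A (x - z0) + w" if "x \<noteq> z0" for x
      using f[rule_format, of "x - z0"] that by (simp add: add.commute)
    then show ?thesis
      by (intro exI[of _ "d \<circ> (c \<circ> (b \<circ> a))"]) (simp add: moebius_comp a b c d)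
  next
    assume f: "\<forall>x. x \<noteq> 0 \<longrightarrow> f (x + z0) = w + (C / (norm x)\<^sup>2) *\<^sub>R A x"
    \<comment> \<open>Since \<open>A\<close> is linear, the radial factor can be moved inside, where
      it is the inversion in the unit sphere.\<close>
    have "f x = C *\<^sub>R A ((1 / norm (x - z0))\<^sup>2 *\<^sub>R (x - z0)) + w" if "x \<noteq> z0" for x
      using f[rule_format, of "x - z0"] that
      by (simp add: add.commute orthogonal_transformation_scaleR[OF CA(2)] power_divide)
    then show ?thesis
      by (intro exI[of _ "d \<circ> (c \<circ> (b \<circ> (sphere_reflection 0 1 \<circ> a)))"])
        (simp add: moebius_comp moebius_reflections a b c d sphere_reflection_def)
  qed
qed

end
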